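(* Let $(M,g,f)$ be a complete weighted manifold. For $K>0$, assume $\mathrm{Ric}_f^1\ge K g$. Then there is no complete two-sided immersed stable $f$-minimal hypersurface $\Sigma$ in $M$ such that $m_{f,\Sigma}(B_r^\Sigma(o))=O(e^{\alpha r})$ as $r\to+\infty$ for some $o\in\Sigma$ and some $\alpha\in(0,2\sqrt K)$.
   Context: Manifolds and hypersurfaces are smooth and without boundary, and $n:=\dim M\ge2$. A weighted manifold $(M,g,f)$ of dimension $n$ is an $n$-dimensional Riemannian manifold $(M,g)$ together with $f\in C^\infty(M)$. Set $\mathrm{Ric}_f^\infty:=\mathrm{Ric}+\mathrm{Hess}\,f$ and $\mathrm{Ric}_f^1:=\mathrm{Ric}+\mathrm{Hess}\,f+\frac{df\otimes df}{n-1}$. Let $\Sigma$ be a two-sided immersed hypersurface with globally defined unit normal field $\nu$. $g_\Sigma$ is the induced metric; $B_r^\Sigma(o)$ is the intrinsic open geodesic ball in $\Sigma$ of radius $r$ centered at $o$; $m_{f,\Sigma}:=e^{-f}v_{g_\Sigma}$, where $v_{g_\Sigma}$ is the Riemannian volume measure of $g_\Sigma$; $f_\nu:=\langle\nabla f,\nu\rangle$; $\mathrm{II}_\Sigma(X,Y):=\langle\nabla_X\nu,Y\rangle$; $H_\Sigma:=\mathrm{tr}\,\mathrm{II}_\Sigma$. $\Sigma$ is $f$-minimal if $H_\Sigma-f_\nu\equiv0$. An $f$-minimal $\Sigma$ is stable if for every $\phi\in C_0^\infty(\Sigma)$ $$\int_\Sigma\left(\mathrm{Ric}_f^\infty(\nu,\nu)+|\mathrm{II}_\Sigma|^2\right)\phi^2\,dm_{f,\Sigma}\le\int_\Sigma|\nabla_\Sigma\phi|^2\,dm_{f,\Sigma}.$$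 *)

theory Defs
  imports "HOL-Analysis.Analysis"
begin

text \<open>
  A manifold without boundary is a whole type that is Hausdorff and second countable, together
  with a smooth atlas. Its dimension is \<open>CARD('n)\<close>, where \<open>real^'n\<close> is the model space.
  Connectedness is not required.
\<close>

type_synonym ('a, 'n) chart = "'a set \<times> ('a \<Rightarrow> real^'n)"

abbreviation cdom :: "('a, 'n::finite) chart \<Rightarrow> 'a set"
  where "cdom c \<equiv> fst c"

abbreviation cmap :: "('a, 'n::finite) chart \<Rightarrow> 'a \<Rightarrow> real^'n"
  where "cmap c \<equiv> snd c"

abbreviation cimg :: "('a, 'n::finite) chart \<Rightarrow> (real^'n) set"
  where "cimg c \<equiv> cmap c ` cdom c"

abbreviation cinv :: "('a, 'n::finite) chart \<Rightarrow> real^'n \<Rightarrow> 'a"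
  where "cinv c \<equiv> inv_into (cdom c) (cmap c)"

definition is_chart :: "('a::topological_space, 'n::finite) chart \<Rightarrow> bool"
  where "is_chart c \<longleftrightarrow>
    open (cdom c) \<and> open (cimg c) \<and> homeomorphism (cdom c) (cimg c) (cmap c) (cinv c)"

text \<open>\<open>Ck_on k F S\<close>, used for open \<open>S\<close> only: \<open>F\<close> is of class \<open>C\<^sup>k\<close> on \<open>S\<close>.\<close>

primrec Ck_on :: "nat \<Rightarrow> ('e::euclidean_space \<Rightarrow> 'b::real_normed_vector) \<Rightarrow> 'e set \<Rightarrow> bool"
  where
    "Ck_on 0 F S \<longleftrightarrow> continuous_on S F"
  | "Ck_on (Suc k) F S \<longleftrightarrow>
      (\<forall>x\<in>S. F differentiable (at x)) \<and> (\<forall>v. Ck_on k (\<lambda>x. frechet_derivative F (at x) v) S)"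

definition smooth_on :: "('e::euclidean_space \<Rightarrow> 'b::real_normed_vector) \<Rightarrow> 'e set \<Rightarrow> bool"
  where "smooth_on F S \<longleftrightarrow> (\<forall>k. Ck_on k F S)"

definition smooth_atlas :: "('a::topological_space, 'n::finite) chart set \<Rightarrow> bool"
  where "smooth_atlas A \<longleftrightarrow>
    (\<forall>c\<in>A. is_chart c) \<and> (\<Union>c\<in>A. cdom c) = UNIV \<and>
    (\<forall>c\<in>A. \<forall>c'\<in>A. smooth_on (cmap c' \<circ> cinv c) (cmap c ` (cdom c \<inter> cdom c')))"

definition smooth_fun ::
    "('a, 'n::finite) chart set \<Rightarrow> 'a set \<Rightarrow> ('a \<Rightarrow> 'b::real_normed_vector) \<Rightarrow> bool"
  where "smooth_fun A W \<phi> \<longleftrightarrow> (\<forall>c\<in>A. smooth_on (\<phi> \<circ> cinv c) (cmap c ` (W \<inter> cdom c)))"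

definition smooth_near ::
    "('a::topological_space, 'n::finite) chart set \<Rightarrow> 'a \<Rightarrow> ('a \<Rightarrow> real) \<Rightarrow> bool"
  where "smooth_near A p \<phi> \<longleftrightarrow> (\<exists>W. open W \<and> p \<in> W \<and> smooth_fun A W \<phi>)"

definition smooth_map ::
    "('b::topological_space, 'm::finite) chart set \<Rightarrow> ('a::topological_space, 'n::finite) chart set
      \<Rightarrow> ('b \<Rightarrow> 'a) \<Rightarrow> bool"
  where "smooth_map B A \<iota> \<longleftrightarrow>
    continuous_on UNIV \<iota> \<and> (\<forall>c\<in>A. smooth_fun B (\<iota> -` cdom c) (cmap c \<circ> \<iota>))"

text \<open>
  A tangent vector at \<open>p\<close> is a directional derivative operator on the functions that are smooth
  near \<open>p\<close>, extended by \<open>0\<close> to all other functions. \<open>chart_vec A c p v\<close> is the vector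
  at \<open>p\<close> with components \<open>v\<close> in the chart \<open>c\<close>.
\<close>

type_synonym 'a tvec = "('a \<Rightarrow> real) \<Rightarrow> real"

definition chart_vec ::
    "('a::topological_space, 'n::finite) chart set \<Rightarrow> ('a, 'n::finite) chart \<Rightarrow> 'a \<Rightarrow> real^'n \<Rightarrow> 'a tvec"
  where "chart_vec A c p v =
    (\<lambda>\<phi>. if smooth_near A p \<phi> then frechet_derivative (\<phi> \<circ> cinv c) (at (cmap c p)) v else 0)"

definition tangent_space :: "('a::topological_space, 'n::finite) chart set \<Rightarrow> 'a \<Rightarrow> 'a tvec set"
  where "tangent_space A p = {chart_vec A c p v | c v. c \<in> A \<and> p \<in> cdom c}"

definition vec_comp :: "('a, 'n::finite) chart \<Rightarrow> 'a tvec \<Rightarrow> real^'n"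
  where "vec_comp c X = (\<chi> k. X (\<lambda>q. cmap c q $ k))"

definition chart_at :: "('a, 'n::finite) chart set \<Rightarrow> 'a \<Rightarrow> ('a, 'n::finite) chart"
  where "chart_at A p = (SOME c. c \<in> A \<and> p \<in> cdom c)"

definition differential ::
    "('a::topological_space, 'n::finite) chart set \<Rightarrow> ('b \<Rightarrow> 'a) \<Rightarrow> 'b \<Rightarrow> 'b tvec \<Rightarrow> 'a tvec"
  where "differential A \<iota> x X = (\<lambda>\<phi>. if smooth_near A (\<iota> x) \<phi> then X (\<phi> \<circ> \<iota>) else 0)"

definition velocity ::
    "('a::topological_space, 'n::finite) chart set \<Rightarrow> (real \<Rightarrow> 'a) \<Rightarrow> real \<Rightarrow> 'a tvec"
  where "velocity A \<gamma> t =
    (\<lambda>\<phi>. if smooth_near A (\<gamma> t) \<phi> then vector_derivative (\<phi> \<circ> \<gamma>) (at t) else 0)"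

type_synonym 'a metric = "'a \<Rightarrow> 'a tvec \<Rightarrow> 'a tvec \<Rightarrow> real"

definition metric_coord ::
    "('a::topological_space, 'n::finite) chart set \<Rightarrow> 'a metric \<Rightarrow> ('a, 'n::finite) chart
      \<Rightarrow> real^'n \<Rightarrow> real^'n \<Rightarrow> real^'n \<Rightarrow> real"
  where "metric_coord A g c y u v =
    g (cinv c y) (chart_vec A c (cinv c y) u) (chart_vec A c (cinv c y) v)"

text \<open>Only the values of \<open>g p\<close> on \<open>tangent_space A p\<close> matter.\<close>

definition riemannian_metric ::
    "('a::topological_space, 'n::finite) chart set \<Rightarrow> 'a metric \<Rightarrow> bool"
  where "riemannian_metric A g \<longleftrightarrow>
    (\<forall>c\<in>A.
      (\<forall>y\<in>cimg c.
        bilinear (metric_coord A g c y) \<and>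
        (\<forall>u v. metric_coord A g c y u v = metric_coord A g c y v u) \<and>
        (\<forall>u. u \<noteq> 0 \<longrightarrow> metric_coord A g c y u u > 0)) \<and>
      (\<forall>u v. smooth_on (\<lambda>y. metric_coord A g c y u v) (cimg c)))"

definition gmat ::
    "('a::topological_space, 'n::finite) chart set \<Rightarrow> 'a metric \<Rightarrow> ('a, 'n::finite) chart
      \<Rightarrow> real^'n \<Rightarrow> real^'n^'n"
  where "gmat A g c y = (\<chi> i j. metric_coord A g c y (axis i 1) (axis j 1))"

definition ginv ::
    "('a::topological_space, 'n::finite) chart set \<Rightarrow> 'a metric \<Rightarrow> ('a, 'n::finite) chart
      \<Rightarrow> real^'n \<Rightarrow> real^'n^'n"
  where "ginv A g c y = matrix_inv (gmat A g c y)"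

definition partial_deriv :: "'n \<Rightarrow> (real^'n \<Rightarrow> real) \<Rightarrow> real^'n \<Rightarrow> real"
  where "partial_deriv i F y = frechet_derivative F (at y) (axis i 1)"

definition grad ::
    "('a::topological_space, 'n::finite) chart set \<Rightarrow> 'a metric \<Rightarrow> ('a \<Rightarrow> real) \<Rightarrow> 'a \<Rightarrow> 'a tvec"
  where "grad A g \<phi> p =
    (let c = chart_at A p; y = cmap c p
     in chart_vec A c p (\<chi> i. \<Sum>j\<in>UNIV. ginv A g c y $ i $ j * partial_deriv j (\<phi> \<circ> cinv c) y))"

text \<open>\<open>christoffel A g c k i j\<close> is \<open>\<Gamma>\<^sup>k\<^sub>i\<^sub>j\<close>, so the Levi-Civita connection is
  \<open>\<nabla>\<^sub>i \<partial>\<^sub>j = \<Sum>k. \<Gamma>\<^sup>k\<^sub>i\<^sub>j \<partial>\<^sub>k\<close>.\<close>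

definition christoffel ::
    "('a::topological_space, 'n::finite) chart set \<Rightarrow> 'a metric \<Rightarrow> ('a, 'n::finite) chart
      \<Rightarrow> 'n \<Rightarrow> 'n \<Rightarrow> 'n \<Rightarrow> real^'n \<Rightarrow> real"
  where "christoffel A g c k i j y =
    (1/2) * (\<Sum>l\<in>UNIV. ginv A g c y $ k $ l *
      (partial_deriv i (\<lambda>z. gmat A g c z $ j $ l) y
       + partial_deriv j (\<lambda>z. gmat A g c z $ i $ l) y
       - partial_deriv l (\<lambda>z. gmat A g c z $ i $ j) y))"

text \<open>\<open>riem_coord A g c l k i j\<close> is the coefficient of \<open>\<partial>\<^sub>l\<close> in
  \<open>R(\<partial>\<^sub>i, \<partial>\<^sub>j) \<partial>\<^sub>k = \<nabla>\<^sub>i \<nabla>\<^sub>j \<partial>\<^sub>k - \<nabla>\<^sub>j \<nabla>\<^sub>i \<partial>\<^sub>k\<close>;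
  \<open>Ric(Y, Z)\<close> is the trace of \<open>X \<mapsto> R(X, Y) Z\<close>, which is positive on round spheres.\<close>

definition riem_coord ::
    "('a::topological_space, 'n::finite) chart set \<Rightarrow> 'a metric \<Rightarrow> ('a, 'n::finite) chart
      \<Rightarrow> 'n \<Rightarrow> 'n \<Rightarrow> 'n \<Rightarrow> 'n \<Rightarrow> real^'n \<Rightarrow> real"
  where "riem_coord A g c l k i j y =
    partial_deriv i (christoffel A g c l j k) y - partial_deriv j (christoffel A g c l i k) y
    + (\<Sum>m\<in>UNIV. christoffel A g c l i m y * christoffel A g c m j k y
                - christoffel A g c l j m y * christoffel A g c m i k y)"

definition ricci :: "('a::topological_space, 'n::finite) chart set \<Rightarrow> 'a metric \<Rightarrow> 'a metric"
  where "ricci A g p X Y =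
    (let c = chart_at A p
     in \<Sum>j\<in>UNIV. \<Sum>k\<in>UNIV. (\<Sum>i\<in>UNIV. riem_coord A g c i k i j (cmap c p))
          * vec_comp c X $ j * vec_comp c Y $ k)"

definition hessian ::
    "('a::topological_space, 'n::finite) chart set \<Rightarrow> 'a metric \<Rightarrow> ('a \<Rightarrow> real) \<Rightarrow> 'a metric"
  where "hessian A g f p X Y =
    (let c = chart_at A p; y = cmap c p; F = f \<circ> cinv c
     in \<Sum>i\<in>UNIV. \<Sum>j\<in>UNIV.
          (partial_deriv i (partial_deriv j F) y
            - (\<Sum>k\<in>UNIV. christoffel A g c k i j y * partial_deriv k F y))
          * vec_comp c X $ i * vec_comp c Y $ j)"

definition pw_C1_curve ::
    "('a::topological_space, 'n::finite) chart set \<Rightarrow> (real \<Rightarrow> 'a) \<Rightarrow> bool"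
  where "pw_C1_curve A \<gamma> \<longleftrightarrow>
    continuous_on {0..1} \<gamma> \<and>
    (\<exists>P. finite P \<and>
      (\<forall>a b. 0 \<le> a \<and> a < b \<and> b \<le> 1 \<and> {a<..<b} \<inter> P = {} \<longrightarrow>
        (\<forall>c\<in>A. \<exists>D. continuous_on {t\<in>{a..b}. \<gamma> t \<in> cdom c} D \<and>
          (\<forall>t\<in>{a..b}. \<gamma> t \<in> cdom c \<longrightarrow>
            ((cmap c \<circ> \<gamma>) has_vector_derivative D t) (at t within {a..b})))))"

definition curve_length ::
    "('a::topological_space, 'n::finite) chart set \<Rightarrow> 'a metric \<Rightarrow> (real \<Rightarrow> 'a) \<Rightarrow> ennreal"
  where "curve_length A g \<gamma> =
    (\<integral>\<^sup>+ t\<in>{0..1}. ennreal (sqrt (g (\<gamma> t) (velocity A \<gamma> t) (velocity A \<gamma> t))) \<partial>lborel)"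

text \<open>The distance between points of different components is \<open>\<infinity>\<close>.\<close>

definition riem_dist ::
    "('a::topological_space, 'n::finite) chart set \<Rightarrow> 'a metric \<Rightarrow> 'a \<Rightarrow> 'a \<Rightarrow> ennreal"
  where "riem_dist A g p q =
    (INF \<gamma>\<in>{\<gamma>. pw_C1_curve A \<gamma> \<and> \<gamma> 0 = p \<and> \<gamma> 1 = q}. curve_length A g \<gamma>)"

definition geodesic_ball ::
    "('a::topological_space, 'n::finite) chart set \<Rightarrow> 'a metric \<Rightarrow> 'a \<Rightarrow> real \<Rightarrow> 'a set"
  where "geodesic_ball A g p r = {q. riem_dist A g p q < ennreal r}"

definition riem_complete ::
    "('a::topological_space, 'n::finite) chart set \<Rightarrow> 'a metric \<Rightarrow> bool"
  where "riem_complete A g \<longleftrightarrow>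
    (\<forall>s :: nat \<Rightarrow> 'a.
      (\<forall>e>0. \<exists>N. \<forall>i\<ge>N. \<forall>j\<ge>N. riem_dist A g (s i) (s j) < ennreal e) \<longrightarrow>
      (\<exists>q. (\<lambda>i. riem_dist A g (s i) q) \<longlonglongrightarrow> 0))"

text \<open>The Borel measure given by \<open>sqrt (det g) dy\<close> in every chart.\<close>

definition riem_volume ::
    "('a::topological_space, 'n::finite) chart set \<Rightarrow> 'a metric \<Rightarrow> 'a measure"
  where "riem_volume A g =
    (THE \<mu>. sets \<mu> = sets borel \<and>
      (\<forall>c\<in>A. \<forall>E\<in>sets borel. E \<subseteq> cdom c \<longrightarrow>
        emeasure \<mu> E = (\<integral>\<^sup>+ y\<in>cmap c ` E. ennreal (sqrt (det (gmat A g c y))) \<partial>lborel)))"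

definition weighted_manifold ::
    "('a::topological_space, 'n::finite) chart set \<Rightarrow> 'a metric \<Rightarrow> ('a \<Rightarrow> real) \<Rightarrow> bool"
  where "weighted_manifold A g f \<longleftrightarrow>
    smooth_atlas A \<and> riemannian_metric A g \<and> smooth_fun A UNIV f"

definition Ric_inf ::
    "('a::topological_space, 'n::finite) chart set \<Rightarrow> 'a metric \<Rightarrow> ('a \<Rightarrow> real) \<Rightarrow> 'a metric"
  where "Ric_inf A g f p X Y = ricci A g p X Y + hessian A g f p X Y"

definition Ric_1 ::
    "('a::topological_space, 'n::finite) chart set \<Rightarrow> 'a metric \<Rightarrow> ('a \<Rightarrow> real) \<Rightarrow> 'a metric"
  where "Ric_1 A g f p X Y =
    ricci A g p X Y + hessian A g f p X Y + X f * Y f / (real CARD('n) - 1)"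

definition induced_metric ::
    "('a::topological_space, 'n::finite) chart set \<Rightarrow> 'a metric \<Rightarrow> ('b \<Rightarrow> 'a) \<Rightarrow> 'b metric"
  where "induced_metric A g \<iota> x X Y = g (\<iota> x) (differential A \<iota> x X) (differential A \<iota> x Y)"

text \<open>\<open>\<iota>\<close> is an immersion of the manifold \<open>'b\<close> with atlas \<open>B\<close>, and \<open>\<nu>\<close> is a globally
  defined smooth unit normal field along \<open>\<iota>\<close>.\<close>

definition two_sided_hypersurface ::
    "('a::topological_space, 'n::finite) chart set \<Rightarrow> 'a metric
      \<Rightarrow> ('b::topological_space, 'm::finite) chart set \<Rightarrow> ('b \<Rightarrow> 'a) \<Rightarrow> ('b \<Rightarrow> 'a tvec) \<Rightarrow> bool"
  where "two_sided_hypersurface A g B \<iota> \<nu> \<longleftrightarrow>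
    CARD('n) = CARD('m) + 1 \<and>
    smooth_atlas B \<and> smooth_map B A \<iota> \<and>
    (\<forall>x. inj_on (differential A \<iota> x) (tangent_space B x)) \<and>
    (\<forall>x. \<nu> x \<in> tangent_space A (\<iota> x) \<and> g (\<iota> x) (\<nu> x) (\<nu> x) = 1 \<and>
      (\<forall>X\<in>tangent_space B x. g (\<iota> x) (\<nu> x) (differential A \<iota> x X) = 0)) \<and>
    (\<forall>c\<in>A. smooth_fun B (\<iota> -` cdom c) (\<lambda>x. vec_comp c (\<nu> x)))"

text \<open>The Levi-Civita derivative of a vector field \<open>V\<close> along \<open>\<iota>\<close> in direction
  \<open>X \<in> tangent_space B x\<close>: \<open>(\<nabla>\<^sub>X V)\<^sup>k = X(V\<^sup>k) + \<Sum>i j. \<Gamma>\<^sup>k\<^sub>i\<^sub>j (d\<iota> X)\<^sup>i V\<^sup>j\<close>.\<close>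

definition cov_deriv_along ::
    "('a::topological_space, 'n::finite) chart set \<Rightarrow> 'a metric \<Rightarrow> ('b \<Rightarrow> 'a)
      \<Rightarrow> ('b \<Rightarrow> 'a tvec) \<Rightarrow> 'b \<Rightarrow> 'b tvec \<Rightarrow> 'a tvec"
  where "cov_deriv_along A g \<iota> V x X =
    (let c = chart_at A (\<iota> x); y = cmap c (\<iota> x)
     in chart_vec A c (\<iota> x)
          (\<chi> k. X (\<lambda>x'. vec_comp c (V x') $ k)
            + (\<Sum>i\<in>UNIV. \<Sum>j\<in>UNIV. christoffel A g c k i j y
                * vec_comp c (differential A \<iota> x X) $ i * vec_comp c (V x) $ j)))"

definition second_ff ::
    "('a::topological_space, 'n::finite) chart set \<Rightarrow> 'a metric \<Rightarrow> ('b \<Rightarrow> 'a)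
      \<Rightarrow> ('b \<Rightarrow> 'a tvec) \<Rightarrow> 'b metric"
  where "second_ff A g \<iota> \<nu> x X Y =
    g (\<iota> x) (cov_deriv_along A g \<iota> \<nu> x X) (differential A \<iota> x Y)"

definition bilinear_trace ::
    "('b::topological_space, 'm::finite) chart set \<Rightarrow> 'b metric \<Rightarrow> 'b metric \<Rightarrow> 'b \<Rightarrow> real"
  where "bilinear_trace B h T x =
    (let c = chart_at B x; y = cmap c x; e = (\<lambda>i. chart_vec B c x (axis i 1))
     in \<Sum>i\<in>UNIV. \<Sum>j\<in>UNIV. ginv B h c y $ i $ j * T x (e i) (e j))"

definition bilinear_normsq ::
    "('b::topological_space, 'm::finite) chart set \<Rightarrow> 'b metric \<Rightarrow> 'b metric \<Rightarrow> 'b \<Rightarrow> real"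
  where "bilinear_normsq B h T x =
    (let c = chart_at B x; y = cmap c x; e = (\<lambda>i. chart_vec B c x (axis i 1))
     in \<Sum>i\<in>UNIV. \<Sum>j\<in>UNIV. \<Sum>k\<in>UNIV. \<Sum>l\<in>UNIV.
          ginv B h c y $ i $ k * ginv B h c y $ j $ l * T x (e i) (e j) * T x (e k) (e l))"

definition mean_curvature ::
    "('a::topological_space, 'n::finite) chart set \<Rightarrow> 'a metric
      \<Rightarrow> ('b::topological_space, 'm::finite) chart set \<Rightarrow> ('b \<Rightarrow> 'a) \<Rightarrow> ('b \<Rightarrow> 'a tvec) \<Rightarrow> 'b \<Rightarrow> real"
  where "mean_curvature A g B \<iota> \<nu> x =
    bilinear_trace B (induced_metric A g \<iota>) (second_ff A g \<iota> \<nu>) x"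

definition f_minimal ::
    "('a::topological_space, 'n::finite) chart set \<Rightarrow> 'a metric \<Rightarrow> ('a \<Rightarrow> real)
      \<Rightarrow> ('b::topological_space, 'm::finite) chart set \<Rightarrow> ('b \<Rightarrow> 'a) \<Rightarrow> ('b \<Rightarrow> 'a tvec) \<Rightarrow> bool"
  where "f_minimal A g f B \<iota> \<nu> \<longleftrightarrow>
    (\<forall>x. mean_curvature A g B \<iota> \<nu> x - g (\<iota> x) (grad A g f (\<iota> x)) (\<nu> x) = 0)"

definition weighted_measure ::
    "('a::topological_space, 'n::finite) chart set \<Rightarrow> 'a metric \<Rightarrow> ('a \<Rightarrow> real)
      \<Rightarrow> ('b::topological_space, 'm::finite) chart set \<Rightarrow> ('b \<Rightarrow> 'a) \<Rightarrow> 'b measure"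
  where "weighted_measure A g f B \<iota> =
    density (riem_volume B (induced_metric A g \<iota>)) (\<lambda>x. ennreal (exp (- f (\<iota> x))))"

text \<open>Both integrands are continuous with compact support, so the Bochner integrals are
  genuine.\<close>

definition f_stable ::
    "('a::topological_space, 'n::finite) chart set \<Rightarrow> 'a metric \<Rightarrow> ('a \<Rightarrow> real)
      \<Rightarrow> ('b::topological_space, 'm::finite) chart set \<Rightarrow> ('b \<Rightarrow> 'a) \<Rightarrow> ('b \<Rightarrow> 'a tvec) \<Rightarrow> bool"
  where "f_stable A g f B \<iota> \<nu> \<longleftrightarrow>
    (let h = induced_metric A g \<iota>; m = weighted_measure A g f B \<iota>
     in \<forall>\<phi>. smooth_fun B UNIV \<phi> \<and> compact (closure {x. \<phi> x \<noteq> 0}) \<longrightarrow>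
          (\<integral>x. (Ric_inf A g f (\<iota> x) (\<nu> x) (\<nu> x)
                + bilinear_normsq B h (second_ff A g \<iota> \<nu>) x) * (\<phi> x)\<^sup>2 \<partial>m)
          \<le> (\<integral>x. h x (grad B h \<phi> x) (grad B h \<phi> x) \<partial>m))"

end

theory Submission
  imports Defs
begin

text \<open>
  On an \<open>f\<close>-minimal hypersurface \<open>|II|\<^sup>2 \<ge> H\<^sup>2 / (n - 1) = f\<^sub>\<nu>\<^sup>2 / (n - 1)\<close>, so the potential
  \<open>Ric\<^sub>f\<^sup>\<infinity>(\<nu>, \<nu>) + |II|\<^sup>2\<close> of the stability inequality is at least \<open>Ric\<^sub>f\<^sup>1(\<nu>, \<nu>) \<ge> K\<close>, and stability gives
  \<open>K \<integral> \<phi>\<^sup>2 dm \<le> \<integral> |\<nabla>\<phi>|\<^sup>2 dm\<close>. Let \<open>d\<close> be the distance from \<open>x\<^sub>0\<close> and \<open>\<alpha> / 2 < b < sqrt K\<close>. The function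
  \<open>u = (exp (- b d) - exp (- b R))\<^sup>+\<close> has compact support by the Hopf--Rinow theorem and local
  Lipschitz constant \<open>b exp (- b d)\<close>, so it can be tested after smoothing. Letting \<open>R\<close> tend to infinity
  gives \<open>K I \<le> b\<^sup>2 I\<close> for \<open>I = \<integral> exp (- 2 b d) dm\<close>, which is positive, and finite by the growth assumption
  and \<open>\<alpha> < 2 b\<close>. This contradicts \<open>b\<^sup>2 < K\<close>.
\<close>

subsection \<open>Smooth functions between Euclidean spaces\<close>

text \<open>Subtracting the constant \<open>exp (- b R)\<close> and truncating at 0 gives compact
  support without a cutoff factor, so no derivative of a cutoff spoils the estimate. The smoothing
  must respect the local Lipschitz constant \<open>b exp (- b d)\<close> at every point, since a
  global bound would not produce the same integral \<open>I\<close> on both sides; hence the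
  mollification is done with the metric frozen at the point in question and glued by a partition of
  unity.

  Three features of the definitions shape the rest. Curvature, Hessian and second fundamental form
  are computed in a chart picked separately at each point, so their continuity passes through the
  transformation laws; this continuity bounds the potential on compact sets, without which its
  Bochner integral could be the default value 0. The volume is a definite description, so existence
  and uniqueness rest on the change of variables formula. Manifolds may be disconnected, so
  distances may be infinite, and the weight is extended by 0 off the component of
  \<open>x0\<close>.\<close>

lemma has_frechet_derivative:
  "F differentiable (at x) \<Longrightarrow> (F has_derivative frechet_derivative F (at x)) (at x)"
  by (simp add: frechet_derivative_works)

lemma frechet_derivative_eqI:
  "(F has_derivative F') (at x) \<Longrightarrow> frechet_derivative F (at x) = F'"
  by (metis frechet_derivative_at)

text \<open>\<open>frechet_derivative\<close> is a choice among all derivatives. Functions that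
  agree near \<open>x\<close> admit the same candidates, so the choices coincide even where neither
  function is differentiable.\<close>

lemma frechet_derivative_cong_open:
  assumes "open S" "x \<in> S" "\<And>y. y \<in> S \<Longrightarrow> F y = G y"
  shows "frechet_derivative F (at x) = frechet_derivative G (at x)"
proof -
  have "(F has_derivative D) (at x) \<longleftrightarrow> (G has_derivative D) (at x)" for D
    using assms has_derivative_transform_within_open[of _ _ x UNIV S] by metis
  then show ?thesis unfolding frechet_derivative_def by simp
qed

lemma differentiable_cong_open:
  assumes "open S" "x \<in> S" "\<And>y. y \<in> S \<Longrightarrow> F y = G y" "F differentiable (at x)"
  shows "G differentiable (at x)"
  using assms has_derivative_transform_within_open[of F _ x UNIV S G] unfolding differentiable_def by metis

lemma Ck_on_subset: "Ck_on k F S \<Longrightarrow> T \<subseteq> S \<Longrightarrow> Ck_on k F T"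
  by (induction k arbitrary: F) (auto intro: continuous_on_subset)

lemma Ck_on_cong:
  "open S \<Longrightarrow> (\<And>x. x \<in> S \<Longrightarrow> F x = G x) \<Longrightarrow> Ck_on k F S \<Longrightarrow> Ck_on k G S"
proof (induction k arbitrary: F G)
  case 0
  then show ?case by (auto cong: continuous_on_cong)
next
  case (Suc k)
  have "frechet_derivative F (at x) v = frechet_derivative G (at x) v" if "x \<in> S" for x v
    using frechet_derivative_cong_open[OF Suc.prems(1) that] Suc.prems(2) by metis
  then have "Ck_on k (\<lambda>x. frechet_derivative G (at x) v) S" for v
    using Suc.IH[OF Suc.prems(1), of "\<lambda>x. frechet_derivative F (at x) v"] Suc.prems(3) by auto
  moreover have "G differentiable (at x)" if "x \<in> S" for x
    using differentiable_cong_open[OF Suc.prems(1) that, of F G] Suc.prems that by auto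
  ultimately show ?case by simp
qed

lemma Ck_on_Suc_D: "Ck_on (Suc k) F S \<Longrightarrow> Ck_on k F S"
proof (induction k arbitrary: F)
  case 0
  then show ?case
    by (auto intro!: continuous_at_imp_continuous_on differentiable_imp_continuous_within)
next
  case (Suc k)
  then show ?case by (metis Ck_on.simps(2))
qed

lemma Ck_on_local:
  "(\<And>x. x \<in> S \<Longrightarrow> \<exists>U. open U \<and> x \<in> U \<and> Ck_on k F U) \<Longrightarrow> Ck_on k F S"
proof (induction k arbitrary: F)
  case 0
  then show ?case
    by (force intro!: continuous_at_imp_continuous_on simp: continuous_on_eq_continuous_at)
next
  case (Suc k)
  have "F differentiable (at x)" if "x \<in> S" for x
    using Suc.prems[OF that] by auto
  moreover have "Ck_on k (\<lambda>x. frechet_derivative F (at x) v) S" for v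
    using Suc.prems by (intro Suc.IH) (metis Ck_on.simps(2))
  ultimately show ?case by simp
qed

lemma Ck_on_const: "Ck_on k (\<lambda>x. c) S"
proof (induction k arbitrary: c)
  case (Suc k)
  have "frechet_derivative (\<lambda>x::'a. c) (at x) v = 0" for x v
    by (metis frechet_derivative_eqI has_derivative_const)
  then show ?case using Suc by simp
qed auto

lemma Ck_on_bounded_linear: "bounded_linear L \<Longrightarrow> Ck_on k L S"
proof (cases k)
  case (Suc j)
  assume L: "bounded_linear L"
  have "frechet_derivative L (at x) v = L v" for x v
    by (metis L bounded_linear_imp_has_derivative frechet_derivative_eqI)
  then show ?thesis using Suc L
    by (auto simp: Ck_on_const bounded_linear_imp_differentiable)
qed (auto simp: linear_continuous_on)

lemma Ck_on_linear_compose: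
  assumes "bounded_linear L" "open S"
  shows "Ck_on k F S \<Longrightarrow> Ck_on k (\<lambda>x. L (F x)) S"
proof (induction k arbitrary: F)
  case 0
  then show ?case using bounded_linear.continuous_on[OF assms(1)] by auto
next
  case (Suc k)
  have d: "((\<lambda>x. L (F x)) has_derivative (\<lambda>v. L (frechet_derivative F (at x) v))) (at x)" if "x \<in> S" for x
    using Suc.prems that by (intro bounded_linear.has_derivative[OF assms(1)] has_frechet_derivative) auto
  have "Ck_on k (\<lambda>x. frechet_derivative (\<lambda>x. L (F x)) (at x) v) S" for v
    by (rule Ck_on_cong[OF assms(2) _ Suc.IH[of "\<lambda>x. frechet_derivative F (at x) v"]])
      (use Suc.prems frechet_derivative_eqI[OF d] in auto)
  then show ?case using d by (auto simp: differentiable_def)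
qed

lemma Ck_on_add:
  assumes "open S"
  shows "Ck_on k F S \<Longrightarrow> Ck_on k G S \<Longrightarrow> Ck_on k (\<lambda>x. F x + G x) S"
proof (induction k arbitrary: F G)
  case 0
  then show ?case by (auto intro: continuous_intros)
next
  case (Suc k)
  have d: "((\<lambda>x. F x + G x) has_derivative (\<lambda>v. frechet_derivative F (at x) v + frechet_derivative G (at x) v)) (at x)" if "x \<in> S" for x
    using Suc.prems that by (intro has_derivative_add has_frechet_derivative) auto
  have "Ck_on k (\<lambda>x. frechet_derivative (\<lambda>x. F x + G x) (at x) v) S" for v
    by (rule Ck_on_cong[OF assms _ Suc.IH[of "\<lambda>x. frechet_derivative F (at x) v" "\<lambda>x. frechet_derivative G (at x) v"]])
      (use Suc.prems frechet_derivative_eqI[OF d] in auto)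
  then show ?case using d by (auto simp: differentiable_def)
qed

lemma Ck_on_bilinear:
  assumes "bounded_bilinear B" "open S"
  shows "Ck_on k F S \<Longrightarrow> Ck_on k G S \<Longrightarrow> Ck_on k (\<lambda>x. B (F x) (G x)) S"
proof (induction k arbitrary: F G)
  case 0
  then show ?case using bounded_bilinear.continuous_on[OF assms(1)] by auto
next
  case (Suc k)
  have d: "((\<lambda>x. B (F x) (G x)) has_derivative (\<lambda>v. B (F x) (frechet_derivative G (at x) v) + B (frechet_derivative F (at x) v) (G x))) (at x)" if "x \<in> S" for x
    using Suc.prems that by (intro bounded_bilinear.FDERIV[OF assms(1)] has_frechet_derivative) auto
  have "Ck_on k (\<lambda>x. frechet_derivative (\<lambda>x. B (F x) (G x)) (at x) v) S" for v
    by (rule Ck_on_cong[OF assms(2) _ Ck_on_add[OF assms(2) Suc.IH[of F "\<lambda>x. frechet_derivative G (at x) v"]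
          Suc.IH[of "\<lambda>x. frechet_derivative F (at x) v" G]]])
      (use Suc.prems frechet_derivative_eqI[OF d] Ck_on_Suc_D in \<open>auto simp del: Ck_on.simps(1)\<close>)
  then show ?case using d by (auto simp: differentiable_def)
qed

lemma Ck_on_sum:
  assumes "open S"
  shows "(\<And>i. i \<in> I \<Longrightarrow> Ck_on k (F i) S) \<Longrightarrow> Ck_on k (\<lambda>x. \<Sum>i\<in>I. F i x) S"
  by (induction I rule: infinite_finite_induct) (auto simp: Ck_on_const intro!: Ck_on_add[OF assms])

text \<open>\<open>Ck_on\<close> takes derivatives in fixed directions, whereas the chain rule feeds
  the derivative of \<open>F\<close> a direction depending on \<open>x\<close>. Expanding that
  direction in \<open>Basis\<close> leaves finitely many derivatives of \<open>F\<close> in fixed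
  directions, each composed with \<open>G\<close>, to which the induction hypothesis
  applies.\<close>

lemma Ck_on_compose:
  fixes F :: "'e::euclidean_space \<Rightarrow> 'b::real_normed_vector" and G :: "'c::euclidean_space \<Rightarrow> 'e"
  assumes "open S" "open T" "G ` S \<subseteq> T"
  shows "Ck_on k F T \<Longrightarrow> Ck_on k G S \<Longrightarrow> Ck_on k (\<lambda>x. F (G x)) S"
proof (induction k arbitrary: F)
  case 0
  then show ?case using assms(3) by (auto intro: continuous_on_compose2)
next
  case (Suc k)
  let ?D = "\<lambda>x v. \<Sum>b\<in>Basis. (frechet_derivative G (at x) v \<bullet> b) *\<^sub>R frechet_derivative F (at (G x)) b"
  have d: "((\<lambda>x. F (G x)) has_derivative ?D x) (at x)" if "x \<in> S" for x
  proof -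
    have F: "(F has_derivative frechet_derivative F (at (G x))) (at (G x))"
      using Suc.prems that assms(3) by (intro has_frechet_derivative) auto
    have "((\<lambda>x. F (G x)) has_derivative (\<lambda>v. frechet_derivative F (at (G x)) (frechet_derivative G (at x) v))) (at x)"
      using has_derivative_compose[of G "frechet_derivative G (at x)" x UNIV F "frechet_derivative F (at (G x))"]
        F has_frechet_derivative[of G x] Suc.prems that by auto
    moreover have "frechet_derivative F (at (G x)) w = (\<Sum>b\<in>Basis. (w \<bullet> b) *\<^sub>R frechet_derivative F (at (G x)) b)" for w
    proof -
      have "frechet_derivative F (at (G x)) (\<Sum>b\<in>Basis. (w \<bullet> b) *\<^sub>R b) = (\<Sum>b\<in>Basis. (w \<bullet> b) *\<^sub>R frechet_derivative F (at (G x)) b)"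
        by (simp only: linear_sum[OF has_derivative_linear[OF F]] linear_scale[OF has_derivative_linear[OF F]])
      then show ?thesis by (simp only: euclidean_representation)
    qed
    ultimately show ?thesis by (rule has_derivative_eq_rhs[OF _ ext])
  qed
  have "Ck_on k (\<lambda>x. ?D x v) S" for v
    using Suc.prems Ck_on_Suc_D[OF Suc.prems(2)] by (intro Ck_on_sum Ck_on_bilinear[OF bounded_bilinear_scaleR] Suc.IH assms
        Ck_on_linear_compose[OF bounded_linear_inner_left]) simp_all
  then have "Ck_on k (\<lambda>x. frechet_derivative (\<lambda>x. F (G x)) (at x) v) S" for v
    by (rule Ck_on_cong[OF assms(1), rotated]) (use frechet_derivative_eqI[OF d] in auto)
  then show ?case using d by (auto simp: differentiable_def)
qed

text \<open>The derivative of the reciprocal contains the reciprocal again, but order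
  \<open>Suc k\<close> requires only order \<open>k\<close> of it, so the induction closes.\<close>

lemma Ck_on_inverse:
  fixes F :: "'e::euclidean_space \<Rightarrow> real"
  assumes "open S" "\<And>x. x \<in> S \<Longrightarrow> F x \<noteq> 0"
  shows "Ck_on k F S \<Longrightarrow> Ck_on k (\<lambda>x. inverse (F x)) S"
proof (induction k)
  case 0
  then show ?case using assms by (auto intro: continuous_intros)
next
  case (Suc k)
  let ?D = "\<lambda>x v. - (inverse (F x) * frechet_derivative F (at x) v * inverse (F x))"
  have d: "((\<lambda>x. inverse (F x)) has_derivative ?D x) (at x)" if "x \<in> S" for x
    using Suc.prems that by (intro Deriv.has_derivative_inverse has_frechet_derivative assms) auto
  have "Ck_on k (\<lambda>x. ?D x v) S" for v
    using Suc.prems Suc.IH[OF Ck_on_Suc_D[OF Suc.prems]]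
    by (intro Ck_on_linear_compose[OF bounded_linear_minus[OF bounded_linear_ident]]
        Ck_on_bilinear[OF bounded_bilinear_mult] assms) auto
  then have "Ck_on k (\<lambda>x. frechet_derivative (\<lambda>x. inverse (F x)) (at x) v) S" for v
    by (rule Ck_on_cong[OF assms(1), rotated]) (use frechet_derivative_eqI[OF d] in auto)
  then show ?case using d by (auto simp: differentiable_def)
qed

lemma Ck_on_real_Suc:
  fixes f :: "real \<Rightarrow> real"
  assumes "open S" "\<And>x. x \<in> S \<Longrightarrow> (f has_real_derivative f' x) (at x)" "Ck_on k f' S"
  shows "Ck_on (Suc k) f S"
proof -
  have d: "(f has_derivative (\<lambda>v. f' x * v)) (at x)" if "x \<in> S" for x
    using assms(2)[OF that] by (simp add: has_field_derivative_def)
  have "Ck_on k (\<lambda>x. frechet_derivative f (at x) v) S" for v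
    by (rule Ck_on_cong[OF assms(1) _ Ck_on_linear_compose[OF bounded_linear_mult_left assms(1,3), of v]])
       (use frechet_derivative_eqI[OF d] in auto)
  then show ?thesis using d by (auto simp: differentiable_def)
qed

lemma Ck_on_componentwise:
  fixes F :: "'e::euclidean_space \<Rightarrow> real^'n"
  assumes "open S" "\<And>i. Ck_on k (\<lambda>x. F x $ i) S"
  shows "Ck_on k F S"
proof -
  have "Ck_on k (\<lambda>x. \<Sum>i\<in>UNIV. (F x $ i) *\<^sub>R axis i (1::real)) S"
    by (intro Ck_on_sum Ck_on_linear_compose[OF bounded_linear_scaleR_left] assms)
  moreover have "(\<Sum>i\<in>UNIV. (F x $ i) *\<^sub>R axis i (1::real)) = F x" for x
    using basis_expansion[of "F x"] by (simp add: scalar_mult_eq_scaleR)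
  ultimately show ?thesis by simp
qed

lemma smooth_on_subset: "smooth_on F S \<Longrightarrow> T \<subseteq> S \<Longrightarrow> smooth_on F T"
  unfolding smooth_on_def using Ck_on_subset by blast

lemma smooth_on_cong: "open S \<Longrightarrow> (\<And>x. x \<in> S \<Longrightarrow> F x = G x) \<Longrightarrow> smooth_on F S \<Longrightarrow> smooth_on G S"
  unfolding smooth_on_def using Ck_on_cong by blast

lemma smooth_on_local:
  "(\<And>x. x \<in> S \<Longrightarrow> \<exists>U. open U \<and> x \<in> U \<and> smooth_on F U) \<Longrightarrow> smooth_on F S"
  unfolding smooth_on_def by (meson Ck_on_local)

lemma smooth_on_const: "smooth_on (\<lambda>x. c) S"
  by (simp add: smooth_on_def Ck_on_const)

lemma smooth_on_bounded_linear: "bounded_linear L \<Longrightarrow> smooth_on L S"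
  by (simp add: smooth_on_def Ck_on_bounded_linear)

lemma smooth_on_linear_compose:
  "bounded_linear L \<Longrightarrow> open S \<Longrightarrow> smooth_on F S \<Longrightarrow> smooth_on (\<lambda>x. L (F x)) S"
  by (simp add: smooth_on_def Ck_on_linear_compose)

lemma smooth_on_add: "open S \<Longrightarrow> smooth_on F S \<Longrightarrow> smooth_on G S \<Longrightarrow> smooth_on (\<lambda>x. F x + G x) S"
  by (simp add: smooth_on_def Ck_on_add)

lemma smooth_on_bilinear:
  "bounded_bilinear B \<Longrightarrow> open S \<Longrightarrow> smooth_on F S \<Longrightarrow> smooth_on G S \<Longrightarrow> smooth_on (\<lambda>x. B (F x) (G x)) S"
  by (simp add: smooth_on_def Ck_on_bilinear)

lemma smooth_on_mult:
  fixes F :: "'e::euclidean_space \<Rightarrow> real"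
  shows "open S \<Longrightarrow> smooth_on F S \<Longrightarrow> smooth_on G S \<Longrightarrow> smooth_on (\<lambda>x. F x * G x) S"
  using smooth_on_bilinear[OF bounded_bilinear_mult] by blast

lemma smooth_on_diff:
  fixes F :: "'e::euclidean_space \<Rightarrow> 'b::real_normed_vector"
  assumes "open S" "smooth_on F S" "smooth_on G S"
  shows "smooth_on (\<lambda>x. F x - G x) S"
  using smooth_on_add[OF assms(1,2) smooth_on_linear_compose[OF bounded_linear_minus[OF bounded_linear_ident] assms(1,3)]]
  by simp

lemma smooth_on_sum:
  "open S \<Longrightarrow> (\<And>i. i \<in> I \<Longrightarrow> smooth_on (F i) S) \<Longrightarrow> smooth_on (\<lambda>x. \<Sum>i\<in>I. F i x) S"
  by (simp add: smooth_on_def Ck_on_sum)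

lemma smooth_on_prod:
  fixes F :: "'i \<Rightarrow> 'e::euclidean_space \<Rightarrow> real"
  assumes "open S"
  shows "(\<And>i. i \<in> I \<Longrightarrow> smooth_on (F i) S) \<Longrightarrow> smooth_on (\<lambda>x. \<Prod>i\<in>I. F i x) S"
  by (induction I rule: infinite_finite_induct) (auto simp: smooth_on_const intro!: smooth_on_mult[OF assms])

lemma smooth_on_compose:
  "open S \<Longrightarrow> open T \<Longrightarrow> G ` S \<subseteq> T \<Longrightarrow> smooth_on F T \<Longrightarrow> smooth_on G S \<Longrightarrow> smooth_on (\<lambda>x. F (G x)) S"
  by (simp add: smooth_on_def Ck_on_compose)

lemma smooth_on_inverse:
  fixes F :: "'e::euclidean_space \<Rightarrow> real"
  shows "open S \<Longrightarrow> (\<And>x. x \<in> S \<Longrightarrow> F x \<noteq> 0) \<Longrightarrow> smooth_on F S \<Longrightarrow> smooth_on (\<lambda>x. inverse (F x)) S"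
  by (simp add: smooth_on_def Ck_on_inverse)

lemma smooth_on_componentwise:
  fixes F :: "'e::euclidean_space \<Rightarrow> real^'n"
  shows "open S \<Longrightarrow> (\<And>i. smooth_on (\<lambda>x. F x $ i) S) \<Longrightarrow> smooth_on F S"
  by (simp add: smooth_on_def Ck_on_componentwise)

lemma smooth_on_vec_nth:
  fixes F :: "'e::euclidean_space \<Rightarrow> real^'n"
  shows "open S \<Longrightarrow> smooth_on F S \<Longrightarrow> smooth_on (\<lambda>x. F x $ i) S"
  by (rule smooth_on_linear_compose[OF bounded_linear_vec_nth])

lemma smooth_on_frechet: "smooth_on F S \<Longrightarrow> smooth_on (\<lambda>x. frechet_derivative F (at x) v) S"
  unfolding smooth_on_def by (metis Ck_on.simps(2))

lemma smooth_on_differentiable: "smooth_on F S \<Longrightarrow> x \<in> S \<Longrightarrow> F differentiable (at x)"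
  unfolding smooth_on_def by (meson Ck_on.simps(2))

lemma smooth_on_has_derivative:
  "smooth_on F S \<Longrightarrow> x \<in> S \<Longrightarrow> (F has_derivative frechet_derivative F (at x)) (at x)"
  by (simp add: has_frechet_derivative smooth_on_differentiable)

lemma smooth_on_continuous: "smooth_on F S \<Longrightarrow> continuous_on S F"
  unfolding smooth_on_def by (metis Ck_on.simps(1))

lemma frechet_derivative_linear:
  "F differentiable (at x) \<Longrightarrow> linear (frechet_derivative F (at x))"
  by (rule has_derivative_linear[OF has_frechet_derivative])

text \<open>Both mixed derivatives are limits of the same second difference quotient.\<close>

lemma second_difference_MVT:
  fixes F :: "'e::euclidean_space \<Rightarrow> real"
  assumes h: "0 < h" and d1: "\<And>s t. \<lbrakk>0 \<le> s; s \<le> h; 0 \<le> t; t \<le> h\<rbrakk> \<Longrightarrow> F differentiable (at (x + s *\<^sub>R u + t *\<^sub>R v))"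
    and d2: "\<And>s t. \<lbrakk>0 \<le> s; s \<le> h; 0 \<le> t; t \<le> h\<rbrakk> \<Longrightarrow> (\<lambda>y. frechet_derivative F (at y) u) differentiable (at (x + s *\<^sub>R u + t *\<^sub>R v))"
  obtains s t where "0 < s" "s < h" "0 < t" "t < h"
    "F (x + h *\<^sub>R u + h *\<^sub>R v) - F (x + h *\<^sub>R u) - F (x + h *\<^sub>R v) + F x
      = h * h * frechet_derivative (\<lambda>y. frechet_derivative F (at y) u) (at (x + s *\<^sub>R u + t *\<^sub>R v)) v"
proof -
  \<comment> \<open>The difference in direction \<open>v\<close> is frozen. The mean value theorem
    in \<open>s\<close> turns it into a difference of derivatives in direction \<open>u\<close>, and
    a second application in \<open>t\<close> gives the mixed derivative at an interior
    point.\<close>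
  define g where "g s = F (x + s *\<^sub>R u + h *\<^sub>R v) - F (x + s *\<^sub>R u)" for s
  have dF: "((\<lambda>s. F (x + s *\<^sub>R u + t *\<^sub>R v)) has_real_derivative frechet_derivative F (at (x + s *\<^sub>R u + t *\<^sub>R v)) u) (at s)"
    if "0 \<le> s" "s \<le> h" "0 \<le> t" "t \<le> h" for s t
  proof -
    have "((\<lambda>s. x + s *\<^sub>R u + t *\<^sub>R v) has_derivative (\<lambda>r. r *\<^sub>R u)) (at s)"
      by (auto intro!: derivative_eq_intros)
    from has_derivative_compose[OF this has_frechet_derivative[OF d1[OF that]]]
    have "((\<lambda>s. F (x + s *\<^sub>R u + t *\<^sub>R v)) has_derivative (\<lambda>r. frechet_derivative F (at (x + s *\<^sub>R u + t *\<^sub>R v)) (r *\<^sub>R u))) (at s)" .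
    moreover have "frechet_derivative F (at (x + s *\<^sub>R u + t *\<^sub>R v)) (r *\<^sub>R u) = frechet_derivative F (at (x + s *\<^sub>R u + t *\<^sub>R v)) u * r" for r
      using linear_scale[OF frechet_derivative_linear[OF d1[OF that]]] by simp
    ultimately show ?thesis by (simp add: has_field_derivative_def)
  qed
  have "(g has_real_derivative frechet_derivative F (at (x + s *\<^sub>R u + h *\<^sub>R v)) u - frechet_derivative F (at (x + s *\<^sub>R u + 0 *\<^sub>R v)) u) (at s)"
    if "0 \<le> s" "s \<le> h" for s
    unfolding g_def using dF[of s h] dF[of s 0] that h by (auto intro!: DERIV_diff)
  from MVT2[OF h this] obtain s where s: "0 < s" "s < h" and
    gs: "g h - g 0 = (h - 0) * (frechet_derivative F (at (x + s *\<^sub>R u + h *\<^sub>R v)) u - frechet_derivative F (at (x + s *\<^sub>R u + 0 *\<^sub>R v)) u)"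
    by blast
  let ?k = "\<lambda>y. frechet_derivative F (at y) u"
  have dk: "((\<lambda>t. ?k (x + s *\<^sub>R u + t *\<^sub>R v)) has_real_derivative frechet_derivative ?k (at (x + s *\<^sub>R u + t *\<^sub>R v)) v) (at t)"
    if "0 \<le> t" "t \<le> h" for t
  proof -
    have dd: "?k differentiable (at (x + s *\<^sub>R u + t *\<^sub>R v))" using d2 s that by simp
    have "((\<lambda>t. x + s *\<^sub>R u + t *\<^sub>R v) has_derivative (\<lambda>r. r *\<^sub>R v)) (at t)"
      by (auto intro!: derivative_eq_intros)
    from has_derivative_compose[OF this has_frechet_derivative[OF dd]]
    have "((\<lambda>t. ?k (x + s *\<^sub>R u + t *\<^sub>R v)) has_derivative (\<lambda>r. frechet_derivative ?k (at (x + s *\<^sub>R u + t *\<^sub>R v)) (r *\<^sub>R v))) (at t)" .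
    moreover have "frechet_derivative ?k (at (x + s *\<^sub>R u + t *\<^sub>R v)) (r *\<^sub>R v) = frechet_derivative ?k (at (x + s *\<^sub>R u + t *\<^sub>R v)) v * r" for r
      using linear_scale[OF frechet_derivative_linear[OF dd]] by simp
    ultimately show ?thesis by (simp add: has_field_derivative_def)
  qed
  from MVT2[OF h dk] obtain t where t: "0 < t" "t < h" and
    "?k (x + s *\<^sub>R u + h *\<^sub>R v) - ?k (x + s *\<^sub>R u + 0 *\<^sub>R v) = (h - 0) * frechet_derivative ?k (at (x + s *\<^sub>R u + t *\<^sub>R v)) v"
    by blast
  with gs have "g h - g 0 = h * h * frechet_derivative ?k (at (x + s *\<^sub>R u + t *\<^sub>R v)) v" by simp
  with that[OF s t] show thesis by (simp add: g_def)
qed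

lemma frechet_derivative_commute_real:
  fixes F :: "'e::euclidean_space \<Rightarrow> real"
  assumes "Ck_on 2 F S" "open S" "x \<in> S"
  shows "frechet_derivative (\<lambda>y. frechet_derivative F (at y) u) (at x) v =
         frechet_derivative (\<lambda>y. frechet_derivative F (at y) v) (at x) u" (is "?A x = ?B x")
proof (rule ccontr)
  assume ne: "?A x \<noteq> ?B x"
  \<comment> \<open>Half of the assumed gap: a single number cannot be closer than \<open>e\<close>
    to both mixed derivatives at \<open>x\<close>.\<close>
  define e where "e = \<bar>?A x - ?B x\<bar> / 2"
  have e: "e > 0" using ne by (simp add: e_def)
  have C: "F differentiable (at y)" "(\<lambda>y. frechet_derivative F (at y) w) differentiable (at y)" if "y \<in> S" for y w
    using assms(1) that by (auto simp: numeral_2_eq_2)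
  have cont: "continuous_on S ?A" "continuous_on S ?B" using assms(1) by (auto simp: numeral_2_eq_2)
  have "\<forall>\<^sub>F y in nhds x. y \<in> S" using assms by (simp add: eventually_nhds_in_open)
  moreover have "\<forall>\<^sub>F y in nhds x. dist (?A y) (?A x) < e"
    using cont(1) assms e by (simp add: continuous_on_eq_continuous_at continuous_at_eps_delta eventually_nhds_metric)
  moreover have "\<forall>\<^sub>F y in nhds x. dist (?B y) (?B x) < e"
    using cont(2) assms e by (simp add: continuous_on_eq_continuous_at continuous_at_eps_delta eventually_nhds_metric)
  ultimately have "\<forall>\<^sub>F y in nhds x. y \<in> S \<and> dist (?A y) (?A x) < e \<and> dist (?B y) (?B x) < e"
    by eventually_elim auto
  then obtain d where d: "d > 0" and dd: "\<And>y. dist y x < d \<Longrightarrow> y \<in> S \<and> dist (?A y) (?A x) < e \<and> dist (?B y) (?B x) < e"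
    unfolding eventually_nhds_metric by blast
  \<comment> \<open>With this step the whole parallelogram spanned by \<open>h u\<close> and
    \<open>h v\<close> stays within distance \<open>d\<close> of \<open>x\<close>; the summand 1
    covers \<open>u = v = 0\<close>.\<close>
  define h where "h = d / (2 * (norm u + norm v + 1))"
  have hpos: "h > 0" using d by (simp add: h_def add_nonneg_pos)
  have hb: "h * (norm u + norm v) < d"
  proof -
    have "h * (norm u + norm v) \<le> h * (norm u + norm v + 1)" using hpos by simp
    also have "\<dots> = d / 2"
    proof -
      have "norm u + norm v + 1 \<noteq> 0" by (smt (verit) norm_ge_zero)
      then show ?thesis unfolding h_def by (metis nonzero_mult_divide_mult_cancel_right times_divide_eq_left)
    qed
    finally show ?thesis using d by simp
  qed
  have near: "dist (x + s *\<^sub>R u + t *\<^sub>R v) x < d" if "0 \<le> s" "s \<le> h" "0 \<le> t" "t \<le> h" for s t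
  proof -
    have "dist (x + s *\<^sub>R u + t *\<^sub>R v) x = norm (s *\<^sub>R u + t *\<^sub>R v)" by (simp add: dist_norm)
    also have "\<dots> \<le> s * norm u + t * norm v" using norm_triangle_ineq[of "s *\<^sub>R u" "t *\<^sub>R v"] that by simp
    also have "\<dots> \<le> h * norm u + h * norm v" using that by (intro add_mono mult_right_mono) auto
    finally show ?thesis using hb by (simp add: algebra_simps)
  qed
  have C1: "F differentiable (at (x + s *\<^sub>R u + t *\<^sub>R v))" "(\<lambda>y. frechet_derivative F (at y) w) differentiable (at (x + s *\<^sub>R u + t *\<^sub>R v))"
    if "0 \<le> s" "s \<le> h" "0 \<le> t" "t \<le> h" for s t w
    using C dd near[OF that] by auto
  obtain s t where st: "0 < s" "s < h" "0 < t" "t < h"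
    "F (x + h *\<^sub>R u + h *\<^sub>R v) - F (x + h *\<^sub>R u) - F (x + h *\<^sub>R v) + F x = h * h * ?A (x + s *\<^sub>R u + t *\<^sub>R v)"
    using second_difference_MVT[OF hpos, of F x u v, OF C1(1) C1(2)] by blast
  have C2: "F differentiable (at (x + s *\<^sub>R v + t *\<^sub>R u))" "(\<lambda>y. frechet_derivative F (at y) w) differentiable (at (x + s *\<^sub>R v + t *\<^sub>R u))"
    if "0 \<le> s" "s \<le> h" "0 \<le> t" "t \<le> h" for s t w
    using C1[of t s] that by (auto simp: add.commute add.left_commute)
  obtain s' t' where st': "0 < s'" "s' < h" "0 < t'" "t' < h"
    "F (x + h *\<^sub>R v + h *\<^sub>R u) - F (x + h *\<^sub>R v) - F (x + h *\<^sub>R u) + F x = h * h * ?B (x + s' *\<^sub>R v + t' *\<^sub>R u)"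
    using second_difference_MVT[OF hpos, of F x v u, OF C2(1) C2(2)] by blast
  have "h * h * ?A (x + s *\<^sub>R u + t *\<^sub>R v) = h * h * ?B (x + s' *\<^sub>R v + t' *\<^sub>R u)"
  proof -
    have "x + h *\<^sub>R v + h *\<^sub>R u = x + h *\<^sub>R u + h *\<^sub>R v" by simp
    then have "F (x + h *\<^sub>R v + h *\<^sub>R u) = F (x + h *\<^sub>R u + h *\<^sub>R v)" by (rule arg_cong)
    then show ?thesis using st(5) st'(5) by linarith
  qed
  then have "?A (x + s *\<^sub>R u + t *\<^sub>R v) = ?B (x + t' *\<^sub>R u + s' *\<^sub>R v)"
    using hpos by (simp add: add.commute add.left_commute)
  moreover have "dist (?A (x + s *\<^sub>R u + t *\<^sub>R v)) (?A x) < e" "dist (?B (x + t' *\<^sub>R u + s' *\<^sub>R v)) (?B x) < e"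
    using dd near st st' by auto
  moreover have False if "a = b" "\<bar>a - p\<bar> < \<bar>p - q\<bar> / 2" "\<bar>b - q\<bar> < \<bar>p - q\<bar> / 2" for a b p q :: real
    using that by (simp add: abs_if split: if_splits)
  ultimately show False unfolding e_def dist_real_def by blast
qed

lemma frechet_derivative_commute:
  fixes F :: "'e::euclidean_space \<Rightarrow> 'b::euclidean_space"
  assumes "Ck_on 2 F S" "open S" "x \<in> S"
  shows "frechet_derivative (\<lambda>y. frechet_derivative F (at y) u) (at x) v =
         frechet_derivative (\<lambda>y. frechet_derivative F (at y) v) (at x) u"
proof (rule euclidean_eqI)
  fix b :: 'b
  have dF: "F differentiable (at y)" "(\<lambda>y. frechet_derivative F (at y) w) differentiable (at y)" if "y \<in> S" for y w
    using assms(1) that by (auto simp: numeral_2_eq_2)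
  have 1: "frechet_derivative (\<lambda>y. F y \<bullet> b) (at y) w = frechet_derivative F (at y) w \<bullet> b" if "y \<in> S" for y w
    using frechet_derivative_eqI[OF bounded_linear.has_derivative[OF bounded_linear_inner_left[of b] has_frechet_derivative[OF dF(1)[OF that]]]] by simp
  have 2: "frechet_derivative (\<lambda>y. frechet_derivative F (at y) w \<bullet> b) (at x) z
      = frechet_derivative (\<lambda>y. frechet_derivative F (at y) w) (at x) z \<bullet> b" for w z
    using frechet_derivative_eqI[OF bounded_linear.has_derivative[OF bounded_linear_inner_left[of b] has_frechet_derivative[OF dF(2)[OF assms(3)]]]] by simp
  have 3: "frechet_derivative (\<lambda>y. frechet_derivative (\<lambda>y. F y \<bullet> b) (at y) w) (at x) z
     = frechet_derivative (\<lambda>y. frechet_derivative F (at y) w) (at x) z \<bullet> b" for w z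
    using frechet_derivative_cong_open[OF assms(2,3), of "\<lambda>y. frechet_derivative (\<lambda>y. F y \<bullet> b) (at y) w"
        "\<lambda>y. frechet_derivative F (at y) w \<bullet> b"] 1 2 by simp
  show "frechet_derivative (\<lambda>y. frechet_derivative F (at y) u) (at x) v \<bullet> b =
         frechet_derivative (\<lambda>y. frechet_derivative F (at y) v) (at x) u \<bullet> b"
    using frechet_derivative_commute_real[OF Ck_on_linear_compose[OF bounded_linear_inner_left[of b] assms(2,1)] assms(2,3), where u=u and v=v] 3
    by simp
qed

subsection \<open>Bump functions and mollification\<close>

text \<open>The functions \<open>exp (- 1 / t) / t ^ n\<close>, extended by 0. Only
  \<open>n = 0\<close> is wanted in the end; the whole family is introduced because its linear span
  is closed under differentiation.\<close>

definition flat :: "nat \<Rightarrow> real \<Rightarrow> real"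
  where "flat n t = (if t \<le> 0 then 0 else exp (- inverse t) * inverse t ^ n)"

text \<open>On the right of 0 the substitution \<open>x = 1 / t\<close> reduces the claim to the
  exponential outgrowing every power.\<close>

lemma flat_tendsto: "(flat n \<longlongrightarrow> 0) (at 0)"
proof -
  have "((\<lambda>x::real. x ^ n / exp x) \<longlongrightarrow> 0) at_top" by (rule tendsto_power_div_exp_0)
  from filterlim_compose[OF this filterlim_inverse_at_top_right]
  have "((\<lambda>t::real. inverse t ^ n / exp (inverse t)) \<longlongrightarrow> 0) (at_right 0)" .
  then have "(flat n \<longlongrightarrow> 0) (at_right 0)"
    by (rule Lim_transform_eventually)
      (auto simp: flat_def eventually_at_right_field exp_minus field_simps intro!: exI[of _ 1])
  moreover have "(flat n \<longlongrightarrow> 0) (at_left 0)"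
    by (rule Lim_transform_eventually[OF tendsto_const])
      (auto simp: flat_def eventually_at_left_field intro!: exI[of _ "-1"])
  ultimately show ?thesis by (simp add: filterlim_split_at)
qed

lemma flat_deriv: "(flat n has_real_derivative flat (n + 2) t - real n * flat (n + 1) t) (at t)"
proof -
  consider "t < 0" | "t = 0" | "t > 0" by linarith
  then show ?thesis
  proof cases
    case 1
    have "((\<lambda>t. 0) has_real_derivative 0) (at t)" by simp
    then have "(flat n has_real_derivative 0) (at t)"
      by (rule has_field_derivative_transform_within_open[of _ _ _ "{..<0}"]) (use 1 in \<open>auto simp: flat_def\<close>)
    then show ?thesis using 1 by (simp add: flat_def)
  next
    case 2
    \<comment> \<open>At the origin the difference quotient of one member of the family is exactly
      the next member, so differentiability there is the limit \<open>flat_tendsto\<close>.\<close>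
    have "(\<lambda>h. (flat n (0 + h) - flat n 0) / h) = flat (n + 1)"
      by (auto simp: flat_def fun_eq_iff field_simps)
    then have "(flat n has_real_derivative 0) (at 0)"
      unfolding DERIV_def using flat_tendsto[of "n+1"] by simp
    then show ?thesis using 2 by (simp add: flat_def)
  next
    case 3
    have "((\<lambda>t. exp (- inverse t) * inverse t ^ n) has_real_derivative
       exp (- inverse t) * (inverse t ^ 2) * inverse t ^ n + exp (- inverse t) * (real n * inverse t ^ (n - 1) * (- (inverse t ^ 2)))) (at t)"
      using 3 by (auto intro!: derivative_eq_intros simp: power2_eq_square)
    then have "(flat n has_real_derivative
       exp (- inverse t) * (inverse t ^ 2) * inverse t ^ n + exp (- inverse t) * (real n * inverse t ^ (n - 1) * (- (inverse t ^ 2)))) (at t)"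
      by (rule has_field_derivative_transform_within_open[of _ _ _ "{0<..}"]) (use 3 in \<open>auto simp: flat_def\<close>)
    moreover have "real n * inverse t ^ (n - 1) * (inverse t ^ 2) = real n * inverse t ^ (n + 1)"
      by (cases n) (simp_all add: power2_eq_square)
    then have "exp (- inverse t) * (inverse t ^ 2) * inverse t ^ n + exp (- inverse t) * (real n * inverse t ^ (n - 1) * (- (inverse t ^ 2)))
        = flat (n + 2) t - real n * flat (n + 1) t"
      using 3 by (simp add: flat_def power_add mult.assoc mult.left_commute power2_eq_square)
    ultimately show ?thesis by simp
  qed
qed

lemma smooth_on_flat: "smooth_on (flat n) UNIV"
proof -
  have "Ck_on k (flat n) UNIV" for k n
  proof (induction k arbitrary: n)
    case 0
    show ?case using DERIV_isCont[OF flat_deriv] by (auto intro: continuous_at_imp_continuous_on)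
  next
    case (Suc k)
    have "Ck_on k (\<lambda>t. flat (n + 2) t + (- real n) * flat (n + 1) t) UNIV"
      by (intro Ck_on_add Ck_on_bilinear[OF bounded_bilinear_mult] Ck_on_const Suc open_UNIV)
    then show ?case by (intro Ck_on_real_Suc[OF open_UNIV flat_deriv]) simp
  qed
  then show ?thesis by (simp add: smooth_on_def)
qed

definition smooth_step :: "real \<Rightarrow> real"
  where "smooth_step t = flat 0 t * inverse (flat 0 t + flat 0 (1 - t))"

lemma flat_nonneg: "0 \<le> flat n t" and flat_pos: "0 < t \<Longrightarrow> 0 < flat n t"
  by (auto simp: flat_def)

text \<open>One of \<open>t\<close> and \<open>1 - t\<close> is always positive, so the denominator
  of \<open>smooth_step\<close> has no zero.\<close>

lemma flat_sum_pos: "0 < flat 0 t + flat 0 (1 - t)"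
  using flat_nonneg[of 0] flat_pos[of t 0] flat_pos[of "1 - t" 0]
  by (cases "0 < t") (auto intro: add_pos_nonneg add_nonneg_pos)

lemma smooth_step_smooth: "smooth_on smooth_step UNIV"
proof -
  have "smooth_on (\<lambda>t. flat 0 (1 - t)) UNIV"
    by (intro smooth_on_compose[OF _ _ _ smooth_on_flat] smooth_on_diff smooth_on_const smooth_on_bounded_linear) auto
  then have "smooth_on (\<lambda>t. flat 0 t * inverse (flat 0 t + flat 0 (1 - t))) UNIV"
    using flat_sum_pos by (intro smooth_on_mult smooth_on_inverse smooth_on_add smooth_on_flat) (auto simp: less_le)
  then show ?thesis unfolding smooth_step_def[abs_def] .
qed

lemma smooth_step_0: "t \<le> 0 \<Longrightarrow> smooth_step t = 0"
  by (simp add: smooth_step_def flat_def)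

lemma smooth_step_1: "1 \<le> t \<Longrightarrow> smooth_step t = 1"
  using flat_pos[of t 0] by (simp add: smooth_step_def flat_def)

lemma smooth_step_bounds: "0 \<le> smooth_step t" "smooth_step t \<le> 1"
  using flat_nonneg[of 0 t] flat_nonneg[of 0 "1 - t"] flat_sum_pos[of t]
  by (auto simp: smooth_step_def field_simps)

text \<open>The squared distance to \<open>a\<close> is a polynomial, so the composite is smooth at
  the centre too. For \<open>0 < r < R\<close> the value is 1 on the ball of radius \<open>r\<close>
  and 0 outside the ball of radius \<open>R\<close>.\<close>

definition bump :: "'e::euclidean_space \<Rightarrow> real \<Rightarrow> real \<Rightarrow> 'e \<Rightarrow> real"
  where "bump a r R y = smooth_step ((R\<^sup>2 - (y - a) \<bullet> (y - a)) * inverse (R\<^sup>2 - r\<^sup>2))"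

lemma bump_smooth: "smooth_on (bump a r R) UNIV"
proof -
  have 1: "smooth_on (\<lambda>y. y - a) UNIV"
    by (intro smooth_on_diff smooth_on_const smooth_on_bounded_linear) auto
  have "smooth_on (\<lambda>y. smooth_step ((R\<^sup>2 - (y - a) \<bullet> (y - a)) * inverse (R\<^sup>2 - r\<^sup>2))) UNIV"
    by (intro smooth_on_compose[OF _ _ _ smooth_step_smooth] smooth_on_mult smooth_on_diff smooth_on_const
        smooth_on_bilinear[OF bounded_bilinear_inner] 1) auto
  then show ?thesis unfolding bump_def[abs_def] .
qed

lemma bump_continuous: "continuous_on S (bump a r R)"
  using smooth_on_continuous[OF bump_smooth] continuous_on_subset by blast

lemma bump_bounds: "0 \<le> bump a r R y" "bump a r R y \<le> 1"
  by (simp_all add: bump_def smooth_step_bounds)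

lemma bump_1:
  assumes "0 < r" "r < R" "dist y a \<le> r" shows "bump a r R y = 1"
proof -
  have "(y - a) \<bullet> (y - a) \<le> r\<^sup>2"
    using assms by (simp add: dot_square_norm dist_norm power_mono)
  moreover have "r\<^sup>2 < R\<^sup>2" using assms by (simp add: power_strict_mono)
  ultimately show ?thesis unfolding bump_def by (intro smooth_step_1) (simp add: field_simps)
qed

lemma bump_0:
  assumes "0 < r" "r < R" "R \<le> dist y a" shows "bump a r R y = 0"
proof -
  have "R\<^sup>2 \<le> (y - a) \<bullet> (y - a)"
    using assms by (simp add: dot_square_norm dist_norm power_mono)
  moreover have "r\<^sup>2 < R\<^sup>2" using assms by (simp add: power_strict_mono)
  ultimately show ?thesis unfolding bump_def by (intro smooth_step_0) (simp add: mult_nonpos_nonneg)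
qed

section \<open>Convolution with a smooth kernel\<close>

lemma integral_frechet_derivative:
  fixes k :: "'e::euclidean_space \<Rightarrow> real"
  assumes u: "continuous_on UNIV u" and k: "smooth_on k UNIV"
  shows "((\<lambda>y. integral (cbox a b) (\<lambda>t. u t * k (t - y))) has_derivative
     (\<lambda>v. integral (cbox a b) (\<lambda>t. u t * - frechet_derivative k (at (t - y)) v))) (at y)"
proof -
  \<comment> \<open>Differentiation under the integral sign is applied with derivatives in the space
    of bounded linear maps. Written in coordinates, the derivative is a finite sum whose joint
    continuity is evident; the sign comes from differentiating \<open>t - y\<close> in
    \<open>y\<close>.\<close>
  define fx where "fx y t = (\<Sum>i\<in>Basis. (u t * - frechet_derivative k (at (t - y)) i) *\<^sub>R blinfun_inner_left i)" for y t
  have kc: "continuous_on UNIV (\<lambda>x. frechet_derivative k (at x) v)" for v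
    using smooth_on_continuous[OF smooth_on_frechet[OF k]] .
  have app: "blinfun_apply (fx y t) v = u t * - frechet_derivative k (at (t - y)) v" for y t v
  proof -
    have "frechet_derivative k (at (t - y)) (\<Sum>i\<in>Basis. (v \<bullet> i) *\<^sub>R i) = (\<Sum>i\<in>Basis. (v \<bullet> i) * frechet_derivative k (at (t - y)) i)"
      using frechet_derivative_linear[OF smooth_on_differentiable[OF k]]
      by (simp add: linear_sum linear_scale)
    then have "frechet_derivative k (at (t - y)) v = (\<Sum>i\<in>Basis. (v \<bullet> i) * frechet_derivative k (at (t - y)) i)"
      by (simp only: euclidean_representation)
    then show ?thesis
      by (simp add: fx_def blinfun.sum_left blinfun.scaleR_left blinfun.minus_left sum_distrib_left
          sum_negf mult_ac inner_commute)
  qed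
  have "((\<lambda>y. integral (cbox a b) (\<lambda>t. u t * k (t - y))) has_derivative integral (cbox a b) (fx y)) (at y within UNIV)"
  proof (rule leibniz_rule)
    fix x t
    have "((\<lambda>x. k (t - x)) has_derivative (\<lambda>v. frechet_derivative k (at (t - x)) (- v))) (at x)"
      by (rule has_derivative_compose[of "\<lambda>x. t - x" uminus, OF _ smooth_on_has_derivative[OF k]])
        (auto intro!: derivative_eq_intros)
    moreover have "frechet_derivative k (at (t - x)) (- v) = - frechet_derivative k (at (t - x)) v" for v
      using linear_neg[OF frechet_derivative_linear[OF smooth_on_differentiable[OF k]]] by simp
    ultimately have "((\<lambda>x. k (t - x)) has_derivative (\<lambda>v. - frechet_derivative k (at (t - x)) v)) (at x)" by simp
    from has_derivative_mult_right[OF this, of "u t"]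
    show "((\<lambda>x. u t * k (t - x)) has_derivative blinfun_apply (fx x t)) (at x within UNIV)"
      unfolding app[THEN ext] by (rule has_derivative_eq_rhs) (simp add: fun_eq_iff)
  next
    fix x
    have "continuous_on (cbox a b) (\<lambda>t. u t * k (t - x))"
      by (intro continuous_intros continuous_on_compose2[OF smooth_on_continuous[OF k]] continuous_on_subset[OF u]) auto
    then show "(\<lambda>t. u t * k (t - x)) integrable_on cbox a b" by (rule integrable_continuous)
  next
    show "continuous_on (UNIV \<times> cbox a b) (\<lambda>(x, t). fx x t)"
      unfolding fx_def split_def
      by (intro continuous_intros continuous_on_compose2[OF kc] continuous_on_compose2[OF u]) auto
  qed auto
  moreover have "blinfun_apply (integral (cbox a b) (fx y)) v = integral (cbox a b) (\<lambda>t. u t * - frechet_derivative k (at (t - y)) v)" for v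
  proof -
    have "continuous_on (cbox a b) (fx y)"
      unfolding fx_def
      by (intro continuous_intros continuous_on_compose2[OF kc] continuous_on_compose2[OF u]) auto
    then have "blinfun_apply (integral (cbox a b) (fx y)) v = integral (cbox a b) (\<lambda>t. blinfun_apply (fx y t) v)"
      by (metis blinfun_apply_integral integrable_continuous)
    then show ?thesis by (simp add: app)
  qed
  ultimately show ?thesis by (rule has_derivative_eq_rhs[OF _ ext])
qed

text \<open>A derivative of the convolution is again such a convolution, with the kernel replaced by
  minus its directional derivative; hence the induction varies the kernel.\<close>

lemma smooth_on_integral:
  fixes k :: "'e::euclidean_space \<Rightarrow> real"
  assumes u: "continuous_on UNIV u" and k: "smooth_on k UNIV"
  shows "smooth_on (\<lambda>y. integral (cbox a b) (\<lambda>t. u t * k (t - y))) UNIV"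
proof -
  have "Ck_on n (\<lambda>y. integral (cbox a b) (\<lambda>t. u t * k (t - y))) UNIV" if "smooth_on k UNIV" for n k
    using that
  proof (induction n arbitrary: k)
    case 0
    show ?case
      using has_derivative_continuous[OF integral_frechet_derivative[OF u 0]]
      by (auto intro!: continuous_at_imp_continuous_on)
  next
    case (Suc n)
    have 1: "smooth_on (\<lambda>x. - frechet_derivative k (at x) v) UNIV" for v
      by (intro smooth_on_linear_compose[OF bounded_linear_minus[OF bounded_linear_ident]] smooth_on_frechet Suc) auto
    have "frechet_derivative (\<lambda>y. integral (cbox a b) (\<lambda>t. u t * k (t - y))) (at y) v =
       integral (cbox a b) (\<lambda>t. u t * - frechet_derivative k (at (t - y)) v)" for y v
      by (simp only: frechet_derivative_eqI[OF integral_frechet_derivative[OF u Suc.prems]])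
    then have "Ck_on n (\<lambda>y. frechet_derivative (\<lambda>y. integral (cbox a b) (\<lambda>t. u t * k (t - y))) (at y) v) UNIV" for v
      using Suc.IH[OF 1, of v] by (simp only:)
    moreover have "(\<lambda>y. integral (cbox a b) (\<lambda>t. u t * k (t - y))) differentiable (at y)" for y
      unfolding differentiable_def using integral_frechet_derivative[OF u Suc.prems] by blast
    ultimately show ?case unfolding Ck_on.simps by blast
  qed
  then show ?thesis using k by (simp add: smooth_on_def)
qed

text \<open>Difference quotients for positive \<open>t\<close> determine the derivative, so the
  bound is required on one side only. This suits the later bounds, which are assumed positively
  homogeneous.\<close>

lemma derivative_bound_directional:
  fixes v :: "'e::real_normed_vector \<Rightarrow> real"
  assumes v: "(v has_derivative D) (at y)" and d: "d > 0"
    and b: "\<And>t. 0 < t \<Longrightarrow> t < d \<Longrightarrow> \<bar>v (y + t *\<^sub>R w) - v y\<bar> \<le> t * L"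
  shows "\<bar>D w\<bar> \<le> L"
proof -
  have "((\<lambda>t. y + t *\<^sub>R w) has_derivative (\<lambda>r. r *\<^sub>R w)) (at (0::real))"
    by (auto intro!: derivative_eq_intros)
  from has_derivative_compose[OF this, of v D] v
  have "((\<lambda>t. v (y + t *\<^sub>R w)) has_derivative (\<lambda>r. D (r *\<^sub>R w))) (at 0)" by simp
  moreover have "D (r *\<^sub>R w) = D w * r" for r using linear_scale[OF has_derivative_linear[OF v]] by simp
  ultimately have "((\<lambda>t. v (y + t *\<^sub>R w)) has_real_derivative D w) (at 0)"
    by (simp add: has_field_derivative_def)
  then have "((\<lambda>t. (v (y + t *\<^sub>R w) - v y) / t) \<longlongrightarrow> D w) (at 0)" by (simp add: DERIV_def)
  then have "((\<lambda>t. \<bar>(v (y + t *\<^sub>R w) - v y) / t\<bar>) \<longlongrightarrow> \<bar>D w\<bar>) (at_right 0)"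
    by (rule filterlim_mono[OF tendsto_rabs order_refl at_le[OF subset_UNIV]])
  moreover have "\<forall>\<^sub>F t in at_right 0. \<bar>(v (y + t *\<^sub>R w) - v y) / t\<bar> \<le> L"
  proof -
    have "\<forall>\<^sub>F t in at_right (0::real). 0 < t \<and> t < d"
      using eventually_at_right_real[OF d] by simp
    then show ?thesis
    proof (rule eventually_mono)
      fix t :: real assume t: "0 < t \<and> t < d"
      then have "\<bar>v (y + t *\<^sub>R w) - v y\<bar> \<le> L * t" using b[of t] by (simp add: mult.commute)
      then show "\<bar>(v (y + t *\<^sub>R w) - v y) / t\<bar> \<le> L"
        using t by (simp add: abs_divide pos_divide_le_eq)
    qed
  qed
  ultimately show ?thesis by (rule tendsto_upperbound) simp
qed

text \<open>Convolution averages the increments of \<open>u\<close>, so a bound shared by these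
  increments near \<open>y\<close> passes to the derivative without loss. The bound \<open>L\<close>
  is a function of the displacement rather than a multiple of the Euclidean norm, because it will
  come from the norm of a Riemannian metric frozen at \<open>y\<close>.\<close>

lemma mollify:
  fixes u :: "'e::euclidean_space \<Rightarrow> real"
  assumes u: "continuous_on UNIV u" and S: "bounded S" and e: "e > 0"
  obtains v where "smooth_on v UNIV"
    "\<And>y c. y \<in> S \<Longrightarrow> (\<And>x. dist x y \<le> e \<Longrightarrow> \<bar>u x - u y\<bar> \<le> c) \<Longrightarrow> \<bar>v y - u y\<bar> \<le> c"
    "\<And>y w L. y \<in> S \<Longrightarrow> (\<And>x x'. dist x y < 2 * e \<Longrightarrow> dist x' y < 2 * e \<Longrightarrow> \<bar>u x - u x'\<bar> \<le> L (x - x'))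
        \<Longrightarrow> (\<And>t. 0 < t \<Longrightarrow> L (t *\<^sub>R w) = t * L w) \<Longrightarrow> \<bar>frechet_derivative v (at y) w\<bar> \<le> L w"
proof -
  obtain B where B: "S \<subseteq> ball 0 B" using S by (meson bounded_subset_ballD)
  \<comment> \<open>Points of \<open>S\<close> lie within \<open>B\<close>. The integral formula is
    available up to \<open>B + 2 e\<close>, and the kernel reaches a further distance
    \<open>e\<close>; inside this box the domain of integration can be restricted to the support of
    the kernel.\<close>
  obtain a where a: "ball 0 (B + 3 * e) \<subseteq> cbox (- a) (a::'e)"
    using bounded_subset_cbox_symmetric[OF bounded_ball] by blast
  define b where "b = bump (0::'e) (e / 2) e"
  have b: "0 \<le> b x" "dist x 0 \<le> e / 2 \<Longrightarrow> b x = 1" "e \<le> dist x 0 \<Longrightarrow> b x = 0" for x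
    using e unfolding b_def by (simp_all add: bump_bounds bump_1 bump_0)
  have bcont: "continuous_on T b" for T unfolding b_def by (rule bump_continuous)
  define I where "I = integral (cball 0 e) b"
  have bI: "(b has_integral I) (cball 0 e)"
    unfolding I_def using borel_integrable_compact[OF compact_cball bcont]
    by (intro integrable_integral set_borel_integral_eq_integral) (simp add: set_integrable_def)
  have Ipos: "I > 0"
  proof -
    have "((\<lambda>x. 1) has_integral measure lborel (cball (0::'e) (e/2))) (cball (0::'e) (e/2))"
      by (rule has_integral_measure_lborel[OF _ emeasure_lborel_cball_finite]) simp
    then have "(b has_integral measure lborel (cball (0::'e) (e/2))) (cball (0::'e) (e/2))"
      by (rule has_integral_eq[rotated]) (use b(2) in auto)
    then have "measure lborel (cball (0::'e) (e/2)) \<le> I"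
      by (rule has_integral_subset_le[rotated]) (use bI b e in auto)
    moreover have "0 < measure lborel (cball (0::'e) (e/2))"
      using e content_cball_pos by simp
    ultimately show ?thesis by linarith
  qed
  define k where "k x = b x * inverse I" for x
  have k_smooth: "smooth_on k UNIV"
    unfolding k_def[abs_def] b_def by (intro smooth_on_mult smooth_on_const bump_smooth) auto
  have kcont: "continuous_on T k" for T
    using smooth_on_continuous[OF k_smooth] continuous_on_subset by blast
  have k: "0 \<le> k x" "e \<le> dist x 0 \<Longrightarrow> k x = 0" for x using b Ipos by (auto simp: k_def)
  have k1: "(k has_integral 1) (cball 0 e)"
    using has_integral_mult_left[OF bI, of "inverse I"] Ipos by (simp add: k_def[abs_def])
  define v where "v y = integral (cbox (-a) a) (\<lambda>t. u t * k (t - y))" for y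
  have v_smooth: "smooth_on v UNIV"
    unfolding v_def[abs_def] by (rule smooth_on_integral[OF u k_smooth])
  have v_int: "((\<lambda>z. u (z + y) * k z) has_integral v y) (cball 0 e)" if "dist y 0 < B + 2 * e" for y
  proof -
    have "continuous_on (cbox (-a) a) (\<lambda>t. u t * k (t - y))"
      by (intro continuous_intros continuous_on_compose2[OF kcont] continuous_on_subset[OF u]) auto
    then have "((\<lambda>t. u t * k (t - y)) has_integral v y) (cbox (-a) a)"
      unfolding v_def using integrable_continuous integrable_integral by blast
    from has_integral_affinity[OF this, of 1 y]
    have i: "((\<lambda>z. u (z + y) * k z) has_integral v y) ((\<lambda>z. z - y) ` cbox (-a) a)" by simp
    have "cball 0 e \<subseteq> (\<lambda>z. z - y) ` cbox (-a) a"
    proof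
      fix z :: 'e assume z: "z \<in> cball 0 e"
      have "norm (z + y) \<le> norm z + norm y" by (rule norm_triangle_ineq)
      then have "z + y \<in> ball 0 (B + 3 * e)" using z that by simp
      then show "z \<in> (\<lambda>z. z - y) ` cbox (-a) a" using a by (intro image_eqI[of _ _ "z + y"]) auto
    qed
    note sub = this
    have "((\<lambda>z. if z \<in> cball 0 e then u (z + y) * k z else 0) has_integral v y) ((\<lambda>z. z - y) ` cbox (-a) a)"
      by (rule has_integral_eq[OF _ i]) (use k(2) in auto)
    then show ?thesis using has_integral_restrict[OF sub] by blast
  qed
  show thesis
  proof (rule that[OF v_smooth])
    fix y c assume y: "y \<in> S" and c: "\<And>x. dist x y \<le> e \<Longrightarrow> \<bar>u x - u y\<bar> \<le> c"
    have "dist y 0 < B + 2 * e" using y B e by (auto simp: dist_commute)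
    note vi = v_int[OF this]
    have "((\<lambda>z. u (z + y) * k z - u y * k z) has_integral v y - u y * 1) (cball 0 e)"
      by (intro has_integral_diff vi has_integral_mult_right k1)
    then have i: "((\<lambda>z. (u (z + y) - u y) * k z) has_integral v y - u y) (cball 0 e)"
      by (simp add: left_diff_distrib)
    have "norm (v y - u y) \<le> c * 1"
      unfolding integral_unique[OF i, symmetric] integral_unique[OF has_integral_mult_right[OF k1, of c], symmetric]
      by (rule integral_norm_bound_integral[OF has_integral_integrable[OF i] has_integral_integrable[OF has_integral_mult_right[OF k1]]])
        (use c k in \<open>auto simp: abs_mult dist_norm intro!: mult_right_mono\<close>)
    then show "\<bar>v y - u y\<bar> \<le> c" by simp
  next
    fix y w and L :: "'e \<Rightarrow> real"
    assume y: "y \<in> S" and c: "\<And>x x'. dist x y < 2 * e \<Longrightarrow> dist x' y < 2 * e \<Longrightarrow> \<bar>u x - u x'\<bar> \<le> L (x - x')"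
      and L: "\<And>t. 0 < t \<Longrightarrow> L (t *\<^sub>R w) = t * L w"
    have yB: "dist y 0 < B" using y B e by (auto simp: dist_commute)
    show "\<bar>frechet_derivative v (at y) w\<bar> \<le> L w"
    proof (rule derivative_bound_directional[OF smooth_on_has_derivative[OF v_smooth UNIV_I]])
      show "0 < e / (norm w + 1)" using e by (simp add: add_nonneg_pos)
      fix t :: real assume t: "0 < t" "t < e / (norm w + 1)"
      have "norm w + 1 > 0" by (simp add: add_nonneg_pos)
      then have "t * (norm w + 1) < e" using t by (simp add: less_divide_eq)
      then have tw: "norm (t *\<^sub>R w) < e" using t by (simp add: algebra_simps)
      have "norm (y + t *\<^sub>R w) \<le> norm y + norm (t *\<^sub>R w)" by (rule norm_triangle_ineq)
      then have "dist (y + t *\<^sub>R w) 0 < B + 2 * e" using yB tw e by (simp add: dist_norm)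
      note vi = v_int[OF this] v_int[of y]
      have i: "((\<lambda>z. (u (z + (y + t *\<^sub>R w)) - u (z + y)) * k z) has_integral v (y + t *\<^sub>R w) - v y) (cball 0 e)"
        using has_integral_diff[OF vi] yB e by (simp add: left_diff_distrib)
      have bd: "\<bar>u (z + (y + t *\<^sub>R w)) - u (z + y)\<bar> \<le> t * L w" if "z \<in> cball 0 e" for z
      proof -
        have "norm (z + t *\<^sub>R w) \<le> norm z + norm (t *\<^sub>R w)" by (rule norm_triangle_ineq)
        then have "dist (z + (y + t *\<^sub>R w)) y < 2 * e" "dist (z + y) y < 2 * e"
          using that tw e by (auto simp: dist_norm algebra_simps)
        from c[OF this] show ?thesis using L t by simp
      qed
      have "norm (v (y + t *\<^sub>R w) - v y) \<le> (t * L w) * 1"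
        unfolding integral_unique[OF i, symmetric] integral_unique[OF has_integral_mult_right[OF k1, of "t * L w"], symmetric]
        by (rule integral_norm_bound_integral[OF has_integral_integrable[OF i] has_integral_integrable[OF has_integral_mult_right[OF k1]]])
          (use bd k in \<open>auto simp: abs_mult intro!: mult_right_mono\<close>)
      then show "\<bar>v (y + t *\<^sub>R w) - v y\<bar> \<le> t * L w" by simp
    qed
  qed
qed

subsection \<open>Charts, tangent vectors and metrics in coordinates\<close>

locale smooth_manifold =
  fixes A :: "('a::{t2_space, second_countable_topology}, 'n::finite) chart set"
  assumes atlas: "smooth_atlas A"
begin

lemma chartD:
  assumes "c \<in> A"
  shows "open (cdom c)" "open (cimg c)" "continuous_on (cdom c) (cmap c)" "continuous_on (cimg c) (cinv c)"
    "inj_on (cmap c) (cdom c)"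
    "p \<in> cdom c \<Longrightarrow> cinv c (cmap c p) = p" "y \<in> cimg c \<Longrightarrow> cmap c (cinv c y) = y" "y \<in> cimg c \<Longrightarrow> cinv c y \<in> cdom c"
proof -
  have *: "open (cdom c)" "open (cimg c)" "homeomorphism (cdom c) (cimg c) (cmap c) (cinv c)"
    using atlas assms unfolding smooth_atlas_def is_chart_def by blast+
  show "open (cdom c)" "open (cimg c)" by (rule *)+
  show "continuous_on (cdom c) (cmap c)" "continuous_on (cimg c) (cinv c)"
    "p \<in> cdom c \<Longrightarrow> cinv c (cmap c p) = p" "y \<in> cimg c \<Longrightarrow> cmap c (cinv c y) = y" "y \<in> cimg c \<Longrightarrow> cinv c y \<in> cdom c"
    using *(3) unfolding homeomorphism_def by auto
  show "inj_on (cmap c) (cdom c)"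
    by (rule inj_on_inverseI[of _ "cinv c"]) (use *(3) in \<open>auto simp: homeomorphism_def\<close>)
qed

lemma chart_at: "chart_at A p \<in> A" "p \<in> cdom (chart_at A p)"
proof -
  have "\<exists>c. c \<in> A \<and> p \<in> cdom c" using atlas unfolding smooth_atlas_def by blast
  from someI_ex[OF this] show "chart_at A p \<in> A" "p \<in> cdom (chart_at A p)" unfolding chart_at_def by auto
qed

lemma smooth_transition:
  "c \<in> A \<Longrightarrow> c' \<in> A \<Longrightarrow> smooth_on (cmap c' \<circ> cinv c) (cmap c ` (cdom c \<inter> cdom c'))"
  using atlas unfolding smooth_atlas_def by blast

lemma cmap_image_eq: "c \<in> A \<Longrightarrow> W \<subseteq> cdom c \<Longrightarrow> cmap c ` W = cimg c \<inter> cinv c -` W"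
  using chartD(6)[of c] by force

lemma open_cmap_image:
  assumes "c \<in> A" "open W" shows "open (cmap c ` (W \<inter> cdom c))"
proof -
  have "open (cimg c \<inter> cinv c -` (W \<inter> cdom c))"
    using continuous_open_preimage[OF chartD(4,2)[OF assms(1)]] chartD(1)[OF assms(1)] assms(2) by blast
  then show ?thesis using cmap_image_eq[OF assms(1), of "W \<inter> cdom c"] by simp
qed

lemma cinv_image_eq: "c \<in> A \<Longrightarrow> V \<subseteq> cimg c \<Longrightarrow> cinv c ` V = cdom c \<inter> cmap c -` V"
  using chartD(6-8)[of c] by (force simp: image_iff)

lemma open_cinv_image:
  assumes "c \<in> A" "open V" "V \<subseteq> cimg c" shows "open (cinv c ` V)"
  using continuous_open_preimage[OF chartD(3,1)[OF assms(1)] assms(2)] cinv_image_eq[OF assms(1,3)] by simp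

lemma smooth_fun_subset: "smooth_fun A W \<phi> \<Longrightarrow> W' \<subseteq> W \<Longrightarrow> smooth_fun A W' \<phi>"
  unfolding smooth_fun_def by (meson smooth_on_subset Int_mono image_mono order_refl)

lemma smooth_fun_local:
  assumes "\<And>p. p \<in> W \<Longrightarrow> \<exists>U. open U \<and> p \<in> U \<and> smooth_fun A U \<phi>"
  shows "smooth_fun A W \<phi>"
  unfolding smooth_fun_def
proof (intro ballI smooth_on_local)
  fix c y assume c: "c \<in> A" and "y \<in> cmap c ` (W \<inter> cdom c)"
  then obtain p where p: "p \<in> W" "p \<in> cdom c" "y = cmap c p" by auto
  obtain U where "open U" "p \<in> U" "smooth_fun A U \<phi>" using assms[OF p(1)] by auto
  then show "\<exists>U. open U \<and> y \<in> U \<and> smooth_on (\<phi> \<circ> cinv c) U"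
    using c p open_cmap_image[OF c, of U] unfolding smooth_fun_def by blast
qed

text \<open>Transition maps are smooth, so a single chart containing \<open>W\<close> decides
  smoothness in all charts.\<close>

lemma smooth_fun_chartI:
  assumes c: "c \<in> A" and W: "open W" "W \<subseteq> cdom c" and s: "smooth_on (\<phi> \<circ> cinv c) (cmap c ` W)"
  shows "smooth_fun A W \<phi>"
  unfolding smooth_fun_def
proof
  fix c' assume c': "c' \<in> A"
  let ?S = "cmap c' ` (W \<inter> cdom c')"
  have S: "open ?S" by (rule open_cmap_image[OF c' W(1)])
  have W': "open (cmap c ` W)" using open_cmap_image[OF c W(1)] W(2) by (simp add: Int_absorb2)
  have "smooth_on (\<lambda>x. (\<phi> \<circ> cinv c) ((cmap c \<circ> cinv c') x)) ?S"
  proof (rule smooth_on_compose[OF S W' _ s])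
    show "(cmap c \<circ> cinv c') ` ?S \<subseteq> cmap c ` W" using chartD(6)[OF c'] by auto
    show "smooth_on (cmap c \<circ> cinv c') ?S"
      by (rule smooth_on_subset[OF smooth_transition[OF c' c]]) (use W(2) in auto)
  qed
  then show "smooth_on (\<phi> \<circ> cinv c') ?S"
    by (rule smooth_on_cong[OF S, rotated]) (use chartD(6)[OF c'] chartD(6)[OF c] W(2) in auto)
qed

lemma smooth_fun_cmap: "c \<in> A \<Longrightarrow> smooth_fun A (cdom c) (\<lambda>q. cmap c q)"
proof (rule smooth_fun_chartI)
  assume c: "c \<in> A"
  show "smooth_on (cmap c \<circ> cinv c) (cimg c)"
    by (rule smooth_on_cong[OF chartD(2)[OF c] _ smooth_on_bounded_linear[OF bounded_linear_ident]])
      (use chartD(7)[OF c] in auto)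
qed (auto intro: chartD)

lemma smooth_fun_vec_nth:
  fixes \<phi> :: "'a \<Rightarrow> real^'k"
  assumes "open W" "smooth_fun A W \<phi>"
  shows "smooth_fun A W (\<lambda>q. \<phi> q $ k)"
  using assms smooth_on_vec_nth[OF open_cmap_image[OF _ assms(1)]] unfolding smooth_fun_def comp_def by blast

lemma smooth_near_cmap: "c \<in> A \<Longrightarrow> p \<in> cdom c \<Longrightarrow> smooth_near A p (\<lambda>q. cmap c q $ k)"
  unfolding smooth_near_def using smooth_fun_vec_nth[OF _ smooth_fun_cmap] chartD(1) by blast

lemma smooth_near_chartD:
  assumes "smooth_near A p \<phi>" "c \<in> A" "p \<in> cdom c"
  obtains U where "open U" "cmap c p \<in> U" "U \<subseteq> cimg c" "smooth_on (\<phi> \<circ> cinv c) U"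
proof -
  obtain W where W: "open W" "p \<in> W" "smooth_fun A W \<phi>" using assms(1) unfolding smooth_near_def by blast
  show thesis
    by (rule that[of "cmap c ` (W \<inter> cdom c)"]) (use W assms open_cmap_image in \<open>auto simp: smooth_fun_def\<close>)
qed

lemma smooth_near_differentiable:
  assumes "smooth_near A p \<phi>" "c \<in> A" "p \<in> cdom c"
  shows "(\<phi> \<circ> cinv c) differentiable (at (cmap c p))"
  using smooth_near_chartD[OF assms] smooth_on_differentiable by metis

abbreviation trans_deriv :: "('a, 'n) chart \<Rightarrow> ('a, 'n) chart \<Rightarrow> real^'n \<Rightarrow> real^'n \<Rightarrow> real^'n"
  where "trans_deriv c c' y \<equiv> frechet_derivative (cmap c' \<circ> cinv c) (at y)"

lemma trans_deriv_has_derivative: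
  assumes "c \<in> A" "c' \<in> A" "p \<in> cdom c" "p \<in> cdom c'"
  shows "((cmap c' \<circ> cinv c) has_derivative trans_deriv c c' (cmap c p)) (at (cmap c p))"
  using smooth_on_has_derivative[OF smooth_transition[OF assms(1,2)]] assms by blast

text \<open>The restriction to functions smooth near \<open>p\<close> makes no reference to a chart,
  so equality of the two operators reduces to the chain rule.\<close>

lemma chart_vec_change:
  assumes c: "c \<in> A" "c' \<in> A" "p \<in> cdom c" "p \<in> cdom c'"
  shows "chart_vec A c p v = chart_vec A c' p (trans_deriv c c' (cmap c p) v)"
proof
  fix \<phi>
  have "frechet_derivative (\<phi> \<circ> cinv c) (at (cmap c p)) v
     = frechet_derivative (\<phi> \<circ> cinv c') (at (cmap c' p)) (trans_deriv c c' (cmap c p) v)" if s: "smooth_near A p \<phi>"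
  proof -
    have d: "((\<phi> \<circ> cinv c') has_derivative frechet_derivative (\<phi> \<circ> cinv c') (at (cmap c' p))) (at ((cmap c' \<circ> cinv c) (cmap c p)))"
      using has_frechet_derivative[OF smooth_near_differentiable[OF s c(2,4)]] chartD(6)[OF c(1,3)] by simp
    have "((\<lambda>y. (\<phi> \<circ> cinv c') ((cmap c' \<circ> cinv c) y)) has_derivative
      (\<lambda>v. frechet_derivative (\<phi> \<circ> cinv c') (at (cmap c' p)) (trans_deriv c c' (cmap c p) v))) (at (cmap c p))"
      by (rule has_derivative_compose[OF trans_deriv_has_derivative[OF c] d])
    then have "((\<phi> \<circ> cinv c) has_derivative
      (\<lambda>v. frechet_derivative (\<phi> \<circ> cinv c') (at (cmap c' p)) (trans_deriv c c' (cmap c p) v))) (at (cmap c p))"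
      by (rule has_derivative_transform_within_open[of _ _ _ _ "cmap c ` (cdom c' \<inter> cdom c)"])
        (use c open_cmap_image[OF c(1) chartD(1)[OF c(2)]] chartD(6)[OF c(1)] chartD(6)[OF c(2)] in auto)
    then show ?thesis by (simp add: frechet_derivative_eqI)
  qed
  then show "chart_vec A c p v \<phi> = chart_vec A c' p (trans_deriv c c' (cmap c p) v) \<phi>"
    by (simp add: chart_vec_def)
qed

lemma chart_vec_apply:
  "smooth_near A p \<phi> \<Longrightarrow> chart_vec A c p v \<phi> = frechet_derivative (\<phi> \<circ> cinv c) (at (cmap c p)) v"
  by (simp add: chart_vec_def)

lemma vec_comp_chart_vec:
  assumes c: "c \<in> A" "p \<in> cdom c"
  shows "vec_comp c (chart_vec A c p v) = v"
proof -
  have "frechet_derivative ((\<lambda>q. cmap c q $ k) \<circ> cinv c) (at (cmap c p)) v = v $ k" for k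
  proof -
    have "((\<lambda>y. y $ k) has_derivative (\<lambda>v. v $ k)) (at (cmap c p))"
      by (rule bounded_linear_imp_has_derivative[OF bounded_linear_vec_nth])
    then have "(((\<lambda>q. cmap c q $ k) \<circ> cinv c) has_derivative (\<lambda>v. v $ k)) (at (cmap c p))"
      by (rule has_derivative_transform_within_open[of _ _ _ _ "cimg c"]) (use c chartD[OF c(1)] in auto)
    then show ?thesis by (simp add: frechet_derivative_eqI)
  qed
  then show ?thesis
    by (simp add: vec_comp_def chart_vec_apply[OF smooth_near_cmap[OF c]] vec_eq_iff)
qed

lemma tangent_space_eq:
  assumes c: "c \<in> A" "p \<in> cdom c"
  shows "tangent_space A p = range (chart_vec A c p)"
  unfolding tangent_space_def using chart_vec_change[of _ c p] c by blast

lemma tangent_spaceE: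
  assumes "X \<in> tangent_space A p" and c: "c \<in> A" "p \<in> cdom c"
  shows "chart_vec A c p (vec_comp c X) = X"
  using assms vec_comp_chart_vec[OF c] by (auto simp: tangent_space_eq[OF c])

lemma chart_vec_in_tangent: "c \<in> A \<Longrightarrow> p \<in> cdom c \<Longrightarrow> chart_vec A c p v \<in> tangent_space A p"
  by (auto simp: tangent_space_eq)

lemma vec_comp_change:
  assumes "X \<in> tangent_space A p" and c: "c \<in> A" "c' \<in> A" "p \<in> cdom c" "p \<in> cdom c'"
  shows "vec_comp c' X = trans_deriv c c' (cmap c p) (vec_comp c X)"
  by (metis assms tangent_spaceE chart_vec_change vec_comp_chart_vec)

text \<open>No differentiation is involved: both component vectors represent the same tangent vector
  at \<open>p\<close>, and components in a chart are unique.\<close>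

lemma trans_deriv_inverse:
  assumes c: "c \<in> A" "c' \<in> A" "p \<in> cdom c" "p \<in> cdom c'"
  shows "trans_deriv c' c (cmap c' p) (trans_deriv c c' (cmap c p) v) = v"
  by (metis c chart_vec_change vec_comp_chart_vec)

lemma trans_deriv_linear:
  assumes c: "c \<in> A" "c' \<in> A" "p \<in> cdom c" "p \<in> cdom c'"
  shows "linear (trans_deriv c c' (cmap c p))"
  using has_derivative_linear[OF trans_deriv_has_derivative[OF c]] .

end

locale riemannian_manifold = smooth_manifold A
  for A :: "('a::{t2_space, second_countable_topology}, 'n::finite) chart set" +
  fixes g :: "'a metric"
  assumes metric: "riemannian_metric A g"
begin

abbreviation gc :: "('a, 'n) chart \<Rightarrow> real^'n \<Rightarrow> real^'n \<Rightarrow> real^'n \<Rightarrow> real"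
  where "gc \<equiv> metric_coord A g"

lemma metric_coordD:
  assumes "c \<in> A"
  shows "y \<in> cimg c \<Longrightarrow> bilinear (gc c y)" "y \<in> cimg c \<Longrightarrow> gc c y u v = gc c y v u"
    "y \<in> cimg c \<Longrightarrow> u \<noteq> 0 \<Longrightarrow> gc c y u u > 0" "smooth_on (\<lambda>y. gc c y u v) (cimg c)"
  using metric assms unfolding riemannian_metric_def by blast+

lemma metric_coord_nonneg: "c \<in> A \<Longrightarrow> y \<in> cimg c \<Longrightarrow> gc c y u u \<ge> 0"
  using metric_coordD[of c y] by (cases "u = 0") (auto simp: bilinear_lzero less_imp_le)

lemma metric_chart_vec:
  "c \<in> A \<Longrightarrow> p \<in> cdom c \<Longrightarrow> g p (chart_vec A c p u) (chart_vec A c p v) = gc c (cmap c p) u v"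
  by (simp add: metric_coord_def chartD)

lemma metric_coord_change:
  assumes c: "c \<in> A" "c' \<in> A" "p \<in> cdom c" "p \<in> cdom c'"
  shows "gc c (cmap c p) u v = gc c' (cmap c' p) (trans_deriv c c' (cmap c p) u) (trans_deriv c c' (cmap c p) v)"
  using metric_chart_vec[OF c(1,3)] metric_chart_vec[OF c(2,4)] chart_vec_change[OF c] by metis

lemma metric_coord_expand:
  assumes "c \<in> A" "y \<in> cimg c"
  shows "gc c y u v = (\<Sum>i\<in>UNIV. \<Sum>j\<in>UNIV. u $ i * v $ j * gmat A g c y $ i $ j)"
proof -
  note b = metric_coordD(1)[OF assms]
  have "gc c y (\<Sum>i\<in>UNIV. u $ i *s axis i 1) (\<Sum>j\<in>UNIV. v $ j *s axis j 1)
     = (\<Sum>(i,j)\<in>UNIV \<times> UNIV. gc c y (u $ i *s axis i 1) (v $ j *s axis j 1))"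
    by (rule bilinear_sum[OF b])
  also have "\<dots> = (\<Sum>i\<in>UNIV. \<Sum>j\<in>UNIV. u $ i * v $ j * gmat A g c y $ i $ j)"
    by (simp add: sum.cartesian_product scalar_mult_eq_scaleR bilinear_lmul[OF b] bilinear_rmul[OF b] gmat_def mult.assoc mult.left_commute)
  finally show ?thesis by (simp only: basis_expansion)
qed

lemma metric_coord_matrix:
  assumes "c \<in> A" "y \<in> cimg c"
  shows "gc c y u v = u \<bullet> (gmat A g c y *v v)"
  by (simp add: metric_coord_expand[OF assms] inner_vec_def matrix_vector_mult_def sum_distrib_left mult_ac)

lemma gmat_sym: "c \<in> A \<Longrightarrow> y \<in> cimg c \<Longrightarrow> transpose (gmat A g c y) = gmat A g c y"
  using metric_coordD(2)[of c y] by (simp add: transpose_def gmat_def vec_eq_iff)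

lemma gmat_invertible:
  assumes "c \<in> A" "y \<in> cimg c" shows "invertible (gmat A g c y)"
proof -
  have "u = 0" if "gmat A g c y *v u = 0" for u
    using metric_coordD(3)[OF assms, of u] metric_coord_matrix[OF assms, of u u] that by auto
  then show ?thesis by (simp add: invertible_left_inverse matrix_left_invertible_ker)
qed

lemma ginv_mult:
  assumes "c \<in> A" "y \<in> cimg c"
  shows "gmat A g c y ** ginv A g c y = mat 1" "ginv A g c y ** gmat A g c y = mat 1"
  using someI_ex[OF gmat_invertible[OF assms, unfolded invertible_def]] by (auto simp: ginv_def matrix_inv_def)

lemma ginv_sym:
  assumes "c \<in> A" "y \<in> cimg c" shows "transpose (ginv A g c y) = ginv A g c y"
  using ginv_mult[OF assms] gmat_sym[OF assms]
  by (metis matrix_mul_assoc matrix_mul_lid matrix_mul_rid matrix_transpose_mul transpose_mat)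

lemma smooth_gmat: "c \<in> A \<Longrightarrow> smooth_on (\<lambda>y. gmat A g c y $ i $ j) (cimg c)"
  using metric_coordD(4) by (simp add: gmat_def)

lemma smooth_det:
  assumes "open S" "\<And>i j. smooth_on (\<lambda>y::'e::euclidean_space. (M y :: real^'n^'n) $ i $ j) S"
  shows "smooth_on (\<lambda>y. det (M y)) S"
  unfolding det_def by (intro smooth_on_sum smooth_on_mult smooth_on_const smooth_on_prod assms)

text \<open>By Cramer's rule the entries of the inverse are quotients of determinants with smooth
  entries, and the denominator, the determinant of the metric, does not vanish.\<close>

lemma smooth_ginv:
  assumes c: "c \<in> A" shows "smooth_on (\<lambda>y. ginv A g c y $ k $ l) (cimg c)"
proof -
  note o = chartD(2)[OF c]
  let ?M = "\<lambda>y. (\<chi> i j. if j = k then axis l 1 $ i else gmat A g c y $ i $ j) :: real^'n^'n"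
  have "ginv A g c y $ k $ l = det (?M y) * inverse (det (gmat A g c y))" if y: "y \<in> cimg c" for y
  proof -
    have d: "det (gmat A g c y) \<noteq> 0" using gmat_invertible[OF c y] invertible_det_nz by blast
    have "gmat A g c y *v (ginv A g c y *v axis l 1) = axis l 1"
      by (simp add: matrix_vector_mul_assoc ginv_mult[OF c y])
    then have "ginv A g c y *v axis l 1 = (\<chi> k. det (\<chi> i j. if j = k then axis l 1 $ i else gmat A g c y $ i $ j) / det (gmat A g c y))"
      using cramer[OF d] by blast
    moreover have "(ginv A g c y *v axis l 1) $ k = ginv A g c y $ k $ l"
      by (simp add: matrix_vector_mult_basis column_def)
    ultimately show ?thesis by (simp add: divide_inverse)
  qed
  note eq = this
  have "smooth_on (\<lambda>y. det (?M y) * inverse (det (gmat A g c y))) (cimg c)"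
  proof (intro smooth_on_mult smooth_on_inverse smooth_det o)
    show "smooth_on (\<lambda>y. ?M y $ i $ j) (cimg c)" for i j
      by (cases "j = k") (simp_all add: smooth_on_const smooth_gmat[OF c])
    show "det (gmat A g c y) \<noteq> 0" if "y \<in> cimg c" for y
      using gmat_invertible[OF c that] invertible_det_nz by blast
  qed (rule smooth_gmat[OF c])
  then show ?thesis by (rule smooth_on_cong[OF o eq[symmetric], rotated])
qed

end

subsection \<open>The Riemannian distance\<close>

definition (in smooth_manifold) C1_on :: "(real \<Rightarrow> 'a) \<Rightarrow> real \<Rightarrow> real \<Rightarrow> bool"
  where "C1_on \<gamma> a b \<longleftrightarrow> (\<forall>c\<in>A. \<exists>D. continuous_on {t\<in>{a..b}. \<gamma> t \<in> cdom c} D \<and>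
          (\<forall>t\<in>{a..b}. \<gamma> t \<in> cdom c \<longrightarrow> ((cmap c \<circ> \<gamma>) has_vector_derivative D t) (at t within {a..b})))"

context smooth_manifold
begin

lemma pw_C1_curve_iff:
  "pw_C1_curve A \<gamma> \<longleftrightarrow> continuous_on {0..1} \<gamma> \<and>
    (\<exists>P. finite P \<and> (\<forall>a b. 0 \<le> a \<and> a < b \<and> b \<le> 1 \<and> {a<..<b} \<inter> P = {} \<longrightarrow> C1_on \<gamma> a b))"
  by (simp add: pw_C1_curve_def C1_on_def)

lemma C1_on_cong:
  assumes "\<And>t. t \<in> {a..b} \<Longrightarrow> \<gamma> t = \<gamma>' t" "C1_on \<gamma> a b"
  shows "C1_on \<gamma>' a b"
  unfolding C1_on_def
proof
  fix c assume "c \<in> A"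
  then obtain D where D: "continuous_on {t\<in>{a..b}. \<gamma> t \<in> cdom c} D"
     "\<And>t. t\<in>{a..b} \<Longrightarrow> \<gamma> t \<in> cdom c \<Longrightarrow> ((cmap c \<circ> \<gamma>) has_vector_derivative D t) (at t within {a..b})"
    using assms(2) unfolding C1_on_def by blast
  have "{t\<in>{a..b}. \<gamma>' t \<in> cdom c} = {t\<in>{a..b}. \<gamma> t \<in> cdom c}" using assms(1) by auto
  moreover have "((cmap c \<circ> \<gamma>') has_vector_derivative D t) (at t within {a..b})"
    if "t\<in>{a..b}" "\<gamma>' t \<in> cdom c" for t
    by (rule has_vector_derivative_transform[OF that(1) _ D(2)[OF that(1)]]) (use assms(1) that in auto)
  ultimately show "\<exists>D. continuous_on {t\<in>{a..b}. \<gamma>' t \<in> cdom c} D \<and>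
          (\<forall>t\<in>{a..b}. \<gamma>' t \<in> cdom c \<longrightarrow> ((cmap c \<circ> \<gamma>') has_vector_derivative D t) (at t within {a..b}))"
    using D(1) by (intro exI[of _ D]) auto
qed

lemma C1_on_affine:
  assumes C: "C1_on \<gamma> a b" and im: "\<And>s. s \<in> {s0..s1} \<Longrightarrow> p + m * s \<in> {a..b}"
  shows "C1_on (\<lambda>s. \<gamma> (p + m * s)) s0 s1"
  unfolding C1_on_def
proof
  fix c assume "c \<in> A"
  then obtain D where D: "continuous_on {t\<in>{a..b}. \<gamma> t \<in> cdom c} D"
     "\<And>t. t\<in>{a..b} \<Longrightarrow> \<gamma> t \<in> cdom c \<Longrightarrow> ((cmap c \<circ> \<gamma>) has_vector_derivative D t) (at t within {a..b})"
    using C unfolding C1_on_def by blast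
  show "\<exists>D. continuous_on {t\<in>{s0..s1}. \<gamma> (p + m * t) \<in> cdom c} D \<and>
          (\<forall>t\<in>{s0..s1}. \<gamma> (p + m * t) \<in> cdom c \<longrightarrow> ((cmap c \<circ> (\<lambda>s. \<gamma> (p + m * s))) has_vector_derivative D t) (at t within {s0..s1}))"
  proof (intro exI[of _ "\<lambda>s. m *\<^sub>R D (p + m * s)"] conjI ballI impI)
    show "continuous_on {t\<in>{s0..s1}. \<gamma> (p + m * t) \<in> cdom c} (\<lambda>s. m *\<^sub>R D (p + m * s))"
      by (intro continuous_intros continuous_on_compose2[OF D(1)]) (use im in auto)
    fix t assume t: "t \<in> {s0..s1}" "\<gamma> (p + m * t) \<in> cdom c"
    have 1: "((\<lambda>s. p + m * s) has_vector_derivative m) (at t within {s0..s1})"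
      by (auto intro!: derivative_eq_intros simp: has_vector_derivative_def)
    have 2: "((cmap c \<circ> \<gamma>) has_vector_derivative D (p + m * t)) (at (p + m * t) within (\<lambda>s. p + m * s) ` {s0..s1})"
      by (rule has_vector_derivative_within_subset[OF D(2)]) (use im t in auto)
    show "((cmap c \<circ> (\<lambda>s. \<gamma> (p + m * s))) has_vector_derivative m *\<^sub>R D (p + m * t)) (at t within {s0..s1})"
      using vector_diff_chain_within[OF 1 2] by (simp add: comp_def)
  qed
qed

text \<open>The parameters \<open>p\<close> and \<open>p + m\<close> are the new start and end. Thus
  \<open>m > 0\<close> restricts a curve to a subinterval and \<open>m < 0\<close> also reverses it;
  symmetry of the distance and the splitting of a curve both rest on this.\<close>

lemma pw_C1_curve_affine:
  assumes \<gamma>: "pw_C1_curve A \<gamma>" and m: "m \<noteq> 0" and p: "p \<in> {0..1}" "p + m \<in> {0..1}"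
  shows "pw_C1_curve A (\<lambda>s. \<gamma> (p + m * s))"
proof -
  obtain P where P: "finite P" "\<And>a b. 0 \<le> a \<Longrightarrow> a < b \<Longrightarrow> b \<le> 1 \<Longrightarrow> {a<..<b} \<inter> P = {} \<Longrightarrow> C1_on \<gamma> a b"
    and cont: "continuous_on {0..1} \<gamma>"
    using \<gamma> unfolding pw_C1_curve_iff by blast
  have im: "p + m * s \<in> {0..1}" if "s \<in> {0..1}" for s
  proof -
    have "p + m * s = (1 - s) * p + s * (p + m)" by (simp add: algebra_simps)
    moreover have "0 \<le> (1 - s) * p" "(1 - s) * p \<le> 1 - s" "0 \<le> s * (p + m)" "s * (p + m) \<le> s"
      using that p mult_left_mono[of p 1 "1 - s"] mult_left_mono[of "p + m" 1 s] mult_nonneg_nonneg[of s "p + m"] by auto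
    ultimately show ?thesis by auto
  qed
  define P' where "P' = (\<lambda>t. (t - p) / m) ` P"
  show ?thesis unfolding pw_C1_curve_iff
  proof (intro conjI exI[of _ P'] allI impI)
    show "continuous_on {0..1} (\<lambda>s. \<gamma> (p + m * s))"
    proof (rule continuous_on_compose2[OF cont])
      show "continuous_on {0..1} (\<lambda>s. p + m * s)" by (intro continuous_intros)
      show "(\<lambda>s. p + m * s) ` {0..1} \<subseteq> {0..1}" using im by blast
    qed
    show "finite P'" using P by (simp add: P'_def)
    fix s0 s1 assume s: "0 \<le> s0 \<and> s0 < s1 \<and> s1 \<le> 1 \<and> {s0<..<s1} \<inter> P' = {}"
    have av: False if "t \<in> P" "s0 < (t - p) / m" "(t - p) / m < s1" for t
      using s that unfolding P'_def by fastforce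
    show "C1_on (\<lambda>s. \<gamma> (p + m * s)) s0 s1"
    proof (cases "m > 0")
      case True
      have "C1_on \<gamma> (p + m * s0) (p + m * s1)"
      proof (rule P(2))
        show "{p + m * s0<..<p + m * s1} \<inter> P = {}"
        proof -
          have "s0 < (t - p) / m \<and> (t - p) / m < s1" if "p + m * s0 < t" "t < p + m * s1" for t
            using that True by (simp add: field_simps)
          then show ?thesis using av by fastforce
        qed
      qed (use s True im[of s0] im[of s1] in auto)
      then show ?thesis by (rule C1_on_affine) (use True in auto)
    next
      case False
      then have neg: "m < 0" using m by simp
      have "C1_on \<gamma> (p + m * s1) (p + m * s0)"
      proof (rule P(2))
        show "{p + m * s1<..<p + m * s0} \<inter> P = {}"
        proof -
          have "s0 < (t - p) / m \<and> (t - p) / m < s1" if "p + m * s1 < t" "t < p + m * s0" for t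
            using that neg by (simp add: field_simps)
          then show ?thesis using av by fastforce
        qed
      qed (use s neg im[of s0] im[of s1] in auto)
      then show ?thesis by (rule C1_on_affine) (use neg in auto)
    qed
  qed
qed

lemma pw_C1_curve_join:
  assumes 1: "pw_C1_curve A \<gamma>1" and 2: "pw_C1_curve A \<gamma>2" and e: "\<gamma>1 1 = \<gamma>2 0"
  shows "pw_C1_curve A (\<lambda>t. if t \<le> 1/2 then \<gamma>1 (2 * t) else \<gamma>2 (2 * t - 1))" (is "pw_C1_curve A ?\<gamma>")
proof -
  obtain P1 where P1: "finite P1" "\<And>a b. 0 \<le> a \<Longrightarrow> a < b \<Longrightarrow> b \<le> 1 \<Longrightarrow> {a<..<b} \<inter> P1 = {} \<Longrightarrow> C1_on \<gamma>1 a b"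
    and c1: "continuous_on {0..1} \<gamma>1" using 1 unfolding pw_C1_curve_iff by blast
  obtain P2 where P2: "finite P2" "\<And>a b. 0 \<le> a \<Longrightarrow> a < b \<Longrightarrow> b \<le> 1 \<Longrightarrow> {a<..<b} \<inter> P2 = {} \<Longrightarrow> C1_on \<gamma>2 a b"
    and c2: "continuous_on {0..1} \<gamma>2" using 2 unfolding pw_C1_curve_iff by blast
  \<comment> \<open>The junction \<open>1/2\<close> is made a break point, so every interval whose
    interior avoids \<open>P\<close> lies on one side of it and sees only one of the two
    curves.\<close>
  define P where "P = {1/2} \<union> (\<lambda>t. t / 2) ` P1 \<union> (\<lambda>t. (t + 1) / 2) ` P2"
  show ?thesis unfolding pw_C1_curve_iff
  proof (intro conjI exI[of _ P] allI impI)
    have half: "\<gamma>1 (2 * t) = \<gamma>2 (2 * t - 1)" if "t = 1/2" for t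
      unfolding that using e by simp
    show "continuous_on {0..1} ?\<gamma>"
    proof (rule continuous_on_cases_le)
      show "continuous_on {t\<in>{0..1}. t \<le> 1/2} (\<lambda>t. \<gamma>1 (2 * t))"
        by (intro continuous_on_compose2[OF c1] continuous_intros) auto
      show "continuous_on {t\<in>{0..1}. 1/2 \<le> t} (\<lambda>t. \<gamma>2 (2 * t - 1))"
        by (intro continuous_on_compose2[OF c2] continuous_intros) auto
    qed (simp_all only: half continuous_on_id)
    show "finite P" using P1 P2 by (simp add: P_def)
    fix a b assume ab: "0 \<le> a \<and> a < b \<and> b \<le> 1 \<and> {a<..<b} \<inter> P = {}"
    have "1/2 \<notin> {a<..<b}" using ab by (auto simp: P_def)
    then consider "b \<le> 1/2" | "1/2 \<le> a" by fastforce
    then show "C1_on ?\<gamma> a b"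
    proof cases
      case 1
      have "{2 * a<..<2 * b} \<inter> P1 = {}"
      proof -
        have "t / 2 \<in> {a<..<b}" if "t \<in> {2 * a<..<2 * b}" for t using that by auto
        then show ?thesis using ab unfolding P_def by fastforce
      qed
      then have "C1_on \<gamma>1 (2 * a) (2 * b)" using ab 1 by (intro P1(2)) auto
      from C1_on_affine[OF this, of a b 0 2] have "C1_on (\<lambda>s. \<gamma>1 (2 * s)) a b" by simp
      then show ?thesis by (rule C1_on_cong[rotated]) (use 1 in auto)
    next
      case 2
      have "{2 * a - 1<..<2 * b - 1} \<inter> P2 = {}"
      proof -
        have "(t + 1) / 2 \<in> {a<..<b}" if "t \<in> {2 * a - 1<..<2 * b - 1}" for t using that by auto
        then show ?thesis using ab unfolding P_def by fastforce
      qed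
      then have "C1_on \<gamma>2 (2 * a - 1) (2 * b - 1)" using ab 2 by (intro P2(2)) auto
      from C1_on_affine[OF this, of a b "-1" 2] have "C1_on (\<lambda>s. \<gamma>2 (2 * s - 1)) a b" by simp
      then show ?thesis
      proof (rule C1_on_cong[rotated])
        fix t assume t: "t \<in> {a..b}"
        show "\<gamma>2 (2 * t - 1) = ?\<gamma> t"
        proof (cases "t = 1/2")
          case True
          show ?thesis unfolding True using e by simp
        qed (use t 2 in auto)
      qed
    qed
  qed
qed

lemma velocity_chart:
  assumes c: "c \<in> A" and t: "\<gamma> t \<in> cdom c" and cont: "isCont \<gamma> t"
    and d: "((cmap c \<circ> \<gamma>) has_vector_derivative v) (at t)"
  shows "velocity A \<gamma> t = chart_vec A c (\<gamma> t) v"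
proof
  fix \<phi>
  have "vector_derivative (\<phi> \<circ> \<gamma>) (at t) = frechet_derivative (\<phi> \<circ> cinv c) (at (cmap c (\<gamma> t))) v"
    if s: "smooth_near A (\<gamma> t) \<phi>"
  proof -
    have "((\<lambda>s. (\<phi> \<circ> cinv c) ((cmap c \<circ> \<gamma>) s)) has_derivative
       (\<lambda>r. frechet_derivative (\<phi> \<circ> cinv c) (at (cmap c (\<gamma> t))) (r *\<^sub>R v))) (at t)"
    proof (rule has_derivative_compose[OF d[unfolded has_vector_derivative_def]])
      have e: "(cmap c \<circ> \<gamma>) t = cmap c (\<gamma> t)" by simp
      show "((\<phi> \<circ> cinv c) has_derivative frechet_derivative (\<phi> \<circ> cinv c) (at (cmap c (\<gamma> t)))) (at ((cmap c \<circ> \<gamma>) t))"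
        unfolding e by (rule has_frechet_derivative[OF smooth_near_differentiable[OF s c t]])
    qed
    moreover have "frechet_derivative (\<phi> \<circ> cinv c) (at (cmap c (\<gamma> t))) (r *\<^sub>R v)
       = r *\<^sub>R frechet_derivative (\<phi> \<circ> cinv c) (at (cmap c (\<gamma> t))) v" for r
      by (rule linear_scale[OF frechet_derivative_linear[OF smooth_near_differentiable[OF s c t]]])
    ultimately have "((\<lambda>s. (\<phi> \<circ> cinv c) ((cmap c \<circ> \<gamma>) s)) has_vector_derivative
       frechet_derivative (\<phi> \<circ> cinv c) (at (cmap c (\<gamma> t))) v) (at t)"
      by (simp add: has_vector_derivative_def)
    moreover obtain T where T: "open T" "t \<in> T" "\<And>s. s \<in> T \<Longrightarrow> \<gamma> s \<in> cdom c"
      using cont t chartD(1)[OF c] unfolding continuous_at_open by metis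
    ultimately have "((\<phi> \<circ> \<gamma>) has_vector_derivative frechet_derivative (\<phi> \<circ> cinv c) (at (cmap c (\<gamma> t))) v) (at t)"
      by (elim has_vector_derivative_transform_within_open[of _ _ _ T]) (use chartD(6)[OF c] in auto)
    then show ?thesis by (rule vector_derivative_at)
  qed
  then show "velocity A \<gamma> t \<phi> = chart_vec A c (\<gamma> t) v \<phi>" by (simp add: velocity_def chart_vec_def)
qed

lemma velocity_cong:
  assumes "open S" "t \<in> S" "\<And>s. s \<in> S \<Longrightarrow> \<gamma> s = \<gamma>' s"
  shows "velocity A \<gamma> t = velocity A \<gamma>' t"
proof -
  have "((\<phi> \<circ> \<gamma>) has_vector_derivative v) (at t) \<longleftrightarrow> ((\<phi> \<circ> \<gamma>') has_vector_derivative v) (at t)" for \<phi> :: "'a \<Rightarrow> real" and v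
    using has_vector_derivative_transform_within_open[OF _ assms(1,2), of "\<phi> \<circ> \<gamma>" v "\<phi> \<circ> \<gamma>'"]
      has_vector_derivative_transform_within_open[OF _ assms(1,2), of "\<phi> \<circ> \<gamma>'" v "\<phi> \<circ> \<gamma>"] assms(3) by auto
  then have "vector_derivative (\<phi> \<circ> \<gamma>) (at t) = vector_derivative (\<phi> \<circ> \<gamma>') (at t)" for \<phi> :: "'a \<Rightarrow> real"
    unfolding vector_derivative_def by simp
  then show ?thesis using assms(2,3) by (auto simp: velocity_def fun_eq_iff)
qed

end

lemma ennreal_less_add: "x < top \<Longrightarrow> 0 < e \<Longrightarrow> x < x + ennreal e"
  by (cases x) (auto simp: ennreal_plus[symmetric] ennreal_less_iff simp del: ennreal_plus)

context riemannian_manifold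
begin

definition speed :: "(real \<Rightarrow> 'a) \<Rightarrow> real \<Rightarrow> real"
  where "speed \<gamma> t = sqrt (g (\<gamma> t) (velocity A \<gamma> t) (velocity A \<gamma> t))"

lemma continuous_metric_coord:
  assumes c: "c \<in> A" and p: "continuous_on T p" "p ` T \<subseteq> cimg c" and u: "continuous_on T u" and v: "continuous_on T v"
  shows "continuous_on T (\<lambda>t. gc c (p t) (u t) (v t))"
proof -
  have "continuous_on T (\<lambda>t. \<Sum>i\<in>UNIV. \<Sum>j\<in>UNIV. u t $ i * v t $ j * gmat A g c (p t) $ i $ j)"
    by (intro continuous_intros u v continuous_on_compose2[OF smooth_on_continuous[OF smooth_gmat[OF c]] p])
  then show ?thesis
    by (rule continuous_on_eq) (use metric_coord_expand[OF c] p in auto)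
qed

lemma speed_chart:
  assumes c: "c \<in> A" and t: "\<gamma> t \<in> cdom c" and cont: "isCont \<gamma> t"
    and d: "((cmap c \<circ> \<gamma>) has_vector_derivative v) (at t)"
  shows "speed \<gamma> t = sqrt (gc c (cmap c (\<gamma> t)) v v)"
  unfolding speed_def velocity_chart[OF assms] metric_chart_vec[OF c t] ..

text \<open>\<open>velocity\<close> uses two-sided derivatives, while \<open>C1_on\<close> gives
  derivatives within a closed interval. This is the version on open parameter sets, from which
  continuity of the speed is obtained.\<close>

definition C1_near :: "real set \<Rightarrow> (real \<Rightarrow> 'a) \<Rightarrow> bool"
  where "C1_near V \<gamma> \<longleftrightarrow> (\<forall>c\<in>A. \<exists>D. continuous_on {s\<in>V. \<gamma> s \<in> cdom c} D \<and>
        (\<forall>s\<in>V. \<gamma> s \<in> cdom c \<longrightarrow> ((cmap c \<circ> \<gamma>) has_vector_derivative D s) (at s)))"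

definition regular_on :: "real set \<Rightarrow> (real \<Rightarrow> 'a) \<Rightarrow> bool"
  where "regular_on U \<gamma> \<longleftrightarrow> open U \<and> continuous_on U \<gamma> \<and>
     (\<forall>t\<in>U. \<exists>V. open V \<and> t \<in> V \<and> V \<subseteq> U \<and> C1_near V \<gamma>)"

text \<open>A parameter in the open unit interval that is not a break point is the midpoint of a
  small closed interval without break points in its interior, and inside it the derivatives of
  \<open>C1_on\<close> are two-sided.\<close>

lemma pw_C1_regular:
  assumes "pw_C1_curve A \<gamma>"
  obtains P where "finite P" "regular_on ({0<..<1} - P) \<gamma>"
proof -
  obtain P where P: "finite P" "\<And>a b. 0 \<le> a \<Longrightarrow> a < b \<Longrightarrow> b \<le> 1 \<Longrightarrow> {a<..<b} \<inter> P = {} \<Longrightarrow> C1_on \<gamma> a b"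
    and cont: "continuous_on {0..1} \<gamma>" using assms unfolding pw_C1_curve_iff by blast
  have o: "open ({0<..<1} - P)" using P(1) by (simp add: finite_imp_closed open_Diff)
  have "regular_on ({0<..<1} - P) \<gamma>"
    unfolding regular_on_def
  proof (intro conjI ballI o)
    show "continuous_on ({0<..<1} - P) \<gamma>" by (rule continuous_on_subset[OF cont]) auto
    fix t assume "t \<in> {0<..<1} - P"
    then obtain e where e: "e > 0" "ball t e \<subseteq> {0<..<1} - P" using o open_contains_ball by metis
    have ball: "ball t e = {t - e<..<t + e}" by (rule ball_eq_greaterThanLessThan)
    have "closure {t - e<..<t + e} \<subseteq> closure {0<..<1}" using e ball by (intro closure_mono) auto
    then have "{t - e..t + e} \<subseteq> {0..1}" using e(1) by simp
    then have "C1_on \<gamma> (t - e) (t + e)" using e ball by (intro P(2)) auto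
    then have "\<exists>D. continuous_on {s\<in>ball t e. \<gamma> s \<in> cdom c} D \<and>
        (\<forall>s\<in>ball t e. \<gamma> s \<in> cdom c \<longrightarrow> ((cmap c \<circ> \<gamma>) has_vector_derivative D s) (at s))" if c: "c \<in> A" for c
    proof -
      obtain D where D: "continuous_on {s\<in>{t - e..t + e}. \<gamma> s \<in> cdom c} D"
         "\<And>s. s\<in>{t - e..t + e} \<Longrightarrow> \<gamma> s \<in> cdom c \<Longrightarrow> ((cmap c \<circ> \<gamma>) has_vector_derivative D s) (at s within {t - e..t + e})"
        using \<open>C1_on \<gamma> (t - e) (t + e)\<close> c unfolding C1_on_def by blast
      have "((cmap c \<circ> \<gamma>) has_vector_derivative D s) (at s)" if s: "s \<in> ball t e" "\<gamma> s \<in> cdom c" for s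
      proof -
        have "((cmap c \<circ> \<gamma>) has_vector_derivative D s) (at s within {t - e<..<t + e})"
          by (rule has_vector_derivative_within_subset[OF D(2)]) (use s ball in auto)
        then show ?thesis using s ball at_within_open[of s "{t - e<..<t + e}"] by simp
      qed
      moreover have "continuous_on {s\<in>ball t e. \<gamma> s \<in> cdom c} D"
        by (rule continuous_on_subset[OF D(1)]) (use ball in auto)
      ultimately show ?thesis by blast
    qed
    then have "C1_near (ball t e) \<gamma>" unfolding C1_near_def by blast
    then show "\<exists>V. open V \<and> t \<in> V \<and> V \<subseteq> {0<..<1} - P \<and> C1_near V \<gamma>"
      using e by (intro exI[of _ "ball t e"]) auto
  qed
  then show thesis using that P(1) by blast
qed

lemma regular_on_isCont: "regular_on U \<gamma> \<Longrightarrow> t \<in> U \<Longrightarrow> isCont \<gamma> t"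
  unfolding regular_on_def using continuous_on_eq_continuous_at by blast

lemma regular_on_derivative:
  assumes "regular_on U \<gamma>" "t \<in> U" "c \<in> A" "\<gamma> t \<in> cdom c"
  shows "((cmap c \<circ> \<gamma>) has_vector_derivative vector_derivative (cmap c \<circ> \<gamma>) (at t)) (at t)"
proof -
  obtain V where "t \<in> V" "C1_near V \<gamma>" using assms(1,2) unfolding regular_on_def by blast
  then obtain D where "((cmap c \<circ> \<gamma>) has_vector_derivative D t) (at t)"
    using assms(3,4) unfolding C1_near_def by blast
  then show ?thesis by (metis vector_derivative_at)
qed

lemma continuous_speed:
  assumes r: "regular_on U \<gamma>" shows "continuous_on U (speed \<gamma>)"
proof (rule continuous_at_imp_continuous_on, rule ballI)
  fix t assume t: "t \<in> U"
  let ?c = "chart_at A (\<gamma> t)"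
  note c = chart_at(1)[of "\<gamma> t"]
  obtain V where V: "open V" "t \<in> V" "V \<subseteq> U" and C: "C1_near V \<gamma>"
    using r t unfolding regular_on_def by blast
  obtain D where D: "continuous_on {s\<in>V. \<gamma> s \<in> cdom ?c} D"
     "\<And>s. s \<in> V \<Longrightarrow> \<gamma> s \<in> cdom ?c \<Longrightarrow> ((cmap ?c \<circ> \<gamma>) has_vector_derivative D s) (at s)"
    using bspec[OF C[unfolded C1_near_def] c] by blast
  have cont: "continuous_on V \<gamma>" using r V(3) continuous_on_subset unfolding regular_on_def by blast
  let ?W = "{s\<in>V. \<gamma> s \<in> cdom ?c}"
  have W: "open ?W" using continuous_open_preimage[OF cont V(1) chartD(1)[OF c]]
    by (simp add: vimage_def Int_def)
  have "continuous_on ?W (\<lambda>s. sqrt (gc ?c (cmap ?c (\<gamma> s)) (D s) (D s)))"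
    by (intro continuous_intros continuous_metric_coord[OF c] D continuous_on_compose2[OF chartD(3)[OF c]]
       continuous_on_subset[OF cont]) auto
  then have "continuous_on ?W (speed \<gamma>)"
  proof (rule continuous_on_eq)
    fix s assume "s \<in> ?W"
    then have s: "s \<in> V" "s \<in> U" "\<gamma> s \<in> cdom ?c" using V(3) by auto
    show "sqrt (gc ?c (cmap ?c (\<gamma> s)) (D s) (D s)) = speed \<gamma> s"
      using speed_chart[OF c s(3) regular_on_isCont[OF r s(2)] D(2)[OF s(1,3)]] by simp
  qed
  then show "isCont (speed \<gamma>) t" using W V(2) chart_at(2)[of "\<gamma> t"] by (simp add: continuous_on_eq_continuous_at)
qed

definition arc :: "real set \<Rightarrow> (real \<Rightarrow> 'a) \<Rightarrow> ennreal"
  where "arc S \<gamma> = (\<integral>\<^sup>+t\<in>S. ennreal (speed \<gamma> t) \<partial>lborel)"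

lemma curve_length_arc: "curve_length A g \<gamma> = arc {0..1} \<gamma>"
  by (simp add: curve_length_def arc_def speed_def)

text \<open>The speed itself is junk at the finitely many corners, so measurability is only available
  for this modification.\<close>

lemma speed_measurable_version:
  assumes "pw_C1_curve A \<gamma>"
  obtains P F where "finite P" "regular_on ({0<..<1} - P) \<gamma>" "F \<in> borel_measurable borel"
    "\<And>t. 0 \<le> F t" "\<And>t. t \<in> {0<..<1} - P \<Longrightarrow> F t = speed \<gamma> t"
    "\<And>S. S \<subseteq> {0..1} \<Longrightarrow> arc S \<gamma> = (\<integral>\<^sup>+t\<in>S. ennreal (F t) \<partial>lborel)"
proof -
  obtain P where P: "finite P" "regular_on ({0<..<1} - P) \<gamma>" using pw_C1_regular[OF assms] by blast
  let ?U = "{0<..<1} - P"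
  define F where "F t = (indicator ?U t *\<^sub>R speed \<gamma> t :: real)" for t
  have o: "open ?U" using P(2) by (simp add: regular_on_def)
  have F: "F \<in> borel_measurable borel"
    unfolding F_def[abs_def] using borel_measurable_continuous_on_indicator[OF _ continuous_speed[OF P(2)]] o by auto
  have "AE t in lborel. t \<notin> P \<union> {0, 1}"
    using P(1) by (intro AE_not_in) (simp add: finite_imp_null_set_lborel)
  have "arc S \<gamma> = (\<integral>\<^sup>+t\<in>S. ennreal (F t) \<partial>lborel)" if "S \<subseteq> {0..1}" for S
    unfolding arc_def
  proof (rule nn_integral_cong_AE)
    show "AE t in lborel. ennreal (speed \<gamma> t) * indicator S t = ennreal (F t) * indicator S t"
      using \<open>AE t in lborel. t \<notin> P \<union> {0, 1}\<close>
    proof eventually_elim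
      case (elim t)
      show ?case
      proof (cases "t \<in> S")
        case True
        then have "t \<in> {0..1}" using that by blast
        then have "t \<in> ?U" using elim by auto
        then show ?thesis by (simp add: F_def)
      qed simp
    qed
  qed
  moreover have "0 \<le> F t" for t
    using metric_coord_nonneg
  proof (cases "t \<in> ?U")
    case True
    let ?c = "chart_at A (\<gamma> t)"
    have "speed \<gamma> t \<ge> 0"
      unfolding speed_chart[OF chart_at regular_on_isCont[OF P(2) True] regular_on_derivative[OF P(2) True chart_at]]
      using metric_coord_nonneg[OF chart_at(1)] chart_at(2) by simp
    then show ?thesis by (simp add: F_def)
  qed (simp add: F_def)
  ultimately show thesis using that[OF P F] by (auto simp: F_def)
qed

lemma speed_affine:
  assumes r: "regular_on U \<gamma>" and t: "p + m * s \<in> U"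
  shows "speed (\<lambda>s. \<gamma> (p + m * s)) s = \<bar>m\<bar> * speed \<gamma> (p + m * s)"
proof -
  let ?t = "p + m * s" let ?c = "chart_at A (\<gamma> ?t)"
  note c = chart_at(1)[of "\<gamma> ?t"] and d = chart_at(2)[of "\<gamma> ?t"]
  obtain v where v: "((cmap ?c \<circ> \<gamma>) has_vector_derivative v) (at ?t)"
    using regular_on_derivative[OF r t c d] by blast
  have 1: "((\<lambda>s. p + m * s) has_vector_derivative m) (at s)"
    by (auto intro!: derivative_eq_intros simp: has_vector_derivative_def)
  have 2: "((cmap ?c \<circ> (\<lambda>s. \<gamma> (p + m * s))) has_vector_derivative m *\<^sub>R v) (at s)"
    using vector_diff_chain_at[OF 1 v] by (simp add: comp_def)
  have 3: "isCont (\<lambda>s. \<gamma> (p + m * s)) s"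
    using continuous_at_compose[of s "\<lambda>s. p + m * s" \<gamma>] regular_on_isCont[OF r t] by (simp add: comp_def)
  have y: "cmap ?c (\<gamma> ?t) \<in> cimg ?c" using d by blast
  show ?thesis
    using speed_chart[OF c d regular_on_isCont[OF r t] v] speed_chart[of ?c "\<lambda>s. \<gamma> (p + m * s)" s, OF c d 3 2]
    by (simp add: bilinear_lmul[OF metric_coordD(1)[OF c y]] bilinear_rmul[OF metric_coordD(1)[OF c y]]
        real_sqrt_mult flip: mult.assoc)
qed

text \<open>The factor \<open>\<bar>m\<bar>\<close> by which the speed is multiplied is the Jacobian
  of the substitution. The integrands are compared off the preimage of the break points and of 0 and
  1, a finite set.\<close>

lemma arc_affine:
  assumes \<gamma>: "pw_C1_curve A \<gamma>" and m: "m \<noteq> 0" and S: "S \<subseteq> {0..1}" "S \<in> sets borel"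
  shows "arc {s. p + m * s \<in> S} (\<lambda>s. \<gamma> (p + m * s)) = arc S \<gamma>"
proof -
  obtain P F where P: "finite P" "regular_on ({0<..<1} - P) \<gamma>" and F: "F \<in> borel_measurable borel"
    "\<And>t. 0 \<le> F t" "\<And>t. t \<in> {0<..<1} - P \<Longrightarrow> F t = speed \<gamma> t" "\<And>S. S \<subseteq> {0..1} \<Longrightarrow> arc S \<gamma> = (\<integral>\<^sup>+t\<in>S. ennreal (F t) \<partial>lborel)"
    by (rule speed_measurable_version[OF \<gamma>]) blast
  have "arc S \<gamma> = ennreal \<bar>m\<bar> * (\<integral>\<^sup>+s. ennreal (F (p + m * s)) * indicator S (p + m * s) \<partial>lborel)"
    unfolding F(4)[OF S(1)] by (rule nn_integral_real_affine) (use F S m in auto)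
  also have "\<dots> = (\<integral>\<^sup>+s. ennreal \<bar>m\<bar> * (ennreal (F (p + m * s)) * indicator S (p + m * s)) \<partial>lborel)"
  proof -
    note [measurable] = F(1) S(2)
    show ?thesis by (intro nn_integral_cmult[symmetric]) measurable
  qed
  also have "\<dots> = arc {s. p + m * s \<in> S} (\<lambda>s. \<gamma> (p + m * s))"
    unfolding arc_def
  proof (rule nn_integral_cong_AE)
    have "finite ((\<lambda>t. (t - p) / m) ` (P \<union> {0, 1}))" using P(1) by simp
    then have "AE s in lborel. s \<notin> (\<lambda>t. (t - p) / m) ` (P \<union> {0, 1})"
      by (intro AE_not_in) (simp add: finite_imp_null_set_lborel)
    then show "AE s in lborel. ennreal \<bar>m\<bar> * (ennreal (F (p + m * s)) * indicator S (p + m * s))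
        = ennreal (speed (\<lambda>s. \<gamma> (p + m * s)) s) * indicator {s. p + m * s \<in> S} s"
    proof eventually_elim
      case (elim s)
      have "s = ((p + m * s) - p) / m" using m by simp
      then have "p + m * s \<notin> P \<union> {0, 1}" using elim by (metis imageI)
      then show ?case using S(1) F(2,3)[of "p + m * s"] speed_affine[OF P(2), of p m s]
        by (cases "p + m * s \<in> S") (force simp: ennreal_mult'[symmetric])+
    qed
  qed
  finally show ?thesis by simp
qed

text \<open>The velocity at a parameter depends on the curve nearby, so agreement is assumed on an
  open set; finitely many parameters of \<open>S\<close> outside it do not affect the
  integral.\<close>

lemma arc_cong:
  assumes "open U" "\<And>s. s \<in> U \<Longrightarrow> \<gamma> s = \<gamma>' s" "finite (S - U)"
  shows "arc S \<gamma> = arc S \<gamma>'"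
  unfolding arc_def
proof (rule nn_integral_cong_AE)
  have "AE s in lborel. s \<notin> S - U" using assms(3) by (intro AE_not_in) (simp add: finite_imp_null_set_lborel)
  then show "AE s in lborel. ennreal (speed \<gamma> s) * indicator S s = ennreal (speed \<gamma>' s) * indicator S s"
  proof eventually_elim
    case (elim s)
    show ?case
    proof (cases "s \<in> S")
      case True
      then have "s \<in> U" using elim by simp
      then show ?thesis using assms(2) velocity_cong[OF assms(1) _ assms(2)] by (simp add: speed_def)
    qed simp
  qed
qed

lemma arc_Un:
  assumes \<gamma>: "pw_C1_curve A \<gamma>" and "S \<union> T \<subseteq> {0..1}" "finite (S \<inter> T)" "S \<in> sets borel" "T \<in> sets borel"
  shows "arc (S \<union> T) \<gamma> = arc S \<gamma> + arc T \<gamma>"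
proof -
  obtain F where F: "F \<in> borel_measurable borel"
    "\<And>S. S \<subseteq> {0..1} \<Longrightarrow> arc S \<gamma> = (\<integral>\<^sup>+t\<in>S. ennreal (F t) \<partial>lborel)"
    by (rule speed_measurable_version[OF \<gamma>]) blast
  have "AE s in lborel. s \<notin> S \<inter> T" using assms(3) by (intro AE_not_in) (simp add: finite_imp_null_set_lborel)
  then have "arc (S \<union> T) \<gamma> = (\<integral>\<^sup>+t. ennreal (F t) * indicator S t + ennreal (F t) * indicator T t \<partial>lborel)"
    unfolding F(2)[OF assms(2)] by (intro nn_integral_cong_AE) (elim eventually_mono, auto simp: indicator_def)
  then show ?thesis using F assms by (simp add: nn_integral_add)
qed

lemma riem_dist_le: "pw_C1_curve A \<gamma> \<Longrightarrow> \<gamma> 0 = p \<Longrightarrow> \<gamma> 1 = q \<Longrightarrow> riem_dist A g p q \<le> arc {0..1} \<gamma>"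
  unfolding riem_dist_def curve_length_arc by (rule INF_lower2[of \<gamma>]) auto

lemma riem_dist_lessE:
  assumes "riem_dist A g p q < r"
  obtains \<gamma> where "pw_C1_curve A \<gamma>" "\<gamma> 0 = p" "\<gamma> 1 = q" "arc {0..1} \<gamma> < r"
  using assms unfolding riem_dist_def curve_length_arc INF_less_iff by blast

lemma riem_dist_commute_le: "riem_dist A g p q \<le> riem_dist A g q p"
proof (rule dense_ge)
  fix r assume "riem_dist A g q p < r"
  then obtain \<gamma> where \<gamma>: "pw_C1_curve A \<gamma>" "\<gamma> 0 = q" "\<gamma> 1 = p" "arc {0..1} \<gamma> < r"
    using riem_dist_lessE by blast
  have "arc {s. 1 + (-1) * s \<in> {0..1}} (\<lambda>s. \<gamma> (1 + (-1) * s)) = arc {0..1} \<gamma>"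
    by (rule arc_affine[OF \<gamma>(1)]) auto
  moreover have "{s. 1 + (-1) * s \<in> {0..1}} = {0..1::real}" by auto
  ultimately have "riem_dist A g p q \<le> arc {0..1} \<gamma>"
    using riem_dist_le[OF pw_C1_curve_affine[OF \<gamma>(1), of "-1" 1]] \<gamma> by auto
  then show "riem_dist A g p q \<le> r" using \<gamma>(4) by simp
qed

lemma riem_dist_commute: "riem_dist A g p q = riem_dist A g q p"
  by (intro antisym riem_dist_commute_le)

lemma riem_dist_triangle: "riem_dist A g p r \<le> riem_dist A g p q + riem_dist A g q r"
proof (rule ennreal_le_epsilon)
  fix e :: real assume fin: "riem_dist A g p q + riem_dist A g q r < top" and e: "0 < e"
  have "riem_dist A g p q < riem_dist A g p q + ennreal (e/2)" "riem_dist A g q r < riem_dist A g q r + ennreal (e/2)"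
    using fin e by (auto intro!: ennreal_less_add)
  then obtain \<gamma>1 \<gamma>2 where 1: "pw_C1_curve A \<gamma>1" "\<gamma>1 0 = p" "\<gamma>1 1 = q" "arc {0..1} \<gamma>1 < riem_dist A g p q + ennreal (e/2)"
    and 2: "pw_C1_curve A \<gamma>2" "\<gamma>2 0 = q" "\<gamma>2 1 = r" "arc {0..1} \<gamma>2 < riem_dist A g q r + ennreal (e/2)"
    by (metis riem_dist_lessE)
  let ?\<gamma> = "\<lambda>t. if t \<le> 1/2 then \<gamma>1 (2 * t) else \<gamma>2 (2 * t - 1)"
  have \<gamma>: "pw_C1_curve A ?\<gamma>" using pw_C1_curve_join[OF 1(1) 2(1)] 1 2 by simp
  have "arc {0..1/2} ?\<gamma> = arc {0..1/2} (\<lambda>s. \<gamma>1 (0 + 2 * s))"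
    by (rule arc_cong[of "{..<1/2}"]) (auto intro: finite_subset[of _ "{1/2}"])
  also have "\<dots> = arc {s. 0 + 2 * s \<in> {0..1::real}} (\<lambda>s. \<gamma>1 (0 + 2 * s))"
    by (rule arg_cong[where f="\<lambda>S. arc S _"]) auto
  also have "\<dots> = arc {0..1} \<gamma>1"
    by (rule arc_affine[OF 1(1)]) auto
  finally have a1: "arc {0..1/2} ?\<gamma> = arc {0..1} \<gamma>1" .
  have "arc {1/2..1} ?\<gamma> = arc {1/2..1} (\<lambda>s. \<gamma>2 (-1 + 2 * s))"
    by (rule arc_cong[of "{1/2<..}"]) (auto intro: finite_subset[of _ "{1/2}"])
  also have "\<dots> = arc {s. -1 + 2 * s \<in> {0..1::real}} (\<lambda>s. \<gamma>2 (-1 + 2 * s))"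
    by (rule arg_cong[where f="\<lambda>S. arc S _"]) auto
  also have "\<dots> = arc {0..1} \<gamma>2"
    by (rule arc_affine[OF 2(1)]) auto
  finally have a2: "arc {1/2..1} ?\<gamma> = arc {0..1} \<gamma>2" .
  have "arc ({0..1/2} \<union> {1/2..1}) ?\<gamma> = arc {0..1/2} ?\<gamma> + arc {1/2..1} ?\<gamma>"
    by (rule arc_Un[OF \<gamma>]) (auto intro: finite_subset[of _ "{1/2}"])
  moreover have "{0..1/2} \<union> {1/2..1} = {0..1::real}" by auto
  ultimately have "riem_dist A g p r \<le> arc {0..1} \<gamma>1 + arc {0..1} \<gamma>2"
    using riem_dist_le[OF \<gamma>] 1 2 a1 a2 by auto
  also have "\<dots> \<le> (riem_dist A g p q + ennreal (e/2)) + (riem_dist A g q r + ennreal (e/2))"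
    using 1(4) 2(4) by (intro add_mono) auto
  also have "\<dots> = riem_dist A g p q + riem_dist A g q r + ennreal e"
    using e ennreal_plus[of "e/2" "e/2"] by (simp add: add_ac)
  finally show "riem_dist A g p r \<le> riem_dist A g p q + riem_dist A g q r + ennreal e" .
qed

text \<open>For a nearly shortest curve this says that each of its points lies nearly between the
  end points, which is the source of the length space property behind the Hopf--Rinow
  theorem.\<close>

lemma riem_dist_split:
  assumes \<gamma>: "pw_C1_curve A \<gamma>" and t: "0 < t" "t < 1"
  shows "riem_dist A g (\<gamma> 0) (\<gamma> t) + riem_dist A g (\<gamma> t) (\<gamma> 1) \<le> arc {0..1} \<gamma>"
proof -
  have "arc {s. 0 + t * s \<in> {0..t}} (\<lambda>s. \<gamma> (0 + t * s)) = arc {0..t} \<gamma>"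
    by (rule arc_affine[OF \<gamma>]) (use t in auto)
  moreover have "{s. 0 + t * s \<in> {0..t}} = {0..1}" using t by (auto simp: zero_le_mult_iff)
  ultimately have 1: "riem_dist A g (\<gamma> 0) (\<gamma> t) \<le> arc {0..t} \<gamma>"
    using riem_dist_le[OF pw_C1_curve_affine[OF \<gamma>, of t 0]] t by auto
  have "arc {s. t + (1 - t) * s \<in> {t..1}} (\<lambda>s. \<gamma> (t + (1 - t) * s)) = arc {t..1} \<gamma>"
    by (rule arc_affine[OF \<gamma>]) (use t in auto)
  moreover have "{s. t + (1 - t) * s \<in> {t..1}} = {0..1}"
  proof -
    have "t + (1 - t) * s \<le> 1 \<longleftrightarrow> s \<le> 1" for s
    proof -
      have "t + (1 - t) * s \<le> 1 \<longleftrightarrow> (1 - t) * s \<le> (1 - t) * 1" by (simp add: algebra_simps)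
      then show ?thesis using t mult_le_cancel_left_pos[of "1 - t" s 1] by auto
    qed
    moreover have "t \<le> t + (1 - t) * s \<longleftrightarrow> 0 \<le> s" for s
      using t by (simp add: zero_le_mult_iff)
    ultimately show ?thesis unfolding set_eq_iff mem_Collect_eq atLeastAtMost_iff by blast
  qed
  ultimately have 2: "riem_dist A g (\<gamma> t) (\<gamma> 1) \<le> arc {t..1} \<gamma>"
    using riem_dist_le[OF pw_C1_curve_affine[OF \<gamma>, of "1 - t" t]] t by auto
  have "arc ({0..t} \<union> {t..1}) \<gamma> = arc {0..t} \<gamma> + arc {t..1} \<gamma>"
    by (rule arc_Un[OF \<gamma>]) (use t in \<open>auto intro: finite_subset[of _ "{t}"]\<close>)
  moreover have "{0..t} \<union> {t..1} = {0..1}" using t by auto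
  ultimately show ?thesis using add_mono[OF 1 2] by simp
qed

lemma riem_dist_self: "riem_dist A g p p = 0"
proof -
  have C: "C1_on (\<lambda>t. p) a b" for a b
    unfolding C1_on_def by (auto intro!: exI[of _ "\<lambda>_. 0"] has_vector_derivative_const simp: comp_def)
  then have \<gamma>: "pw_C1_curve A (\<lambda>t. p)" unfolding pw_C1_curve_iff by auto
  have "speed (\<lambda>t. p) t = 0" for t
  proof -
    have "speed (\<lambda>t. p) t = sqrt (gc (chart_at A p) (cmap (chart_at A p) p) 0 0)"
      by (rule speed_chart) (auto simp: chart_at comp_def)
    moreover have "bilinear (gc (chart_at A p) (cmap (chart_at A p) p))"
      using chart_at by (intro metric_coordD(1)) auto
    ultimately show ?thesis by (simp add: bilinear_lzero)
  qed
  then have "arc {0..1} (\<lambda>t. p) = 0" by (simp add: arc_def)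
  then show ?thesis using riem_dist_le[OF \<gamma>, of p p] by simp
qed

text \<open>The coordinate segment, run with constant coordinate velocity \<open>y' - y\<close>, is
  a competitor for the distance, and \<open>M\<close> bounds its speed.\<close>

lemma riem_dist_segment:
  assumes c: "c \<in> A" and seg: "closed_segment y y' \<subseteq> cimg c"
    and M: "0 \<le> M" "\<And>q. q \<in> closed_segment y y' \<Longrightarrow> gc c q (y' - y) (y' - y) \<le> M\<^sup>2"
  shows "riem_dist A g (cinv c y) (cinv c y') \<le> ennreal M"
proof -
  define l where "l t = y + t *\<^sub>R (y' - y)" for t
  have l_seg: "l t \<in> closed_segment y y'" if "t \<in> {0..1}" for t
    using that by (auto simp: l_def closed_segment_def algebra_simps intro!: exI[of _ t])
  have l_img: "l t \<in> cimg c" if "t \<in> {0..1}" for t using l_seg[OF that] seg by blast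
  have l_cont: "continuous_on T l" for T unfolding l_def by (intro continuous_intros)
  have l_der: "(l has_vector_derivative (y' - y)) (at t within T)" for t T
    unfolding l_def has_vector_derivative_def by (auto intro!: derivative_eq_intros)
  define \<gamma> where "\<gamma> t = cinv c (l t)" for t
  have \<gamma>_cont: "continuous_on {0..1} \<gamma>"
    unfolding \<gamma>_def by (rule continuous_on_compose2[OF chartD(4)[OF c] l_cont]) (use l_img in auto)
  have \<gamma>_dom: "\<gamma> t \<in> cdom c" "cmap c (\<gamma> t) = l t" if "t \<in> {0..1}" for t
    using chartD(7,8)[OF c l_img[OF that]] by (auto simp: \<gamma>_def)
  have "C1_on \<gamma> a b" if ab: "0 \<le> a" "a < b" "b \<le> 1" for a b
    unfolding C1_on_def
  proof
    fix c' assume c': "c' \<in> A"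
    let ?D = "\<lambda>t. \<Sum>i\<in>Basis. ((y' - y) \<bullet> i) *\<^sub>R trans_deriv c c' (l t) i"
    have l_in: "l t \<in> cmap c ` (cdom c \<inter> cdom c')" if "t \<in> {a..b}" "\<gamma> t \<in> cdom c'" for t
      using that ab \<gamma>_dom[of t] by (intro image_eqI[of _ _ "\<gamma> t"]) auto
    have "continuous_on {t\<in>{a..b}. \<gamma> t \<in> cdom c'} ?D"
      by (intro continuous_intros continuous_on_compose2[OF smooth_on_continuous[OF smooth_on_frechet[OF smooth_transition[OF c c']]] l_cont])
        (use l_in in auto)
    moreover have "((cmap c' \<circ> \<gamma>) has_vector_derivative ?D t) (at t within {a..b})" if t: "t \<in> {a..b}" "\<gamma> t \<in> cdom c'" for t
    proof -
      have d: "((cmap c' \<circ> cinv c) has_derivative trans_deriv c c' (l t)) (at (l t))"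
        using smooth_on_has_derivative[OF smooth_transition[OF c c'] l_in[OF t]] .
      have "((\<lambda>t. (cmap c' \<circ> cinv c) (l t)) has_derivative (\<lambda>r. trans_deriv c c' (l t) (r *\<^sub>R (y' - y)))) (at t within {a..b})"
        by (rule has_derivative_compose[OF l_der[unfolded has_vector_derivative_def] d])
      moreover have "trans_deriv c c' (l t) (r *\<^sub>R (y' - y)) = r *\<^sub>R ?D t" for r
      proof -
        have "trans_deriv c c' (l t) (y' - y) = trans_deriv c c' (l t) (\<Sum>i\<in>Basis. ((y' - y) \<bullet> i) *\<^sub>R i)"
          by (simp only: euclidean_representation)
        also have "\<dots> = ?D t" by (simp only: linear_sum[OF has_derivative_linear[OF d]] linear_scale[OF has_derivative_linear[OF d]])
        finally show ?thesis by (simp only: linear_scale[OF has_derivative_linear[OF d]])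
      qed
      ultimately show ?thesis by (simp add: has_vector_derivative_def \<gamma>_def comp_def)
    qed
    ultimately show "\<exists>D. continuous_on {t\<in>{a..b}. \<gamma> t \<in> cdom c'} D \<and>
          (\<forall>t\<in>{a..b}. \<gamma> t \<in> cdom c' \<longrightarrow> ((cmap c' \<circ> \<gamma>) has_vector_derivative D t) (at t within {a..b}))"
      by blast
  qed
  then have \<gamma>: "pw_C1_curve A \<gamma>" unfolding pw_C1_curve_iff using \<gamma>_cont by blast
  have sp: "speed \<gamma> t \<le> M" if t: "t \<in> {0<..<1}" for t
  proof -
    have "continuous_on {0<..<1} \<gamma>" by (rule continuous_on_subset[OF \<gamma>_cont]) auto
    then have "isCont \<gamma> t" using t by (simp add: continuous_on_eq_continuous_at)
    moreover have "((cmap c \<circ> \<gamma>) has_vector_derivative (y' - y)) (at t)"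
      by (rule has_vector_derivative_transform_within_open[OF l_der, of "{0<..<1}"]) (use t \<gamma>_dom in auto)
    ultimately have "speed \<gamma> t = sqrt (gc c (l t) (y' - y) (y' - y))"
      using speed_chart[OF c, of \<gamma> t] \<gamma>_dom[of t] t by simp
    also have "\<dots> \<le> M" using M(2)[OF l_seg[of t]] M(1) t by (intro real_le_lsqrt) auto
    finally show ?thesis .
  qed
  have "arc {0..1} \<gamma> = (\<integral>\<^sup>+t\<in>{0<..<1}. ennreal (speed \<gamma> t) \<partial>lborel)"
    unfolding arc_def
  proof (rule nn_integral_cong_AE)
    have "AE t in lborel. t \<notin> {0, 1::real}" by (intro AE_not_in) (simp add: finite_imp_null_set_lborel)
    then show "AE t in lborel. ennreal (speed \<gamma> t) * indicator {0..1} t = ennreal (speed \<gamma> t) * indicator {0<..<1} t"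
      by eventually_elim (auto simp: indicator_def)
  qed
  also have "\<dots> \<le> (\<integral>\<^sup>+t. ennreal M * indicator {0<..<1::real} t \<partial>lborel)"
    by (intro nn_integral_mono) (auto simp: indicator_def intro!: ennreal_leI sp)
  also have "\<dots> = ennreal M" by (subst nn_integral_cmult_indicator) auto
  finally show ?thesis
    using riem_dist_le[OF \<gamma>, of "cinv c y" "cinv c y'"] by (simp add: \<gamma>_def l_def)
qed

text \<open>With \<open>w\<close> the coordinate displacement, \<open>w \<bullet> w\<close> is the
  integral of the coordinate velocity against \<open>w\<close>. Cauchy-Schwarz and the lower bound
  on the metric estimate the integrand by \<open>norm w / k\<close> times the speed, and dividing by
  \<open>norm w\<close> gives the claim. For a curve of infinite length the bound is
  trivial.\<close>

lemma chart_displacement_le: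
  assumes \<gamma>: "pw_C1_curve A \<gamma>" and c: "c \<in> A" and \<tau>: "\<tau> \<in> {0..1}"
    and dom: "\<And>t. t \<in> {0..\<tau>} \<Longrightarrow> \<gamma> t \<in> cdom c" and k: "0 < k"
    and lower: "\<And>t w. t \<in> {0..\<tau>} \<Longrightarrow> k\<^sup>2 * (norm w)\<^sup>2 \<le> gc c (cmap c (\<gamma> t)) w w"
  shows "ennreal (k * norm (cmap c (\<gamma> \<tau>) - cmap c (\<gamma> 0))) \<le> arc {0..1} \<gamma>"
proof (cases "arc {0..1} \<gamma> < top")
  case True
  define w where "w = cmap c (\<gamma> \<tau>) - cmap c (\<gamma> 0)"
  obtain P F where P: "finite P" and r: "regular_on ({0<..<1} - P) \<gamma>" and F: "F \<in> borel_measurable borel"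
    "\<And>t. 0 \<le> F t" "\<And>t. t \<in> {0<..<1} - P \<Longrightarrow> F t = speed \<gamma> t" "\<And>S. S \<subseteq> {0..1} \<Longrightarrow> arc S \<gamma> = (\<integral>\<^sup>+t\<in>S. ennreal (F t) \<partial>lborel)"
    by (rule speed_measurable_version[OF \<gamma>]) blast
  define L where "L = enn2real (arc {0..1} \<gamma>)"
  have L: "arc {0..1} \<gamma> = ennreal L" "0 \<le> L" using True by (auto simp: L_def)
  have "((\<lambda>t. F t * indicator {0..1} t) has_integral L) UNIV"
    using F(1,2) F(4)[OF order_refl] L by (intro nn_integral_has_integral) (auto simp: ennreal_mult'' ennreal_indicator)
  then have FL: "((\<lambda>t. (norm w / k) * (F t * indicator {0..1} t)) has_integral (norm w / k) * L) UNIV"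
    by (rule has_integral_mult_right)
  let ?D = "\<lambda>t. vector_derivative (cmap c \<circ> \<gamma>) (at t)"
  have cont: "continuous_on {0..1} \<gamma>" using \<gamma> by (simp add: pw_C1_curve_iff)
  have i: "(?D has_integral ((cmap c \<circ> \<gamma>) \<tau> - (cmap c \<circ> \<gamma>) 0)) {0..\<tau>}"
  proof (rule fundamental_theorem_of_calculus_interior_strong[OF P])
    show "((cmap c \<circ> \<gamma>) has_vector_derivative ?D t) (at t)" if "t \<in> {0<..<\<tau>} - P" for t
      by (rule regular_on_derivative[OF r _ c]) (use that \<tau> dom in auto)
    show "continuous_on {0..\<tau>} (cmap c \<circ> \<gamma>)"
      unfolding comp_def
      by (rule continuous_on_compose2[OF chartD(3)[OF c] continuous_on_subset[OF cont]]) (use \<tau> dom in auto)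
  qed (use \<tau> in auto)
  have "((\<lambda>t. ?D t \<bullet> w) has_integral (w \<bullet> w)) {0..\<tau>}"
    using has_integral_linear[OF i bounded_linear_inner_left[of w]] by (simp add: comp_def w_def[symmetric])
  then have "((\<lambda>t. if t \<in> P \<union> {0, \<tau>} then 0 else ?D t \<bullet> w) has_integral (w \<bullet> w)) {0..\<tau>}"
    by (rule has_integral_spike_finite[of "P \<union> {0, \<tau>}", rotated -1]) (use P in auto)
  then have Dw: "((\<lambda>t. if t \<in> {0..\<tau>} then (if t \<in> P \<union> {0, \<tau>} then 0 else ?D t \<bullet> w) else 0) has_integral (w \<bullet> w)) UNIV"
    by (simp only: has_integral_restrict_UNIV)
  have "w \<bullet> w \<le> (norm w / k) * L"
  proof (rule has_integral_le[OF Dw FL])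
    fix t
    show "(if t \<in> {0..\<tau>} then (if t \<in> P \<union> {0, \<tau>} then 0 else ?D t \<bullet> w) else 0) \<le> (norm w / k) * (F t * indicator {0..1} t)"
    proof (cases "t \<in> {0<..<\<tau>} - P")
      case True
      then have t: "t \<in> {0<..<1} - P" "t \<in> {0..\<tau>}" using \<tau> by auto
      have "F t = sqrt (gc c (cmap c (\<gamma> t)) (?D t) (?D t))"
        using speed_chart[OF c dom[OF t(2)] regular_on_isCont[OF r t(1)] regular_on_derivative[OF r t(1) c dom[OF t(2)]]] F(3)[OF t(1)] by simp
      also have "\<dots> \<ge> sqrt ((k * norm (?D t))\<^sup>2)"
        using lower[OF t(2)] by (intro real_sqrt_le_mono) (simp add: power_mult_distrib)
      finally have "k * norm (?D t) \<le> F t" using k by (simp add: comp_def)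
      then have "norm (?D t) * norm w \<le> F t / k * norm w" using k by (intro mult_right_mono) (auto simp: field_simps)
      moreover have "?D t \<bullet> w \<le> norm (?D t) * norm w" by (rule norm_cauchy_schwarz)
      ultimately show ?thesis using True t by (simp add: mult.commute)
    qed (use F(2)[of t] k in \<open>auto simp: indicator_def\<close>)
  qed
  then have "norm w * (k * norm w) \<le> norm w * L" using k by (simp add: dot_square_norm power2_eq_square field_simps)
  then have "k * norm w \<le> L" using L(2) k by (cases "w = 0") auto
  then show ?thesis using L by (simp add: w_def ennreal_leI)
next
  case False
  then show ?thesis by (simp add: not_less top_unique)
qed

lemma metric_coord_scaleR:
  assumes "c \<in> A" "y \<in> cimg c"
  shows "gc c y (a *\<^sub>R u) (a *\<^sub>R u) = a\<^sup>2 * gc c y u u"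
  using metric_coordD(1)[OF assms] by (simp add: bilinear_lmul bilinear_rmul power2_eq_square mult.assoc)

text \<open>On the compact product of \<open>S\<close> with the unit sphere the metric attains a
  positive minimum; quadratic homogeneity extends the bound to all vectors.\<close>

lemma metric_lower_bound:
  assumes c: "c \<in> A" and S: "compact S" "S \<subseteq> cimg c"
  obtains k where "k > 0" "\<And>y w. y \<in> S \<Longrightarrow> k\<^sup>2 * (norm w)\<^sup>2 \<le> gc c y w w"
proof -
  have cont: "continuous_on (S \<times> sphere 0 1) (\<lambda>(y, w). gc c y w w)"
    unfolding split_def by (intro continuous_metric_coord[OF c] continuous_intros) (use S in auto)
  have "\<exists>m>0. \<forall>y\<in>S. \<forall>w\<in>sphere 0 1. m \<le> gc c y w w"
  proof (cases "S = {}")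
    case False
    have "S \<times> (sphere 0 1 :: (real^'n) set) \<noteq> {}"
      using False by (auto intro: exI[of _ "axis undefined 1"])
    from continuous_attains_inf[OF compact_Times[OF S(1) compact_sphere] this cont]
    obtain y0 w0 where 0: "y0 \<in> S" "w0 \<in> sphere 0 1" "\<And>y w. y \<in> S \<Longrightarrow> w \<in> sphere 0 1 \<Longrightarrow> gc c y0 w0 w0 \<le> gc c y w w"
      by force
    have "gc c y0 w0 w0 > 0" using metric_coordD(3)[OF c subsetD[OF S(2) 0(1)], of w0] 0(2) by (cases "w0 = 0") auto
    then show ?thesis using 0 by blast
  qed (auto intro: exI[of _ 1])
  then obtain m where m: "m > 0" "\<And>y w. y \<in> S \<Longrightarrow> norm w = 1 \<Longrightarrow> m \<le> gc c y w w" by auto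
  show thesis
  proof (rule that[of "sqrt m"])
    fix y w assume y: "y \<in> S"
    note b = metric_coordD(1)[OF c subsetD[OF S(2) y]]
    show "(sqrt m)\<^sup>2 * (norm w)\<^sup>2 \<le> gc c y w w"
    proof (cases "w = 0")
      case False
      have "gc c y w w = (norm w)\<^sup>2 * gc c y (w /\<^sub>R norm w) (w /\<^sub>R norm w)"
        using False metric_coord_scaleR[OF c subsetD[OF S(2) y], of "norm w" "w /\<^sub>R norm w"] by simp
      moreover have "m \<le> gc c y (w /\<^sub>R norm w) (w /\<^sub>R norm w)" using m(2)[OF y, of "w /\<^sub>R norm w"] False by simp
      ultimately show ?thesis using m(1) by (simp add: mult.commute[of m] mult_left_mono)
    qed (simp add: bilinear_lzero[OF b])
  qed (use m in simp)
qed

lemma metric_upper_bound: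
  assumes c: "c \<in> A" and S: "compact S" "S \<subseteq> cimg c"
  obtains k where "k > 0" "\<And>y w. y \<in> S \<Longrightarrow> gc c y w w \<le> k\<^sup>2 * (norm w)\<^sup>2"
proof -
  have cont: "continuous_on (S \<times> sphere 0 1) (\<lambda>(y, w). gc c y w w)"
    unfolding split_def by (intro continuous_metric_coord[OF c] continuous_intros) (use S in auto)
  have "bounded ((\<lambda>(y, w). gc c y w w) ` (S \<times> sphere 0 1))"
    by (intro compact_imp_bounded compact_continuous_image[OF cont] compact_Times S compact_sphere)
  then obtain m where m: "m > 0" "\<And>y w. y \<in> S \<Longrightarrow> norm w = 1 \<Longrightarrow> gc c y w w \<le> m"
    unfolding bounded_pos by (force simp: abs_le_iff)
  show thesis
  proof (rule that[of "sqrt m"])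
    fix y w assume y: "y \<in> S"
    note b = metric_coordD(1)[OF c subsetD[OF S(2) y]]
    show "gc c y w w \<le> (sqrt m)\<^sup>2 * (norm w)\<^sup>2"
    proof (cases "w = 0")
      case False
      have "gc c y w w = (norm w)\<^sup>2 * gc c y (w /\<^sub>R norm w) (w /\<^sub>R norm w)"
        using False metric_coord_scaleR[OF c subsetD[OF S(2) y], of "norm w" "w /\<^sub>R norm w"] by simp
      moreover have "gc c y (w /\<^sub>R norm w) (w /\<^sub>R norm w) \<le> m" using m(2)[OF y, of "w /\<^sub>R norm w"] False by simp
      ultimately show ?thesis using m(1) by (simp add: mult.commute[of m] mult_left_mono)
    qed (simp add: bilinear_lzero[OF b])
  qed (use m in simp)
qed

text \<open>A curve from \<open>x\<close> that leaves the coordinate ball of radius \<open>r\<close>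
  has length at least \<open>k * r\<close>. Hence a point at smaller distance lies in the chart,
  with coordinates controlled by the distance. This is what makes the distance separate points and
  induce the manifold topology.\<close>

lemma riem_dist_lower:
  assumes c: "c \<in> A" and x: "x \<in> cdom c"
  obtains r k where "r > 0" "k > 0" "cball (cmap c x) r \<subseteq> cimg c"
    "\<And>z. riem_dist A g x z < ennreal (k * r) \<Longrightarrow>
        z \<in> cdom c \<and> cmap c z \<in> ball (cmap c x) r \<and> ennreal (k * norm (cmap c z - cmap c x)) \<le> riem_dist A g x z"
proof -
  have "cmap c x \<in> cimg c" using x by blast
  then obtain r where r: "r > 0" "cball (cmap c x) r \<subseteq> cimg c"
    using chartD(2)[OF c] open_contains_cball by metis
  obtain k where k: "k > 0" "\<And>y w. y \<in> cball (cmap c x) r \<Longrightarrow> k\<^sup>2 * (norm w)\<^sup>2 \<le> gc c y w w"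
    using metric_lower_bound[OF c compact_cball r(2)] by blast
  have main: "\<gamma> 1 \<in> cdom c \<and> cmap c (\<gamma> 1) \<in> ball (cmap c x) r \<and> ennreal (k * norm (cmap c (\<gamma> 1) - cmap c x)) \<le> arc {0..1} \<gamma>"
    if \<gamma>: "pw_C1_curve A \<gamma>" "\<gamma> 0 = x" and len: "arc {0..1} \<gamma> < ennreal (k * r)" for \<gamma>
  proof -
    define L where "L = enn2real (arc {0..1} \<gamma>)"
    have L: "arc {0..1} \<gamma> = ennreal L" "0 \<le> L" using less_trans[OF len ennreal_less_top] by (simp_all add: L_def)
    have Lr: "L / k < r" using len k(1) r(1) unfolding L(1) by (simp add: ennreal_less_iff L(2) field_simps)
    define V where "V = cinv c ` ball (cmap c x) r"
    have V: "open V" unfolding V_def by (rule open_cinv_image[OF c]) (use r in auto)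
    have V_iff: "p \<in> V \<longleftrightarrow> p \<in> cdom c \<and> cmap c p \<in> ball (cmap c x) r" for p
      using cinv_image_eq[OF c order_trans[OF ball_subset_cball r(2)]] by (auto simp: V_def)
    \<comment> \<open>A curve of length \<open>L\<close> moves by at most \<open>L / k < r\<close>
      in coordinates while it stays in \<open>V\<close>. The set \<open>C\<close> to which it is
      thus confined is closed, so it still contains the point at the first exit time, which
      contradicts the exit from \<open>V\<close>.\<close>
    define C where "C = cinv c ` cball (cmap c x) (L / k)"
    have C: "closed C" unfolding C_def
      using Lr r(2) by (intro compact_imp_closed compact_continuous_image continuous_on_subset[OF chartD(4)[OF c]]) auto
    have CV: "C \<subseteq> V" using Lr by (auto simp: C_def V_def)
    have cont: "continuous_on {0..1} \<gamma>" using \<gamma> by (simp add: pw_C1_curve_iff)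
    have bd: "\<gamma> \<tau> \<in> C \<and> ennreal (k * norm (cmap c (\<gamma> \<tau>) - cmap c x)) \<le> arc {0..1} \<gamma>"
      if \<tau>: "\<tau> \<in> {0..1}" and in_V: "\<And>t. t \<in> {0..\<tau>} \<Longrightarrow> \<gamma> t \<in> V" for \<tau>
    proof -
      have e: "ennreal (k * norm (cmap c (\<gamma> \<tau>) - cmap c (\<gamma> 0))) \<le> arc {0..1} \<gamma>"
        by (rule chart_displacement_le[OF \<gamma>(1) c \<tau> _ k(1) k(2)]) (use in_V V_iff in \<open>auto intro: less_imp_le\<close>)
      then have "norm (cmap c (\<gamma> \<tau>) - cmap c x) \<le> L / k" using L k(1) \<gamma>(2) by (simp add: field_simps)
      then have "cmap c (\<gamma> \<tau>) \<in> cball (cmap c x) (L / k)" by (simp add: dist_norm norm_minus_commute)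
      moreover have "\<gamma> \<tau> = cinv c (cmap c (\<gamma> \<tau>))" using in_V[of \<tau>] V_iff \<tau> chartD(6)[OF c] by auto
      ultimately show ?thesis unfolding C_def using e \<gamma>(2) by blast
    qed
    have "\<gamma> t \<in> V" if "t \<in> {0..1}" for t
    proof (rule ccontr)
      assume "\<gamma> t \<notin> V"
      define E where "E = {s\<in>{0..1}. \<gamma> s \<notin> V}"
      have "closed E"
        unfolding E_def using continuous_closed_preimage[OF cont _ closed_Compl[OF V]] by (simp add: vimage_def Int_def)
      moreover have E: "t \<in> E" "bdd_below E" using that \<open>\<gamma> t \<notin> V\<close> by (auto simp: E_def)
      ultimately have IE: "Inf E \<in> E" using closed_contains_Inf by blast
      define \<tau> where "\<tau> = Inf E"
      have \<tau>: "\<tau> \<in> {0..1}" "\<gamma> \<tau> \<notin> V" using IE by (auto simp: E_def \<tau>_def)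
      have before: "\<gamma> s \<in> V" if "0 \<le> s" "s < \<tau>" for s
        using that \<tau> cInf_lower[OF _ E(2), of s] by (force simp: E_def \<tau>_def)
      have "x \<in> V" using V_iff x r(1) by simp
      then have "\<tau> > 0" using \<tau> \<gamma>(2) by (cases "\<tau> = 0") auto
      have "\<gamma> ` closure {0..<\<tau>} \<subseteq> C"
      proof (rule image_closure_subset[OF _ C])
        show "continuous_on (closure {0..<\<tau>}) \<gamma>" by (rule continuous_on_subset[OF cont]) (use \<tau> \<open>\<tau> > 0\<close> in auto)
        show "\<gamma> ` {0..<\<tau>} \<subseteq> C" using bd before \<tau> by auto
      qed
      moreover have "\<tau> \<in> closure {0..<\<tau>}" using \<open>\<tau> > 0\<close> by simp
      ultimately show False using CV \<tau>(2) by blast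
    qed
    then show ?thesis using bd[of 1] V_iff by auto
  qed
  show thesis
  proof (rule that[OF r(1) k(1) r(2)])
    fix z assume z: "riem_dist A g x z < ennreal (k * r)"
    obtain \<gamma>0 where "pw_C1_curve A \<gamma>0" "\<gamma>0 0 = x" "\<gamma>0 1 = z" "arc {0..1} \<gamma>0 < ennreal (k * r)"
      using riem_dist_lessE[OF z] by blast
    then have "z \<in> cdom c \<and> cmap c z \<in> ball (cmap c x) r" using main by blast
    moreover have "ennreal (k * norm (cmap c z - cmap c x)) \<le> riem_dist A g x z"
    proof (rule dense_ge)
      fix s assume "riem_dist A g x z < s"
      then have "riem_dist A g x z < min s (ennreal (k * r))" using z by simp
      then obtain \<gamma> where "pw_C1_curve A \<gamma>" "\<gamma> 0 = x" "\<gamma> 1 = z" "arc {0..1} \<gamma> < min s (ennreal (k * r))"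
        using riem_dist_lessE by blast
      then show "ennreal (k * norm (cmap c z - cmap c x)) \<le> s" using main[of \<gamma>] by auto
    qed
    ultimately show "z \<in> cdom c \<and> cmap c z \<in> ball (cmap c x) r \<and> ennreal (k * norm (cmap c z - cmap c x)) \<le> riem_dist A g x z"
      by blast
  qed
qed

lemma riem_dist_upper:
  assumes c: "c \<in> A" and S: "cball y0 r \<subseteq> cimg c"
  obtains k where "k > 0" "\<And>y y'. y \<in> cball y0 r \<Longrightarrow> y' \<in> cball y0 r \<Longrightarrow>
     riem_dist A g (cinv c y) (cinv c y') \<le> ennreal (k * norm (y' - y))"
proof -
  obtain k where k: "k > 0" "\<And>y w. y \<in> cball y0 r \<Longrightarrow> gc c y w w \<le> k\<^sup>2 * (norm w)\<^sup>2"
    using metric_upper_bound[OF c compact_cball S] by blast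
  show thesis
  proof (rule that[OF k(1)])
    fix y y' assume y: "y \<in> cball y0 r" "y' \<in> cball y0 r"
    have seg: "closed_segment y y' \<subseteq> cball y0 r" using y by (intro closed_segment_subset) auto
    show "riem_dist A g (cinv c y) (cinv c y') \<le> ennreal (k * norm (y' - y))"
      by (rule riem_dist_segment[OF c]) (use seg S k in \<open>auto simp: power_mult_distrib\<close>)
  qed
qed

text \<open>The converse comparison of topologies: short coordinate segments show that points near
  \<open>x\<close> in the manifold are near \<open>x\<close> in the distance.\<close>

lemma riem_dist_nhd:
  assumes e: "e > 0"
  obtains U where "open U" "x \<in> U" "\<And>z. z \<in> U \<Longrightarrow> riem_dist A g x z < ennreal e"
proof -
  note c = chart_at[of x]
  let ?c = "chart_at A x"
  have "cmap ?c x \<in> cimg ?c" using c by blast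
  then obtain r where r: "r > 0" "cball (cmap ?c x) r \<subseteq> cimg ?c"
    using chartD(2)[OF c(1)] open_contains_cball by metis
  obtain k where k: "k > 0" "\<And>y y'. y \<in> cball (cmap ?c x) r \<Longrightarrow> y' \<in> cball (cmap ?c x) r \<Longrightarrow>
     riem_dist A g (cinv ?c y) (cinv ?c y') \<le> ennreal (k * norm (y' - y))"
    using riem_dist_upper[OF c(1) r(2)] by blast
  define s where "s = min r (e / k)"
  have s: "s > 0" "s \<le> r" "s \<le> e / k" using r k e by (auto simp: s_def)
  show thesis
  proof (rule that[of "cinv ?c ` ball (cmap ?c x) s"])
    show "open (cinv ?c ` ball (cmap ?c x) s)" by (rule open_cinv_image[OF c(1)]) (use r s in auto)
    show "x \<in> cinv ?c ` ball (cmap ?c x) s"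
      using chartD(6)[OF c] s by (intro image_eqI[of _ _ "cmap ?c x"]) auto
    fix z assume "z \<in> cinv ?c ` ball (cmap ?c x) s"
    then obtain y where y: "y \<in> ball (cmap ?c x) s" "z = cinv ?c y" by blast
    have "riem_dist A g x z \<le> ennreal (k * norm (y - cmap ?c x))"
      using k(2)[of "cmap ?c x" y] y r s chartD(6)[OF c] by auto
    also have "\<dots> < ennreal e"
    proof (rule ennreal_lessI[OF e])
      have "norm (y - cmap ?c x) < e / k" using y s by (auto simp: dist_norm norm_minus_commute)
      then show "k * norm (y - cmap ?c x) < e" using k(1) by (simp add: field_simps)
    qed
    finally show "riem_dist A g x z < ennreal e" .
  qed
qed

lemma riem_dist_eq_0D:
  assumes "riem_dist A g x z = 0" shows "z = x"
proof -
  note c = chart_at[of x]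
  obtain r k where rk: "r > 0" "k > 0"
    "riem_dist A g x z < ennreal (k * r) \<Longrightarrow>
        z \<in> cdom (chart_at A x) \<and> cmap (chart_at A x) z \<in> ball (cmap (chart_at A x) x) r
        \<and> ennreal (k * norm (cmap (chart_at A x) z - cmap (chart_at A x) x)) \<le> riem_dist A g x z"
    using riem_dist_lower[OF c] by metis
  then have "z \<in> cdom (chart_at A x)" "k * norm (cmap (chart_at A x) z - cmap (chart_at A x) x) \<le> 0"
    using assms by (auto simp: ennreal_eq_0_iff)
  then have "cmap (chart_at A x) z = cmap (chart_at A x) x" using rk(2) by (simp add: mult_le_0_iff)
  then show ?thesis using chartD(5)[OF c(1)] c(2) \<open>z \<in> cdom (chart_at A x)\<close> by (auto dest: inj_onD)
qed

end

subsection \<open>The Hopf--Rinow theorem\<close>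

context Metric_space
begin

lemma compactin_mcball_mono:
  assumes "compactin mtopology (mcball x R)" "R' \<le> R"
  shows "compactin mtopology (mcball x R')"
  by (rule closed_compactin[OF assms(1) mcball_subset_concentric[OF assms(2)] closedin_mcball])

text \<open>This is the Cohn-Vossen form of the theorem, for complete locally compact spaces with
  almost intermediate points. If some closed ball fails to be compact, the radii of compact balls
  about \<open>x\<close> have a finite supremum \<open>r\<close>. Total boundedness shows that
  \<open>r\<close> itself is such a radius, and a finite cover by small compact balls then pushes
  past it.\<close>

lemma compact_mcball_of_length_space:
  assumes complete: mcomplete
    and loc: "\<And>x. x \<in> M \<Longrightarrow> \<exists>r>0. compactin mtopology (mcball x r)"
    and len: "\<And>x y s e. \<lbrakk>x \<in> M; y \<in> M; 0 \<le> s; s \<le> d x y; 0 < e\<rbrakk> \<Longrightarrow> \<exists>z\<in>M. d x z \<le> s \<and> d z y \<le> d x y - s + e"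
    and x: "x \<in> M"
  shows "compactin mtopology (mcball x R0)"
proof (rule ccontr)
  assume n: "\<not> compactin mtopology (mcball x R0)"
  define S where "S = {R. compactin mtopology (mcball x R)}"
  obtain r1 where r1: "r1 > 0" "r1 \<in> S" using loc[OF x] by (auto simp: S_def)
  have down: "R' \<in> S" if "R \<in> S" "R' \<le> R" for R R'
    using that compactin_mcball_mono unfolding S_def by blast
  have bdd: "bdd_above S"
    using down[of _ R0] n by (intro bdd_aboveI[of _ R0]) (metis linear mem_Collect_eq S_def)
  define r where "r = Sup S"
  have r_pos: "r > 0" using cSup_upper[OF r1(2) bdd] r1 by (simp add: r_def)
  have below: "R \<in> S" if R: "R < r" for R
  proof -
    obtain R' where "R' \<in> S" "R < R'"
      using less_cSup_iff[of S R] bdd r1(2) R unfolding r_def by blast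
    then show ?thesis using down by simp
  qed
  have near: "\<exists>z\<in>mcball x s. d z y \<le> max 0 (d x y - s) + e" if y: "y \<in> M" and s: "0 \<le> s" and e: "0 < e" for y s e
  proof (cases "d x y \<le> s")
    case True
    then show ?thesis using y e x by (intro bexI[of _ y]) auto
  next
    case False
    then obtain z where "z \<in> M" "d x z \<le> s" "d z y \<le> d x y - s + e"
      using len[OF x y s _ e] by auto
    then show ?thesis using x by (intro bexI[of _ z]) auto
  qed
  have rS: "r \<in> S"
  proof -
    have "mtotally_bounded (mcball x r)"
      unfolding mtotally_bounded_def
    proof (intro allI impI)
      fix e :: real assume e: "0 < e"
      show "\<exists>K. finite K \<and> K \<subseteq> mcball x r \<and> mcball x r \<subseteq> (\<Union>x\<in>K. mball x e)"
      proof (cases "r < e")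
        case True
        then show ?thesis using x r_pos by (intro exI[of _ "{x}"]) auto
      next
        case False
        \<comment> \<open>A point of the ball of radius \<open>r\<close> is within
          \<open>e/3 + e/6\<close> of a point of the compact ball of radius \<open>s\<close>, and
          that point is within \<open>e/3\<close> of the net, which adds up to less than
          \<open>e\<close>.\<close>
        define s where "s = r - e / 3"
        have s: "0 \<le> s" "s < r" using e False by (auto simp: s_def)
        have "mtotally_bounded (mcball x s)"
          using below[OF s(2)] compactin_imp_mtotally_bounded by (auto simp: S_def)
        then obtain K where K: "finite K" "K \<subseteq> mcball x s" "mcball x s \<subseteq> (\<Union>k\<in>K. mball k (e/3))"
          unfolding mtotally_bounded_def using e by (metis divide_pos_pos zero_less_numeral)
        have "mcball x r \<subseteq> (\<Union>k\<in>K. mball k e)"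
        proof
          fix y assume y: "y \<in> mcball x r"
          obtain z where z: "z \<in> mcball x s" "d z y \<le> max 0 (d x y - s) + e / 6"
            using near[of y s "e/6"] y s e by auto
          obtain k where k: "k \<in> K" "z \<in> mball k (e/3)" using K(3) z(1) by auto
          have "d k y \<le> d k z + d z y" using k z y by (intro triangle) auto
          moreover have "d z y \<le> e / 3 + e / 6" using z(2) y e by (auto simp: s_def max_def split: if_splits)
          ultimately have "d k y < e" using k e by auto
          then show "y \<in> (\<Union>k\<in>K. mball k e)" using k y by (intro UN_I[of k]) auto
        qed
        then show ?thesis
          using K mcball_subset_concentric[of s r x] s by (intro exI[of _ K]) auto
      qed
    qed
    then have "compactin mtopology (mtopology closure_of (mcball x r))"
      using mtotally_bounded_eq_compact_closure_of[OF complete] by blast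
    then show ?thesis by (simp add: S_def closure_of_closedin closedin_mcball)
  qed
  obtain \<rho> where \<rho>: "\<And>y. y \<in> M \<Longrightarrow> \<rho> y > 0 \<and> compactin mtopology (mcball y (\<rho> y))" using loc by metis
  have "\<exists>F. finite F \<and> F \<subseteq> (\<lambda>y. mball y (\<rho> y / 2)) ` mcball x r \<and> mcball x r \<subseteq> \<Union>F"
  proof (rule compactinD)
    show "compactin mtopology (mcball x r)" using rS by (simp add: S_def)
    show "mcball x r \<subseteq> \<Union> ((\<lambda>y. mball y (\<rho> y / 2)) ` mcball x r)"
    proof
      fix y assume y: "y \<in> mcball x r"
      then have "y \<in> mball y (\<rho> y / 2)" using \<rho>[of y] by simp
      then show "y \<in> \<Union> ((\<lambda>y. mball y (\<rho> y / 2)) ` mcball x r)" using y by blast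
    qed
  qed auto
  then obtain F where F: "finite F" "F \<subseteq> (\<lambda>y. mball y (\<rho> y / 2)) ` mcball x r" "mcball x r \<subseteq> \<Union>F"
    by blast
  obtain Y where Y: "Y \<subseteq> mcball x r" "finite Y" "F = (\<lambda>y. mball y (\<rho> y / 2)) ` Y"
    using finite_subset_image[OF F(1,2)] by blast
  then have Y: "finite Y" "Y \<subseteq> mcball x r" "mcball x r \<subseteq> (\<Union>y\<in>Y. mball y (\<rho> y / 2))"
    using F(3) by blast+
  \<comment> \<open>Finiteness of the cover makes \<open>\<delta>\<close> positive. Since the cover
    uses half radii, any point within \<open>\<delta>\<close> of the ball of radius \<open>r\<close>
    lies in one of the full, compact closed balls.\<close>
  define \<delta> where "\<delta> = Min ((\<lambda>y. \<rho> y / 2) ` Y)"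
  have "x \<in> mcball x r" using x r_pos by simp
  then have "Y \<noteq> {}" using Y(3) by blast
  have Y_M: "y \<in> M" if "y \<in> Y" for y using Y(2) that by auto
  have \<delta>: "\<delta> > 0" "\<And>y. y \<in> Y \<Longrightarrow> \<delta> \<le> \<rho> y / 2"
  proof -
    show "\<delta> > 0" using Y(1) \<open>Y \<noteq> {}\<close> \<rho> Y_M by (simp add: \<delta>_def)
    show "\<delta> \<le> \<rho> y / 2" if "y \<in> Y" for y
      unfolding \<delta>_def using Y(1) that by (intro Min_le) auto
  qed
  have "mcball x (r + \<delta> / 2) \<subseteq> (\<Union>y\<in>Y. mcball y (\<rho> y))"
  proof
    fix z assume z: "z \<in> mcball x (r + \<delta> / 2)"
    obtain w where w: "w \<in> mcball x r" "d w z \<le> max 0 (d x z - r) + \<delta> / 4"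
      using near[of z r "\<delta>/4"] z r_pos \<delta> by auto
    have wz: "d w z \<le> \<delta>" using w(2) z \<delta>(1) by (auto simp: max_def split: if_splits)
    obtain y where y: "y \<in> Y" "w \<in> mball y (\<rho> y / 2)" using Y(3) w(1) by auto
    have "d y z \<le> d y w + d w z" using y w z by (intro triangle) auto
    also have "\<dots> \<le> \<rho> y" using wz y \<delta>(2)[OF y(1)] by auto
    finally show "z \<in> (\<Union>y\<in>Y. mcball y (\<rho> y))" using y z by (intro UN_I[of y]) auto
  qed
  moreover have "compactin mtopology (\<Union>y\<in>Y. mcball y (\<rho> y))"
    using Y(1) \<rho> Y_M by (intro compactin_Union) auto
  ultimately have "compactin mtopology (mcball x (r + \<delta> / 2))"
    using closed_compactin closedin_mcball by blast
  then have "r + \<delta> / 2 \<le> r" by (intro cSup_upper[OF _ bdd, folded r_def]) (simp add: S_def)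
  then show False using \<delta> by simp
qed

end

context riemannian_manifold
begin

text \<open>Without connectedness the distance may be infinite. A real-valued metric exists only on
  the points at finite distance from \<open>x0\<close>, and that is where the abstract theorem is
  applied.\<close>

definition dist_component :: "'a \<Rightarrow> 'a set"
  where "dist_component x0 = {x. riem_dist A g x0 x < top}"

definition real_dist :: "'a \<Rightarrow> 'a \<Rightarrow> real"
  where "real_dist p q = enn2real (riem_dist A g p q)"

lemma dist_component_finite:
  assumes "p \<in> dist_component x0" "q \<in> dist_component x0" shows "riem_dist A g p q < top"
proof -
  have "riem_dist A g p q \<le> riem_dist A g p x0 + riem_dist A g x0 q" by (rule riem_dist_triangle)
  also have "\<dots> < top" using assms riem_dist_commute[of p x0] by (simp add: dist_component_def)
  finally show ?thesis .
qed

lemma ennreal_real_dist: "p \<in> dist_component x0 \<Longrightarrow> q \<in> dist_component x0 \<Longrightarrow> ennreal (real_dist p q) = riem_dist A g p q"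
  using dist_component_finite[of p x0 q] by (simp add: real_dist_def)

lemma center_in_dist_component: "x0 \<in> dist_component x0"
  by (simp add: dist_component_def riem_dist_self)

lemma Metric_space_dist_component: "Metric_space (dist_component x0) real_dist"
proof
  show "0 \<le> real_dist x y" for x y by (simp add: real_dist_def)
  show "real_dist x y = real_dist y x" for x y by (simp add: real_dist_def riem_dist_commute)
  show "real_dist x y = 0 \<longleftrightarrow> x = y" if xy: "x \<in> dist_component x0" "y \<in> dist_component x0" for x y
  proof
    assume "real_dist x y = 0"
    then have "riem_dist A g x y = 0" using ennreal_real_dist[OF xy] by simp
    then show "x = y" using riem_dist_eq_0D by blast
  qed (simp add: real_dist_def riem_dist_self)
  show "real_dist x z \<le> real_dist x y + real_dist y z" if "x \<in> dist_component x0" "y \<in> dist_component x0" "z \<in> dist_component x0" for x y z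
  proof -
    have "ennreal (real_dist x z) \<le> ennreal (real_dist x y) + ennreal (real_dist y z)"
      using that riem_dist_triangle[of x z y] by (simp add: ennreal_real_dist)
    then show ?thesis by (simp add: real_dist_def flip: ennreal_plus)
  qed
qed

lemma open_dist_component: "open (dist_component x0)"
proof (subst open_subopen, rule ballI)
  fix x assume x: "x \<in> dist_component x0"
  obtain U where U: "open U" "x \<in> U" "\<And>z. z \<in> U \<Longrightarrow> riem_dist A g x z < ennreal 1"
    using riem_dist_nhd[OF zero_less_one, of x] by blast
  have "U \<subseteq> dist_component x0"
  proof
    fix z assume "z \<in> U"
    then have "riem_dist A g x z < top" using U(3)[of z] less_trans by fastforce
    then have "riem_dist A g x0 x + riem_dist A g x z < top" using x by (simp add: dist_component_def)
    then show "z \<in> dist_component x0" using riem_dist_triangle[of x0 z x] by (auto simp: dist_component_def intro: le_less_trans)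
  qed
  then show "\<exists>T. open T \<and> x \<in> T \<and> T \<subseteq> dist_component x0" using U by blast
qed

lemma closed_riem_cball: "closed {x. riem_dist A g x0 x \<le> ennreal R}"
proof -
  have "open {x. ennreal R < riem_dist A g x0 x}"
  proof (subst open_subopen, rule ballI)
    fix x assume "x \<in> {x. ennreal R < riem_dist A g x0 x}"
    then have x: "ennreal R < riem_dist A g x0 x" by simp
    obtain e where e: "e > 0" "ennreal R + ennreal e \<le> riem_dist A g x0 x"
    proof (cases "riem_dist A g x0 x")
      case (real r)
      define R' where "R' = max 0 R"
      have R': "ennreal R' = ennreal R" "0 \<le> R'" by (auto simp: R'_def max_def ennreal_neg)
      then have "R' < r" using x unfolding real(2) R'(1)[symmetric] by (simp add: ennreal_less_iff)
      moreover have "ennreal R' + ennreal (r - R') = ennreal (R' + (r - R'))"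
        using R'(2) \<open>R' < r\<close> by (intro ennreal_plus[symmetric]) auto
      ultimately show thesis using real(2) R'(1) by (intro that[of "r - R'"]) auto
    next
      case top
      then show thesis by (intro that[of 1]) auto
    qed
    obtain U where U: "open U" "x \<in> U" "\<And>z. z \<in> U \<Longrightarrow> riem_dist A g x z < ennreal e"
      using riem_dist_nhd[OF e(1)] by auto
    have "ennreal R < riem_dist A g x0 z" if z: "z \<in> U" for z
    proof (rule ccontr)
      assume "\<not> ennreal R < riem_dist A g x0 z"
      then have "riem_dist A g x0 z + riem_dist A g z x \<le> ennreal R + riem_dist A g z x"
        by (intro add_right_mono) simp
      also have "\<dots> < ennreal R + ennreal e"
        using U(3)[OF z] riem_dist_commute[of z x] by (simp add: ennreal_add_left_cancel_less)
      finally show False using riem_dist_triangle[of x0 x z] e(2) by simp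
    qed
    then show "\<exists>T. open T \<and> x \<in> T \<and> T \<subseteq> {x. ennreal R < riem_dist A g x0 x}" using U by blast
  qed
  moreover have "{x. riem_dist A g x0 x \<le> ennreal R} = - {x. ennreal R < riem_dist A g x0 x}" by auto
  ultimately show ?thesis by (simp add: closed_def)
qed

lemma open_riem_ball: "open (geodesic_ball A g x0 R)"
proof (subst open_subopen, rule ballI)
  fix x assume "x \<in> geodesic_ball A g x0 R"
  then have x: "riem_dist A g x0 x < ennreal R" by (simp add: geodesic_ball_def)
  then obtain r where r: "riem_dist A g x0 x = ennreal r" "0 \<le> r" by (cases "riem_dist A g x0 x") auto
  have rR: "r < R" using x r by (simp add: ennreal_less_iff)
  obtain U where U: "open U" "x \<in> U" "\<And>z. z \<in> U \<Longrightarrow> riem_dist A g x z < ennreal (R - r)"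
    using riem_dist_nhd[OF iffD2[OF diff_gt_0_iff_gt rR], of x] by blast
  have "U \<subseteq> geodesic_ball A g x0 R"
  proof
    fix z assume z: "z \<in> U"
    have "riem_dist A g x0 z \<le> ennreal r + riem_dist A g x z" using riem_dist_triangle[of x0 z x] r by simp
    also have "\<dots> < ennreal r + ennreal (R - r)" using U(3)[OF z] by (simp add: ennreal_add_left_cancel_less)
    also have "\<dots> = ennreal R" using r(2) rR by (simp flip: ennreal_plus)
    finally show "z \<in> geodesic_ball A g x0 R" by (simp add: geodesic_ball_def)
  qed
  then show "\<exists>T. open T \<and> x \<in> T \<and> T \<subseteq> geodesic_ball A g x0 R" using U by blast
qed

text \<open>Compactness is proved in the metric topology of the component and transported to the
  manifold topology by continuity of the identity. The opposite continuity is needed as well, since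
  local compactness comes from coordinate balls.\<close>

theorem hopf_rinow:
  assumes complete: "riem_complete A g"
  shows "compact {x. riem_dist A g x0 x \<le> ennreal R}"
proof (cases "R < 0")
  case True
  \<comment> \<open>Negative radii become 0 under \<open>ennreal\<close>, so only the centre is
    left.\<close>
  then have "{x. riem_dist A g x0 x \<le> ennreal R} \<subseteq> {x0}" using riem_dist_eq_0D[of x0] by (auto simp: ennreal_neg)
  then show ?thesis by (meson finite.emptyI finite_imp_compact finite_insert finite_subset)
next
  case False
  interpret M: Metric_space "dist_component x0" real_dist by (rule Metric_space_dist_component)
  have ball: "x \<in> dist_component x0 \<Longrightarrow> M.mball x r = {z \<in> dist_component x0. riem_dist A g x z < ennreal r}" if "r > 0" for x r
  proof -
    have "real_dist x z < r \<longleftrightarrow> riem_dist A g x z < ennreal r" if "x \<in> dist_component x0" "z \<in> dist_component x0" for z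
      unfolding ennreal_real_dist[OF that, symmetric] by (rule ennreal_less_iff[symmetric]) (simp add: real_dist_def)
    then show "x \<in> dist_component x0 \<Longrightarrow> M.mball x r = {z \<in> dist_component x0. riem_dist A g x z < ennreal r}"
      by (auto simp: M.mball_def)
  qed
  have down: "z \<in> dist_component x0" if "x \<in> dist_component x0" "riem_dist A g x z < top" for x z
    using that riem_dist_triangle[of x0 z x] by (auto simp: dist_component_def intro: le_less_trans)
  \<comment> \<open>By \<open>riem_dist_lower\<close> a small distance forces nearby coordinates, so
    every manifold neighbourhood of a point contains a metric ball about it.\<close>
  have fine: "continuous_map M.mtopology euclidean (\<lambda>x. x)"
    unfolding continuous_map_def
  proof (intro conjI allI impI)
    fix U :: "'a set" assume "openin euclidean U"
    then have U: "open U" by simp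
    have "\<exists>r>0. M.mball x r \<subseteq> {x \<in> dist_component x0. x \<in> U}" if x: "x \<in> dist_component x0" "x \<in> U" for x
    proof -
      let ?c = "chart_at A x"
      note c = chart_at[of x]
      obtain r k where rk: "r > 0" "k > 0" "cball (cmap ?c x) r \<subseteq> cimg ?c"
        "\<And>z. riem_dist A g x z < ennreal (k * r) \<Longrightarrow>
        z \<in> cdom ?c \<and> cmap ?c z \<in> ball (cmap ?c x) r \<and> ennreal (k * norm (cmap ?c z - cmap ?c x)) \<le> riem_dist A g x z"
        using riem_dist_lower[OF c] by blast
      have "open (cmap ?c ` (U \<inter> cdom ?c))" by (rule open_cmap_image[OF c(1) U])
      then obtain s where s: "s > 0" "ball (cmap ?c x) s \<subseteq> cmap ?c ` (U \<inter> cdom ?c)"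
        using x(2) c(2) open_contains_ball by (metis IntI imageI)
      define t where "t = min (k * r) (k * s)"
      have t: "t > 0" using rk s by (simp add: t_def)
      have "z \<in> U" if "riem_dist A g x z < ennreal t" for z
      proof -
        have z: "riem_dist A g x z < ennreal (k * r)" "riem_dist A g x z < ennreal (k * s)"
          by (rule less_le_trans[OF that ennreal_leI], simp add: t_def)+
        note z1 = rk(4)[OF z(1)]
        then have "ennreal (k * norm (cmap ?c z - cmap ?c x)) < ennreal (k * s)" using z(2) by auto
        then have "norm (cmap ?c z - cmap ?c x) < s" using rk(2) by (simp add: ennreal_less_iff)
        then have "cmap ?c z \<in> cmap ?c ` (U \<inter> cdom ?c)" using s(2) by (auto simp: dist_norm norm_minus_commute subset_iff)
        then show "z \<in> U" using z1 chartD(5)[OF c(1)] by (auto dest: inj_onD)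
      qed
      then show ?thesis using ball[OF t x(1)] t by (intro exI[of _ t]) auto
    qed
    then show "openin M.mtopology {x \<in> topspace M.mtopology. x \<in> U}"
      unfolding M.openin_mtopology by auto
  qed simp
  \<comment> \<open>Here \<open>riem_dist_nhd\<close> is used: metric balls contain manifold
    neighbourhoods.\<close>
  have coarse: "continuous_map (top_of_set (dist_component x0)) M.mtopology (\<lambda>x. x)"
    unfolding continuous_map_def
  proof (intro conjI allI impI)
    fix U assume U: "openin M.mtopology U"
    have sub: "U \<subseteq> dist_component x0" using U openin_subset by fastforce
    have "open U"
    proof (subst open_subopen, rule ballI)
      fix x assume x: "x \<in> U"
      obtain r where r: "r > 0" "M.mball x r \<subseteq> U" using U x unfolding M.openin_mtopology by blast
      obtain V where V: "open V" "x \<in> V" "\<And>z. z \<in> V \<Longrightarrow> riem_dist A g x z < ennreal r"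
        using riem_dist_nhd[OF r(1)] by blast
      have "V \<subseteq> M.mball x r"
        using ball[OF r(1)] x sub V(3) down less_trans[OF _ ennreal_less_top] by blast
      then show "\<exists>T. open T \<and> x \<in> T \<and> T \<subseteq> U" using V r(2) by blast
    qed
    moreover have "{x \<in> topspace (top_of_set (dist_component x0)). x \<in> U} = U" using sub by auto
    ultimately show "openin (top_of_set (dist_component x0)) {x \<in> topspace (top_of_set (dist_component x0)). x \<in> U}"
      using sub openin_open_eq[OF open_dist_component] by simp
  qed simp
  have "compactin M.mtopology (M.mcball x0 R)"
  proof (rule M.compact_mcball_of_length_space)
    show "M.mcomplete"
      unfolding M.mcomplete_def
    proof (intro allI impI)
      fix s assume s: "M.MCauchy s"
      have s_in: "s i \<in> dist_component x0" for i using s by (auto simp: M.MCauchy_def)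
      have "\<exists>N. \<forall>i\<ge>N. \<forall>j\<ge>N. riem_dist A g (s i) (s j) < ennreal e" if "e > 0" for e
      proof -
        obtain N where "\<And>i j. N \<le> i \<Longrightarrow> N \<le> j \<Longrightarrow> real_dist (s i) (s j) < e"
          using s \<open>e > 0\<close> unfolding M.MCauchy_def by meson
        then show ?thesis using ennreal_real_dist[OF s_in s_in, symmetric] \<open>e > 0\<close> by (intro exI[of _ N]) (auto intro: ennreal_lessI)
      qed
      then obtain q where q: "(\<lambda>i. riem_dist A g (s i) q) \<longlonglongrightarrow> 0"
        using complete unfolding riem_complete_def by meson
      have ev: "\<forall>\<^sub>F i in sequentially. riem_dist A g (s i) q < ennreal e" if "e > 0" for e
        using order_tendstoD(2)[OF q] that by simp
      obtain i where "riem_dist A g (s i) q < ennreal 1" using ev[of 1] eventually_sequentially by auto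
      then have q_in: "q \<in> dist_component x0" using down[OF s_in] less_trans[OF _ ennreal_less_top] by blast
      have "limitin M.mtopology s q sequentially"
        unfolding M.limitin_metric
      proof (intro conjI allI impI q_in)
        fix e :: real assume e: "0 < e"
        from ev[OF this] show "\<forall>\<^sub>F x in sequentially. s x \<in> dist_component x0 \<and> real_dist (s x) q < e"
        proof (rule eventually_mono)
          fix i assume "riem_dist A g (s i) q < ennreal e"
          then have "ennreal (real_dist (s i) q) < ennreal e" unfolding ennreal_real_dist[OF s_in q_in] .
          moreover have "0 \<le> real_dist (s i) q" by (simp add: real_dist_def)
          ultimately show "s i \<in> dist_component x0 \<and> real_dist (s i) q < e" using s_in by (simp add: ennreal_less_iff)
        qed
      qed
      then show "\<exists>x. limitin M.mtopology s x sequentially" by blast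
    qed
  next
    fix x assume x: "x \<in> dist_component x0"
    let ?c = "chart_at A x"
    note c = chart_at[of x]
    obtain r k where rk: "r > 0" "k > 0" "cball (cmap ?c x) r \<subseteq> cimg ?c"
        "\<And>z. riem_dist A g x z < ennreal (k * r) \<Longrightarrow>
        z \<in> cdom ?c \<and> cmap ?c z \<in> ball (cmap ?c x) r \<and> ennreal (k * norm (cmap ?c z - cmap ?c x)) \<le> riem_dist A g x z"
      using riem_dist_lower[OF c] by blast
    define C where "C = cinv ?c ` cball (cmap ?c x) r"
    have C: "compact C" unfolding C_def
      by (intro compact_continuous_image continuous_on_subset[OF chartD(4)[OF c(1)]] rk compact_cball)
    obtain k' where k': "k' > 0" "\<And>y y'. y \<in> cball (cmap ?c x) r \<Longrightarrow> y' \<in> cball (cmap ?c x) r \<Longrightarrow>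
       riem_dist A g (cinv ?c y) (cinv ?c y') \<le> ennreal (k' * norm (y' - y))"
      using riem_dist_upper[OF c(1) rk(3)] by blast
    have "C \<subseteq> dist_component x0"
    proof
      fix z assume "z \<in> C"
      then obtain y where y: "y \<in> cball (cmap ?c x) r" "z = cinv ?c y" by (auto simp: C_def)
      then have "riem_dist A g x z \<le> ennreal (k' * norm (y - cmap ?c x))"
        using k'(2)[of "cmap ?c x" y] rk(1) chartD(6)[OF c] by simp
      then show "z \<in> dist_component x0" using down[OF x] le_less_trans[OF _ ennreal_less_top] by blast
    qed
    then have "compactin (top_of_set (dist_component x0)) C" using C by (simp add: compactin_subtopology)
    from image_compactin[OF this coarse] have "compactin M.mtopology C" by simp
    \<comment> \<open>Half of the radius turns the non-strict inequality of the closed ball into the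
      strict one required by \<open>riem_dist_lower\<close>.\<close>
    moreover have "M.mcball x (k * r / 2) \<subseteq> C"
    proof
      fix z assume z: "z \<in> M.mcball x (k * r / 2)"
      then have "z \<in> dist_component x0" "real_dist x z \<le> k * r / 2" by auto
      moreover have "k * r / 2 < k * r" "0 < k * r" using rk(1,2) by auto
      ultimately have "riem_dist A g x z < ennreal (k * r)"
        using ennreal_real_dist[OF x \<open>z \<in> dist_component x0\<close>, symmetric] by (simp only:) (rule ennreal_lessI, auto)
      from rk(4)[OF this] show "z \<in> C"
        unfolding C_def using chartD(6)[OF c(1), of z] by (intro image_eqI[of _ _ "cmap ?c z"]) auto
    qed
    ultimately show "\<exists>r>0. compactin M.mtopology (M.mcball x r)"
      using rk closed_compactin[OF _ _ M.closedin_mcball] by (intro exI[of _ "k * r / 2"]) auto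
  next
    fix x y s e assume x: "x \<in> dist_component x0" and y: "y \<in> dist_component x0" and s: "0 \<le> s" "s \<le> real_dist x y" and e: "(0::real) < e"
    \<comment> \<open>An almost shortest curve provides the intermediate point: the distance from
      \<open>x\<close> varies continuously along it and so takes the value \<open>s\<close>, and
      \<open>riem_dist_split\<close> bounds what remains up to \<open>e\<close>.\<close>
    have "riem_dist A g x y < riem_dist A g x y + ennreal e"
      using dist_component_finite[OF x y] e by (rule ennreal_less_add)
    then obtain \<gamma> where \<gamma>: "pw_C1_curve A \<gamma>" "\<gamma> 0 = x" "\<gamma> 1 = y" "arc {0..1} \<gamma> < riem_dist A g x y + ennreal e"
      using riem_dist_lessE by blast
    have fin: "arc {0..1} \<gamma> < top" using \<gamma>(4) less_le_trans top_greatest by blast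
    have split: "riem_dist A g x (\<gamma> t) + riem_dist A g (\<gamma> t) y \<le> arc {0..1} \<gamma>" if t: "t \<in> {0..1}" for t
    proof -
      consider "t = 0" | "t = 1" | "0 < t" "t < 1" using t by fastforce
      then show ?thesis
        by cases (use riem_dist_split[OF \<gamma>(1)] riem_dist_le[OF \<gamma>(1)] \<gamma>(2,3) riem_dist_self in auto)
    qed
    have in_comp: "\<gamma> t \<in> dist_component x0" if t: "t \<in> {0..1}" for t
    proof (rule down[OF x])
      have "riem_dist A g x (\<gamma> t) \<le> riem_dist A g x (\<gamma> t) + riem_dist A g (\<gamma> t) y" by (rule le_iff_add[THEN iffD2]) blast
      then show "riem_dist A g x (\<gamma> t) < top" using split[OF t] fin by (meson le_less_trans)
    qed
    have "continuous_on {0..1} (\<lambda>t. real_dist x (\<gamma> t))"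
      unfolding continuous_on_iff
    proof (intro ballI allI impI)
      fix t \<epsilon> assume t: "t \<in> {0..1::real}" and \<epsilon>: "0 < (\<epsilon>::real)"
      obtain U where U: "open U" "\<gamma> t \<in> U" "\<And>z. z \<in> U \<Longrightarrow> riem_dist A g (\<gamma> t) z < ennreal \<epsilon>"
        using riem_dist_nhd[OF \<epsilon>] by blast
      have "continuous_on {0..1} \<gamma>" using \<gamma>(1) by (simp add: pw_C1_curve_iff)
      then obtain V where V: "open V" "t \<in> V" "\<And>s. s \<in> {0..1} \<Longrightarrow> s \<in> V \<Longrightarrow> \<gamma> s \<in> U"
        using U t unfolding continuous_on_topological by metis
      obtain d where d: "d > 0" "ball t d \<subseteq> V" using V open_contains_ball by metis
      have "dist (real_dist x (\<gamma> s)) (real_dist x (\<gamma> t)) < \<epsilon>" if s: "s \<in> {0..1}" "dist s t < d" for s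
      proof -
        have "s \<in> ball t d" using s(2) by (simp add: dist_commute)
        then have "\<gamma> s \<in> U" using V(3)[OF s(1)] d(2) by blast
        then have "ennreal (real_dist (\<gamma> t) (\<gamma> s)) < ennreal \<epsilon>" using U(3) ennreal_real_dist[OF in_comp[OF t] in_comp[OF s(1)]] by simp
        then have "real_dist (\<gamma> t) (\<gamma> s) < \<epsilon>" by (simp add: ennreal_less_iff real_dist_def)
        moreover have "real_dist x (\<gamma> s) \<le> real_dist x (\<gamma> t) + real_dist (\<gamma> t) (\<gamma> s)" "real_dist x (\<gamma> t) \<le> real_dist x (\<gamma> s) + real_dist (\<gamma> s) (\<gamma> t)"
          using x in_comp[OF t] in_comp[OF s(1)] by (auto intro: M.triangle)
        ultimately show ?thesis using M.commute[of "\<gamma> t" "\<gamma> s"] by (simp add: dist_real_def)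
      qed
      then show "\<exists>d>0. \<forall>x'\<in>{0..1}. dist x' t < d \<longrightarrow> dist (real_dist x (\<gamma> x')) (real_dist x (\<gamma> t)) < \<epsilon>" using d(1) by blast
    qed
    moreover have "real_dist x (\<gamma> 0) \<le> s" "s \<le> real_dist x (\<gamma> 1)" using \<gamma>(2,3) s by (auto simp: real_dist_def riem_dist_self)
    ultimately obtain t where t: "0 \<le> t" "t \<le> 1" "real_dist x (\<gamma> t) = s"
      using IVT'[of "\<lambda>t. real_dist x (\<gamma> t)" 0 s 1] by auto
    then have t01: "t \<in> {0..1}" by simp
    have "ennreal (s + real_dist (\<gamma> t) y) = riem_dist A g x (\<gamma> t) + riem_dist A g (\<gamma> t) y"
      using t(3) s(1) ennreal_real_dist[OF x in_comp[OF t01]] ennreal_real_dist[OF in_comp[OF t01] y] by (simp add: ennreal_plus real_dist_def)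
    also have "\<dots> \<le> riem_dist A g x y + ennreal e" using split[OF t01] \<gamma>(4) by simp
    also have "\<dots> = ennreal (real_dist x y + e)" using ennreal_real_dist[OF x y] e by (simp add: ennreal_plus real_dist_def)
    finally have "ennreal (s + real_dist (\<gamma> t) y) \<le> ennreal (real_dist x y + e)" .
    moreover have "0 \<le> real_dist x y + e" using M.nonneg[of x y] e by linarith
    ultimately have "s + real_dist (\<gamma> t) y \<le> real_dist x y + e" using ennreal_le_iff by blast
    then have "real_dist (\<gamma> t) y \<le> real_dist x y - s + e" by linarith
    then show "\<exists>z\<in>dist_component x0. real_dist x z \<le> s \<and> real_dist z y \<le> real_dist x y - s + e"
      using in_comp[OF t01] t(3) by (intro bexI[of _ "\<gamma> t"]) auto
  qed (rule center_in_dist_component)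
  from image_compactin[OF this fine] have "compact (M.mcball x0 R)" by simp
  moreover have "M.mcball x0 R = {x. riem_dist A g x0 x \<le> ennreal R}"
  proof -
    have "real_dist x0 x \<le> R \<longleftrightarrow> riem_dist A g x0 x \<le> ennreal R" if "x \<in> dist_component x0" for x
      unfolding ennreal_real_dist[OF center_in_dist_component that, symmetric] using False by simp
    moreover have "x \<in> dist_component x0" if "riem_dist A g x0 x \<le> ennreal R" for x
      using that le_less_trans[OF _ ennreal_less_top] by (auto simp: dist_component_def)
    ultimately show ?thesis using center_in_dist_component by (auto simp: M.mcball_def)
  qed
  ultimately show ?thesis by simp
qed

end

subsection \<open>Linear algebra of positive definite matrices\<close>

text \<open>Gram-Schmidt for the inner product \<open>b\<close>: while fewer than
  \<open>CARD('m)\<close> orthonormal vectors are present their span is proper, and a vector outside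
  it can be projected and normalised.\<close>

lemma orthonormal_frame_exists:
  fixes b :: "real^'m \<Rightarrow> real^'m \<Rightarrow> real"
  assumes b: "bilinear b" and sym: "\<And>u v. b u v = b v u" and pos: "\<And>u. u \<noteq> 0 \<Longrightarrow> b u u > 0"
  obtains e :: "'m \<Rightarrow> real^'m" where "\<And>i j. b (e i) (e j) = (if i = j then 1 else 0)"
proof -
  have "k \<le> CARD('m) \<Longrightarrow> \<exists>S. finite S \<and> card S = k \<and> (\<forall>u\<in>S. \<forall>v\<in>S. b u v = (if u = v then 1 else 0))" for k
  proof (induction k)
    case 0
    show ?case by (rule exI[of _ "{}"]) simp
  next
    case (Suc k)
    then obtain S where S: "finite S" "card S = k" "\<And>u v. u \<in> S \<Longrightarrow> v \<in> S \<Longrightarrow> b u v = (if u = v then 1 else 0)"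
      by auto
    have "dim (span S) \<le> k" using dim_le_card[OF span_superset S(1)] S(2) by (simp add: dim_span)
    have "span S \<noteq> UNIV"
    proof
      assume e: "span S = UNIV"
      have "dim (span S) = DIM(real^'m)" unfolding e by (rule dim_UNIV)
      then show False using \<open>dim (span S) \<le> k\<close> Suc.prems by simp
    qed
    then obtain v where v: "v \<notin> span S" by auto
    define w where "w = v - (\<Sum>s\<in>S. b v s *\<^sub>R s)"
    have "w \<noteq> 0"
    proof
      assume "w = 0"
      then have "v = (\<Sum>s\<in>S. b v s *\<^sub>R s)" by (simp add: w_def)
      moreover have "(\<Sum>s\<in>S. b v s *\<^sub>R s) \<in> span S" by (intro span_sum span_scale span_base)
      ultimately show False using v by simp
    qed
    have orth: "b w u = 0" if "u \<in> S" for u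
    proof -
      have "b (\<Sum>s\<in>S. b v s *\<^sub>R s) u = (\<Sum>s\<in>S. b v s * b s u)"
        using linear_sum[of "\<lambda>x. b x u" "\<lambda>s. b v s *\<^sub>R s" S] b by (simp add: bilinear_lmul[OF b] bilinear_def)
      also have "\<dots> = (\<Sum>s\<in>S. if s = u then b v s else 0)" by (intro sum.cong) (auto simp: S(3) that)
      also have "\<dots> = b v u" using S(1) that by simp
      finally show ?thesis by (simp add: w_def bilinear_lsub[OF b])
    qed
    define n where "n = w /\<^sub>R sqrt (b w w)"
    have "b w w > 0" using pos[OF \<open>w \<noteq> 0\<close>] .
    then have n1: "b n n = 1" by (simp add: n_def bilinear_lmul[OF b] bilinear_rmul[OF b] field_simps)
    have n2: "b n u = 0" "b u n = 0" if "u \<in> S" for u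
      using orth[OF that] sym by (simp_all add: n_def bilinear_lmul[OF b] bilinear_rmul[OF b])
    have "n \<notin> S" using n1 n2 by force
    then show ?case
      using S n1 n2 by (intro exI[of _ "insert n S"]) auto
  qed
  from this[OF order_refl] obtain S where S: "finite S" "card S = CARD('m)"
    "\<And>u v. u \<in> S \<Longrightarrow> v \<in> S \<Longrightarrow> b u v = (if u = v then 1 else 0)" by blast
  then obtain e where e: "bij_betw e (UNIV::'m set) S"
    using finite_same_card_bij[of "UNIV::'m set" S] by auto
  show thesis
  proof (rule that[of e])
    fix i j
    have "e i \<in> S" "e j \<in> S" using e by (auto simp: bij_betw_def)
    moreover have "e i = e j \<longleftrightarrow> i = j" using e by (auto simp: bij_betw_def inj_on_def)
    ultimately show "b (e i) (e j) = (if i = j then 1 else 0)" using S(3) by simp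
  qed
qed

lemma bilinear_matrix:
  fixes G :: "real^'m^'m"
  shows "bilinear (\<lambda>u v. u \<bullet> (G *v v))"
  unfolding bilinear_def
  by (auto intro!: linearI simp: inner_add_left inner_add_right matrix_vector_right_distrib
      matrix_vector_mult_scaleR)

text \<open>The columns of \<open>E\<close> are an orthonormal frame for the inner product given by
  \<open>G\<close>.\<close>

lemma orthonormalizing_matrix:
  fixes G :: "real^'m^'m"
  assumes sym: "transpose G = G" and pos: "\<And>u. u \<noteq> 0 \<Longrightarrow> u \<bullet> (G *v u) > 0"
  obtains E :: "real^'m^'m" where "transpose E ** G ** E = mat 1"
proof -
  have s: "u \<bullet> (G *v v) = v \<bullet> (G *v u)" for u v
    by (metis dot_lmul_matrix inner_commute sym transpose_matrix_vector)
  obtain e :: "'m \<Rightarrow> real^'m" where e: "\<And>i j. e i \<bullet> (G *v e j) = (if i = j then 1 else 0)"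
    using orthonormal_frame_exists[OF bilinear_matrix[of G] s pos] by blast
  define E where "E = (\<chi> i j. e j $ i)"
  have "(transpose E ** G ** E) $ i $ j = e i \<bullet> (G *v e j)" for i j
    by (simp add: matrix_matrix_mult_def transpose_def E_def inner_vec_def
        matrix_vector_mult_def sum_distrib_left sum_distrib_right mult.assoc) (rule sum.swap)
  then have "transpose E ** G ** E = mat 1" by (simp add: vec_eq_iff e mat_def)
  then show thesis by (rule that)
qed

text \<open>Determinants in \<open>transpose E ** G ** E = mat 1\<close> give
  \<open>(det E)^2 * det G = 1\<close>.\<close>

lemma det_pos_definite:
  fixes G :: "real^'m^'m"
  assumes sym: "transpose G = G" and pos: "\<And>u. u \<noteq> 0 \<Longrightarrow> u \<bullet> (G *v u) > 0"
  shows "det G > 0"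
proof -
  obtain E :: "real^'m^'m" where "transpose E ** G ** E = mat 1" using orthonormalizing_matrix[OF assms] .
  then have "det (transpose E ** G ** E) = 1" by simp
  then have "(det E)\<^sup>2 * det G = 1" by (simp add: det_mul det_transpose power2_eq_square mult_ac)
  then show ?thesis by (metis zero_less_mult_iff zero_less_one not_less zero_le_power2)
qed

lemma orthonormalizing_inverse:
  fixes G E :: "real^'m^'m"
  assumes E: "transpose E ** G ** E = mat 1" and Gi: "Gi ** G = mat 1"
  shows "Gi = E ** transpose E"
proof -
  have "(transpose E ** G) ** E = mat 1" using E by (simp add: matrix_mul_assoc)
  then have "E ** (transpose E ** G) = mat 1" using matrix_left_right_inverse by blast
  then have "(E ** transpose E) ** G = mat 1" by (simp add: matrix_mul_assoc)
  moreover have "G ** Gi = mat 1" using Gi matrix_left_right_inverse by blast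
  ultimately show ?thesis by (metis matrix_mul_assoc matrix_mul_lid matrix_mul_rid)
qed

text \<open>The norm of the trace-free part of \<open>T\<close> is nonnegative.\<close>

lemma trace_sq_le_normsq:
  fixes G Gi T :: "real^'m^'m"
  assumes sym: "transpose G = G" and pos: "\<And>u. u \<noteq> 0 \<Longrightarrow> u \<bullet> (G *v u) > 0" and Gi: "Gi ** G = mat 1"
  shows "(trace (Gi ** T))\<^sup>2 \<le> real CARD('m) * trace (Gi ** T ** Gi ** transpose T)"
proof -
  obtain E :: "real^'m^'m" where E: "transpose E ** G ** E = mat 1" using orthonormalizing_matrix[OF sym pos] .
  have Gi_eq: "Gi = E ** transpose E" by (rule orthonormalizing_inverse[OF E Gi])
  \<comment> \<open>In an orthonormal frame the two quantities become the trace and the squared norm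
    of \<open>S\<close>. Cauchy-Schwarz on the diagonal, followed by adding the off-diagonal
    squares, then suffices.\<close>
  define S where "S = transpose E ** T ** E"
  have 1: "trace (Gi ** T) = trace S"
    unfolding Gi_eq S_def by (metis matrix_mul_assoc trace_mul_sym)
  have "trace (Gi ** T ** Gi ** transpose T) = trace (E ** (transpose E ** T ** E ** transpose E ** transpose T))"
    unfolding Gi_eq by (simp add: matrix_mul_assoc)
  also have "\<dots> = trace ((transpose E ** T ** E ** transpose E ** transpose T) ** E)"
    by (rule trace_mul_sym)
  also have "\<dots> = trace (S ** transpose S)"
    by (simp add: S_def matrix_transpose_mul matrix_mul_assoc)
  finally have 2: "trace (Gi ** T ** Gi ** transpose T) = trace (S ** transpose S)" .
  have "(trace S)\<^sup>2 = (\<Sum>i\<in>UNIV. 1 * S $ i $ i)\<^sup>2" by (simp add: trace_def)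
  also have "\<dots> \<le> (\<Sum>i\<in>(UNIV::'m set). 1\<^sup>2) * (\<Sum>i\<in>UNIV. (S $ i $ i)\<^sup>2)" by (rule Cauchy_Schwarz_ineq_sum[of "\<lambda>_. 1" "\<lambda>i. S $ i $ i" UNIV])
  also have "\<dots> \<le> real CARD('m) * (\<Sum>i\<in>UNIV. \<Sum>j\<in>UNIV. (S $ i $ j)\<^sup>2)"
    by (auto intro!: mult_left_mono sum_mono member_le_sum[of _ UNIV "\<lambda>j. (S $ _ $ j)\<^sup>2"])
  also have "(\<Sum>i\<in>UNIV. \<Sum>j\<in>UNIV. (S $ i $ j)\<^sup>2) = trace (S ** transpose S)"
    by (simp add: trace_def matrix_matrix_mult_def transpose_def power2_eq_square)
  finally show ?thesis unfolding 1 2 .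
qed

subsection \<open>The Riemannian volume\<close>

text \<open>The change of variables theorem of the library needs an index type that is well-ordered.
  \<open>'m fin\<close> is a well-ordered copy of an arbitrary finite type.\<close>

typedef (overloaded) 'm fin = "{..<CARD('m::finite)}"
  by (rule exI[of _ 0]) simp

instance fin :: (finite) finite
proof
  show "finite (UNIV :: 'a fin set)"
    using type_definition.univ[OF type_definition_fin[where ?'m = 'a]] by (metis finite_imageI finite_lessThan)
qed

instantiation fin :: (finite) linorder
begin
definition "a < b \<longleftrightarrow> Rep_fin a < Rep_fin b"
definition "a \<le> b \<longleftrightarrow> Rep_fin a \<le> Rep_fin b"
instance
  by intro_classes (auto simp: less_eq_fin_def less_fin_def Rep_fin_inject)
end

instance fin :: (finite) wellorder
proof
  fix P :: "'a fin \<Rightarrow> bool" and a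
  assume step: "\<And>x. (\<And>y. y < x \<Longrightarrow> P y) \<Longrightarrow> P x"
  show "P a"
    by (induction a rule: measure_induct_rule[of Rep_fin]) (auto intro: step simp: less_fin_def)
qed

lemma card_fin: "CARD('m fin) = CARD('m::finite)"
  using type_definition.card[OF type_definition_fin[where ?'m = 'm]] by simp

definition fin_index :: "'m fin \<Rightarrow> 'm::finite"
  where "fin_index = (SOME e. bij e)"

lemma bij_fin_index: "bij (fin_index :: 'm fin \<Rightarrow> 'm::finite)"
proof -
  have "\<exists>e :: 'm fin \<Rightarrow> 'm. bij e"
    using finite_same_card_bij[of "UNIV :: 'm fin set" "UNIV :: 'm set"] card_fin by auto
  then show ?thesis unfolding fin_index_def by (rule someI_ex)
qed

definition to_fin :: "real^'m::finite \<Rightarrow> real^('m fin)"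
  where "to_fin x = (\<chi> i. x $ fin_index i)"

definition of_fin :: "real^('m fin) \<Rightarrow> real^'m::finite"
  where "of_fin x = (\<chi> i. x $ inv fin_index i)"

lemma fin_index_inv [simp]: "fin_index (inv fin_index i) = i" "inv fin_index (fin_index j) = j"
  by (simp_all add: bij_fin_index bij_is_surj surj_f_inv_f bij_is_inj)

lemma of_fin_to_fin [simp]: "of_fin (to_fin x) = x" "to_fin (of_fin y) = y"
  by (simp_all add: of_fin_def to_fin_def vec_eq_iff)

lemma linear_to_fin: "linear to_fin" and linear_of_fin: "linear of_fin"
  by (auto intro!: linearI simp: to_fin_def of_fin_def vec_eq_iff)

lemma bounded_linear_fin: "bounded_linear to_fin" "bounded_linear of_fin"
  using linear_to_fin linear_of_fin by (auto simp: linear_conv_bounded_linear)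

lemma to_fin_axis: "of_fin (axis i x) = axis (fin_index i) x"
  by (auto simp: of_fin_def axis_def vec_eq_iff bij_inv_eq_iff[OF bij_fin_index])

lemma borel_measurable_fin [measurable]: "to_fin \<in> borel_measurable borel" "of_fin \<in> borel_measurable borel"
  using bounded_linear_fin by (auto intro: borel_measurable_continuous_onI linear_continuous_on)

text \<open>Relabelling coordinates maps boxes to boxes with the same side lengths, and the values
  on boxes determine Lebesgue measure.\<close>

lemma distr_to_fin: "distr lborel borel (to_fin :: real^'m::finite \<Rightarrow> _) = lborel"
proof (rule lborel_eqI[symmetric])
  fix l u :: "real^('m fin)" assume lu: "\<And>b. b \<in> Basis \<Longrightarrow> l \<bullet> b \<le> u \<bullet> b"
  have lu': "l $ i \<le> u $ i" for i using lu[of "axis i 1"] by (simp add: inner_axis)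
  have "to_fin -` box l u = box (of_fin l) (of_fin u)"
  proof -
    have "(\<forall>i. l $ i < x $ fin_index i \<and> x $ fin_index i < u $ i) \<longleftrightarrow>
       (\<forall>j. l $ inv fin_index j < x $ j \<and> x $ j < u $ inv fin_index j)" for x :: "real^'m"
      by (metis fin_index_inv)
    then show ?thesis by (auto simp: mem_box_cart to_fin_def of_fin_def)
  qed
  then have "emeasure (distr lborel borel to_fin) (box l u) = emeasure lborel (box (of_fin l :: real^'m) (of_fin u))"
    by (subst emeasure_distr) auto
  also have "\<dots> = (\<Prod>b\<in>Basis. (of_fin u - of_fin l :: real^'m) \<bullet> b)"
    by (rule emeasure_lborel_box) (auto simp: Basis_vec_def inner_axis of_fin_def lu')
  also have "(\<Prod>b\<in>Basis. (of_fin u - of_fin l :: real^'m) \<bullet> b) = (\<Prod>j\<in>UNIV. (of_fin u - of_fin l :: real^'m) $ j)"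
    by (rule prod.reindex_cong[of "\<lambda>j. axis j 1"]) (auto simp: inj_on_def axis_eq_axis Basis_vec_def inner_axis)
  also have "\<dots> = (\<Prod>i\<in>UNIV. (u - l) $ i)"
    by (rule prod.reindex_bij_betw[OF bij_fin_index, symmetric, THEN trans]) (simp add: of_fin_def)
  also have "\<dots> = (\<Prod>b\<in>Basis. (u - l) \<bullet> b)"
    by (rule prod.reindex_cong[of "\<lambda>j. axis j 1", symmetric]) (auto simp: inj_on_def axis_eq_axis Basis_vec_def inner_axis)
  finally show "emeasure (distr lborel borel to_fin) (box l u) = ennreal (\<Prod>b\<in>Basis. (u - l) \<bullet> b)" .
qed simp

lemma nn_integral_of_fin:
  fixes f :: "real^'m::finite \<Rightarrow> ennreal"
  assumes [measurable]: "f \<in> borel_measurable borel"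
  shows "(\<integral>\<^sup>+x. f (of_fin x) \<partial>lborel) = (\<integral>\<^sup>+x. f x \<partial>lborel)"
proof -
  have "(\<integral>\<^sup>+x. f (of_fin x) \<partial>lborel) = (\<integral>\<^sup>+x. f (of_fin x) \<partial>distr lborel borel (to_fin :: real^'m \<Rightarrow> _))"
    by (simp add: distr_to_fin)
  also have "\<dots> = (\<integral>\<^sup>+x. f (of_fin (to_fin x)) \<partial>lborel)" by (rule nn_integral_distr) measurable
  finally show ?thesis by simp
qed

text \<open>Conjugation by \<open>e\<close> is a sign-preserving bijection between the permutations
  of the two index types, so the Leibniz sums agree term by term.\<close>

lemma det_reindex:
  fixes M :: "real^'m::finite^'m" and e :: "'n::finite \<Rightarrow> 'm"
  assumes e: "bij e"
  shows "det (\<chi> i j. M $ e i $ e j) = det M"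
proof -
  let ?mp = "map_permutation UNIV e"
  have inj: "inj_on e UNIV" and surj: "e ` UNIV = UNIV" using e by (auto simp: bij_def)
  have mp: "?mp p (e i) = e (p i)" for p i by (rule map_permutation_apply[OF inj]) simp
  have bij: "bij_betw ?mp {p. p permutes UNIV} {p. p permutes UNIV}"
  proof (rule bij_betw_byWitness[where f' = "map_permutation UNIV (inv e)"])
    have bi: "bij (inv e)" using e by (rule bij_imp_bij_inv)
    have im: "?mp p permutes UNIV" if "p permutes UNIV" for p
      by (rule map_permutation_permutes) (use that e in auto)
    have im': "map_permutation UNIV (inv e) q permutes UNIV" if "q permutes UNIV" for q
      by (rule map_permutation_permutes) (use that bi in auto)
    have mp': "map_permutation UNIV (inv e) q (inv e i) = inv e (q i)" for q i
      by (rule map_permutation_apply) (use bi in \<open>auto simp: bij_def\<close>)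
    show "?mp ` {p. p permutes UNIV} \<subseteq> {p. p permutes UNIV}" using im by auto
    show "map_permutation UNIV (inv e) ` {p. p permutes UNIV} \<subseteq> {p. p permutes UNIV}" using im' by auto
    show "\<forall>p\<in>{p. p permutes UNIV}. map_permutation UNIV (inv e) (?mp p) = p"
    proof (intro ballI ext)
      fix p i
      have "map_permutation UNIV (inv e) (?mp p) (inv e (e i)) = inv e (?mp p (e i))" by (rule mp')
      then show "map_permutation UNIV (inv e) (?mp p) i = p i" using mp inj by simp
    qed
    show "\<forall>q\<in>{p. p permutes UNIV}. ?mp (map_permutation UNIV (inv e) q) = q"
    proof (intro ballI ext)
      fix q i
      have "?mp (map_permutation UNIV (inv e) q) (e (inv e i)) = e (map_permutation UNIV (inv e) q (inv e i))" by (rule mp)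
      then show "?mp (map_permutation UNIV (inv e) q) i = q i" using mp' e by (simp add: bij_is_surj surj_f_inv_f)
    qed
  qed
  have "det (\<chi> i j. M $ e i $ e j) = (\<Sum>p | p permutes UNIV. of_int (sign p) * (\<Prod>i\<in>UNIV. M $ e i $ e (p i)))"
    by (simp add: det_def)
  also have "\<dots> = (\<Sum>p | p permutes UNIV. of_int (sign (?mp p)) * (\<Prod>i\<in>UNIV. M $ i $ ?mp p i))"
  proof (rule sum.cong[OF refl])
    fix p :: "'n \<Rightarrow> 'n" assume "p \<in> {p. p permutes UNIV}"
    then have "sign (?mp p) = sign p" by (intro sign_map_permutation inj) auto
    moreover have "(\<Prod>i\<in>UNIV. M $ i $ ?mp p i) = (\<Prod>i\<in>UNIV. M $ e i $ ?mp p (e i))"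
      by (rule prod.reindex_bij_betw[OF e, symmetric])
    ultimately show "of_int (sign p) * (\<Prod>i\<in>UNIV. M $ e i $ e (p i)) = of_int (sign (?mp p)) * (\<Prod>i\<in>UNIV. M $ i $ ?mp p i)"
      by (simp add: mp)
  qed
  also have "\<dots> = det M"
    unfolding det_def by (rule sum.reindex_bij_betw[OF bij])
  finally show ?thesis .
qed

section \<open>Change of variables for nonnegative integrals\<close>

lemma nn_integral_absolutely_integrable:
  fixes f :: "'e::euclidean_space \<Rightarrow> real"
  assumes "\<And>x. x \<in> S \<Longrightarrow> 0 \<le> f x" "f absolutely_integrable_on S"
  shows "(\<integral>\<^sup>+x\<in>S. ennreal (f x) \<partial>lborel) = ennreal (integral S f)"
proof -
  have "(f has_integral integral S f) S" using assms(2) by (simp add: absolutely_integrable_on_def integrable_integral)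
  from nn_integral_has_integral_lebesgue[OF assms(1) this]
  have "(\<integral>\<^sup>+x. ennreal (indicator S x * f x) \<partial>lborel) = ennreal (integral S f)" by simp
  moreover have "ennreal (indicator S x * f x) = ennreal (f x) * indicator S x" for x
    by (simp add: indicator_def)
  ultimately show ?thesis by simp
qed

lemma absolutely_integrable_nn_integral:
  fixes f :: "'e::euclidean_space \<Rightarrow> real"
  assumes nn: "\<And>x. x \<in> S \<Longrightarrow> 0 \<le> f x" and m: "(\<lambda>x. f x * indicator S x) \<in> borel_measurable borel"
    and fin: "(\<integral>\<^sup>+x\<in>S. ennreal (f x) \<partial>lborel) < top"
  shows "f absolutely_integrable_on S"
proof -
  have "integrable lborel (\<lambda>x. f x * indicator S x)"
  proof (rule integrableI_bounded)
    have "(\<integral>\<^sup>+x. ennreal (norm (f x * indicator S x)) \<partial>lborel) = (\<integral>\<^sup>+x\<in>S. ennreal (f x) \<partial>lborel)"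
      by (intro nn_integral_cong) (auto simp: indicator_def nn)
    then show "(\<integral>\<^sup>+x. ennreal (norm (f x * indicator S x)) \<partial>lborel) < \<infinity>" using fin by simp
  qed (use m in simp)
  then have "integrable lebesgue (\<lambda>x. f x * indicator S x)"
    by (subst integrable_completion) (use m in auto)
  then show ?thesis by (simp add: set_integrable_def mult.commute)
qed

text \<open>The change of variables theorem makes absolute integrability on the two sides
  equivalent, with equal integrals. When it fails, it fails on both sides, and for nonnegative
  measurable integrands both integrals are then infinite, so the equality holds in every
  case.\<close>

lemma nn_change_of_variables_wellorder:
  fixes g :: "real^'m::{finite,wellorder} \<Rightarrow> real^'m::_" and f :: "real^'m::_ \<Rightarrow> real"
  assumes S: "S \<in> sets borel" "g ` S \<in> sets borel" and der: "\<And>x. x \<in> S \<Longrightarrow> (g has_derivative g' x) (at x within S)" and inj: "inj_on g S"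
    and f: "\<And>y. 0 \<le> f y" "(\<lambda>y. f y * indicator (g ` S) y) \<in> borel_measurable borel"
    and m: "(\<lambda>x. \<bar>det (matrix (g' x))\<bar> * f (g x) * indicator S x) \<in> borel_measurable borel"
  shows "(\<integral>\<^sup>+y\<in>g ` S. ennreal (f y) \<partial>lborel) = (\<integral>\<^sup>+x\<in>S. ennreal (\<bar>det (matrix (g' x))\<bar> * f (g x)) \<partial>lborel)"
proof -
  let ?h = "\<lambda>x. \<bar>det (matrix (g' x))\<bar> * f (g x)"
  have S': "S \<in> sets lebesgue" using S by simp
  have cov: "?h absolutely_integrable_on S \<and> integral S ?h = r \<longleftrightarrow> f absolutely_integrable_on (g ` S) \<and> integral (g ` S) f = r" for r
  proof -
    have v: "f absolutely_integrable_on T \<longleftrightarrow> (\<lambda>x. vec (f x) :: real^1) absolutely_integrable_on T" for f :: "real^'m::_ \<Rightarrow> real" and T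
      by (subst absolutely_integrable_on_1_iff) simp
    have i: "integral T (\<lambda>x. vec (f x) :: real^1) = vec r \<longleftrightarrow> integral T f = r" for f :: "real^'m::_ \<Rightarrow> real" and T r
      by (subst integral_on_1_eq) (simp add: vec_eq_iff)
    have e: "(\<lambda>x. \<bar>det (matrix (g' x))\<bar> *\<^sub>R (vec (f (g x)) :: real^1)) = (\<lambda>x. vec (?h x))" by (simp add: vec_eq_iff fun_eq_iff)
    show ?thesis
      using has_absolute_integral_change_of_variables[OF S' der inj, of "\<lambda>x. vec (f x) :: real^1" "vec r"]
      unfolding e i v[symmetric] .
  qed
  show ?thesis
  proof (cases "f absolutely_integrable_on (g ` S)")
    case True
    then have "?h absolutely_integrable_on S" "integral S ?h = integral (g ` S) f" using cov by blast+
    then show ?thesis using nn_integral_absolutely_integrable[of "g ` S" f] nn_integral_absolutely_integrable[of S ?h] True f(1)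
      by simp
  next
    case False
    then have "\<not> ?h absolutely_integrable_on S" using cov by blast
    then have "\<not> (\<integral>\<^sup>+x\<in>S. ennreal (?h x) \<partial>lborel) < top"
      using absolutely_integrable_nn_integral[of S ?h] m f(1) by auto
    moreover have "\<not> (\<integral>\<^sup>+y\<in>g ` S. ennreal (f y) \<partial>lborel) < top"
      using False absolutely_integrable_nn_integral[of "g ` S" f] f by auto
    ultimately show ?thesis by (simp add: not_less top_unique)
  qed
qed

lemma ennreal_mult_indicator: "ennreal a * indicator T y = ennreal (a * indicator T y)"
  by (simp add: indicator_def)

text \<open>The map is conjugated by the relabelling of coordinates, which changes neither Lebesgue
  measure nor the Jacobian determinant.\<close>

lemma nn_change_of_variables:
  fixes g :: "real^'m::finite \<Rightarrow> real^'m" and f :: "real^'m \<Rightarrow> real"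
  assumes S: "S \<in> sets borel" "g ` S \<in> sets borel" and der: "\<And>x. x \<in> S \<Longrightarrow> (g has_derivative g' x) (at x)" and inj: "inj_on g S"
    and f: "\<And>y. 0 \<le> f y" and fm [measurable]: "(\<lambda>y. f y * indicator (g ` S) y) \<in> borel_measurable borel"
    and m [measurable]: "(\<lambda>x. \<bar>det (matrix (g' x))\<bar> * f (g x) * indicator S x) \<in> borel_measurable borel"
  shows "(\<integral>\<^sup>+y\<in>g ` S. ennreal (f y) \<partial>lborel) = (\<integral>\<^sup>+x\<in>S. ennreal (\<bar>det (matrix (g' x))\<bar> * f (g x)) \<partial>lborel)"
proof -
  let ?S = "of_fin -` S :: (real^('m fin)) set"
  let ?g = "\<lambda>x. to_fin (g (of_fin x))"
  let ?g' = "\<lambda>x v. to_fin (g' (of_fin x) (of_fin v))"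
  have img: "?g ` ?S = of_fin -` (g ` S)"
  proof (intro set_eqI iffI)
    fix x assume "x \<in> of_fin -` (g ` S)"
    then obtain s where "s \<in> S" "of_fin x = g s" by auto
    then have "to_fin (of_fin x) = to_fin (g s)" by simp
    with \<open>s \<in> S\<close> show "x \<in> ?g ` ?S" by (intro image_eqI[of _ _ "to_fin s"]) auto
  qed auto
  have det: "det (matrix (?g' x)) = det (matrix (g' (of_fin x)))" for x
  proof -
    have "matrix (?g' x) = (\<chi> i j. matrix (g' (of_fin x)) $ fin_index i $ fin_index j)"
      by (simp add: matrix_def to_fin_axis) (simp add: to_fin_def)
    then show ?thesis using det_reindex[OF bij_fin_index] by metis
  qed
  have pre: "of_fin -` T \<in> sets borel" if "T \<in> sets borel" for T :: "(real^'m) set"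
    using measurable_sets[OF borel_measurable_fin(2) that] by simp
  have ind: "indicator ?S x = (indicator S (of_fin x) :: real)" "indicator (of_fin -` (g ` S)) x = (indicator (g ` S) (of_fin x) :: real)" for x
    by (auto simp: indicator_def)
  have "(\<integral>\<^sup>+y\<in>?g ` ?S. ennreal (f (of_fin y)) \<partial>lborel)
      = (\<integral>\<^sup>+x\<in>?S. ennreal (\<bar>det (matrix (?g' x))\<bar> * f (of_fin (?g x))) \<partial>lborel)"
  proof (rule nn_change_of_variables_wellorder)
    show "?S \<in> sets borel" "?g ` ?S \<in> sets borel" unfolding img using pre S by auto
    show "(?g has_derivative ?g' x) (at x within ?S)" if "x \<in> ?S" for x
    proof -
      have "((\<lambda>x. g (of_fin x)) has_derivative (\<lambda>v. g' (of_fin x) (of_fin v))) (at x)"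
        by (rule has_derivative_compose[OF bounded_linear_imp_has_derivative[OF bounded_linear_fin(2)] der]) (use that in simp)
      from bounded_linear.has_derivative[OF bounded_linear_fin(1) this]
      show ?thesis by (rule has_derivative_at_withinI)
    qed
    show "inj_on ?g ?S" using inj unfolding inj_on_def by (metis of_fin_to_fin vimageE)
    show "(\<lambda>y. f (of_fin y) * indicator (?g ` ?S) y) \<in> borel_measurable borel"
      unfolding img ind using measurable_compose[OF borel_measurable_fin(2) fm] by simp
    show "(\<lambda>x. \<bar>det (matrix (?g' x))\<bar> * f (of_fin (?g x)) * indicator ?S x) \<in> borel_measurable borel"
      unfolding det ind using measurable_compose[OF borel_measurable_fin(2) m] by simp
  qed (use f in simp)
  moreover have "(\<integral>\<^sup>+y\<in>?g ` ?S. ennreal (f (of_fin y)) \<partial>lborel) = (\<integral>\<^sup>+y\<in>g ` S. ennreal (f y) \<partial>lborel)"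
  proof -
    have "(\<lambda>y. ennreal (f y * indicator (g ` S) y)) \<in> borel_measurable borel" by measurable
    from nn_integral_of_fin[OF this] show ?thesis unfolding img ennreal_mult_indicator ind .
  qed
  moreover have "(\<integral>\<^sup>+x\<in>?S. ennreal (\<bar>det (matrix (?g' x))\<bar> * f (of_fin (?g x))) \<partial>lborel)
     = (\<integral>\<^sup>+x\<in>S. ennreal (\<bar>det (matrix (g' x))\<bar> * f (g x)) \<partial>lborel)"
  proof -
    have "(\<lambda>x. ennreal (\<bar>det (matrix (g' x))\<bar> * f (g x) * indicator S x)) \<in> borel_measurable borel" by measurable
    from nn_integral_of_fin[OF this] show ?thesis unfolding det ennreal_mult_indicator ind by simp
  qed
  ultimately show ?thesis by simp
qed

lemma suminf_ennreal_swap: "(\<Sum>n. \<Sum>i. f n i) = (\<Sum>i. \<Sum>n. f n i :: ennreal)"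
proof -
  have "(\<Sum>n. \<Sum>i. f n i) = (\<Sum>n. \<integral>\<^sup>+i. f n i \<partial>count_space UNIV)"
    by (simp add: nn_integral_count_space_nat)
  also have "\<dots> = (\<integral>\<^sup>+i. (\<Sum>n. f n i) \<partial>count_space UNIV)"
    by (rule nn_integral_suminf[symmetric]) simp
  finally show ?thesis by (simp add: nn_integral_count_space_nat)
qed

section \<open>Existence and uniqueness of the Riemannian volume\<close>

context smooth_manifold
begin

lemma borel_cmap_image:
  assumes c: "c \<in> A" and E: "E \<in> sets borel" "E \<subseteq> cdom c"
  shows "cmap c ` E \<in> sets borel"
proof -
  have "cinv c \<in> measurable (restrict_space borel (cimg c)) borel"
    by (rule borel_measurable_continuous_on_restrict[OF chartD(4)[OF c]])
  from measurable_sets[OF this E(1)]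
  have "cinv c -` E \<inter> cimg c \<in> sets (restrict_space borel (cimg c))"
    by (simp add: space_restrict_space)
  then show ?thesis
    using chartD(2)[OF c] cmap_image_eq[OF c E(2)] by (simp add: sets_restrict_space_iff Int_commute)
qed

text \<open>Second countability reduces the atlas to countably many charts, as required for gluing
  the volume by countable additivity.\<close>

lemma countable_atlas:
  obtains C :: "nat \<Rightarrow> ('a, 'n) chart" where "\<And>i. C i \<in> A" "(\<Union>i. cdom (C i)) = UNIV"
proof -
  have "\<And>S. S \<in> cdom ` A \<Longrightarrow> open S" using chartD(1) by auto
  then obtain F where F: "F \<subseteq> cdom ` A" "countable F" "\<Union>F = \<Union>(cdom ` A)"
    using Lindelof by metis
  have un: "\<Union>F = UNIV" using F(3) atlas by (simp add: smooth_atlas_def)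
  then have ne: "F \<noteq> {}" by auto
  have "\<exists>c\<in>A. cdom c = from_nat_into F i" for i
    using from_nat_into[OF ne, of i] F(1) by (metis imageE subsetD)
  then obtain C where C: "\<And>i. C i \<in> A" "\<And>i. cdom (C i) = from_nat_into F i" by metis
  show thesis
    by (rule that[of C]) (use C un range_from_nat_into[OF ne F(2)] in auto)
qed

end

context riemannian_manifold
begin

text \<open>Extended by 0 off the chart image, where the metric coefficients are meaningless, so
  that it is Borel on the whole model space.\<close>

definition volume_density :: "('a, 'n) chart \<Rightarrow> real^'n \<Rightarrow> real"
  where "volume_density c y = (if y \<in> cimg c then sqrt (det (gmat A g c y)) else 0)"

lemma det_gmat_pos: "c \<in> A \<Longrightarrow> y \<in> cimg c \<Longrightarrow> det (gmat A g c y) > 0"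
  by (rule det_pos_definite[OF gmat_sym]) (auto simp: metric_coord_matrix[symmetric] metric_coordD)

lemma volume_density_nonneg: "c \<in> A \<Longrightarrow> 0 \<le> volume_density c y"
  using det_gmat_pos[of c y] by (simp add: volume_density_def less_imp_le)

lemma borel_volume_density [measurable]: "c \<in> A \<Longrightarrow> volume_density c \<in> borel_measurable borel"
proof -
  assume c: "c \<in> A"
  have "continuous_on (cimg c) (\<lambda>y. sqrt (det (gmat A g c y)))"
    by (intro continuous_intros smooth_on_continuous[OF smooth_det] chartD(2) smooth_gmat c)
  from borel_measurable_continuous_on_indicator[OF _ this]
  have "(\<lambda>y. indicator (cimg c) y *\<^sub>R sqrt (det (gmat A g c y))) \<in> borel_measurable borel"
    using chartD(2)[OF c] by simp
  moreover have "(\<lambda>y. indicator (cimg c) y *\<^sub>R sqrt (det (gmat A g c y))) = volume_density c"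
    by (auto simp: volume_density_def fun_eq_iff)
  ultimately show ?thesis by simp
qed

text \<open>With \<open>J\<close> the Jacobian matrix the metric matrices satisfy
  \<open>G = J^T G' J\<close>, and the square root of the determinant produces the factor of the
  change of variables formula.\<close>

lemma volume_density_change:
  assumes c: "c \<in> A" "c' \<in> A" "p \<in> cdom c" "p \<in> cdom c'"
  shows "volume_density c (cmap c p) = \<bar>det (matrix (trans_deriv c c' (cmap c p)))\<bar> * volume_density c' (cmap c' p)"
proof -
  let ?J = "matrix (trans_deriv c c' (cmap c p))" let ?G = "gmat A g c' (cmap c' p)"
  have J: "?J *v u = trans_deriv c c' (cmap c p) u" for u
    using fun_cong[OF matrix_vector_mul(2)[OF trans_deriv_linear[OF c]]] .
  have y: "cmap c p \<in> cimg c" "cmap c' p \<in> cimg c'" using c by auto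
  have "gmat A g c (cmap c p) $ i $ j = (transpose ?J ** ?G ** ?J) $ i $ j" for i j
  proof -
    have "gmat A g c (cmap c p) $ i $ j = gc c' (cmap c' p) (?J *v axis i 1) (?J *v axis j 1)"
      unfolding J by (simp add: gmat_def metric_coord_change[OF c])
    also have "\<dots> = (?J *v axis i 1) \<bullet> ((?G ** ?J) *v axis j 1)"
      by (simp add: metric_coord_matrix[OF c(2) y(2)] matrix_vector_mul_assoc)
    also have "\<dots> = axis i 1 \<bullet> ((transpose ?J ** (?G ** ?J)) *v axis j 1)"
    proof -
      have "axis i 1 \<bullet> (transpose ?J *v w) = (?J *v axis i 1) \<bullet> w" for w
        using dot_lmul_matrix[of "axis i 1" "transpose ?J" w] transpose_matrix_vector[of "transpose ?J" "axis i 1"]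
        by (simp only: transpose_transpose)
      from this[of "(?G ** ?J) *v axis j 1"] show ?thesis
        by (simp only: matrix_vector_mul_assoc)
    qed
    also have "\<dots> = (transpose ?J ** (?G ** ?J)) $ i $ j"
      by (simp add: inner_axis' matrix_vector_mult_basis column_def)
    finally show ?thesis by (simp add: matrix_mul_assoc)
  qed
  then have "gmat A g c (cmap c p) = transpose ?J ** ?G ** ?J" by (simp add: vec_eq_iff)
  then have "det (gmat A g c (cmap c p)) = (det ?J)\<^sup>2 * det ?G"
    by (simp add: det_mul det_transpose power2_eq_square mult_ac)
  then show ?thesis using y by (simp add: volume_density_def real_sqrt_mult)
qed

definition chart_vol :: "('a, 'n) chart \<Rightarrow> (real^'n) measure"
  where "chart_vol c = density lborel (\<lambda>y. ennreal (volume_density c y))"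

lemma sets_chart_vol [simp]: "sets (chart_vol c) = sets borel"
  by (simp add: chart_vol_def)

lemma emeasure_chart_vol:
  "c \<in> A \<Longrightarrow> S \<in> sets borel \<Longrightarrow> emeasure (chart_vol c) S = (\<integral>\<^sup>+y\<in>S. ennreal (volume_density c y) \<partial>lborel)"
  unfolding chart_vol_def by (subst emeasure_density) auto

lemma emeasure_chart_vol_det:
  assumes "c \<in> A" "S \<in> sets borel" "S \<subseteq> cimg c"
  shows "emeasure (chart_vol c) S = (\<integral>\<^sup>+y\<in>S. ennreal (sqrt (det (gmat A g c y))) \<partial>lborel)"
  unfolding emeasure_chart_vol[OF assms(1,2)]
  by (intro nn_integral_cong) (use assms(3) in \<open>auto simp: volume_density_def indicator_def\<close>)

lemma chart_vol_change:
  assumes c: "c \<in> A" "c' \<in> A" and E: "E \<in> sets borel" "E \<subseteq> cdom c" "E \<subseteq> cdom c'"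
  shows "emeasure (chart_vol c) (cmap c ` E) = emeasure (chart_vol c') (cmap c' ` E)"
proof -
  let ?S = "cmap c ` E" let ?T = "cmap c' \<circ> cinv c"
  have T: "?T (cmap c p) = cmap c' p" if "p \<in> E" for p using chartD(6)[OF c(1)] E that by auto
  have img: "?T ` ?S = cmap c' ` E" using T by (force simp: image_iff)
  have S: "?S \<in> sets borel" "cmap c' ` E \<in> sets borel" using borel_cmap_image c E by auto
  note [measurable] = S borel_volume_density[OF c(1)] borel_volume_density[OF c(2)]
  have eq: "\<bar>det (matrix (trans_deriv c c' x))\<bar> * volume_density c' (?T x) = volume_density c x" if "x \<in> ?S" for x
    using that volume_density_change[OF c] T E by (auto simp: subset_iff)
  have "(\<integral>\<^sup>+y\<in>?T ` ?S. ennreal (volume_density c' y) \<partial>lborel)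
      = (\<integral>\<^sup>+x\<in>?S. ennreal (\<bar>det (matrix (trans_deriv c c' x))\<bar> * volume_density c' (?T x)) \<partial>lborel)"
  proof (rule nn_change_of_variables)
    show "?S \<in> sets borel" "?T ` ?S \<in> sets borel" unfolding img by (rule S)+
    show "(?T has_derivative trans_deriv c c' x) (at x)" if "x \<in> ?S" for x
      using that trans_deriv_has_derivative[OF c] E by (auto simp: subset_iff)
    show "inj_on ?T ?S"
    proof (rule inj_onI)
      fix x y assume "x \<in> ?S" "y \<in> ?S" and xy: "?T x = ?T y"
      then obtain p q where pq: "p \<in> E" "q \<in> E" "x = cmap c p" "y = cmap c q" by blast
      then have "cmap c' p = cmap c' q" using xy T by simp
      then show "x = y" using inj_onD[OF chartD(5)[OF c(2)]] pq E(3) by blast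
    qed
    show "(\<lambda>y. volume_density c' y * indicator (?T ` ?S) y) \<in> borel_measurable borel" unfolding img by measurable
    have "(\<lambda>x. \<bar>det (matrix (trans_deriv c c' x))\<bar> * volume_density c' (?T x) * indicator ?S x) = (\<lambda>x. volume_density c x * indicator ?S x)"
      by (rule ext) (use eq in \<open>auto simp: indicator_def\<close>)
    then show "(\<lambda>x. \<bar>det (matrix (trans_deriv c c' x))\<bar> * volume_density c' (?T x) * indicator ?S x) \<in> borel_measurable borel"
      by simp
  qed (rule volume_density_nonneg[OF c(2)])
  also have "\<dots> = (\<integral>\<^sup>+x\<in>?S. ennreal (volume_density c x) \<partial>lborel)"
    by (intro nn_integral_cong) (use eq in \<open>auto simp: indicator_def\<close>)
  finally show ?thesis using emeasure_chart_vol c S img by simp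
qed

text \<open>The characterisation inside \<open>riem_volume\<close>, with the chart integral
  rewritten as a measure on the model space so that its countable additivity is immediate.\<close>

definition is_volume :: "'a measure \<Rightarrow> bool"
  where "is_volume \<mu> \<longleftrightarrow> sets \<mu> = sets borel \<and>
      (\<forall>c\<in>A. \<forall>E\<in>sets borel. E \<subseteq> cdom c \<longrightarrow> emeasure \<mu> E = emeasure (chart_vol c) (cmap c ` E))"

lemma riem_volume_eq: "riem_volume A g = (THE \<mu>. is_volume \<mu>)"
proof -
  have "(\<forall>c\<in>A. \<forall>E\<in>sets borel. E \<subseteq> cdom c \<longrightarrow>
        emeasure \<mu> E = (\<integral>\<^sup>+ y\<in>cmap c ` E. ennreal (sqrt (det (gmat A g c y))) \<partial>lborel)) \<longleftrightarrow>
     (\<forall>c\<in>A. \<forall>E\<in>sets borel. E \<subseteq> cdom c \<longrightarrow> emeasure \<mu> E = emeasure (chart_vol c) (cmap c ` E))" for \<mu>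
    using emeasure_chart_vol_det borel_cmap_image by (intro ball_cong refl imp_cong) (auto simp: image_mono)
  then show ?thesis by (simp add: riem_volume_def is_volume_def)
qed

text \<open>A Borel set splits into countably many disjoint pieces, each inside one chart, where the
  value is prescribed.\<close>

lemma is_volume_unique:
  assumes "is_volume \<mu>" "is_volume \<mu>'" shows "\<mu> = \<mu>'"
proof (rule measure_eqI)
  show s: "sets \<mu> = sets \<mu>'" using assms by (simp add: is_volume_def)
  have sb: "sets \<mu> = sets borel" "sets \<mu>' = sets borel" using assms by (simp_all add: is_volume_def)
  fix E assume "E \<in> sets \<mu>"
  then have E: "E \<in> sets borel" using assms by (simp add: is_volume_def)
  obtain C :: "nat \<Rightarrow> ('a, 'n) chart" where C: "\<And>i. C i \<in> A" "(\<Union>i. cdom (C i)) = UNIV"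
    using countable_atlas by blast
  let ?D = "disjointed (\<lambda>i. cdom (C i))"
  define D where "D i = E \<inter> ?D i" for i
  have D1: "disjoint_family D"
    by (rule disjoint_family_subset[OF disjoint_family_disjointed[of "\<lambda>i. cdom (C i)"]]) (simp add: D_def)
  have "(\<Union>i. D i) = E \<inter> (\<Union>i. ?D i)" unfolding D_def by blast
  then have D2: "(\<Union>i. D i) = E" by (simp add: UN_disjointed_eq C(2))
  have "D i \<subseteq> cdom (C i)" for i
    using disjointed_subset[of "\<lambda>i. cdom (C i)" i] unfolding D_def by blast
  note D = D1 D2 this
  have "range (\<lambda>i. cdom (C i)) \<subseteq> sets borel" using chartD(1)[OF C(1)] by auto
  from sets.range_disjointed_sets[OF this] have Db: "D i \<in> sets borel" for i using E by (auto simp: D_def)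
  have "emeasure \<mu> E = (\<Sum>i. emeasure \<mu> (D i))"
    using suminf_emeasure[of D \<mu>] D(1) Db sb unfolding D(2)[symmetric] by (simp add: image_subset_iff)
  also have "\<dots> = (\<Sum>i. emeasure \<mu>' (D i))"
  proof (intro suminf_cong)
    fix i
    have "emeasure \<mu> (D i) = emeasure (chart_vol (C i)) (cmap (C i) ` D i)"
      "emeasure \<mu>' (D i) = emeasure (chart_vol (C i)) (cmap (C i) ` D i)"
      using assms[unfolded is_volume_def] C(1)[of i] D(3)[of i] Db[of i] by metis+
    then show "emeasure \<mu> (D i) = emeasure \<mu>' (D i)" by simp
  qed
  also have "\<dots> = emeasure \<mu>' E"
    using suminf_emeasure[of D \<mu>'] D(1) Db sb unfolding D(2)[symmetric] by (simp add: image_subset_iff)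
  finally show "emeasure \<mu> E = emeasure \<mu>' E" .
qed

text \<open>The measure is assembled from one countable family of charts with disjointed domains.
  That it has the prescribed values in every chart of the atlas follows piece by piece from
  \<open>chart_vol_change\<close>.\<close>

lemma is_volume_exists: "\<exists>\<mu>. is_volume \<mu>"
proof -
  obtain C :: "nat \<Rightarrow> ('a, 'n) chart" where C: "\<And>i. C i \<in> A" "(\<Union>i. cdom (C i)) = UNIV"
    using countable_atlas by blast
  define D where "D = disjointed (\<lambda>i. cdom (C i))"
  have D: "disjoint_family D" "(\<Union>i. D i) = UNIV" "D i \<subseteq> cdom (C i)" for i
    using disjoint_family_disjointed[of "\<lambda>i. cdom (C i)"] UN_disjointed_eq[of "\<lambda>i. cdom (C i)"] C(2)
      disjointed_subset[of "\<lambda>i. cdom (C i)"]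
    by (auto simp: D_def)
  have "range (\<lambda>i. cdom (C i)) \<subseteq> sets borel" using chartD(1)[OF C(1)] by auto
  from sets.range_disjointed_sets[OF this] have Db: "D i \<in> sets borel" for i by (auto simp: D_def)
  define F where "F E = (\<Sum>i. emeasure (chart_vol (C i)) (cmap (C i) ` (E \<inter> D i)))" for E
  have add: "(\<Sum>n. emeasure (chart_vol c) (cmap c ` (X n))) = emeasure (chart_vol c) (cmap c ` (\<Union>n. X n))"
    if c: "c \<in> A" and X: "\<And>n. X n \<in> sets borel" "\<And>n. X n \<subseteq> cdom c" "disjoint_family X" for c and X :: "nat \<Rightarrow> 'a set"
  proof -
    have "disjoint_family (\<lambda>n. cmap c ` (X n))"
      unfolding disjoint_family_on_def
    proof (intro ballI impI)
      fix m n :: nat assume "m \<noteq> n"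
      then have "X m \<inter> X n = {}" using X(3) by (auto simp: disjoint_family_on_def)
      then show "cmap c ` X m \<inter> cmap c ` X n = {}"
        using inj_on_image_Int[OF chartD(5)[OF c] X(2) X(2), of m n] by simp
    qed
    then show ?thesis
      using suminf_emeasure[of "\<lambda>n. cmap c ` (X n)" "chart_vol c"] borel_cmap_image[OF c X(1,2)]
      by (auto simp: image_UN)
  qed
  have ca: "countably_additive (sets borel) F"
    unfolding countably_additive_def
  proof (intro allI impI)
    fix X :: "nat \<Rightarrow> 'a set" assume X: "range X \<subseteq> sets borel" "disjoint_family X" "\<Union> (range X) \<in> sets borel"
    have "(\<Sum>n. F (X n)) = (\<Sum>i. \<Sum>n. emeasure (chart_vol (C i)) (cmap (C i) ` (X n \<inter> D i)))"
      unfolding F_def by (rule suminf_ennreal_swap)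
    also have "\<dots> = (\<Sum>i. emeasure (chart_vol (C i)) (cmap (C i) ` (\<Union>n. X n \<inter> D i)))"
    proof (intro suminf_cong add C)
      show "X n \<inter> D i \<in> sets borel" for n i using X(1) Db by auto
      show "X n \<inter> D i \<subseteq> cdom (C i)" for n i using D(3) by auto
      show "disjoint_family (\<lambda>n. X n \<inter> D i)" for i using X(2) by (auto simp: disjoint_family_on_def)
    qed
    also have "\<dots> = F (\<Union> (range X))" by (simp add: F_def)
    finally show "(\<Sum>n. F (X n)) = F (\<Union> (range X))" .
  qed
  define \<mu> where "\<mu> = measure_of UNIV (sets borel) F"
  have sa: "sigma_algebra UNIV (sets (borel :: 'a measure))"
    using sets.sigma_algebra_axioms[of "borel :: 'a measure"] by simp
  have sets: "sets \<mu> = sets borel" unfolding \<mu>_def using sigma_algebra.sets_measure_of_eq[OF sa] by simp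
  have em: "emeasure \<mu> E = F E" if "E \<in> sets borel" for E
    unfolding \<mu>_def by (rule emeasure_measure_of_sigma[OF sa _ ca that]) (simp add: positive_def F_def)
  have "emeasure \<mu> E = emeasure (chart_vol c) (cmap c ` E)" if c: "c \<in> A" and E: "E \<in> sets borel" "E \<subseteq> cdom c" for c E
  proof -
    have "emeasure \<mu> E = (\<Sum>i. emeasure (chart_vol c) (cmap c ` (E \<inter> D i)))"
      unfolding em[OF E(1)] F_def
      by (intro suminf_cong chart_vol_change) (use C(1) c E D(3) Db in auto)
    also have "\<dots> = emeasure (chart_vol c) (cmap c ` (\<Union>i. E \<inter> D i))"
    proof (rule add[OF c])
      show "disjoint_family (\<lambda>i. E \<inter> D i)" by (rule disjoint_family_subset[OF D(1)]) auto
    qed (use E Db in auto)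
    also have "(\<Union>i. E \<inter> D i) = E" using D(2) by auto
    finally show ?thesis .
  qed
  then show ?thesis using sets unfolding is_volume_def by blast
qed

lemma is_volume_riem_volume: "is_volume (riem_volume A g)"
  unfolding riem_volume_eq using is_volume_exists is_volume_unique by (metis theI)

lemma sets_riem_volume [simp]: "sets (riem_volume A g) = sets borel"
  using is_volume_riem_volume by (simp add: is_volume_def)

text \<open>A nonempty open set contains a coordinate patch whose image is open, hence not Lebesgue
  null, and the density is positive there. This is what makes the integral of the weight positive in
  the end.\<close>

lemma emeasure_riem_volume_pos:
  assumes U: "open U" "U \<noteq> {}"
  shows "emeasure (riem_volume A g) U > 0"
proof -
  obtain p where p: "p \<in> U" using U by blast
  let ?c = "chart_at A p" let ?V = "U \<inter> cdom ?c"
  note c = chart_at[of p]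
  have V: "?V \<in> sets borel" using U chartD(1)[OF c(1)] by auto
  have o: "open (cmap ?c ` ?V)" by (rule open_cmap_image[OF c(1) U(1)])
  have "emeasure (chart_vol ?c) (cmap ?c ` ?V) \<noteq> 0"
  proof
    assume "emeasure (chart_vol ?c) (cmap ?c ` ?V) = 0"
    then have "AE y in lborel. ennreal (volume_density ?c y) * indicator (cmap ?c ` ?V) y = 0"
      using o by (subst (asm) emeasure_chart_vol[OF c(1)]) (auto simp: nn_integral_0_iff_AE c(1))
    then have "AE y in lborel. y \<notin> cmap ?c ` ?V"
    proof eventually_elim
      case (elim y)
      show ?case
      proof
        assume y: "y \<in> cmap ?c ` ?V"
        then have "y \<in> cimg ?c" by auto
        then show False using elim y det_gmat_pos[OF c(1), of y] by (simp add: volume_density_def ennreal_eq_0_iff)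
      qed
    qed
    then have "cmap ?c ` ?V \<in> null_sets lborel" using o by (auto simp: AE_iff_null_sets)
    then show False using open_not_negligible[OF o] p c(2) by (auto simp: negligible_iff_null_sets dest: null_sets_completionI)
  qed
  then have "emeasure (riem_volume A g) ?V > 0"
    using is_volume_riem_volume c V unfolding is_volume_def by (simp add: zero_less_iff_neq_zero)
  also have "emeasure (riem_volume A g) ?V \<le> emeasure (riem_volume A g) U"
    using U by (intro emeasure_mono) auto
  finally show ?thesis .
qed

end

subsection \<open>Hypersurfaces\<close>

locale hypersurface = amb: riemannian_manifold A g
  for A :: "('a::{t2_space, second_countable_topology}, 'n::finite) chart set" and g :: "'a metric" +
  fixes B :: "('b::{t2_space, second_countable_topology}, 'm::finite) chart set"
    and \<iota> :: "'b \<Rightarrow> 'a" and \<nu> :: "'b \<Rightarrow> 'a tvec"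
  assumes hypersurface: "two_sided_hypersurface A g B \<iota> \<nu>"

sublocale hypersurface \<subseteq> sub: smooth_manifold B
  using hypersurface by unfold_locales (simp add: two_sided_hypersurface_def)

context hypersurface
begin

lemma hypersurfaceD:
  "CARD('n) = CARD('m) + 1" "continuous_on UNIV \<iota>" "c \<in> A \<Longrightarrow> smooth_fun B (\<iota> -` cdom c) (cmap c \<circ> \<iota>)"
  "inj_on (differential A \<iota> x) (tangent_space B x)" "\<nu> x \<in> tangent_space A (\<iota> x)" "g (\<iota> x) (\<nu> x) (\<nu> x) = 1"
  "c \<in> A \<Longrightarrow> smooth_fun B (\<iota> -` cdom c) (\<lambda>x. vec_comp c (\<nu> x))"
  using hypersurface unfolding two_sided_hypersurface_def smooth_map_def by auto

abbreviation h where "h \<equiv> induced_metric A g \<iota>"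

definition overlap :: "('a, 'n) chart \<Rightarrow> ('b, 'm) chart \<Rightarrow> (real^'m) set"
  where "overlap c b = cmap b ` (\<iota> -` cdom c \<inter> cdom b)"

definition emb :: "('a, 'n) chart \<Rightarrow> ('b, 'm) chart \<Rightarrow> real^'m \<Rightarrow> real^'n"
  where "emb c b = cmap c \<circ> \<iota> \<circ> cinv b"

abbreviation demb where "demb c b y \<equiv> frechet_derivative (emb c b) (at y)"

lemma open_vimage_cdom: "c \<in> A \<Longrightarrow> open (\<iota> -` cdom c)"
  using hypersurfaceD(2) amb.chartD(1) by (simp add: continuous_on_open_vimage)

lemma open_overlap: "c \<in> A \<Longrightarrow> b \<in> B \<Longrightarrow> open (overlap c b)"
  unfolding overlap_def by (rule sub.open_cmap_image[OF _ open_vimage_cdom])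

lemma overlap_subset: "overlap c b \<subseteq> cimg b"
  by (auto simp: overlap_def)

lemma overlapD:
  assumes "b \<in> B" "y \<in> overlap c b"
  shows "cinv b y \<in> cdom b" "\<iota> (cinv b y) \<in> cdom c" "cmap b (cinv b y) = y"
  using assms sub.chartD(6) by (auto simp: overlap_def)

lemma smooth_emb: "c \<in> A \<Longrightarrow> b \<in> B \<Longrightarrow> smooth_on (emb c b) (overlap c b)"
  using hypersurfaceD(3)[of c] unfolding smooth_fun_def overlap_def emb_def by blast

lemma emb_cimg: "b \<in> B \<Longrightarrow> y \<in> overlap c b \<Longrightarrow> emb c b y \<in> cimg c"
  using overlapD[of b y c] by (auto simp: emb_def)

lemma smooth_normal: "c \<in> A \<Longrightarrow> b \<in> B \<Longrightarrow> smooth_on (\<lambda>y. vec_comp c (\<nu> (cinv b y))) (overlap c b)"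
  using hypersurfaceD(7)[of c] unfolding smooth_fun_def overlap_def comp_def by blast

text \<open>Composition with the immersion stays in the class on which tangent vectors of the
  hypersurface are genuine derivatives, so \<open>differential\<close> does not run into their
  default value 0.\<close>

lemma smooth_near_comp:
  assumes s: "smooth_near A (\<iota> x) \<phi>"
  shows "smooth_near B x (\<phi> \<circ> \<iota>)"
proof -
  obtain W where W: "open W" "\<iota> x \<in> W" "smooth_fun A W \<phi>" using s unfolding smooth_near_def by blast
  define c where "c = chart_at A (\<iota> x)"
  have c: "c \<in> A" "\<iota> x \<in> cdom c" using amb.chart_at[of "\<iota> x"] by (auto simp: c_def)
  let ?U = "\<iota> -` (W \<inter> cdom c)"
  have U: "open ?U" using hypersurfaceD(2) W(1) amb.chartD(1)[OF c(1)] by (simp add: continuous_on_open_vimage open_Int del: vimage_Int)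
  have "smooth_fun B ?U (\<phi> \<circ> \<iota>)"
    unfolding smooth_fun_def
  proof
    fix b assume b: "b \<in> B"
    let ?S = "cmap b ` (?U \<inter> cdom b)" let ?T = "cmap c ` (W \<inter> cdom c)"
    have S: "open ?S" by (rule sub.open_cmap_image[OF b U])
    have sub: "?S \<subseteq> overlap c b" by (auto simp: overlap_def)
    have "smooth_on (\<lambda>y. (\<phi> \<circ> cinv c) (emb c b y)) ?S"
    proof (rule smooth_on_compose[OF S amb.open_cmap_image[OF c(1) W(1)]])
      show "emb c b ` ?S \<subseteq> ?T" using sub.chartD(6)[OF b] by (auto simp: emb_def)
      show "smooth_on (\<phi> \<circ> cinv c) ?T" using W(3) c(1) unfolding smooth_fun_def by blast
      show "smooth_on (emb c b) ?S" by (rule smooth_on_subset[OF smooth_emb[OF c(1) b] sub])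
    qed
    then show "smooth_on (\<phi> \<circ> \<iota> \<circ> cinv b) ?S"
      by (rule smooth_on_cong[OF S, rotated]) (use sub.chartD(6)[OF b] amb.chartD(6)[OF c(1)] in \<open>auto simp: emb_def\<close>)
  qed
  then show ?thesis unfolding smooth_near_def using U W(2) c(2) by blast
qed

lemma differential_chart_vec:
  assumes c: "c \<in> A" "\<iota> x \<in> cdom c" and b: "b \<in> B" "x \<in> cdom b"
  shows "differential A \<iota> x (chart_vec B b x v) = chart_vec A c (\<iota> x) (demb c b (cmap b x) v)"
proof
  fix \<phi>
  have "frechet_derivative (\<phi> \<circ> \<iota> \<circ> cinv b) (at (cmap b x)) v = frechet_derivative (\<phi> \<circ> cinv c) (at (cmap c (\<iota> x))) (demb c b (cmap b x) v)"
    if s: "smooth_near A (\<iota> x) \<phi>"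
  proof -
    have y: "cmap b x \<in> overlap c b" using c b by (auto simp: overlap_def)
    have e: "emb c b (cmap b x) = cmap c (\<iota> x)" using sub.chartD(6)[OF b] by (simp add: emb_def)
    have "((\<phi> \<circ> cinv c) has_derivative frechet_derivative (\<phi> \<circ> cinv c) (at (cmap c (\<iota> x)))) (at (emb c b (cmap b x)))"
      unfolding e by (rule has_frechet_derivative[OF amb.smooth_near_differentiable[OF s c]])
    from has_derivative_compose[OF smooth_on_has_derivative[OF smooth_emb[OF c(1) b(1)] y] this]
    have "((\<phi> \<circ> \<iota> \<circ> cinv b) has_derivative (\<lambda>v. frechet_derivative (\<phi> \<circ> cinv c) (at (cmap c (\<iota> x))) (demb c b (cmap b x) v))) (at (cmap b x))"
      by (rule has_derivative_transform_within_open[OF _ open_overlap[OF c(1) b(1)] y])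
        (use overlapD[OF b(1)] amb.chartD(6)[OF c(1)] in \<open>auto simp: emb_def\<close>)
    then show ?thesis by (simp add: frechet_derivative_eqI)
  qed
  then show "differential A \<iota> x (chart_vec B b x v) \<phi> = chart_vec A c (\<iota> x) (demb c b (cmap b x) v) \<phi>"
    using smooth_near_comp[of x \<phi>] by (simp add: differential_def chart_vec_def)
qed

lemma demb_linear: "c \<in> A \<Longrightarrow> b \<in> B \<Longrightarrow> y \<in> overlap c b \<Longrightarrow> linear (demb c b y)"
  by (rule has_derivative_linear[OF smooth_on_has_derivative[OF smooth_emb]])

text \<open>Injectivity is assumed for operators on functions; uniqueness of components carries it
  over to the derivative of the coordinate expression.\<close>

lemma demb_inj:
  assumes c: "c \<in> A" and b: "b \<in> B" and y: "y \<in> overlap c b" and u: "demb c b y u = 0"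
  shows "u = 0"
proof -
  let ?x = "cinv b y"
  note x = overlapD[OF b y]
  have "demb c b y 0 = 0" using linear_0[OF demb_linear[OF c b y]] .
  then have "differential A \<iota> ?x (chart_vec B b ?x u) = differential A \<iota> ?x (chart_vec B b ?x 0)"
    using u differential_chart_vec[OF c x(2) b x(1)] x(3) by simp
  then have "chart_vec B b ?x u = chart_vec B b ?x 0"
    using hypersurfaceD(4)[of ?x] sub.chart_vec_in_tangent[OF b x(1)] by (auto dest: inj_onD)
  then show ?thesis using sub.vec_comp_chart_vec[OF b x(1)] by metis
qed

lemma induced_metric_coord:
  assumes c: "c \<in> A" and b: "b \<in> B" and y: "y \<in> overlap c b"
  shows "metric_coord B h b y u v = metric_coord A g c (emb c b y) (demb c b y u) (demb c b y v)"
  using differential_chart_vec[OF c overlapD(2)[OF b y] b overlapD(1)[OF b y]] overlapD(3)[OF b y]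
    amb.metric_chart_vec[OF c overlapD(2)[OF b y]]
  by (simp add: metric_coord_def[of B] induced_metric_def emb_def)

lemma overlap_exists:
  assumes b: "b \<in> B" and y: "y \<in> cimg b"
  obtains c where "c \<in> A" "y \<in> overlap c b"
proof (rule that)
  show "chart_at A (\<iota> (cinv b y)) \<in> A" by (rule amb.chart_at)
  show "y \<in> overlap (chart_at A (\<iota> (cinv b y))) b"
    unfolding overlap_def using sub.chartD(7,8)[OF b y] amb.chart_at(2)[of "\<iota> (cinv b y)"]
    by (intro image_eqI[of _ _ "cinv b y"]) auto
qed

text \<open>In coordinates the induced metric is the pullback of \<open>g\<close> by
  \<open>emb c b\<close>. A chart of the hypersurface need not be mapped into a single ambient
  chart, so smoothness is checked locally, with an ambient chart chosen per point.\<close>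

lemma induced_riemannian: "riemannian_metric B h"
  unfolding riemannian_metric_def
proof (intro ballI conjI allI)
  fix b y u v assume b: "b \<in> B" and y: "y \<in> cimg b"
  obtain c where c: "c \<in> A" "y \<in> overlap c b" using overlap_exists[OF b y] .
  note eq = induced_metric_coord[OF c(1) b c(2)] and lin = demb_linear[OF c(1) b c(2)]
  note bl = amb.metric_coordD(1)[OF c(1) emb_cimg[OF b c(2)]]
  show "bilinear (metric_coord B h b y)"
    unfolding bilinear_def eq using bl lin
    by (auto intro!: linearI simp: linear_add linear_scale bilinear_ladd bilinear_radd bilinear_lmul bilinear_rmul)
  show "metric_coord B h b y u v = metric_coord B h b y v u"
    unfolding eq by (rule amb.metric_coordD(2)[OF c(1) emb_cimg[OF b c(2)]])
  show "u \<noteq> 0 \<longrightarrow> metric_coord B h b y u u > 0"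
    unfolding eq using amb.metric_coordD(3)[OF c(1) emb_cimg[OF b c(2)]] demb_inj[OF c(1) b c(2)] by blast
next
  fix b u v assume b: "b \<in> B"
  show "smooth_on (\<lambda>y. metric_coord B h b y u v) (cimg b)"
  proof (rule smooth_on_local)
    fix y assume "y \<in> cimg b"
    then obtain c where c: "c \<in> A" "y \<in> overlap c b" using overlap_exists[OF b] by blast
    note o = open_overlap[OF c(1) b]
    have sg: "smooth_on (\<lambda>y. gmat A g c (emb c b y) $ i $ j) (overlap c b)" for i j
      by (rule smooth_on_compose[OF o amb.chartD(2)[OF c(1)] _ amb.smooth_gmat[OF c(1)] smooth_emb[OF c(1) b]])
        (use emb_cimg[OF b] in blast)
    have "smooth_on (\<lambda>y. \<Sum>i\<in>UNIV. \<Sum>j\<in>UNIV. demb c b y u $ i * demb c b y v $ j * gmat A g c (emb c b y) $ i $ j) (overlap c b)"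
      by (intro smooth_on_sum smooth_on_mult sg o smooth_on_vec_nth[OF o smooth_on_frechet[OF smooth_emb[OF c(1) b]]])
    then have "smooth_on (\<lambda>y. metric_coord B h b y u v) (overlap c b)"
      by (rule smooth_on_cong[OF o, rotated])
        (use amb.metric_coord_expand[OF c(1)] emb_cimg[OF b] induced_metric_coord[OF c(1) b] in auto)
    then show "\<exists>U. open U \<and> y \<in> U \<and> smooth_on (\<lambda>y. metric_coord B h b y u v) U" using o c(2) by blast
  qed
qed

end

sublocale hypersurface \<subseteq> sub: riemannian_manifold B "induced_metric A g \<iota>"
  by unfold_locales (rule induced_riemannian)

subsection \<open>Chart invariance of curvature and Hessian\<close>

text \<open>A product rule for evaluating a varying linear map at a varying vector. The derivative
  of the map is known only for each fixed argument; expansion in the standard basis reduces the rule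
  to products with scalar functions.\<close>

lemma has_derivative_linear_family:
  fixes F :: "'e::real_normed_vector \<Rightarrow> real^'n \<Rightarrow> 'b::real_normed_vector" and V :: "'e \<Rightarrow> real^'n"
  assumes S: "open S" "y \<in> S" and lin: "\<And>z. z \<in> S \<Longrightarrow> linear (F z)"
    and dF: "\<And>v. ((\<lambda>z. F z v) has_derivative F' v) (at y)" and dV: "(V has_derivative V') (at y)"
  shows "((\<lambda>z. F z (V z)) has_derivative (\<lambda>u. F' (V y) u + F y (V' u))) (at y)"
proof -
  have ex: "F z v = (\<Sum>i\<in>UNIV. (v $ i) *\<^sub>R F z (axis i 1))" if "z \<in> S" for z v
  proof -
    have "F z (\<Sum>i\<in>UNIV. v $ i *s axis i 1) = (\<Sum>i\<in>UNIV. (v $ i) *\<^sub>R F z (axis i 1))"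
      by (simp only: linear_sum[OF lin[OF that]] linear_scale[OF lin[OF that]] scalar_mult_eq_scaleR)
    then show ?thesis by (simp only: basis_expansion)
  qed
  have dVi: "((\<lambda>z. V z $ i) has_derivative (\<lambda>u. V' u $ i)) (at y)" for i
    by (rule bounded_linear.has_derivative[OF bounded_linear_vec_nth dV])
  have "((\<lambda>z. \<Sum>i\<in>UNIV. (V y $ i) *\<^sub>R F z (axis i 1)) has_derivative (\<lambda>u. \<Sum>i\<in>UNIV. (V y $ i) *\<^sub>R F' (axis i 1) u)) (at y)"
    by (intro has_derivative_sum has_derivative_scaleR_right dF)
  then have "((\<lambda>z. F z (V y)) has_derivative (\<lambda>u. \<Sum>i\<in>UNIV. (V y $ i) *\<^sub>R F' (axis i 1) u)) (at y)"
    by (rule has_derivative_transform_within_open[OF _ S]) (simp add: ex[symmetric])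
  then have F'_eq: "F' (V y) = (\<lambda>u. \<Sum>i\<in>UNIV. (V y $ i) *\<^sub>R F' (axis i 1) u)"
    by (rule has_derivative_unique[OF dF])
  have "((\<lambda>z. \<Sum>i\<in>UNIV. (V z $ i) *\<^sub>R F z (axis i 1)) has_derivative
     (\<lambda>u. \<Sum>i\<in>UNIV. (V y $ i) *\<^sub>R F' (axis i 1) u + (V' u $ i) *\<^sub>R F y (axis i 1))) (at y)"
    by (intro has_derivative_sum has_derivative_scaleR dF dVi)
  then have "((\<lambda>z. F z (V z)) has_derivative
     (\<lambda>u. \<Sum>i\<in>UNIV. (V y $ i) *\<^sub>R F' (axis i 1) u + (V' u $ i) *\<^sub>R F y (axis i 1))) (at y)"
    by (rule has_derivative_transform_within_open[OF _ S]) (simp add: ex[symmetric])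
  moreover have "(\<Sum>i\<in>UNIV. (V y $ i) *\<^sub>R F' (axis i 1) u + (V' u $ i) *\<^sub>R F y (axis i 1)) = F' (V y) u + F y (V' u)" for u
    by (simp add: F'_eq sum.distrib ex[OF S(2), of "V' u"])
  ultimately show ?thesis by simp
qed

lemma has_derivative_bilinear_family:
  fixes F :: "'e::real_normed_vector \<Rightarrow> real^'n \<Rightarrow> real^'k \<Rightarrow> 'b::real_normed_vector"
  assumes S: "open S" "y \<in> S" and lin: "\<And>z. z \<in> S \<Longrightarrow> bilinear (F z)"
    and dF: "\<And>v w. ((\<lambda>z. F z v w) has_derivative F' v w) (at y)"
    and dV: "(V has_derivative V') (at y)" and dW: "(W has_derivative W') (at y)"
  shows "((\<lambda>z. F z (V z) (W z)) has_derivative (\<lambda>u. F' (V y) (W y) u + F y (V' u) (W y) + F y (V y) (W' u))) (at y)"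
proof -
  have 1: "((\<lambda>z. F z v (W z)) has_derivative (\<lambda>u. F' v (W y) u + F y v (W' u))) (at y)" for v
    by (rule has_derivative_linear_family[OF S _ dF dW]) (use lin in \<open>simp add: bilinear_def\<close>)
  have "((\<lambda>z. F z (V z) (W z)) has_derivative (\<lambda>u. (F' (V y) (W y) u + F y (V y) (W' u)) + F y (V' u) (W y))) (at y)"
    by (rule has_derivative_linear_family[where F="\<lambda>z v. F z v (W z)", OF S _ 1 dV]) (use lin in \<open>simp add: bilinear_def\<close>)
  then show ?thesis by (simp add: add_ac)
qed

lemma linear_eq_axis:
  fixes f f' :: "real^'n \<Rightarrow> 'b::real_vector"
  assumes "linear f" "linear f'" "\<And>i. f (axis i 1) = f' (axis i 1)"
  shows "f v = f' v"
proof -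
  have "f (\<Sum>i\<in>UNIV. v $ i *s axis i 1) = f' (\<Sum>i\<in>UNIV. v $ i *s axis i 1)"
    by (simp only: linear_sum[OF assms(1)] linear_scale[OF assms(1)] linear_sum[OF assms(2)] linear_scale[OF assms(2)]
        scalar_mult_eq_scaleR assms(3))
  then show ?thesis by (simp only: basis_expansion)
qed

lemma frechet_derivative_linear_param:
  fixes F :: "'e::euclidean_space \<Rightarrow> 'v::real_vector \<Rightarrow> 'b::real_normed_vector"
  assumes S: "open S" "y \<in> S" and lin: "\<And>z. z \<in> S \<Longrightarrow> linear (F z)" and d: "\<And>v. (\<lambda>z. F z v) differentiable (at y)"
  shows "linear (\<lambda>v. frechet_derivative (\<lambda>z. F z v) (at y) u)"
proof (rule linearI)
  note D = has_frechet_derivative[OF d]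
  fix v w a
  have "((\<lambda>z. F z v + F z w) has_derivative (\<lambda>u. frechet_derivative (\<lambda>z. F z v) (at y) u + frechet_derivative (\<lambda>z. F z w) (at y) u)) (at y)"
    by (rule has_derivative_add[OF D D])
  then have "((\<lambda>z. F z (v + w)) has_derivative (\<lambda>u. frechet_derivative (\<lambda>z. F z v) (at y) u + frechet_derivative (\<lambda>z. F z w) (at y) u)) (at y)"
    by (rule has_derivative_transform_within_open[OF _ S]) (simp add: linear_add[OF lin])
  then show "frechet_derivative (\<lambda>z. F z (v + w)) (at y) u = frechet_derivative (\<lambda>z. F z v) (at y) u + frechet_derivative (\<lambda>z. F z w) (at y) u"
    by (simp add: frechet_derivative_eqI)
  have "((\<lambda>z. a *\<^sub>R F z v) has_derivative (\<lambda>u. a *\<^sub>R frechet_derivative (\<lambda>z. F z v) (at y) u)) (at y)"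
    by (rule has_derivative_scaleR_right[OF D])
  then have "((\<lambda>z. F z (a *\<^sub>R v)) has_derivative (\<lambda>u. a *\<^sub>R frechet_derivative (\<lambda>z. F z v) (at y) u)) (at y)"
    by (rule has_derivative_transform_within_open[OF _ S]) (simp add: linear_scale[OF lin])
  then show "frechet_derivative (\<lambda>z. F z (a *\<^sub>R v)) (at y) u = a *\<^sub>R frechet_derivative (\<lambda>z. F z v) (at y) u"
    by (simp add: frechet_derivative_eqI)
qed

context smooth_manifold
begin

definition chart_overlap where "chart_overlap c c' = cmap c ` (cdom c \<inter> cdom c')"

definition trans :: "('a, 'n) chart \<Rightarrow> ('a, 'n) chart \<Rightarrow> real^'n \<Rightarrow> real^'n"
  where "trans c c' = cmap c' \<circ> cinv c"

abbreviation J where "J c c' y \<equiv> frechet_derivative (trans c c') (at y)"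

text \<open>Second derivative of the transition map: the inhomogeneous term by which Christoffel
  symbols fail to be tensors.\<close>

abbreviation T2 where "T2 c c' y u v \<equiv> frechet_derivative (\<lambda>z. J c c' z v) (at y) u"

context
  fixes c c' assumes c: "c \<in> A" "c' \<in> A"
begin

lemma open_chart_overlap: "open (chart_overlap c c')"
  using open_cmap_image[OF c(1) chartD(1)[OF c(2)]] by (simp add: chart_overlap_def Int_commute)

lemma chart_overlap_subset: "chart_overlap c c' \<subseteq> cimg c"
  by (auto simp: chart_overlap_def)

lemma trans_cimg: "y \<in> chart_overlap c c' \<Longrightarrow> trans c c' y \<in> cimg c'"
  using chartD(6)[OF c(1)] by (auto simp: chart_overlap_def trans_def)

lemma smooth_trans: "smooth_on (trans c c') (chart_overlap c c')"
  using smooth_transition[OF c] by (simp add: chart_overlap_def trans_def)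

lemma smooth_J: "smooth_on (\<lambda>z. J c c' z v) (chart_overlap c c')"
  by (rule smooth_on_frechet[OF smooth_trans])

lemma linear_J: "y \<in> chart_overlap c c' \<Longrightarrow> linear (J c c' y)"
  by (rule frechet_derivative_linear[OF smooth_on_differentiable[OF smooth_trans]])

lemma T2_commute: "y \<in> chart_overlap c c' \<Longrightarrow> T2 c c' y u v = T2 c c' y v u"
  using frechet_derivative_commute[OF _ open_chart_overlap] smooth_trans by (metis smooth_on_def)

lemma T3_commute:
  assumes "y \<in> chart_overlap c c'"
  shows "frechet_derivative (\<lambda>z. T2 c c' z v w) (at y) u = frechet_derivative (\<lambda>z. T2 c c' z u w) (at y) v"
  using frechet_derivative_commute[OF _ open_chart_overlap assms, of "\<lambda>z. J c c' z w" v u] smooth_J[of w]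
  by (simp add: smooth_on_def)

lemma J_surj:
  assumes "y \<in> chart_overlap c c'" obtains v where "J c c' y v = w"
proof -
  obtain p where p: "y = cmap c p" "p \<in> cdom c" "p \<in> cdom c'" using assms by (auto simp: chart_overlap_def)
  show thesis
    by (rule that[of "trans_deriv c' c (cmap c' p) w"])
      (use trans_deriv_inverse[OF c(2,1) p(3,2)] p in \<open>simp add: trans_def\<close>)
qed

lemma has_derivative_trans: "y \<in> chart_overlap c c' \<Longrightarrow> (trans c c' has_derivative J c c' y) (at y)"
  by (rule smooth_on_has_derivative[OF smooth_trans])

end

end

section \<open>Christoffel symbols, curvature and Hessian as multilinear maps in a chart\<close>

context riemannian_manifold
begin

definition dg where "dg c y u v w = frechet_derivative (\<lambda>z. gc c z v w) (at y) u"

text \<open>The Christoffel symbols as a bilinear map of two vectors. In this form the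
  transformation laws are identities between multilinear maps instead of rearrangements of index
  sums.\<close>

definition Gam :: "('a, 'n) chart \<Rightarrow> real^'n \<Rightarrow> real^'n \<Rightarrow> real^'n \<Rightarrow> real^'n"
  where "Gam c y u v = (\<chi> k. \<Sum>i\<in>UNIV. \<Sum>j\<in>UNIV. christoffel A g c k i j y * u $ i * v $ j)"

lemma bilinear_Gam: "bilinear (Gam c y)"
  unfolding bilinear_def Gam_def
  by (auto intro!: linearI simp: vec_eq_iff sum.distrib[symmetric] sum_distrib_left algebra_simps)

lemma Gam_axis: "Gam c y (axis i 1) (axis j 1) = (\<chi> k. christoffel A g c k i j y)"
  by (simp add: Gam_def axis_def vec_eq_iff if_distrib[of "\<lambda>x. _ * x"] if_distrib[of "\<lambda>x. x * _"] cong: if_cong)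

lemma metric_nondegenerate:
  assumes c: "c \<in> A" "y \<in> cimg c" and e: "\<And>w. gc c y a w = gc c y b w" shows "a = b"
proof (rule ccontr)
  assume "a \<noteq> b"
  then have "gc c y (a - b) (a - b) > 0" using metric_coordD(3)[OF c] by simp
  then show False using e[of "a - b"] by (simp add: bilinear_lsub[OF metric_coordD(1)[OF c]])
qed

lemma gc_differentiable: "c \<in> A \<Longrightarrow> y \<in> cimg c \<Longrightarrow> (\<lambda>z. gc c z v w) differentiable (at y)"
  by (rule smooth_on_differentiable[OF metric_coordD(4)])

lemma linear_dg:
  assumes c: "c \<in> A" "y \<in> cimg c"
  shows "linear (\<lambda>u. dg c y u v w)" "linear (\<lambda>v. dg c y u v w)" "linear (\<lambda>w. dg c y u v w)"
proof -
  show "linear (\<lambda>u. dg c y u v w)" unfolding dg_def by (rule frechet_derivative_linear[OF gc_differentiable[OF c]])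
  show "linear (\<lambda>v. dg c y u v w)" unfolding dg_def
    by (rule frechet_derivative_linear_param[OF chartD(2)[OF c(1)] c(2), where F="\<lambda>z v. gc c z v w"])
      (use metric_coordD(1)[OF c(1)] gc_differentiable[OF c] in \<open>auto simp: bilinear_def\<close>)
  show "linear (\<lambda>w. dg c y u v w)" unfolding dg_def
    by (rule frechet_derivative_linear_param[OF chartD(2)[OF c(1)] c(2), where F="\<lambda>z w. gc c z v w"])
      (use metric_coordD(1)[OF c(1)] gc_differentiable[OF c] in \<open>auto simp: bilinear_def\<close>)
qed

text \<open>Pairing with the metric cancels the inverse metric in the Christoffel symbols. The
  result is the Koszul formula for coordinate fields, whose brackets vanish.\<close>

lemma koszul_axis:
  assumes c: "c \<in> A" "y \<in> cimg c"
  shows "2 * gc c y (Gam c y (axis i 1) (axis j 1)) (axis m 1) =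
     dg c y (axis i 1) (axis j 1) (axis m 1) + dg c y (axis j 1) (axis i 1) (axis m 1) - dg c y (axis m 1) (axis i 1) (axis j 1)"
proof -
  let ?S = "\<chi> m. dg c y (axis i 1) (axis j 1) (axis m 1) + dg c y (axis j 1) (axis i 1) (axis m 1) - dg c y (axis m 1) (axis i 1) (axis j 1)"
  have "partial_deriv i (\<lambda>z. gmat A g c z $ j $ l) y = dg c y (axis i 1) (axis j 1) (axis l 1)" for i j l
    by (simp add: partial_deriv_def dg_def gmat_def)
  then have "Gam c y (axis i 1) (axis j 1) = (1/2) *\<^sub>R (ginv A g c y *v ?S)"
    by (simp add: Gam_axis christoffel_def vec_eq_iff matrix_vector_mult_def)
  then have "gmat A g c y *v Gam c y (axis i 1) (axis j 1) = (1/2) *\<^sub>R ?S"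
    by (simp add: matrix_vector_mult_scaleR matrix_vector_mul_assoc ginv_mult[OF c])
  then have "gc c y (axis m 1) (Gam c y (axis i 1) (axis j 1)) = (1/2) * ?S $ m"
    by (simp add: metric_coord_matrix[OF c] inner_axis')
  then show ?thesis using metric_coordD(2)[OF c] by simp
qed

lemma koszul:
  assumes c: "c \<in> A" "y \<in> cimg c"
  shows "2 * gc c y (Gam c y u v) w = dg c y u v w + dg c y v u w - dg c y w u v"
proof -
  note lin = linear_dg[OF c] and b = metric_coordD(1)[OF c] and bG = bilinear_Gam[of c y]
  note ls = linear_add[OF lin(1)] linear_add[OF lin(2)] linear_add[OF lin(3)] linear_scale[OF lin(1)] linear_scale[OF lin(2)] linear_scale[OF lin(3)]
  note bs = bilinear_ladd[OF b] bilinear_radd[OF b] bilinear_lmul[OF b] bilinear_rmul[OF b]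
    bilinear_ladd[OF bG] bilinear_radd[OF bG] bilinear_lmul[OF bG] bilinear_rmul[OF bG]
  have L: "linear (\<lambda>u. 2 * gc c y (Gam c y u v) w)" "linear (\<lambda>v. 2 * gc c y (Gam c y u v) w)" "linear (\<lambda>w. 2 * gc c y (Gam c y u v) w)" for u v w
    by (auto intro!: linearI simp: bs algebra_simps)
  have R: "linear (\<lambda>u. dg c y u v w + dg c y v u w - dg c y w u v)" "linear (\<lambda>v. dg c y u v w + dg c y v u w - dg c y w u v)"
      "linear (\<lambda>w. dg c y u v w + dg c y v u w - dg c y w u v)" for u v w
    by (auto intro!: linearI simp: ls algebra_simps)
  have 1: "2 * gc c y (Gam c y (axis i 1) (axis j 1)) w = dg c y (axis i 1) (axis j 1) w + dg c y (axis j 1) (axis i 1) w - dg c y w (axis i 1) (axis j 1)" for i j w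
    by (rule linear_eq_axis[OF L(3) R(3) koszul_axis[OF c]])
  have 2: "2 * gc c y (Gam c y (axis i 1) v) w = dg c y (axis i 1) v w + dg c y v (axis i 1) w - dg c y w (axis i 1) v" for i v w
    by (rule linear_eq_axis[OF L(2) R(2) 1])
  show ?thesis by (rule linear_eq_axis[OF L(1) R(1) 2])
qed

lemma smooth_christoffel: "c \<in> A \<Longrightarrow> smooth_on (christoffel A g c k i j) (cimg c)"
  unfolding christoffel_def[abs_def] partial_deriv_def
  by (intro smooth_on_mult smooth_on_sum smooth_on_const smooth_on_add smooth_on_diff smooth_on_frechet
      smooth_ginv smooth_gmat chartD(2))

lemma smooth_Gam: "c \<in> A \<Longrightarrow> smooth_on (\<lambda>y. Gam c y u v) (cimg c)"
  by (rule smooth_on_componentwise)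
    (auto simp: Gam_def intro!: smooth_on_sum smooth_on_mult smooth_on_const smooth_christoffel chartD(2))

lemma metric_coord_trans:
  assumes c: "c \<in> A" "c' \<in> A" and y: "y \<in> chart_overlap c c'"
  shows "gc c y v w = gc c' (trans c c' y) (J c c' y v) (J c c' y w)"
proof -
  obtain p where p: "y = cmap c p" "p \<in> cdom c" "p \<in> cdom c'" using y by (auto simp: chart_overlap_def)
  show ?thesis using metric_coord_change[OF c p(2,3)] p chartD(6)[OF c(1)] by (simp add: trans_def)
qed

lemma dg_trans:
  assumes c: "c \<in> A" "c' \<in> A" and y: "y \<in> chart_overlap c c'"
  shows "dg c y u v w = dg c' (trans c c' y) (J c c' y u) (J c c' y v) (J c c' y w)
     + gc c' (trans c c' y) (T2 c c' y u v) (J c c' y w) + gc c' (trans c c' y) (J c c' y v) (T2 c c' y u w)"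
proof -
  note o = open_chart_overlap[OF c] and ty = trans_cimg[OF c]
  have d: "((\<lambda>z. gc c' (trans c c' z) a b) has_derivative (\<lambda>u. dg c' (trans c c' y) (J c c' y u) a b)) (at y)" for a b
    unfolding dg_def
    by (rule has_derivative_compose[OF has_derivative_trans[OF c y] has_frechet_derivative[OF gc_differentiable[OF c(2) ty[OF y]]]])
  have dJ: "((\<lambda>z. J c c' z a) has_derivative (\<lambda>u. T2 c c' y u a)) (at y)" for a
    by (rule smooth_on_has_derivative[OF smooth_J[OF c] y])
  have "((\<lambda>z. gc c' (trans c c' z) (J c c' z v) (J c c' z w)) has_derivative
    (\<lambda>u. dg c' (trans c c' y) (J c c' y u) (J c c' y v) (J c c' y w)
     + gc c' (trans c c' y) (T2 c c' y u v) (J c c' y w) + gc c' (trans c c' y) (J c c' y v) (T2 c c' y u w))) (at y)"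
    by (rule has_derivative_bilinear_family[OF o y _ d dJ dJ]) (rule metric_coordD(1)[OF c(2) ty])
  then have "((\<lambda>z. gc c z v w) has_derivative
    (\<lambda>u. dg c' (trans c c' y) (J c c' y u) (J c c' y v) (J c c' y w)
     + gc c' (trans c c' y) (T2 c c' y u v) (J c c' y w) + gc c' (trans c c' y) (J c c' y v) (T2 c c' y u w))) (at y)"
    by (rule has_derivative_transform_within_open[OF _ o y]) (rule metric_coord_trans[OF c, symmetric])
  then show ?thesis by (simp add: dg_def[of c] frechet_derivative_eqI)
qed

text \<open>Both sides are compared through the Koszul formula in the two charts. Transforming the
  derivatives of the metric produces six terms with \<open>T2\<close>; by symmetry of
  \<open>T2\<close> and of the metric four cancel and two add up, and nondegeneracy removes the
  pairing.\<close>

lemma Gam_trans: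
  assumes c: "c \<in> A" "c' \<in> A" and y: "y \<in> chart_overlap c c'"
  shows "J c c' y (Gam c y u v) = T2 c c' y u v + Gam c' (trans c c' y) (J c c' y u) (J c c' y v)"
proof (rule metric_nondegenerate[OF c(2) trans_cimg[OF c y]])
  fix w'
  obtain w where w: "w' = J c c' y w" using J_surj[OF c y] by metis
  have y1: "y \<in> cimg c" using y chart_overlap_subset[OF c] by blast
  note y2 = trans_cimg[OF c y]
  note b = metric_coordD(1)[OF c(2) y2] and s = metric_coordD(2)[OF c(2) y2]
  have "2 * gc c' (trans c c' y) (J c c' y (Gam c y u v)) w' = dg c y u v w + dg c y v u w - dg c y w u v"
    unfolding w metric_coord_trans[OF c y, symmetric] by (rule koszul[OF c(1) y1])
  also have "\<dots> = 2 * gc c' (trans c c' y) (Gam c' (trans c c' y) (J c c' y u) (J c c' y v)) w' + 2 * gc c' (trans c c' y) (T2 c c' y u v) w'"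
    unfolding koszul[OF c(2) y2] w dg_trans[OF c y]
    using T2_commute[OF c y, of v u] T2_commute[OF c y, of w u] T2_commute[OF c y, of w v]
      s[of "J c c' y v" "T2 c c' y u w"] s[of "J c c' y u" "T2 c c' y v w"]
    by (simp add: field_simps)
  finally show "gc c' (trans c c' y) (J c c' y (Gam c y u v)) w' =
     gc c' (trans c c' y) (T2 c c' y u v + Gam c' (trans c c' y) (J c c' y u) (J c c' y v)) w'"
    by (simp add: bilinear_ladd[OF b])
qed

definition dGam where "dGam c y u v w = frechet_derivative (\<lambda>z. Gam c z v w) (at y) u"

lemma has_derivative_Gam: "c \<in> A \<Longrightarrow> y \<in> cimg c \<Longrightarrow> ((\<lambda>z. Gam c z v w) has_derivative (\<lambda>u. dGam c y u v w)) (at y)"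
  unfolding dGam_def by (rule smooth_on_has_derivative[OF smooth_Gam])

lemma linear_dGam:
  assumes c: "c \<in> A" "y \<in> cimg c"
  shows "linear (\<lambda>u. dGam c y u v w)" "linear (\<lambda>v. dGam c y u v w)" "linear (\<lambda>w. dGam c y u v w)"
proof -
  note d = smooth_on_differentiable[OF smooth_Gam[OF c(1)] c(2)]
  show "linear (\<lambda>u. dGam c y u v w)" unfolding dGam_def by (rule frechet_derivative_linear[OF d])
  show "linear (\<lambda>v. dGam c y u v w)" unfolding dGam_def
    by (rule frechet_derivative_linear_param[OF chartD(2)[OF c(1)] c(2), where F="\<lambda>z v. Gam c z v w"])
      (use bilinear_Gam d in \<open>auto simp: bilinear_def\<close>)
  show "linear (\<lambda>w. dGam c y u v w)" unfolding dGam_def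
    by (rule frechet_derivative_linear_param[OF chartD(2)[OF c(1)] c(2), where F="\<lambda>z w. Gam c z v w"])
      (use bilinear_Gam d in \<open>auto simp: bilinear_def\<close>)
qed

definition Riem where
  "Riem c y u v w = dGam c y u v w - dGam c y v u w + Gam c y u (Gam c y v w) - Gam c y v (Gam c y u w)"

text \<open>Obtained by differentiating \<open>Gam_trans\<close> in direction \<open>u\<close>, with
  the product rule on either side.\<close>

lemma dGam_trans:
  assumes c: "c \<in> A" "c' \<in> A" and y: "y \<in> chart_overlap c c'"
  defines "y' \<equiv> trans c c' y" and "j \<equiv> J c c' y" and "t \<equiv> T2 c c' y"
  shows "t u (Gam c y v w) + j (dGam c y u v w) =
     frechet_derivative (\<lambda>z. T2 c c' z v w) (at y) u + dGam c' y' (j u) (j v) (j w)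
     + Gam c' y' (t u v) (j w) + Gam c' y' (j v) (t u w)"
proof -
  note o = open_chart_overlap[OF c] and ty = trans_cimg[OF c]
  have y1: "y \<in> cimg c" using y chart_overlap_subset[OF c] by blast
  have dJ: "((\<lambda>z. J c c' z a) has_derivative (\<lambda>u. t u a)) (at y)" for a
    unfolding t_def by (rule smooth_on_has_derivative[OF smooth_J[OF c] y])
  have L: "((\<lambda>z. J c c' z (Gam c z v w)) has_derivative (\<lambda>u. t u (Gam c y v w) + j (dGam c y u v w))) (at y)"
    unfolding j_def by (rule has_derivative_linear_family[OF o y linear_J[OF c] dJ has_derivative_Gam[OF c(1) y1]])
  have d: "((\<lambda>z. Gam c' (trans c c' z) a b) has_derivative (\<lambda>u. dGam c' y' (j u) a b)) (at y)" for a b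
    unfolding y'_def j_def
    by (rule has_derivative_compose[OF has_derivative_trans[OF c y] has_derivative_Gam[OF c(2) ty[OF y]]])
  have "((\<lambda>z. Gam c' (trans c c' z) (J c c' z v) (J c c' z w)) has_derivative
    (\<lambda>u. dGam c' y' (j u) (j v) (j w) + Gam c' y' (t u v) (j w) + Gam c' y' (j v) (t u w))) (at y)"
    unfolding j_def y'_def
    by (rule has_derivative_bilinear_family[OF o y bilinear_Gam d[unfolded j_def y'_def] dJ dJ])
  from has_derivative_add[OF smooth_on_has_derivative[OF smooth_on_frechet[OF smooth_J[OF c]] y] this]
  have "((\<lambda>z. T2 c c' z v w + Gam c' (trans c c' z) (J c c' z v) (J c c' z w)) has_derivative
    (\<lambda>u. frechet_derivative (\<lambda>z. T2 c c' z v w) (at y) u +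
      (dGam c' y' (j u) (j v) (j w) + Gam c' y' (t u v) (j w) + Gam c' y' (j v) (t u w)))) (at y)" .
  then have "((\<lambda>z. J c c' z (Gam c z v w)) has_derivative
    (\<lambda>u. frechet_derivative (\<lambda>z. T2 c c' z v w) (at y) u +
      (dGam c' y' (j u) (j v) (j w) + Gam c' y' (t u v) (j w) + Gam c' y' (j v) (t u w)))) (at y)"
    by (rule has_derivative_transform_within_open[OF _ o y]) (rule Gam_trans[OF c, symmetric])
  from fun_cong[OF has_derivative_unique[OF L this], of u] show ?thesis by (simp add: add.assoc)
qed

text \<open>Exchanging \<open>u\<close> and \<open>v\<close> and subtracting removes the third
  derivative of the transition map, which is symmetric, and the terms with \<open>T2\<close> cancel
  in pairs; only tensorial terms survive.\<close>

lemma Riem_trans: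
  assumes c: "c \<in> A" "c' \<in> A" and y: "y \<in> chart_overlap c c'"
  shows "J c c' y (Riem c y u v w) = Riem c' (trans c c' y) (J c c' y u) (J c c' y v) (J c c' y w)"
proof -
  define j where "j = J c c' y"
  define t where "t a b = T2 c c' y a b" for a b
  define y' where "y' = trans c c' y"
  have bG: "bilinear (Gam c' y')" by (rule bilinear_Gam)
  have lj: "linear j" unfolding j_def by (rule linear_J[OF c y])
  have G: "j (Gam c y a b) = t a b + Gam c' y' (j a) (j b)" for a b
    unfolding j_def t_def y'_def by (rule Gam_trans[OF c y])
  have tc: "t a b = t b a" for a b by (simp only: t_def T2_commute[OF c y, of a b])
  have D: "t u (Gam c y v w) + j (dGam c y u v w) = frechet_derivative (\<lambda>z. T2 c c' z v w) (at y) u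
     + dGam c' y' (j u) (j v) (j w) + Gam c' y' (t u v) (j w) + Gam c' y' (j v) (t u w)" for u v w
    using dGam_trans[OF c y, where u=u and v=v and w=w] by (simp only: j_def t_def y'_def)
  have 3: "frechet_derivative (\<lambda>z. T2 c c' z v w) (at y) u = frechet_derivative (\<lambda>z. T2 c c' z u w) (at y) v"
    by (rule T3_commute[OF c y])
  have "j (Riem c y u v w) = j (dGam c y u v w) - j (dGam c y v u w) + (t u (Gam c y v w) + Gam c' y' (j u) (t v w + Gam c' y' (j v) (j w)))
     - (t v (Gam c y u w) + Gam c' y' (j v) (t u w + Gam c' y' (j u) (j w)))"
    unfolding Riem_def by (simp add: linear_add[OF lj] linear_diff[OF lj] G)
  also have "\<dots> = (t u (Gam c y v w) + j (dGam c y u v w)) - (t v (Gam c y u w) + j (dGam c y v u w))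
     + Gam c' y' (j u) (t v w) + Gam c' y' (j u) (Gam c' y' (j v) (j w)) - Gam c' y' (j v) (t u w) - Gam c' y' (j v) (Gam c' y' (j u) (j w))"
    by (simp add: bilinear_radd[OF bG])
  also have "\<dots> = Riem c' y' (j u) (j v) (j w)"
    unfolding D 3 Riem_def using tc[of u v] by simp
  finally show ?thesis unfolding j_def y'_def .
qed

lemma linear_Riem:
  assumes c: "c \<in> A" "y \<in> cimg c"
  shows "linear (\<lambda>u. Riem c y u v w)" "linear (\<lambda>v. Riem c y u v w)" "linear (\<lambda>w. Riem c y u v w)"
proof -
  note lin = linear_dGam[OF c] and bG = bilinear_Gam[of c y]
  note ls = linear_add[OF lin(1)] linear_add[OF lin(2)] linear_add[OF lin(3)] linear_scale[OF lin(1)] linear_scale[OF lin(2)] linear_scale[OF lin(3)]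
    bilinear_ladd[OF bG] bilinear_radd[OF bG] bilinear_lmul[OF bG] bilinear_rmul[OF bG]
  show "linear (\<lambda>u. Riem c y u v w)" "linear (\<lambda>v. Riem c y u v w)" "linear (\<lambda>w. Riem c y u v w)"
    unfolding Riem_def by (auto intro!: linearI simp: ls algebra_simps)
qed

definition Ric_loc where "Ric_loc c y v w = (\<Sum>i\<in>UNIV. Riem c y (axis i 1) v w $ i)"

lemma bilinear_Ric_loc:
  assumes c: "c \<in> A" "y \<in> cimg c" shows "bilinear (Ric_loc c y)"
proof -
  note lin = linear_Riem[OF c]
  show ?thesis
    unfolding bilinear_def Ric_loc_def
    by (auto intro!: linearI simp: linear_add[OF lin(2)] linear_add[OF lin(3)] linear_scale[OF lin(2)] linear_scale[OF lin(3)]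
        sum.distrib sum_distrib_left)
qed

text \<open>By \<open>Riem_trans\<close> the endomorphism \<open>u \<mapsto> R(u, v) w\<close> is
  conjugated by the Jacobian, which does not change its trace.\<close>

lemma Ric_loc_trans:
  assumes c: "c \<in> A" "c' \<in> A" and y: "y \<in> chart_overlap c c'"
  shows "Ric_loc c y v w = Ric_loc c' (trans c c' y) (J c c' y v) (J c c' y w)"
proof -
  define j where "j = J c c' y"
  define y' where "y' = trans c c' y"
  let ?L = "\<lambda>u. Riem c y u v w" let ?L' = "\<lambda>u. Riem c' y' u (j v) (j w)"
  have lj: "linear j" unfolding j_def by (rule linear_J[OF c y])
  have y1: "y \<in> cimg c" "y' \<in> cimg c'" using y chart_overlap_subset[OF c] trans_cimg[OF c y] by (auto simp: y'_def)
  have lL: "linear ?L" "linear ?L'" using linear_Riem[OF c(1) y1(1)] linear_Riem[OF c(2) y1(2)] by auto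
  have tr: "trace (matrix f) = (\<Sum>i\<in>UNIV. f (axis i 1) $ i)" for f :: "real^'n \<Rightarrow> real^'n"
    by (simp add: trace_def matrix_def)
  obtain p where p: "y = cmap c p" "p \<in> cdom c" "p \<in> cdom c'" using y by (auto simp: chart_overlap_def)
  define k where "k = trans_deriv c' c (cmap c' p)"
  have kj: "k (j u) = u" "j (k u) = u" for u
    using trans_deriv_inverse[OF c p(2,3)] trans_deriv_inverse[OF c(2,1) p(3,2)] p(1) by (simp_all add: k_def j_def trans_def)
  have lk: "linear k" unfolding k_def by (rule trans_deriv_linear[OF c(2,1) p(3,2)])
  have "?L = k \<circ> (?L' \<circ> j)"
  proof
    fix u
    have "j (?L u) = ?L' (j u)" using Riem_trans[OF c y, of u v w] by (simp add: j_def y'_def)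
    then have "k (j (?L u)) = k (?L' (j u))" by simp
    then show "?L u = (k \<circ> (?L' \<circ> j)) u" by (simp add: kj)
  qed
  then have "matrix ?L = matrix k ** (matrix ?L' ** matrix j)"
    using lj lk lL by (simp add: matrix_compose linear_compose)
  then have "trace (matrix ?L) = trace (matrix k ** (matrix ?L' ** matrix j))" by simp
  also have "\<dots> = trace ((matrix ?L' ** matrix j) ** matrix k)" by (rule trace_mul_sym)
  also have "(matrix ?L' ** matrix j) ** matrix k = matrix (?L' \<circ> (j \<circ> k))"
    using lj lk lL by (simp add: matrix_compose linear_compose matrix_mul_assoc)
  also have "?L' \<circ> (j \<circ> k) = ?L'" using kj by (simp add: fun_eq_iff)
  finally show ?thesis by (simp add: tr Ric_loc_def j_def y'_def)
qed

lemma riem_coord_Riem: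
  assumes c: "c \<in> A" "y \<in> cimg c"
  shows "riem_coord A g c l k i j y = Riem c y (axis i 1) (axis j 1) (axis k 1) $ l"
proof -
  have 1: "partial_deriv i (christoffel A g c l j k) y = dGam c y (axis i 1) (axis j 1) (axis k 1) $ l" for i j k
  proof -
    have "((\<lambda>z. Gam c z (axis j 1) (axis k 1) $ l) has_derivative (\<lambda>u. dGam c y u (axis j 1) (axis k 1) $ l)) (at y)"
      by (rule bounded_linear.has_derivative[OF bounded_linear_vec_nth has_derivative_Gam[OF c]])
    then show ?thesis unfolding partial_deriv_def by (simp add: Gam_axis frechet_derivative_eqI)
  qed
  have 2: "Gam c y (axis i 1) v $ l = (\<Sum>m\<in>UNIV. christoffel A g c l i m y * v $ m)" for i v
    by (simp add: Gam_def axis_def if_distrib[of "\<lambda>x. _ * x"] if_distrib[of "\<lambda>x. x * _"] cong: if_cong)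
      (subst sum.swap, simp add: if_distrib[of "\<lambda>x. _ * x"] if_distrib[of "\<lambda>x. x * _"] cong: if_cong)
  show ?thesis
    unfolding riem_coord_def Riem_def 1 by (simp add: 2 Gam_axis sum_subtractf)
qed

lemma linear_form_expand2:
  fixes f :: "real^'n \<Rightarrow> real^'n \<Rightarrow> real"
  assumes "bilinear f"
  shows "f u v = (\<Sum>i\<in>UNIV. \<Sum>j\<in>UNIV. f (axis i 1) (axis j 1) * u $ i * v $ j)"
proof -
  have "f (\<Sum>i\<in>UNIV. u $ i *s axis i 1) (\<Sum>j\<in>UNIV. v $ j *s axis j 1)
     = (\<Sum>(i,j)\<in>UNIV \<times> UNIV. f (u $ i *s axis i 1) (v $ j *s axis j 1))"
    by (rule bilinear_sum[OF assms])
  also have "\<dots> = (\<Sum>i\<in>UNIV. \<Sum>j\<in>UNIV. f (axis i 1) (axis j 1) * u $ i * v $ j)"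
    by (simp add: sum.cartesian_product scalar_mult_eq_scaleR bilinear_lmul[OF assms] bilinear_rmul[OF assms] mult_ac)
  finally show ?thesis by (simp only: basis_expansion)
qed

text \<open>\<open>ricci\<close> is evaluated in a chart chosen separately at each point, with no
  continuity of the choice. Using one fixed chart near a point is what makes continuity of the Ricci
  term accessible; \<open>hessian_chart\<close> serves the same purpose.\<close>

lemma ricci_chart:
  assumes c: "c \<in> A" "p \<in> cdom c" and X: "X \<in> tangent_space A p" "Y \<in> tangent_space A p"
  shows "ricci A g p X Y = Ric_loc c (cmap c p) (vec_comp c X) (vec_comp c Y)"
proof -
  let ?c = "chart_at A p"
  note c0 = chart_at[of p]
  have y: "cmap ?c p \<in> chart_overlap ?c c" using c c0 by (auto simp: chart_overlap_def)
  have y0: "cmap ?c p \<in> cimg ?c" using c0 by auto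
  note bil = bilinear_Ric_loc[OF c0(1) y0]
  have "ricci A g p X Y = (\<Sum>j\<in>UNIV. \<Sum>k\<in>UNIV. Ric_loc ?c (cmap ?c p) (axis j 1) (axis k 1) * vec_comp ?c X $ j * vec_comp ?c Y $ k)"
    by (simp add: ricci_def Let_def riem_coord_Riem[OF c0(1) y0] Ric_loc_def)
  also have "\<dots> = Ric_loc ?c (cmap ?c p) (vec_comp ?c X) (vec_comp ?c Y)"
    by (rule linear_form_expand2[OF bil, symmetric])
  also have "\<dots> = Ric_loc c (cmap c p) (vec_comp c X) (vec_comp c Y)"
    unfolding Ric_loc_trans[OF c0(1) c(1) y]
    using vec_comp_change[OF X(1) c0(1) c(1) c0(2) c(2)] vec_comp_change[OF X(2) c0(1) c(1) c0(2) c(2)] chartD(6)[OF c0]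
    by (simp add: trans_def)
  finally show ?thesis .
qed

lemma continuous_Ric_loc:
  assumes c: "c \<in> A" and p: "continuous_on S p" "p ` S \<subseteq> cimg c" and v: "continuous_on S v" and w: "continuous_on S w"
  shows "continuous_on S (\<lambda>x. Ric_loc c (p x) (v x) (w x))"
proof -
  note bil = bilinear_Ric_loc[OF c]
  have G: "continuous_on (cimg c) (\<lambda>y. Gam c y a b)" for a b by (rule smooth_on_continuous[OF smooth_Gam[OF c]])
  have ch: "continuous_on (cimg c) (\<lambda>y. christoffel A g c k i j y)" for k i j by (rule smooth_on_continuous[OF smooth_christoffel[OF c]])
  have dG: "continuous_on (cimg c) (\<lambda>y. dGam c y u a b)" for u a b
    unfolding dGam_def by (rule smooth_on_continuous[OF smooth_on_frechet[OF smooth_Gam[OF c]]])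
  have GG: "continuous_on (cimg c) (\<lambda>y. Gam c y u (Gam c y a b))" for u a b
    by (subst Gam_def) (intro continuous_intros ch G)
  have "continuous_on (cimg c) (\<lambda>y. Ric_loc c y a b)" for a b
    unfolding Ric_loc_def Riem_def by (intro continuous_intros dG GG)
  then have "continuous_on S (\<lambda>x. \<Sum>i\<in>UNIV. \<Sum>j\<in>UNIV. Ric_loc c (p x) (axis i 1) (axis j 1) * v x $ i * w x $ j)"
    by (intro continuous_intros v w continuous_on_compose2[OF _ p])
  then show ?thesis
    by (rule continuous_on_eq) (use p(2) linear_form_expand2[OF bil] in auto)
qed

definition Hess_loc where
  "Hess_loc f c y u v = frechet_derivative (\<lambda>z. frechet_derivative (f \<circ> cinv c) (at z) v) (at y) u
     - frechet_derivative (f \<circ> cinv c) (at y) (Gam c y u v)"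

context
  fixes f :: "'a \<Rightarrow> real" assumes f: "smooth_fun A UNIV f"
begin

lemma smooth_f: "c \<in> A \<Longrightarrow> smooth_on (f \<circ> cinv c) (cimg c)"
  using f by (simp add: smooth_fun_def)

lemma df_trans:
  assumes c: "c \<in> A" "c' \<in> A" and y: "y \<in> chart_overlap c c'"
  shows "frechet_derivative (f \<circ> cinv c) (at y) v = frechet_derivative (f \<circ> cinv c') (at (trans c c' y)) (J c c' y v)"
proof -
  have "((\<lambda>z. (f \<circ> cinv c') (trans c c' z)) has_derivative (\<lambda>v. frechet_derivative (f \<circ> cinv c') (at (trans c c' y)) (J c c' y v))) (at y)"
    by (rule has_derivative_compose[OF has_derivative_trans[OF c y] smooth_on_has_derivative[OF smooth_f[OF c(2)] trans_cimg[OF c y]]])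
  then have "((f \<circ> cinv c) has_derivative (\<lambda>v. frechet_derivative (f \<circ> cinv c') (at (trans c c' y)) (J c c' y v))) (at y)"
    by (rule has_derivative_transform_within_open[OF _ open_chart_overlap[OF c] y])
      (use chartD(6)[OF c(1)] chartD(6)[OF c(2)] in \<open>auto simp: chart_overlap_def trans_def\<close>)
  then show ?thesis by (simp add: frechet_derivative_eqI)
qed

text \<open>The second derivative of a composite contains the derivative of \<open>f\<close> along
  \<open>T2\<close>, and \<open>Gam_trans\<close> contributes the same term with the opposite
  sign.\<close>

lemma Hess_loc_trans:
  assumes c: "c \<in> A" "c' \<in> A" and y: "y \<in> chart_overlap c c'"
  shows "Hess_loc f c y u v = Hess_loc f c' (trans c c' y) (J c c' y u) (J c c' y v)"
proof -
  let ?F = "f \<circ> cinv c'" let ?y = "trans c c' y"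
  note o = open_chart_overlap[OF c] and ty = trans_cimg[OF c]
  have lF: "linear (frechet_derivative ?F (at z))" if "z \<in> cimg c'" for z
    by (rule frechet_derivative_linear[OF smooth_on_differentiable[OF smooth_f[OF c(2)] that]])
  have d: "((\<lambda>z. frechet_derivative ?F (at (trans c c' z)) a) has_derivative
      (\<lambda>u. frechet_derivative (\<lambda>z. frechet_derivative ?F (at z) a) (at ?y) (J c c' y u))) (at y)" for a
    by (rule has_derivative_compose[OF has_derivative_trans[OF c y] smooth_on_has_derivative[OF smooth_on_frechet[OF smooth_f[OF c(2)]] ty[OF y]]])
  have dJ: "((\<lambda>z. J c c' z v) has_derivative (\<lambda>u. T2 c c' y u v)) (at y)"
    by (rule smooth_on_has_derivative[OF smooth_J[OF c] y])
  have "((\<lambda>z. frechet_derivative ?F (at (trans c c' z)) (J c c' z v)) has_derivative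
     (\<lambda>u. frechet_derivative (\<lambda>z. frechet_derivative ?F (at z) (J c c' y v)) (at ?y) (J c c' y u) + frechet_derivative ?F (at ?y) (T2 c c' y u v))) (at y)"
    by (rule has_derivative_linear_family[OF o y lF[OF ty] d dJ])
  then have "((\<lambda>z. frechet_derivative (f \<circ> cinv c) (at z) v) has_derivative
     (\<lambda>u. frechet_derivative (\<lambda>z. frechet_derivative ?F (at z) (J c c' y v)) (at ?y) (J c c' y u) + frechet_derivative ?F (at ?y) (T2 c c' y u v))) (at y)"
    by (rule has_derivative_transform_within_open[OF _ o y]) (rule df_trans[OF c, symmetric])
  then show ?thesis
    unfolding Hess_loc_def df_trans[OF c y] Gam_trans[OF c y] linear_add[OF lF[OF ty[OF y]]]
    by (simp add: frechet_derivative_eqI)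
qed

lemma bilinear_Hess_loc:
  assumes c: "c \<in> A" "y \<in> cimg c" shows "bilinear (Hess_loc f c y)"
proof -
  have l1: "linear (frechet_derivative (f \<circ> cinv c) (at z))" if "z \<in> cimg c" for z
    by (rule frechet_derivative_linear[OF smooth_on_differentiable[OF smooth_f[OF c(1)] that]])
  have d: "(\<lambda>z. frechet_derivative (f \<circ> cinv c) (at z) v) differentiable (at y)" for v
    by (rule smooth_on_differentiable[OF smooth_on_frechet[OF smooth_f[OF c(1)]] c(2)])
  have l2: "linear (\<lambda>v. frechet_derivative (\<lambda>z. frechet_derivative (f \<circ> cinv c) (at z) v) (at y) u)" for u
    by (rule frechet_derivative_linear_param[OF chartD(2)[OF c(1)] c(2) l1 d])
  note bG = bilinear_Gam[of c y]
  note ls = linear_add[OF l1[OF c(2)]] linear_scale[OF l1[OF c(2)]] linear_add[OF l2] linear_scale[OF l2]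
    linear_add[OF frechet_derivative_linear[OF d]] linear_scale[OF frechet_derivative_linear[OF d]]
    bilinear_ladd[OF bG] bilinear_radd[OF bG] bilinear_lmul[OF bG] bilinear_rmul[OF bG]
  show ?thesis
    unfolding bilinear_def Hess_loc_def by (auto intro!: linearI simp: ls algebra_simps)
qed

lemma hessian_chart:
  assumes c: "c \<in> A" "p \<in> cdom c" and X: "X \<in> tangent_space A p" "Y \<in> tangent_space A p"
  shows "hessian A g f p X Y = Hess_loc f c (cmap c p) (vec_comp c X) (vec_comp c Y)"
proof -
  let ?c = "chart_at A p" let ?y = "cmap ?c p" let ?F = "f \<circ> cinv ?c"
  note c0 = chart_at[of p]
  have y: "?y \<in> chart_overlap ?c c" using c c0 by (auto simp: chart_overlap_def)
  have y0: "?y \<in> cimg ?c" using c0 by auto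
  have lF: "linear (frechet_derivative ?F (at ?y))"
    by (rule frechet_derivative_linear[OF smooth_on_differentiable[OF smooth_f[OF c0(1)] y0]])
  have 1: "(\<Sum>k\<in>UNIV. christoffel A g ?c k i j ?y * partial_deriv k ?F ?y) = frechet_derivative ?F (at ?y) (Gam ?c ?y (axis i 1) (axis j 1))" for i j
  proof -
    have "frechet_derivative ?F (at ?y) (\<Sum>k\<in>UNIV. (Gam ?c ?y (axis i 1) (axis j 1)) $ k *s axis k 1)
       = (\<Sum>k\<in>UNIV. christoffel A g ?c k i j ?y * partial_deriv k ?F ?y)"
      unfolding Gam_axis partial_deriv_def
      by (simp only: linear_sum[OF lF] linear_scale[OF lF] scalar_mult_eq_scaleR vec_lambda_beta real_scaleR_def)
    then show ?thesis by (simp only: basis_expansion)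
  qed
  have "hessian A g f p X Y = (\<Sum>i\<in>UNIV. \<Sum>j\<in>UNIV. Hess_loc f ?c ?y (axis i 1) (axis j 1) * vec_comp ?c X $ i * vec_comp ?c Y $ j)"
    unfolding hessian_def Let_def 1 unfolding Hess_loc_def partial_deriv_def ..
  also have "\<dots> = Hess_loc f ?c ?y (vec_comp ?c X) (vec_comp ?c Y)"
    by (rule linear_form_expand2[OF bilinear_Hess_loc[OF c0(1) y0], symmetric])
  also have "\<dots> = Hess_loc f c (cmap c p) (vec_comp c X) (vec_comp c Y)"
    unfolding Hess_loc_trans[OF c0(1) c(1) y]
    using vec_comp_change[OF X(1) c0(1) c(1) c0(2) c(2)] vec_comp_change[OF X(2) c0(1) c(1) c0(2) c(2)] chartD(6)[OF c0]
    by (simp add: trans_def)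
  finally show ?thesis .
qed

lemma continuous_Hess_loc:
  assumes c: "c \<in> A" and p: "continuous_on S p" "p ` S \<subseteq> cimg c" and v: "continuous_on S v" and w: "continuous_on S w"
  shows "continuous_on S (\<lambda>x. Hess_loc f c (p x) (v x) (w x))"
proof -
  let ?F = "f \<circ> cinv c"
  have ex: "frechet_derivative ?F (at y) a = (\<Sum>k\<in>UNIV. a $ k * frechet_derivative ?F (at y) (axis k 1))" if "y \<in> cimg c" for y a
  proof -
    have lF: "linear (frechet_derivative ?F (at y))"
      by (rule frechet_derivative_linear[OF smooth_on_differentiable[OF smooth_f[OF c] that]])
    have "frechet_derivative ?F (at y) (\<Sum>k\<in>UNIV. a $ k *s axis k 1) = (\<Sum>k\<in>UNIV. a $ k * frechet_derivative ?F (at y) (axis k 1))"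
      by (simp only: linear_sum[OF lF] linear_scale[OF lF] scalar_mult_eq_scaleR real_scaleR_def)
    then show ?thesis by (simp only: basis_expansion)
  qed
  have d1: "continuous_on (cimg c) (\<lambda>y. frechet_derivative ?F (at y) a)" for a
    by (rule smooth_on_continuous[OF smooth_on_frechet[OF smooth_f[OF c]]])
  have d2: "continuous_on (cimg c) (\<lambda>y. frechet_derivative (\<lambda>z. frechet_derivative ?F (at z) a) (at y) b)" for a b
    by (rule smooth_on_continuous[OF smooth_on_frechet[OF smooth_on_frechet[OF smooth_f[OF c]]]])
  have G: "continuous_on (cimg c) (\<lambda>y. Gam c y a b)" for a b by (rule smooth_on_continuous[OF smooth_Gam[OF c]])
  have "continuous_on (cimg c) (\<lambda>y. \<Sum>k\<in>UNIV. Gam c y a b $ k * frechet_derivative ?F (at y) (axis k 1))" for a b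
    by (intro continuous_intros G d1)
  then have "continuous_on (cimg c) (\<lambda>y. frechet_derivative ?F (at y) (Gam c y a b))" for a b
    by (rule continuous_on_eq) (use ex in auto)
  then have "continuous_on (cimg c) (\<lambda>y. Hess_loc f c y a b)" for a b
    unfolding Hess_loc_def by (intro continuous_intros d2)
  then have "continuous_on S (\<lambda>x. \<Sum>i\<in>UNIV. \<Sum>j\<in>UNIV. Hess_loc f c (p x) (axis i 1) (axis j 1) * v x $ i * w x $ j)"
    by (intro continuous_intros v w continuous_on_compose2[OF _ p])
  then show ?thesis
    by (rule continuous_on_eq) (use p(2) linear_form_expand2[OF bilinear_Hess_loc[OF c]] in auto)
qed

end

end

subsection \<open>Smoothing Lipschitz functions\<close>

context smooth_manifold
begin

lemma smooth_fun_const: "smooth_fun A W (\<lambda>q. k)"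
  unfolding smooth_fun_def comp_def by (simp add: smooth_on_const)

lemma smooth_fun_add:
  "open W \<Longrightarrow> smooth_fun A W \<phi> \<Longrightarrow> smooth_fun A W \<psi> \<Longrightarrow> smooth_fun A W (\<lambda>q. \<phi> q + \<psi> q)"
  using smooth_on_add[OF open_cmap_image] unfolding smooth_fun_def comp_def by blast

lemma smooth_fun_mult:
  fixes \<phi> :: "'a \<Rightarrow> real"
  shows "open W \<Longrightarrow> smooth_fun A W \<phi> \<Longrightarrow> smooth_fun A W \<psi> \<Longrightarrow> smooth_fun A W (\<lambda>q. \<phi> q * \<psi> q)"
  using smooth_on_mult[OF open_cmap_image] unfolding smooth_fun_def comp_def by blast

lemma smooth_fun_diff:
  "open W \<Longrightarrow> smooth_fun A W \<phi> \<Longrightarrow> smooth_fun A W \<psi> \<Longrightarrow> smooth_fun A W (\<lambda>q. \<phi> q - \<psi> q)"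
  using smooth_on_diff[OF open_cmap_image] unfolding smooth_fun_def comp_def by blast

lemma smooth_fun_sum:
  assumes "open W"
  shows "(\<And>i. i \<in> I \<Longrightarrow> smooth_fun A W (\<phi> i)) \<Longrightarrow> smooth_fun A W (\<lambda>q. \<Sum>i\<in>I. \<phi> i q)"
  by (induction I rule: infinite_finite_induct) (auto simp: smooth_fun_const intro!: smooth_fun_add[OF assms])

lemma smooth_fun_prod:
  fixes \<phi> :: "'i \<Rightarrow> 'a \<Rightarrow> real"
  assumes "open W"
  shows "(\<And>i. i \<in> I \<Longrightarrow> smooth_fun A W (\<phi> i)) \<Longrightarrow> smooth_fun A W (\<lambda>q. \<Prod>i\<in>I. \<phi> i q)"
  by (induction I rule: infinite_finite_induct) (auto simp: smooth_fun_const intro!: smooth_fun_mult[OF assms])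

lemma smooth_near_fun: "smooth_fun A UNIV \<phi> \<Longrightarrow> smooth_near A p \<phi>"
  unfolding smooth_near_def by blast

lemma smooth_fun_pull:
  assumes c: "c \<in> A" and F: "smooth_on F (cimg c)"
  shows "smooth_fun A (cdom c) (\<lambda>q. F (cmap c q))"
  by (rule smooth_fun_chartI[OF c chartD(1)[OF c] order_refl smooth_on_cong[OF chartD(2)[OF c] _ F]])
    (use chartD(7)[OF c] in auto)

text \<open>In a Hausdorff space the compact preimage of \<open>S\<close> is closed. So two open
  sets cover the manifold: the chart domain, where smoothness is read off, and the complement of
  that preimage, where the function is 0.\<close>

lemma smooth_fun_extend:
  fixes F :: "real^'n \<Rightarrow> real"
  assumes c: "c \<in> A" and F: "smooth_on F (cimg c)" and S: "compact S" "S \<subseteq> cimg c" and z: "\<And>y. y \<notin> S \<Longrightarrow> F y = 0"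
  shows "smooth_fun A UNIV (\<lambda>q. if q \<in> cdom c then F (cmap c q) else 0)" (is "smooth_fun A UNIV ?f")
proof (rule smooth_fun_local)
  fix p
  show "\<exists>U. open U \<and> p \<in> U \<and> smooth_fun A U ?f"
  proof (cases "p \<in> cdom c")
    case True
    have "smooth_fun A (cdom c) ?f"
    proof (rule smooth_fun_chartI[OF c chartD(1)[OF c] order_refl])
      show "smooth_on (?f \<circ> cinv c) (cimg c)"
        by (rule smooth_on_cong[OF chartD(2)[OF c] _ F]) (use chartD(7,8)[OF c] in auto)
    qed
    then show ?thesis using True chartD(1)[OF c] by blast
  next
    case False
    let ?U = "- (cinv c ` S)"
    have "compact (cinv c ` S)" by (intro compact_continuous_image continuous_on_subset[OF chartD(4)[OF c]] S)
    then have U: "open ?U" by (simp add: compact_imp_closed open_Compl)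
    have "?f q = 0" if q: "q \<in> ?U" for q
    proof (cases "q \<in> cdom c")
      case True
      have "cmap c q \<notin> S"
      proof
        assume "cmap c q \<in> S"
        then have "cinv c (cmap c q) \<in> cinv c ` S" by blast
        then show False using q chartD(6)[OF c True] by simp
      qed
      then show ?thesis using z by simp
    qed simp
    then have "smooth_fun A ?U ?f"
      unfolding smooth_fun_def
    proof (intro ballI)
      fix c' assume 0: "\<And>q. q \<in> ?U \<Longrightarrow> ?f q = 0" and c': "c' \<in> A"
      show "smooth_on (?f \<circ> cinv c') (cmap c' ` (?U \<inter> cdom c'))"
        by (rule smooth_on_cong[OF open_cmap_image[OF c' U] _ smooth_on_const[of 0]])
          (use 0 chartD(6)[OF c'] in fastforce)
    qed
    moreover have "p \<in> ?U" using False chartD(8)[OF c] S(2) by auto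
    ultimately show ?thesis using U by blast
  qed
qed

context
  fixes p X assumes X: "X \<in> tangent_space A p"
begin

lemma tangent_apply: "smooth_near A p \<phi> \<Longrightarrow> c \<in> A \<Longrightarrow> p \<in> cdom c \<Longrightarrow> X \<phi> = frechet_derivative (\<phi> \<circ> cinv c) (at (cmap c p)) (vec_comp c X)"
  using chart_vec_apply[of p \<phi> c "vec_comp c X"] tangent_spaceE[OF X] by simp

lemma tangent_cong:
  assumes s: "smooth_near A p \<phi>" "smooth_near A p \<psi>" and U: "open U" "p \<in> U" "\<And>q. q \<in> U \<Longrightarrow> \<phi> q = \<psi> q"
  shows "X \<phi> = X \<psi>"
proof -
  let ?c = "chart_at A p"
  note c = chart_at[of p]
  have "frechet_derivative (\<phi> \<circ> cinv ?c) (at (cmap ?c p)) = frechet_derivative (\<psi> \<circ> cinv ?c) (at (cmap ?c p))"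
    by (rule frechet_derivative_cong_open[OF open_cmap_image[OF c(1) U(1)]])
      (use U c chartD(6)[OF c(1)] in auto)
  then show ?thesis using tangent_apply[OF s(1) c] tangent_apply[OF s(2) c] by simp
qed

lemma tangent_const: "X (\<lambda>q. k) = 0"
proof -
  have "X (\<lambda>q. k) = frechet_derivative ((\<lambda>q. k) \<circ> cinv (chart_at A p)) (at (cmap (chart_at A p) p)) (vec_comp (chart_at A p) X)"
    by (rule tangent_apply[OF smooth_near_fun[OF smooth_fun_const] chart_at])
  also have "\<dots> = 0" by (simp add: comp_def frechet_derivative_eqI[OF has_derivative_const])
  finally show ?thesis .
qed

lemma smooth_near_add: "smooth_near A p \<phi> \<Longrightarrow> smooth_near A p \<psi> \<Longrightarrow> smooth_near A p (\<lambda>q. \<phi> q + \<psi> q)"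
  and smooth_near_mult: "smooth_near A p \<phi> \<Longrightarrow> smooth_near A p \<psi> \<Longrightarrow> smooth_near A p (\<lambda>q. \<phi> q * \<psi> q)"
proof -
  assume "smooth_near A p \<phi>" "smooth_near A p \<psi>"
  then obtain U V where U: "open U" "p \<in> U" "smooth_fun A U \<phi>" and V: "open V" "p \<in> V" "smooth_fun A V \<psi>"
    unfolding smooth_near_def by blast
  have o: "open (U \<inter> V)" "p \<in> U \<inter> V" using U V by auto
  have "smooth_fun A (U \<inter> V) \<phi>" "smooth_fun A (U \<inter> V) \<psi>" using U V smooth_fun_subset by blast+
  then show "smooth_near A p (\<lambda>q. \<phi> q + \<psi> q)" "smooth_near A p (\<lambda>q. \<phi> q * \<psi> q)"
    using o smooth_fun_add[OF o(1)] smooth_fun_mult[OF o(1)] unfolding smooth_near_def by blast+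
qed

lemma tangent_add:
  assumes s: "smooth_near A p \<phi>" "smooth_near A p \<psi>"
  shows "X (\<lambda>q. \<phi> q + \<psi> q) = X \<phi> + X \<psi>"
proof -
  let ?c = "chart_at A p"
  note c = chart_at[of p]
  have "((\<lambda>q. \<phi> q + \<psi> q) \<circ> cinv ?c has_derivative (\<lambda>v. frechet_derivative (\<phi> \<circ> cinv ?c) (at (cmap ?c p)) v
     + frechet_derivative (\<psi> \<circ> cinv ?c) (at (cmap ?c p)) v)) (at (cmap ?c p))"
    using has_derivative_add[OF has_frechet_derivative[OF smooth_near_differentiable[OF s(1) c]]
        has_frechet_derivative[OF smooth_near_differentiable[OF s(2) c]]] by (simp add: comp_def)
  then show ?thesis
    using tangent_apply[OF s(1) c] tangent_apply[OF s(2) c] tangent_apply[OF smooth_near_add[OF s] c]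
    by (simp add: frechet_derivative_eqI)
qed

lemma tangent_mult:
  assumes s: "smooth_near A p \<phi>" "smooth_near A p \<psi>"
  shows "X (\<lambda>q. \<phi> q * \<psi> q) = \<phi> p * X \<psi> + \<psi> p * X \<phi>"
proof -
  let ?c = "chart_at A p"
  note c = chart_at[of p]
  have "((\<lambda>q. \<phi> q * \<psi> q) \<circ> cinv ?c has_derivative (\<lambda>v. \<phi> p * frechet_derivative (\<psi> \<circ> cinv ?c) (at (cmap ?c p)) v
     + frechet_derivative (\<phi> \<circ> cinv ?c) (at (cmap ?c p)) v * \<psi> p)) (at (cmap ?c p))"
    using has_derivative_mult[OF has_frechet_derivative[OF smooth_near_differentiable[OF s(1) c]]
        has_frechet_derivative[OF smooth_near_differentiable[OF s(2) c]]] chartD(6)[OF c] by (simp add: comp_def)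
  then show ?thesis
    using tangent_apply[OF s(1) c] tangent_apply[OF s(2) c] tangent_apply[OF smooth_near_mult[OF s] c]
    by (simp add: frechet_derivative_eqI)
qed

lemma tangent_sum:
  assumes "\<And>i. i \<in> I \<Longrightarrow> smooth_fun A UNIV (\<phi> i)"
  shows "X (\<lambda>q. \<Sum>i\<in>I. \<phi> i q) = (\<Sum>i\<in>I. X (\<phi> i))"
  using assms
proof (induction I rule: infinite_finite_induct)
  case (insert i I)
  then have "smooth_near A p (\<phi> i)" "smooth_near A p (\<lambda>q. \<Sum>i\<in>I. \<phi> i q)"
    by (auto intro!: smooth_near_fun smooth_fun_sum)
  then show ?case using insert tangent_add by simp
qed (simp_all add: tangent_const)

end

end

text \<open>Multiplying each bump by the complements of the earlier ones gives functions that sum to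
  1 wherever some bump equals 1. No normalising quotient occurs, so they stay smooth
  everywhere.\<close>

lemma partition_telescope:
  fixes b :: "nat \<Rightarrow> real"
  shows "(\<Sum>i<n. b i * (\<Prod>j<i. 1 - b j)) = 1 - (\<Prod>i<n. 1 - b i)"
  by (induction n) (simp_all add: algebra_simps)

context riemannian_manifold
begin

lemma grad_inner:
  assumes f: "smooth_fun A UNIV f" and X: "X \<in> tangent_space A p"
  shows "g p (grad A g f p) X = X f"
proof -
  let ?c = "chart_at A p" let ?y = "cmap ?c p" let ?F = "f \<circ> cinv ?c"
  note c = chart_at[of p]
  have y: "?y \<in> cimg ?c" using c by auto
  let ?d = "\<chi> j. partial_deriv j ?F ?y"
  define v where "v = vec_comp ?c X"
  have Xv: "X = chart_vec A ?c p v" using tangent_spaceE[OF X c] by (simp add: v_def)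
  have near: "smooth_near A p f" using f unfolding smooth_near_def by blast
  have "grad A g f p = chart_vec A ?c p (ginv A g ?c ?y *v ?d)"
    by (simp add: grad_def Let_def matrix_vector_mult_def)
  then have "g p (grad A g f p) X = gc ?c ?y (ginv A g ?c ?y *v ?d) v"
    by (simp add: Xv metric_chart_vec[OF c])
  also have "\<dots> = gc ?c ?y v (ginv A g ?c ?y *v ?d)" by (rule metric_coordD(2)[OF c(1) y])
  also have "\<dots> = v \<bullet> ?d" by (simp add: metric_coord_matrix[OF c(1) y] matrix_vector_mul_assoc ginv_mult[OF c(1) y])
  also have "\<dots> = frechet_derivative ?F (at ?y) v"
  proof -
    have lF: "linear (frechet_derivative ?F (at ?y))"
      by (rule frechet_derivative_linear[OF smooth_near_differentiable[OF near c]])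
    have "frechet_derivative ?F (at ?y) (\<Sum>k\<in>UNIV. v $ k *s axis k 1) = v \<bullet> ?d"
      unfolding inner_vec_def partial_deriv_def
      by (simp only: linear_sum[OF lF] linear_scale[OF lF] scalar_mult_eq_scaleR vec_lambda_beta real_scaleR_def inner_real_def)
    then show ?thesis by (simp only: basis_expansion)
  qed
  also have "\<dots> = X f" by (simp add: Xv chart_vec_apply[OF near])
  finally show ?thesis .
qed

lemma metric_nonneg: "X \<in> tangent_space A p \<Longrightarrow> g p X X \<ge> 0"
  using metric_chart_vec[OF chart_at, of p] metric_coord_nonneg[OF chart_at(1), of "cmap (chart_at A p) p" p]
    tangent_spaceE[OF _ chart_at, of X p] chart_at(2)[of p] by (metis imageI)

lemma grad_tangent: "grad A g f p \<in> tangent_space A p"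
  unfolding grad_def Let_def by (rule chart_vec_in_tangent[OF chart_at])

text \<open>The hypothesis is applied to the gradient itself, along which the derivative of
  \<open>f\<close> is the squared norm of the gradient.\<close>

lemma grad_bound:
  assumes f: "smooth_fun A UNIV f" and b: "0 \<le> b" and le: "\<And>X. X \<in> tangent_space A p \<Longrightarrow> \<bar>X f\<bar> \<le> b * sqrt (g p X X)"
  shows "g p (grad A g f p) (grad A g f p) \<le> b\<^sup>2"
proof -
  let ?G = "grad A g f p" let ?n = "g p ?G ?G"
  have n: "?n \<ge> 0" by (rule metric_nonneg[OF grad_tangent])
  have "sqrt ?n * sqrt ?n \<le> b * sqrt ?n" using le[OF grad_tangent, of f] grad_inner[OF f grad_tangent, of p f] n by simp
  then have "sqrt ?n \<le> b"
  proof (cases "?n = 0")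
    case False
    then have "sqrt ?n > 0" using n by simp
    then show ?thesis by (rule mult_right_le_imp_le[OF \<open>sqrt ?n * sqrt ?n \<le> b * sqrt ?n\<close>])
  qed (use b in simp)
  then have "(sqrt ?n)\<^sup>2 \<le> b\<^sup>2" using n by (intro power_mono) auto
  then show ?thesis using n by simp
qed

text \<open>Uniform continuity on unit vectors gives an additive error
  \<open>k^2 * \<theta>\<close>. As the metric is at least \<open>k^2\<close> there, this is a
  relative error \<open>\<theta>\<close>, which homogeneity carries to all vectors; the squared
  factor is chosen so that norms compare with factor \<open>1 + \<theta>\<close>.\<close>

lemma metric_comparable:
  assumes c: "c \<in> A" and y0: "y0 \<in> cimg c" and \<theta>: "\<theta> > 0"
  obtains s where "s > 0" "ball y0 s \<subseteq> cimg c" "\<And>q z w. q \<in> ball y0 s \<Longrightarrow> z \<in> ball y0 s \<Longrightarrow> gc c q w w \<le> (1 + \<theta>)\<^sup>2 * gc c z w w"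
proof -
  obtain s0 where s0: "s0 > 0" "cball y0 s0 \<subseteq> cimg c" using chartD(2)[OF c] y0 open_contains_cball by metis
  obtain k where k: "k > 0" "\<And>y w. y \<in> cball y0 s0 \<Longrightarrow> k\<^sup>2 * (norm w)\<^sup>2 \<le> gc c y w w"
    using metric_lower_bound[OF c compact_cball s0(2)] by blast
  have "continuous_on (cball y0 s0 \<times> sphere 0 1) (\<lambda>(y, w). gc c y w w)"
    unfolding split_def by (intro continuous_metric_coord[OF c] continuous_intros) (use s0 in auto)
  then have "uniformly_continuous_on (cball y0 s0 \<times> sphere 0 1) (\<lambda>(y, w). gc c y w w)"
    by (rule compact_uniformly_continuous) (intro compact_Times compact_cball compact_sphere)
  moreover have "k\<^sup>2 * \<theta> > 0" using k \<theta> by simp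
  ultimately obtain d where d: "d > 0" "\<And>P P'. P \<in> cball y0 s0 \<times> sphere 0 1 \<Longrightarrow> P' \<in> cball y0 s0 \<times> sphere 0 1 \<Longrightarrow> dist P' P < d
      \<Longrightarrow> dist (case P' of (y, w) \<Rightarrow> gc c y w w) (case P of (y, w) \<Rightarrow> gc c y w w) < k\<^sup>2 * \<theta>"
    unfolding uniformly_continuous_on_def by meson
  have unit: "gc c q w w \<le> (1 + \<theta>)\<^sup>2 * gc c z w w" if q: "q \<in> cball y0 s0" "z \<in> cball y0 s0" "dist q z < d" and w: "norm w = 1" for q z w
  proof -
    have "dist (q, w) (z, w) < d" using q(3) by (simp add: dist_Pair_Pair)
    then have "dist (gc c q w w) (gc c z w w) < k\<^sup>2 * \<theta>" using d(2)[of "(z, w)" "(q, w)"] q w by simp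
    then have "gc c q w w \<le> gc c z w w + k\<^sup>2 * \<theta>" by (simp add: dist_real_def abs_less_iff)
    moreover have kz: "k\<^sup>2 \<le> gc c z w w" using k(2)[OF q(2), of w] w by simp
    then have "k\<^sup>2 * \<theta> \<le> gc c z w w * \<theta>" using \<theta> by (intro mult_right_mono) auto
    moreover have "gc c z w w \<ge> 0" using kz order_trans zero_le_power2 by blast
    then have "gc c z w w * (1 + \<theta>) \<le> gc c z w w * (1 + \<theta>)\<^sup>2"
      using \<theta> by (intro mult_left_mono) (auto simp: power2_eq_square)
    ultimately show ?thesis by (simp add: algebra_simps)
  qed
  have comp: "gc c q w w \<le> (1 + \<theta>)\<^sup>2 * gc c z w w" if q: "q \<in> cball y0 s0" "z \<in> cball y0 s0" "dist q z < d" for q z w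
  proof (cases "w = 0")
    case True
    then show ?thesis using metric_coordD(1)[OF c, of q] metric_coordD(1)[OF c, of z] q s0(2) by (auto simp: bilinear_lzero subset_iff)
  next
    case False
    have qz: "q \<in> cimg c" "z \<in> cimg c" using q s0(2) by auto
    have "gc c q w w = (norm w)\<^sup>2 * gc c q (w /\<^sub>R norm w) (w /\<^sub>R norm w)"
      "gc c z w w = (norm w)\<^sup>2 * gc c z (w /\<^sub>R norm w) (w /\<^sub>R norm w)"
      using False metric_coord_scaleR[OF c qz(1), of "norm w" "w /\<^sub>R norm w"]
         metric_coord_scaleR[OF c qz(2), of "norm w" "w /\<^sub>R norm w"] by simp_all
    moreover have "gc c q (w /\<^sub>R norm w) (w /\<^sub>R norm w) \<le> (1 + \<theta>)\<^sup>2 * gc c z (w /\<^sub>R norm w) (w /\<^sub>R norm w)"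
      by (rule unit[OF q]) (use False in simp)
    then have "(norm w)\<^sup>2 * gc c q (w /\<^sub>R norm w) (w /\<^sub>R norm w) \<le> (norm w)\<^sup>2 * ((1 + \<theta>)\<^sup>2 * gc c z (w /\<^sub>R norm w) (w /\<^sub>R norm w))"
      by (rule mult_left_mono) simp
    ultimately show ?thesis by (simp add: mult.left_commute)
  qed
  show thesis
  proof (rule that[of "min s0 (d / 2)"])
    show "min s0 (d / 2) > 0" using s0 d by simp
    show "ball y0 (min s0 (d / 2)) \<subseteq> cimg c" using s0(2) by (auto simp: subset_iff)
    fix q z w assume q: "q \<in> ball y0 (min s0 (d / 2))" "z \<in> ball y0 (min s0 (d / 2))"
    have "dist q z \<le> dist y0 q + dist y0 z" by (metis dist_commute dist_triangle)
    then have "dist q z < d" using q by simp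
    then show "gc c q w w \<le> (1 + \<theta>)\<^sup>2 * gc c z w w" using q by (intro comp) auto
  qed
qed

text \<open>Compactness bounds the partial derivatives of \<open>f\<close> from above and the metric
  from below. The functions of the partition of unity are the intended case; their derivatives enter
  the error of the gluing.\<close>

lemma tangent_bounded:
  assumes c: "c \<in> A" and S: "compact S" "S \<subseteq> cimg c" and f: "smooth_fun A UNIV f"
  obtains C where "0 \<le> C" "\<And>p X. p \<in> cdom c \<Longrightarrow> cmap c p \<in> S \<Longrightarrow> X \<in> tangent_space A p \<Longrightarrow> \<bar>X f\<bar> \<le> C * sqrt (g p X X)"
proof -
  obtain k where k: "k > 0" "\<And>y w. y \<in> S \<Longrightarrow> k\<^sup>2 * (norm w)\<^sup>2 \<le> gc c y w w" using metric_lower_bound[OF c S] by blast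
  let ?F = "f \<circ> cinv c"
  have F: "smooth_on ?F (cimg c)" using f c by (simp add: smooth_fun_def)
  have "\<exists>M. \<forall>y\<in>S. \<bar>frechet_derivative ?F (at y) (axis i 1)\<bar> \<le> M" for i
  proof -
    have "continuous_on S (\<lambda>y. frechet_derivative ?F (at y) (axis i 1))"
      by (rule continuous_on_subset[OF smooth_on_continuous[OF smooth_on_frechet[OF F]] S(2)])
    then have "bounded ((\<lambda>y. frechet_derivative ?F (at y) (axis i 1)) ` S)"
      by (intro compact_imp_bounded compact_continuous_image S)
    then show ?thesis unfolding bounded_iff by auto
  qed
  then obtain M where M: "\<And>i y. y \<in> S \<Longrightarrow> \<bar>frechet_derivative ?F (at y) (axis i 1)\<bar> \<le> M i" by metis
  define C where "C = (\<Sum>i\<in>UNIV. max 0 (M i)) / k"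
  show thesis
  proof (rule that[of C])
    show "0 \<le> C" using k by (simp add: C_def sum_nonneg)
    fix p X assume p: "p \<in> cdom c" "cmap c p \<in> S" and X: "X \<in> tangent_space A p"
    define w where "w = vec_comp c X"
    have lF: "linear (frechet_derivative ?F (at (cmap c p)))"
      by (rule frechet_derivative_linear[OF smooth_on_differentiable[OF F]]) (use p S in auto)
    have "X f = frechet_derivative ?F (at (cmap c p)) (\<Sum>i\<in>UNIV. w $ i *s axis i 1)"
      unfolding basis_expansion w_def by (rule tangent_apply[OF X smooth_near_fun[OF f] c p(1)])
    also have "\<dots> = (\<Sum>i\<in>UNIV. w $ i * frechet_derivative ?F (at (cmap c p)) (axis i 1))"
      by (simp only: linear_sum[OF lF] linear_scale[OF lF] scalar_mult_eq_scaleR real_scaleR_def)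
    finally have "\<bar>X f\<bar> \<le> (\<Sum>i\<in>UNIV. \<bar>w $ i * frechet_derivative ?F (at (cmap c p)) (axis i 1)\<bar>)"
      by (simp add: sum_abs)
    also have "\<dots> \<le> (\<Sum>i\<in>UNIV. norm w * max 0 (M i))"
      unfolding abs_mult using M[OF p(2)] component_le_norm_cart[of w]
      by (intro sum_mono mult_mono) (auto simp: le_max_iff_disj)
    also have "\<dots> = C * (k * norm w)"
    proof -
      have "C * (k * norm w) = (\<Sum>i\<in>UNIV. max 0 (M i)) * norm w" using k(1) by (simp add: C_def)
      then show ?thesis by (simp only: sum_distrib_left[symmetric] mult.commute)
    qed
    also have "\<dots> \<le> C * sqrt (g p X X)"
    proof (rule mult_left_mono)
      have "g p X X = gc c (cmap c p) w w" using metric_chart_vec[OF c p(1)] tangent_spaceE[OF X c p(1)] by (metis w_def)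
      then have "(k * norm w)\<^sup>2 \<le> g p X X" using k(2)[OF p(2), of w] by (simp add: power_mult_distrib)
      then show "k * norm w \<le> sqrt (g p X X)" by (rule real_le_rsqrt)
    qed fact
    finally show "\<bar>X f\<bar> \<le> C * sqrt (g p X X)" .
  qed
qed

text \<open>\<open>L\<close> bounds the Lipschitz constant of \<open>u\<close> infinitesimally: at
  each point, up to an error \<open>\<delta>\<close> on a small neighbourhood. The condition is
  phrased with a real majorant \<open>r\<close> of the distance, so pairs at infinite distance
  impose nothing.\<close>

definition lipschitz_at :: "('a \<Rightarrow> real) \<Rightarrow> ('a \<Rightarrow> real) \<Rightarrow> bool"
  where "lipschitz_at u L \<longleftrightarrow> (\<forall>p0. \<forall>\<delta>>0. \<exists>U. open U \<and> p0 \<in> U \<and>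
    (\<forall>p\<in>U. \<forall>q\<in>U. \<forall>r\<ge>0. riem_dist A g p q \<le> ennreal r \<longrightarrow> \<bar>u p - u q\<bar> \<le> (L p0 + \<delta>) * r))"

text \<open>A short coordinate segment has length close to the norm of \<open>x - x'\<close> for the
  metric frozen at \<open>y\<close>, so a Lipschitz bound for the distance becomes one for that
  norm. Because \<open>y\<close> is arbitrary near \<open>y0\<close>, the mollifier can use the norm
  at the very point where the gradient is estimated.\<close>

lemma lipschitz_chart_point:
  assumes lip: "lipschitz_at u L" and L: "continuous_on UNIV L" "\<And>p. 0 \<le> L p" and c: "c \<in> A" and y0: "y0 \<in> cimg c" and \<delta>: "\<delta> > 0"
  obtains s where "s > 0" "ball y0 s \<subseteq> cimg c" "\<And>y x x'. y \<in> ball y0 s \<Longrightarrow> x \<in> ball y0 s \<Longrightarrow> x' \<in> ball y0 s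
     \<Longrightarrow> \<bar>u (cinv c x) - u (cinv c x')\<bar> \<le> (L (cinv c y) + \<delta>) * sqrt (gc c y (x - x') (x - x'))"
proof -
  let ?p = "cinv c y0"
  \<comment> \<open>The error \<open>\<delta>\<close> is spent in quarters: one in
    \<open>lipschitz_at\<close>, one on comparing metrics through the choice of
    \<open>\<theta>\<close>, and one on the variation of \<open>L\<close> near
    \<open>y0\<close>.\<close>
  define K where "K = L ?p + \<delta> / 4"
  have K: "K > 0" using L(2)[of ?p] \<delta> by (simp add: K_def)
  define \<theta> where "\<theta> = \<delta> / (4 * K)"
  have \<theta>: "\<theta> > 0" "K * (1 + \<theta>) = K + \<delta> / 4" using K \<delta> by (auto simp: \<theta>_def field_simps)
  obtain s1 where s1: "s1 > 0" "ball y0 s1 \<subseteq> cimg c" "\<And>q z w. q \<in> ball y0 s1 \<Longrightarrow> z \<in> ball y0 s1 \<Longrightarrow> gc c q w w \<le> (1 + \<theta>)\<^sup>2 * gc c z w w"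
    using metric_comparable[OF c y0 \<theta>(1)] by blast
  have "\<delta> / 4 > 0" using \<delta> by simp
  then obtain U where U: "open U" "?p \<in> U" "\<And>p q r. p \<in> U \<Longrightarrow> q \<in> U \<Longrightarrow> 0 \<le> r \<Longrightarrow> riem_dist A g p q \<le> ennreal r \<Longrightarrow> \<bar>u p - u q\<bar> \<le> K * r"
    using lip unfolding lipschitz_at_def K_def by meson
  have "open (cmap c ` (U \<inter> cdom c))" by (rule open_cmap_image[OF c U(1)])
  moreover have "y0 \<in> cmap c ` (U \<inter> cdom c)" using U(2) chartD(7,8)[OF c y0] by (intro image_eqI[of _ _ ?p]) auto
  ultimately obtain s2 where s2: "s2 > 0" "ball y0 s2 \<subseteq> cmap c ` (U \<inter> cdom c)" using open_contains_ball by metis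
  have inU: "cinv c x \<in> U" if "x \<in> ball y0 s2" for x
    using that s2(2) chartD(6)[OF c] by auto
  have "continuous_on (cimg c) (\<lambda>y. L (cinv c y))" by (rule continuous_on_compose2[OF L(1) chartD(4)[OF c]]) auto
  then have "isCont (\<lambda>y. L (cinv c y)) y0" using continuous_on_eq_continuous_at[OF chartD(2)[OF c]] y0 by blast
  then obtain s3 where s3: "s3 > 0" "\<And>y. dist y y0 < s3 \<Longrightarrow> dist (L (cinv c y)) (L ?p) < \<delta> / 4"
    using \<open>\<delta> / 4 > 0\<close> unfolding continuous_at_eps_delta by meson
  define s where "s = min s1 (min s2 s3)"
  show thesis
  proof (rule that[of s])
    show "s > 0" using s1 s2 s3 by (simp add: s_def)
    have sub: "ball y0 s \<subseteq> ball y0 s1" "ball y0 s \<subseteq> ball y0 s2" by (auto simp: s_def)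
    then show img: "ball y0 s \<subseteq> cimg c" using s1(2) by blast
    fix y x x' assume y: "y \<in> ball y0 s" and x: "x \<in> ball y0 s" "x' \<in> ball y0 s"
    let ?N = "sqrt (gc c y (x - x') (x - x'))"
    have N: "?N \<ge> 0" "gc c y (x - x') (x - x') \<ge> 0" using metric_coord_nonneg[OF c, of y] img y by auto
    have seg: "closed_segment x' x \<subseteq> ball y0 s" using x by (intro closed_segment_subset) auto
    have "riem_dist A g (cinv c x') (cinv c x) \<le> ennreal ((1 + \<theta>) * ?N)"
    proof (rule riem_dist_segment[OF c])
      show "closed_segment x' x \<subseteq> cimg c" using seg img by blast
      show "0 \<le> (1 + \<theta>) * ?N" using \<theta> N by simp
      show "gc c q (x - x') (x - x') \<le> ((1 + \<theta>) * ?N)\<^sup>2" if "q \<in> closed_segment x' x" for q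
      proof -
        have "q \<in> ball y0 s1" "y \<in> ball y0 s1" using that seg sub y by blast+
        then have "gc c q (x - x') (x - x') \<le> (1 + \<theta>)\<^sup>2 * gc c y (x - x') (x - x')" by (rule s1(3))
        also have "\<dots> = ((1 + \<theta>) * ?N)\<^sup>2" using N(2) by (simp only: power_mult_distrib real_sqrt_pow2)
        finally show ?thesis .
      qed
    qed
    then have "\<bar>u (cinv c x') - u (cinv c x)\<bar> \<le> K * ((1 + \<theta>) * ?N)"
      using inU x sub \<theta> N by (intro U(3)) auto
    also have "\<dots> = (K + \<delta> / 4) * ?N" using \<theta>(2) by (simp add: mult.assoc[symmetric])
    also have "\<dots> \<le> (L (cinv c y) + \<delta>) * ?N"
    proof (rule mult_right_mono[OF _ N(1)])
      have "dist y y0 < s3" using y by (simp add: s_def dist_commute)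
      then have "\<bar>L (cinv c y) - L ?p\<bar> < \<delta> / 4" using s3(2) by (simp add: dist_real_def)
      then show "K + \<delta> / 4 \<le> L (cinv c y) + \<delta>" using \<delta> unfolding K_def by linarith
    qed
    finally show "\<bar>u (cinv c x) - u (cinv c x')\<bar> \<le> (L (cinv c y) + \<delta>) * ?N" by (simp add: abs_minus_commute)
  qed
qed

lemma local_mollify:
  assumes u: "continuous_on UNIV u" and lip: "lipschitz_at u L" and L: "continuous_on UNIV L" "\<And>p. 0 \<le> L p"
    and c: "c \<in> A" and a: "cball a (3 * r) \<subseteq> cimg c" and r: "r > 0" and \<delta>: "\<delta> > 0" and \<eta>: "\<eta> > 0"
  obtains v where "smooth_on v UNIV" "\<And>y. y \<in> cball a (2 * r) \<Longrightarrow> \<bar>v y - u (cinv c y)\<bar> \<le> \<eta>"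
    "\<And>y w. y \<in> cball a (2 * r) \<Longrightarrow> \<bar>frechet_derivative v (at y) w\<bar> \<le> (L (cinv c y) + \<delta>) * sqrt (gc c y w w)"
proof -
  have cont: "continuous_on (cball a (3 * r)) (\<lambda>y. u (cinv c y))"
    by (rule continuous_on_compose2[OF u continuous_on_subset[OF chartD(4)[OF c] a]]) auto
  have "closedin (top_of_set UNIV) (cball a (3 * r))" by simp
  \<comment> \<open>The mollifier asks for a continuous function on the whole space; the values
    outside the ball of radius \<open>3 * r\<close> do not influence the estimates on the ball of
    radius \<open>2 * r\<close>.\<close>
  from Tietze_unbounded[OF cont this] obtain u' where u': "continuous_on UNIV u'" "\<And>y. y \<in> cball a (3 * r) \<Longrightarrow> u' y = u (cinv c y)"
    by auto
  have "uniformly_continuous_on (cball a (3 * r)) (\<lambda>y. u (cinv c y))" by (rule compact_uniformly_continuous[OF cont compact_cball])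
  then obtain e1 where e1: "e1 > 0" "\<And>x y. x \<in> cball a (3 * r) \<Longrightarrow> y \<in> cball a (3 * r) \<Longrightarrow> dist y x < e1 \<Longrightarrow> dist (u (cinv c y)) (u (cinv c x)) < \<eta>"
    using \<eta> unfolding uniformly_continuous_on_def by meson
  define good where "good y0 s \<longleftrightarrow> s > 0 \<and> (\<forall>y\<in>ball y0 s. \<forall>x\<in>ball y0 s. \<forall>x'\<in>ball y0 s.
     \<bar>u (cinv c x) - u (cinv c x')\<bar> \<le> (L (cinv c y) + \<delta>) * sqrt (gc c y (x - x') (x - x')))" for y0 s
  have "\<exists>s. good y0 s" if "y0 \<in> cball a (2 * r)" for y0
  proof -
    have "y0 \<in> cimg c" using that a r by (auto simp: subset_iff)
    from lipschitz_chart_point[OF lip L c this \<delta>] show ?thesis unfolding good_def by metis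
  qed
  then obtain s where s: "\<And>y0. y0 \<in> cball a (2 * r) \<Longrightarrow> good y0 (s y0)" by metis
  \<comment> \<open>A Lebesgue number of the cover by balls on which the Lipschitz bound holds
    provides one smoothing scale for all points.\<close>
  have "\<exists>e>0. \<forall>x\<in>cball a (2 * r). \<exists>G\<in>(\<lambda>y0. ball y0 (s y0)) ` cball a (2 * r). ball x e \<subseteq> G"
  proof (rule Heine_Borel_lemma[OF compact_cball])
    show "cball a (2 * r) \<subseteq> \<Union> ((\<lambda>y0. ball y0 (s y0)) ` cball a (2 * r))"
    proof
      fix y assume "y \<in> cball a (2 * r)"
      moreover have "y \<in> ball y (s y)" using s[OF calculation] by (simp add: good_def)
      ultimately show "y \<in> \<Union> ((\<lambda>y0. ball y0 (s y0)) ` cball a (2 * r))" by blast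
    qed
  qed auto
  then obtain e2 where e2: "e2 > 0" "\<And>y. y \<in> cball a (2 * r) \<Longrightarrow> \<exists>y0\<in>cball a (2 * r). ball y e2 \<subseteq> ball y0 (s y0)" by blast
  define e where "e = min (r / 3) (min (e1 / 2) (e2 / 2))"
  have e: "e > 0" "e < r" "2 * e < r" "e < e1" "2 * e \<le> e2" using r e1 e2 by (auto simp: e_def)
  have near: "x \<in> cball a (3 * r)" if "y \<in> cball a (2 * r)" "dist x y < r" for x y
    using that dist_triangle[of a x y] by (simp add: dist_commute)
  obtain v where v: "smooth_on v UNIV"
    "\<And>y c. y \<in> cball a (2 * r) \<Longrightarrow> (\<And>x. dist x y \<le> e \<Longrightarrow> \<bar>u' x - u' y\<bar> \<le> c) \<Longrightarrow> \<bar>v y - u' y\<bar> \<le> c"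
    "\<And>y w L. y \<in> cball a (2 * r) \<Longrightarrow> (\<And>x x'. dist x y < 2 * e \<Longrightarrow> dist x' y < 2 * e \<Longrightarrow> \<bar>u' x - u' x'\<bar> \<le> L (x - x'))
        \<Longrightarrow> (\<And>t. 0 < t \<Longrightarrow> L (t *\<^sub>R w) = t * L w) \<Longrightarrow> \<bar>frechet_derivative v (at y) w\<bar> \<le> L w"
    using mollify[OF u'(1) bounded_cball e(1)] by blast
  show thesis
  proof (rule that[OF v(1)])
    fix y assume y: "y \<in> cball a (2 * r)"
    have y3: "y \<in> cball a (3 * r)" using y r by simp
    have "\<bar>v y - u' y\<bar> \<le> \<eta>"
    proof (rule v(2)[OF y])
      fix x assume x: "dist x y \<le> e"
      have "x \<in> cball a (3 * r)" using near[OF y] x e by simp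
      then show "\<bar>u' x - u' y\<bar> \<le> \<eta>" using e1(2)[OF y3, of x] x e u'(2) y3 by (simp add: dist_real_def)
    qed
    then show "\<bar>v y - u (cinv c y)\<bar> \<le> \<eta>" using u'(2)[OF y3] by simp
    fix w
    have "y \<in> cimg c" using y3 a by blast
    note sc = metric_coord_scaleR[OF c this]
    show "\<bar>frechet_derivative v (at y) w\<bar> \<le> (L (cinv c y) + \<delta>) * sqrt (gc c y w w)"
    proof (rule v(3)[OF y, of "\<lambda>w. (L (cinv c y) + \<delta>) * sqrt (gc c y w w)"])
      fix x x' assume x: "dist x y < 2 * e" "dist x' y < 2 * e"
      obtain y0 where y0: "y0 \<in> cball a (2 * r)" "ball y e2 \<subseteq> ball y0 (s y0)" using e2(2)[OF y] by blast
      have "x \<in> ball y e2" "x' \<in> ball y e2" "y \<in> ball y e2" using x e e2(1) by (auto simp: dist_commute)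
      then have "\<bar>u (cinv c x) - u (cinv c x')\<bar> \<le> (L (cinv c y) + \<delta>) * sqrt (gc c y (x - x') (x - x'))"
        using s[OF y0(1)] y0(2) unfolding good_def by blast
      moreover have "x \<in> cball a (3 * r)" "x' \<in> cball a (3 * r)" using near[OF y] x e by auto
      ultimately show "\<bar>u' x - u' x'\<bar> \<le> (L (cinv c y) + \<delta>) * sqrt (gc c y (x - x') (x - x'))" using u'(2) by simp
    next
      fix t :: real assume "0 < t"
      then show "(L (cinv c y) + \<delta>) * sqrt (gc c y (t *\<^sub>R w) (t *\<^sub>R w)) = t * ((L (cinv c y) + \<delta>) * sqrt (gc c y w w))"
        by (simp add: sc real_sqrt_mult)
    qed
  qed
qed

text \<open>Local mollifications \<open>Vf i\<close> are glued with weights \<open>\<psi> i\<close>.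
  The derivative is a weighted sum of the local derivatives, which obey the bound, plus terms
  \<open>Vf i p * X (\<psi> i)\<close>. The derivatives of the \<open>\<psi> i\<close> may be large
  but sum to 0 where the \<open>\<psi> i\<close> sum to 1, so \<open>Vf i\<close> may be replaced
  there by \<open>Vf i - u\<close>, which is as small as desired because the partition is fixed
  before the smoothing scale.\<close>

theorem smooth_approximation:
  assumes u: "continuous_on UNIV u" and lip: "lipschitz_at u L" and L: "continuous_on UNIV L" "\<And>p. 0 \<le> L p"
    and K: "compact K" "\<And>p. p \<notin> K \<Longrightarrow> u p = 0" and V: "open V" "K \<subseteq> V" and \<delta>: "\<delta> > 0"
  obtains \<phi> where "smooth_fun A UNIV \<phi>" "{p. \<phi> p \<noteq> 0} \<subseteq> V" "\<And>p. \<bar>\<phi> p - u p\<bar> \<le> \<delta>"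
    "\<And>p. g p (grad A g \<phi> p) (grad A g \<phi> p) \<le> (L p + \<delta>)\<^sup>2"
proof -
  have "\<exists>r>0. cball (cmap (chart_at A p) p) (3 * r) \<subseteq> cmap (chart_at A p) ` (V \<inter> cdom (chart_at A p))" if p: "p \<in> K" for p
  proof -
    note c = chart_at[of p]
    have "cmap (chart_at A p) p \<in> cmap (chart_at A p) ` (V \<inter> cdom (chart_at A p))" using p V c by blast
    then obtain e where "e > 0" "cball (cmap (chart_at A p) p) e \<subseteq> cmap (chart_at A p) ` (V \<inter> cdom (chart_at A p))"
      using open_cmap_image[OF c(1) V(1)] open_contains_cball by metis
    then show ?thesis by (intro exI[of _ "e / 3"]) auto
  qed
  then obtain R where R: "\<And>p. p \<in> K \<Longrightarrow> R p > 0 \<and> cball (cmap (chart_at A p) p) (3 * R p) \<subseteq> cmap (chart_at A p) ` (V \<inter> cdom (chart_at A p))"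
    by metis
  let ?O = "\<lambda>p. cinv (chart_at A p) ` ball (cmap (chart_at A p) p) (R p)"
  have R_img: "cball (cmap (chart_at A p) p) (3 * R p) \<subseteq> cimg (chart_at A p)" if "p \<in> K" for p using R[OF that] by blast
  have O_sub: "ball (cmap (chart_at A p) p) (R p) \<subseteq> cimg (chart_at A p)" if "p \<in> K" for p
    using R_img[OF that] R[OF that] by (auto simp: subset_iff)
  have "\<exists>D\<subseteq>K. finite D \<and> K \<subseteq> (\<Union>p\<in>D. ?O p)"
  proof -
    have "K \<subseteq> (\<Union>p\<in>K. ?O p)"
    proof
      fix p assume p: "p \<in> K"
      have "p \<in> ?O p" using chartD(6)[OF chart_at] R[OF p] by (intro image_eqI[of _ _ "cmap (chart_at A p) p"]) auto
      then show "p \<in> (\<Union>p\<in>K. ?O p)" using p by blast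
    qed
    moreover have "open (?O p)" if "p \<in> K" for p by (rule open_cinv_image[OF chart_at(1) open_ball O_sub[OF that]])
    ultimately obtain D where "D \<subseteq> K" "finite D" "K \<subseteq> (\<Union>p\<in>D. ?O p)"
      using compactE_image[OF K(1), of K ?O] by blast
    then show ?thesis by blast
  qed
  then obtain D where D: "D \<subseteq> K" "finite D" "K \<subseteq> (\<Union>p\<in>D. ?O p)" by blast
  obtain ps where ps: "set ps = D" using finite_list[OF D(2)] by blast
  define n where "n = length ps"
  define c where "c i = chart_at A (ps ! i)" for i
  define a where "a i = cmap (c i) (ps ! i)" for i
  define r where "r i = R (ps ! i)" for i
  have psK: "ps ! i \<in> K" if "i < n" for i using that ps D(1) by (auto simp: n_def)
  have cA: "c i \<in> A" for i by (simp add: c_def chart_at)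
  have r: "r i > 0" if "i < n" for i using R[OF psK[OF that]] by (simp add: r_def)
  have a3: "cball (a i) (3 * r i) \<subseteq> cimg (c i)" if "i < n" for i using R_img[OF psK[OF that]] by (simp add: a_def r_def c_def)
  have a3V: "cinv (c i) y \<in> V" if "i < n" "y \<in> cball (a i) (3 * r i)" for i y
  proof -
    have "y \<in> cmap (c i) ` (V \<inter> cdom (c i))" using R[OF psK[OF that(1)]] that(2) by (auto simp: a_def r_def c_def)
    then show ?thesis using chartD(6)[OF cA] by auto
  qed
  define W where "W = (\<Union>i<n. cinv (c i) ` ball (a i) (r i))"
  have W: "open W" unfolding W_def
  proof (intro open_UN ballI open_cinv_image cA open_ball)
    fix i assume "i \<in> {..<n}"
    then show "ball (a i) (r i) \<subseteq> cimg (c i)" using O_sub[OF psK] by (simp add: a_def r_def c_def)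
  qed
  have KW: "K \<subseteq> W"
  proof
    fix x assume "x \<in> K"
    then obtain p where "p \<in> D" "x \<in> ?O p" using D(3) by blast
    then obtain i where "i < n" "p = ps ! i" using ps by (auto simp: in_set_conv_nth n_def)
    then show "x \<in> W" using \<open>x \<in> ?O p\<close> by (auto simp: W_def a_def r_def c_def)
  qed
  have a2: "cball (a i) (2 * r i) \<subseteq> cimg (c i)" if "i < n" for i using a3[OF that] r[OF that] by (auto simp: subset_iff)
  define b where "b i p = (if p \<in> cdom (c i) then bump (a i) (r i) (2 * r i) (cmap (c i) p) else 0)" for i p
  have bump0: "bump (a i) (r i) (2 * r i) y = 0" if "i < n" "y \<notin> cball (a i) (2 * r i)" for i y
    using that r[OF that(1)] by (intro bump_0) (auto simp: dist_commute)
  have b_smooth: "smooth_fun A UNIV (b i)" if "i < n" for i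
    unfolding b_def
    by (rule smooth_fun_extend[OF cA smooth_on_subset[OF bump_smooth] compact_cball a2[OF that]]) (use bump0 that in auto)
  have b01: "0 \<le> b i p" "b i p \<le> 1" for i p by (simp_all add: b_def bump_bounds)
  have b1: "b i p = 1" if "i < n" "p \<in> cinv (c i) ` ball (a i) (r i)" for i p
  proof -
    from that(2) obtain y where y: "y \<in> ball (a i) (r i)" "p = cinv (c i) y" by blast
    have "y \<in> cimg (c i)" using y(1) a3[OF that(1)] r[OF that(1)] by (auto simp: subset_iff)
    then show ?thesis using y r[OF that(1)] chartD(7,8)[OF cA] by (simp add: b_def bump_1 dist_commute less_imp_le)
  qed
  define S where "S i = cinv (c i) ` cball (a i) (2 * r i)" for i
  have S_iff: "p \<in> S i \<longleftrightarrow> p \<in> cdom (c i) \<and> cmap (c i) p \<in> cball (a i) (2 * r i)" if "i < n" for i p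
    using cinv_image_eq[OF cA a2[OF that]] by (auto simp: S_def)
  have S_closed: "closed (S i)" if "i < n" for i
    unfolding S_def by (intro compact_imp_closed compact_continuous_image continuous_on_subset[OF chartD(4)[OF cA]] compact_cball a2 that)
  have b_S: "b i p = 0" if "i < n" "p \<notin> S i" for i p
    using that S_iff[OF that(1)] bump0[OF that(1)] by (auto simp: b_def)
  define P where "P i p = (\<Prod>j<i. 1 - b j p)" for i p
  define \<psi> where "\<psi> i p = b i p * P i p" for i p
  have P_smooth: "smooth_fun A UNIV (P i)" if "i < n" for i
    unfolding P_def using that by (intro smooth_fun_prod smooth_fun_diff smooth_fun_const b_smooth) auto
  have \<psi>_smooth: "smooth_fun A UNIV (\<psi> i)" if "i < n" for i
    unfolding \<psi>_def[abs_def] using that by (intro smooth_fun_mult b_smooth P_smooth) auto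
  have P0: "0 \<le> P i p" for i p unfolding P_def by (intro prod_nonneg) (use b01 in auto)
  have \<psi>0: "0 \<le> \<psi> i p" for i p using P0 b01 by (simp add: \<psi>_def)
  have sum\<psi>: "(\<Sum>i<n. \<psi> i p) = 1 - (\<Prod>i<n. 1 - b i p)" for p
    unfolding \<psi>_def P_def by (rule partition_telescope)
  have sum\<psi>_le: "(\<Sum>i<n. \<psi> i p) \<le> 1" for p
    unfolding sum\<psi> using prod_nonneg[of "{..<n}" "\<lambda>i. 1 - b i p"] b01 by auto
  have sum\<psi>_W: "(\<Sum>i<n. \<psi> i p) = 1" if "p \<in> W" for p
  proof -
    from that obtain i where "i < n" "p \<in> cinv (c i) ` ball (a i) (r i)" by (auto simp: W_def)
    then have "1 - b i p = 0" "i \<in> {..<n}" using b1 by auto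
    then have "(\<Prod>i<n. 1 - b i p) = 0" by (intro prod_zero) auto
    then show ?thesis by (simp add: sum\<psi>)
  qed
  have "\<exists>C\<ge>0. \<forall>p X. p \<in> S i \<longrightarrow> X \<in> tangent_space A p \<longrightarrow> \<bar>X (\<psi> i)\<bar> \<le> C * sqrt (g p X X)" if "i < n" for i
    using tangent_bounded[OF cA compact_cball a2[OF that] \<psi>_smooth[OF that]] S_iff[OF that] by metis
  then obtain C where C: "\<And>i. i < n \<Longrightarrow> 0 \<le> C i" "\<And>i p X. i < n \<Longrightarrow> p \<in> S i \<Longrightarrow> X \<in> tangent_space A p \<Longrightarrow> \<bar>X (\<psi> i)\<bar> \<le> C i * sqrt (g p X X)"
    by metis
  define Ct where "Ct = (\<Sum>i<n. C i)"
  have Ct: "0 \<le> Ct" unfolding Ct_def using C(1) by (intro sum_nonneg) auto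
  \<comment> \<open>\<open>Ct\<close> bounds all derivatives of the partition together and does not
    depend on the mollified functions, so the admissible error \<open>\<eta>\<close> can be chosen
    after it. The summand 1 excludes division by 0 and also gives
    \<open>\<eta> \<le> \<delta>\<close>.\<close>
  define \<eta> where "\<eta> = \<delta> / (2 * (Ct + 1))"
  have \<eta>: "\<eta> > 0" "\<eta> * Ct \<le> \<delta> / 2" "\<eta> \<le> \<delta>"
  proof -
    show "\<eta> > 0" using \<delta> Ct by (simp add: \<eta>_def)
    have "\<eta> * (Ct + 1) = \<delta> / 2" using Ct by (simp add: \<eta>_def field_simps)
    moreover have "0 \<le> \<eta> * Ct" using \<open>\<eta> > 0\<close> Ct by simp
    ultimately show "\<eta> * Ct \<le> \<delta> / 2" "\<eta> \<le> \<delta>" using \<open>\<eta> > 0\<close> \<delta> by (simp_all add: distrib_left)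
  qed
  have "\<exists>v. smooth_on v UNIV \<and> (\<forall>y\<in>cball (a i) (2 * r i). \<bar>v y - u (cinv (c i) y)\<bar> \<le> \<eta>) \<and>
     (\<forall>y\<in>cball (a i) (2 * r i). \<forall>w. \<bar>frechet_derivative v (at y) w\<bar> \<le> (L (cinv (c i) y) + \<delta> / 2) * sqrt (gc (c i) y w w))" if i: "i < n" for i
  proof -
    have "\<delta> / 2 > 0" using \<delta> by simp
    from local_mollify[OF u lip L cA a3[OF i] r[OF i] this \<eta>(1)] show ?thesis by metis
  qed
  then obtain v where v: "\<And>i. i < n \<Longrightarrow> smooth_on (v i) UNIV"
     "\<And>i y. i < n \<Longrightarrow> y \<in> cball (a i) (2 * r i) \<Longrightarrow> \<bar>v i y - u (cinv (c i) y)\<bar> \<le> \<eta>"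
     "\<And>i y w. i < n \<Longrightarrow> y \<in> cball (a i) (2 * r i) \<Longrightarrow> \<bar>frechet_derivative (v i) (at y) w\<bar> \<le> (L (cinv (c i) y) + \<delta> / 2) * sqrt (gc (c i) y w w)"
    by metis
  define Vf where "Vf i p = v i (cmap (c i) p)" for i p
  have Vf_u: "\<bar>Vf i p - u p\<bar> \<le> \<eta>" if "i < n" "p \<in> S i" for i p
    using v(2)[OF that(1), of "cmap (c i) p"] S_iff[OF that(1)] that(2) chartD(6)[OF cA] by (simp add: Vf_def)
  have Vf_near: "smooth_near A p (Vf i)" if "i < n" "p \<in> cdom (c i)" for i p
    unfolding smooth_near_def Vf_def
    using smooth_fun_pull[OF cA smooth_on_subset[OF v(1)[OF that(1)]], of i] chartD(1)[OF cA] that(2) by blast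
  have Vf_deriv: "\<bar>X (Vf i)\<bar> \<le> (L p + \<delta> / 2) * sqrt (g p X X)" if i: "i < n" "p \<in> S i" and X: "X \<in> tangent_space A p" for i p X
  proof -
    have p: "p \<in> cdom (c i)" "cmap (c i) p \<in> cball (a i) (2 * r i)" using S_iff[OF i(1)] i(2) by auto
    have y: "cmap (c i) p \<in> cimg (c i)" using p by blast
    have "X (Vf i) = frechet_derivative (Vf i \<circ> cinv (c i)) (at (cmap (c i) p)) (vec_comp (c i) X)"
      by (rule tangent_apply[OF X Vf_near[OF i(1) p(1)] cA p(1)])
    also have "frechet_derivative (Vf i \<circ> cinv (c i)) (at (cmap (c i) p)) = frechet_derivative (v i) (at (cmap (c i) p))"
      by (rule frechet_derivative_cong_open[OF chartD(2)[OF cA] y]) (use chartD(7)[OF cA] in \<open>auto simp: Vf_def\<close>)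
    finally have "\<bar>X (Vf i)\<bar> \<le> (L (cinv (c i) (cmap (c i) p)) + \<delta> / 2) * sqrt (gc (c i) (cmap (c i) p) (vec_comp (c i) X) (vec_comp (c i) X))"
      using v(3)[OF i(1) p(2)] by simp
    also have "gc (c i) (cmap (c i) p) (vec_comp (c i) X) (vec_comp (c i) X) = g p X X"
      using metric_chart_vec[OF cA p(1)] tangent_spaceE[OF X cA p(1)] by metis
    finally show ?thesis using chartD(6)[OF cA p(1)] by simp
  qed
  \<comment> \<open>\<open>Vf i\<close> is meaningful only on the chart domain. Multiplied by the
    bump and extended by 0 it is smooth on the whole manifold; the remaining factor
    \<open>P i\<close> of \<open>\<psi> i\<close> is already global.\<close>
  define G where "G i p = (if p \<in> cdom (c i) then bump (a i) (r i) (2 * r i) (cmap (c i) p) * v i (cmap (c i) p) else 0)" for i p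
  have G_smooth: "smooth_fun A UNIV (G i)" if "i < n" for i
    unfolding G_def
  proof (rule smooth_fun_extend[OF cA smooth_on_mult[OF chartD(2)[OF cA]] compact_cball a2[OF that]])
    show "smooth_on (bump (a i) (r i) (2 * r i)) (cimg (c i))" by (rule smooth_on_subset[OF bump_smooth subset_UNIV])
    show "smooth_on (v i) (cimg (c i))" by (rule smooth_on_subset[OF v(1)[OF that] subset_UNIV])
  qed (use bump0[OF that] in simp)
  have G_eq: "G i p = b i p * Vf i p" for i p by (simp add: G_def b_def Vf_def)
  define F where "F i p = P i p * G i p" for i p
  have F_smooth: "smooth_fun A UNIV (F i)" if "i < n" for i
    unfolding F_def[abs_def] using that by (intro smooth_fun_mult P_smooth G_smooth) auto
  have F_eq: "F i p = \<psi> i p * Vf i p" for i p by (simp add: F_def G_eq \<psi>_def)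
  define \<phi> where "\<phi> p = (\<Sum>i<n. F i p)" for p
  have \<phi>_smooth: "smooth_fun A UNIV \<phi>" unfolding \<phi>_def[abs_def] by (intro smooth_fun_sum F_smooth) auto
  have \<psi>_S: "\<psi> i p = 0" if "i < n" "p \<notin> S i" for i p using b_S[OF that] by (simp add: \<psi>_def)
  have XF: "X (F i) = (if p \<in> S i then \<psi> i p * X (Vf i) + Vf i p * X (\<psi> i) else 0)"
    and X\<psi>: "p \<notin> S i \<Longrightarrow> X (\<psi> i) = 0" if i: "i < n" and X: "X \<in> tangent_space A p" for i p X
  proof -
    have out: "X (F i) = 0" "X (\<psi> i) = 0" if p: "p \<notin> S i"
    proof -
      have U: "open (- S i)" "p \<in> - S i" using S_closed[OF i] p by auto
      have "X (F i) = X (\<lambda>q. 0)" "X (\<psi> i) = X (\<lambda>q. 0)"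
        using tangent_cong[OF X smooth_near_fun[OF F_smooth[OF i]] smooth_near_fun[OF smooth_fun_const] U]
          tangent_cong[OF X smooth_near_fun[OF \<psi>_smooth[OF i]] smooth_near_fun[OF smooth_fun_const] U]
          \<psi>_S[OF i] F_eq by auto
      then show "X (F i) = 0" "X (\<psi> i) = 0" using tangent_const[OF X] by auto
    qed
    show "p \<notin> S i \<Longrightarrow> X (\<psi> i) = 0" by (rule out)
    show "X (F i) = (if p \<in> S i then \<psi> i p * X (Vf i) + Vf i p * X (\<psi> i) else 0)"
    proof (cases "p \<in> S i")
      case True
      then have "p \<in> cdom (c i)" using S_iff[OF i] by blast
      moreover have "F i = (\<lambda>p. \<psi> i p * Vf i p)" by (rule ext) (rule F_eq)
      ultimately show ?thesis using tangent_mult[OF X smooth_near_fun[OF \<psi>_smooth[OF i]] Vf_near[OF i]] True by simp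
    qed (use out in simp)
  qed
  show thesis
  proof (rule that[OF \<phi>_smooth])
    show "{p. \<phi> p \<noteq> 0} \<subseteq> V"
    proof
      fix p assume "p \<in> {p. \<phi> p \<noteq> 0}"
      then have "\<exists>i<n. F i p \<noteq> 0" unfolding \<phi>_def by (auto dest: sum.not_neutral_contains_not_neutral)
      then obtain i where i: "i < n" "p \<in> S i" using \<psi>_S F_eq by (metis mult_zero_left)
      then obtain y where "y \<in> cball (a i) (2 * r i)" "p = cinv (c i) y" by (auto simp: S_def)
      then show "p \<in> V" using a3V[OF i(1), of y] r[OF i(1)] by simp
    qed
  next
    fix p
    \<comment> \<open>On \<open>K\<close> the partition sums to 1 and off \<open>K\<close> the
      function \<open>u\<close> vanishes, so \<open>u\<close> equals its own glued version.\<close>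
    have "(1 - (\<Sum>i<n. \<psi> i p)) * u p = 0" using sum\<psi>_W[of p] K(2)[of p] KW by (cases "p \<in> K") auto
    then have "\<phi> p - u p = (\<Sum>i<n. \<psi> i p * (Vf i p - u p))"
      by (simp add: \<phi>_def F_eq right_diff_distrib sum_subtractf sum_distrib_right[symmetric] left_diff_distrib)
    also have "\<bar>\<dots>\<bar> \<le> (\<Sum>i<n. \<bar>\<psi> i p * (Vf i p - u p)\<bar>)" by (rule sum_abs)
    also have "\<dots> \<le> (\<Sum>i<n. \<psi> i p * \<eta>)"
    proof (rule sum_mono)
      fix i assume "i \<in> {..<n}"
      then have i: "i < n" by simp
      show "\<bar>\<psi> i p * (Vf i p - u p)\<bar> \<le> \<psi> i p * \<eta>"
        using Vf_u[OF i, of p] \<psi>_S[OF i, of p] \<psi>0[of i p] by (cases "p \<in> S i") (auto simp: abs_mult intro!: mult_left_mono)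
    qed
    also have "\<dots> \<le> 1 * \<eta>" unfolding sum_distrib_right[symmetric] using sum\<psi>_le \<eta> by (intro mult_right_mono) auto
    finally show "\<bar>\<phi> p - u p\<bar> \<le> \<delta>" using \<eta>(3) by simp
  next
    fix p
    show "g p (grad A g \<phi> p) (grad A g \<phi> p) \<le> (L p + \<delta>)\<^sup>2"
    proof (rule grad_bound[OF \<phi>_smooth])
      show "0 \<le> L p + \<delta>" using L(2)[of p] \<delta> by simp
      fix X assume X: "X \<in> tangent_space A p"
      let ?N = "sqrt (g p X X)"
      have N: "?N \<ge> 0" using metric_nonneg[OF X] by simp
      let ?I = "{i. i < n \<and> p \<in> S i}"
      have fin: "finite ?I" by simp
      have I: "(\<Sum>i<n. if p \<in> S i then f i else 0) = (\<Sum>i\<in>?I. f i)" for f :: "nat \<Rightarrow> real"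
        by (simp add: sum.If_cases) (rule sum.cong, auto)
      have X\<phi>: "X \<phi> = (\<Sum>i\<in>?I. \<psi> i p * X (Vf i) + Vf i p * X (\<psi> i))"
      proof -
        have "X \<phi> = (\<Sum>i<n. X (F i))" unfolding \<phi>_def[abs_def] by (rule tangent_sum[OF X]) (use F_smooth in auto)
        also have "\<dots> = (\<Sum>i<n. if p \<in> S i then \<psi> i p * X (Vf i) + Vf i p * X (\<psi> i) else 0)"
          by (rule sum.cong[OF refl]) (use XF[OF _ X] in auto)
        finally show ?thesis by (simp only: I)
      qed
      \<comment> \<open>The same alternative for derivatives: near a point of \<open>K\<close> the
        sum of the \<open>\<psi> i\<close> is constant, and off \<open>K\<close> the factor
        \<open>u p\<close> is 0.\<close>
      have "u p * (\<Sum>i\<in>?I. X (\<psi> i)) = 0"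
      proof (cases "p \<in> K")
        case True
        have "(\<Sum>i\<in>?I. X (\<psi> i)) = (\<Sum>i<n. X (\<psi> i))"
          by (rule sum.mono_neutral_left) (use X\<psi>[OF _ X] in auto)
        also have "\<dots> = X (\<lambda>q. \<Sum>i<n. \<psi> i q)" by (rule tangent_sum[OF X, symmetric]) (use \<psi>_smooth in auto)
        also have "\<dots> = X (\<lambda>q. 1)"
          by (rule tangent_cong[OF X _ smooth_near_fun[OF smooth_fun_const] W])
            (use True KW sum\<psi>_W \<psi>_smooth in \<open>auto intro!: smooth_near_fun smooth_fun_sum\<close>)
        finally show ?thesis by (simp add: tangent_const[OF X])
      qed (use K(2) in simp)
      then have "X \<phi> = (\<Sum>i\<in>?I. \<psi> i p * X (Vf i) + (Vf i p - u p) * X (\<psi> i))"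
        unfolding X\<phi> by (simp add: sum.distrib left_diff_distrib sum_subtractf sum_distrib_left)
      also have "\<bar>\<dots>\<bar> \<le> (\<Sum>i\<in>?I. \<bar>\<psi> i p * X (Vf i) + (Vf i p - u p) * X (\<psi> i)\<bar>)" by (rule sum_abs)
      also have "\<dots> \<le> (\<Sum>i\<in>?I. \<psi> i p * ((L p + \<delta> / 2) * ?N) + \<eta> * (C i * ?N))"
      proof (rule sum_mono)
        fix i assume "i \<in> ?I"
        then have i: "i < n" "p \<in> S i" by auto
        have "\<bar>\<psi> i p * X (Vf i)\<bar> \<le> \<psi> i p * ((L p + \<delta> / 2) * ?N)"
          using Vf_deriv[OF i X] \<psi>0 by (simp add: abs_mult mult_left_mono)
        moreover have "\<bar>(Vf i p - u p) * X (\<psi> i)\<bar> \<le> \<eta> * (C i * ?N)"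
          unfolding abs_mult using Vf_u[OF i] C(2)[OF i X] by (intro mult_mono) (use \<eta>(1) in auto)
        ultimately show "\<bar>\<psi> i p * X (Vf i) + (Vf i p - u p) * X (\<psi> i)\<bar> \<le> \<psi> i p * ((L p + \<delta> / 2) * ?N) + \<eta> * (C i * ?N)"
          by linarith
      qed
      also have "\<dots> = (\<Sum>i\<in>?I. \<psi> i p) * ((L p + \<delta> / 2) * ?N) + \<eta> * (\<Sum>i\<in>?I. C i) * ?N"
        by (simp add: sum.distrib sum_distrib_right sum_distrib_left mult.assoc)
      also have "\<dots> \<le> 1 * ((L p + \<delta> / 2) * ?N) + (\<eta> * Ct) * ?N"
      proof (intro add_mono mult_right_mono mult_left_mono)
        have "(\<Sum>i\<in>?I. \<psi> i p) \<le> (\<Sum>i<n. \<psi> i p)" using \<psi>0 by (intro sum_mono2) auto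
        then show "(\<Sum>i\<in>?I. \<psi> i p) \<le> 1" using sum\<psi>_le[of p] by simp
        show "(\<Sum>i\<in>?I. C i) \<le> Ct" unfolding Ct_def using C(1) by (intro sum_mono2) auto
      qed (use N L(2)[of p] \<delta> \<eta>(1) in auto)
      also have "\<dots> \<le> (L p + \<delta>) * ?N"
      proof -
        have "(\<eta> * Ct) * ?N \<le> (\<delta> / 2) * ?N" by (rule mult_right_mono[OF \<eta>(2) N])
        then show ?thesis by (simp add: algebra_simps)
      qed
      finally show "\<bar>X \<phi>\<bar> \<le> (L p + \<delta>) * ?N" .
    qed
  qed
qed

end

subsection \<open>The stability potential\<close>

text \<open>Under a change of basis the metric and the bilinear form are both multiplied by
  \<open>transpose J\<close> and \<open>J\<close>. In the product these factors cancel against those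
  of the inverse metric except for one conjugation, to which the trace is insensitive.\<close>

lemma trace_congruence:
  fixes G Gi M J K :: "real^'n^'n"
  assumes JK: "J ** K = mat 1" and Gi: "Gi ** G = mat 1"
  shows "matrix_inv (transpose J ** G ** J) = K ** Gi ** transpose K"
    and "trace ((K ** Gi ** transpose K) ** (transpose J ** M ** J) ** (K ** Gi ** transpose K) ** transpose (transpose J ** M ** J))
      = trace (Gi ** M ** Gi ** transpose M)"
proof -
  have KJ: "K ** J = mat 1" using JK matrix_left_right_inverse by blast
  have tr: "transpose K ** transpose J = mat 1" by (metis JK matrix_transpose_mul transpose_mat)
  have c1: "transpose K ** (transpose J ** X) = X" for X :: "real^'n^'n"
    by (simp add: matrix_mul_assoc tr)
  have c2: "J ** (K ** X) = X" for X :: "real^'n^'n" by (simp add: matrix_mul_assoc JK)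
  have c3: "Gi ** (G ** X) = X" for X :: "real^'n^'n" by (simp add: matrix_mul_assoc Gi)
  let ?P = "transpose J ** G ** J" let ?R = "K ** Gi ** transpose K"
  have RP: "?R ** ?P = mat 1"
    by (simp add: matrix_mul_assoc[symmetric] c1 c3 KJ)
  then have PR: "?P ** ?R = mat 1" using matrix_left_right_inverse by blast
  have "invertible ?P" using RP PR unfolding invertible_def by blast
  then have "?P ** matrix_inv ?P = mat 1" "matrix_inv ?P ** ?P = mat 1"
    using someI_ex[of "\<lambda>A'. ?P ** A' = mat 1 \<and> A' ** ?P = mat 1"] unfolding matrix_inv_def invertible_def by blast+
  then show "matrix_inv ?P = ?R" by (metis PR matrix_mul_assoc matrix_mul_lid matrix_mul_rid)
  have "?R ** (transpose J ** M ** J) ** ?R ** transpose (transpose J ** M ** J) = K ** (Gi ** M ** Gi ** transpose M ** J)"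
    by (simp add: matrix_mul_assoc[symmetric] c1 c2 matrix_transpose_mul)
  then have "trace (?R ** (transpose J ** M ** J) ** ?R ** transpose (transpose J ** M ** J))
     = trace ((Gi ** M ** Gi ** transpose M ** J) ** K)"
    by (simp only:) (rule trace_mul_sym)
  also have "(Gi ** M ** Gi ** transpose M ** J) ** K = Gi ** M ** Gi ** transpose M"
    by (simp add: matrix_mul_assoc[symmetric] JK)
  finally show "trace (?R ** (transpose J ** M ** J) ** ?R ** transpose (transpose J ** M ** J)) = trace (Gi ** M ** Gi ** transpose M)" .
qed

lemma bilinear_pullback_matrix:
  fixes S :: "real^'n \<Rightarrow> real^'n \<Rightarrow> real" and j :: "real^'n \<Rightarrow> real^'n"
  assumes S: "bilinear S"
  shows "(\<chi> a b. S (j (axis a 1)) (j (axis b 1))) = transpose (matrix j) ** (\<chi> a b. S (axis a 1) (axis b 1)) ** matrix j"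
proof -
  have "S u v = (\<Sum>i\<in>UNIV. \<Sum>k\<in>UNIV. u $ i * S (axis i 1) (axis k 1) * v $ k)" for u v
  proof -
    have "S (\<Sum>i\<in>UNIV. u $ i *s axis i 1) (\<Sum>k\<in>UNIV. v $ k *s axis k 1)
       = (\<Sum>(i,k)\<in>UNIV \<times> UNIV. S (u $ i *s axis i 1) (v $ k *s axis k 1))"
      by (rule bilinear_sum[OF S])
    also have "\<dots> = (\<Sum>i\<in>UNIV. \<Sum>k\<in>UNIV. u $ i * S (axis i 1) (axis k 1) * v $ k)"
      by (simp add: sum.cartesian_product scalar_mult_eq_scaleR bilinear_lmul[OF S] bilinear_rmul[OF S] mult_ac)
    finally show ?thesis by (simp only: basis_expansion)
  qed
  note ex = this
  let ?M = "\<chi> a b. S (axis a 1) (axis b 1)"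
  have "S (j (axis a 1)) (j (axis b 1)) = (transpose (matrix j) ** ?M ** matrix j) $ a $ b" for a b
  proof -
    have "(transpose (matrix j) ** ?M ** matrix j) $ a $ b
      = (\<Sum>k\<in>UNIV. \<Sum>i\<in>UNIV. j (axis a 1) $ i * S (axis i 1) (axis k 1) * j (axis b 1) $ k)"
      by (simp add: matrix_matrix_mult_def transpose_def matrix_def sum_distrib_right)
    also have "\<dots> = (\<Sum>i\<in>UNIV. \<Sum>k\<in>UNIV. j (axis a 1) $ i * S (axis i 1) (axis k 1) * j (axis b 1) $ k)"
      by (rule sum.swap)
    finally show ?thesis by (simp only: ex[of "j (axis a 1)" "j (axis b 1)"])
  qed
  then show ?thesis by (simp add: vec_eq_iff)
qed

context riemannian_manifold
begin

definition coord_matrix :: "('a, 'n) chart \<Rightarrow> 'a metric \<Rightarrow> 'a \<Rightarrow> real^'n^'n"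
  where "coord_matrix c T x = (\<chi> i j. T x (chart_vec A c x (axis i 1)) (chart_vec A c x (axis j 1)))"

text \<open>The four-fold index sum becomes a trace of matrices once the symmetry of the inverse
  metric is used; in this form change of basis and the trace inequality apply.\<close>

lemma bilinear_normsq_trace:
  "bilinear_normsq A g T x = (let c = chart_at A x; Gi = ginv A g c (cmap c x); M = coord_matrix c T x in trace (Gi ** M ** Gi ** transpose M))"
proof -
  define c where "c = chart_at A x"
  define Gi where "Gi = ginv A g c (cmap c x)"
  define M where "M = coord_matrix c T x"
  have c: "c \<in> A" "x \<in> cdom c" using chart_at by (auto simp: c_def)
  have "cmap c x \<in> cimg c" using c by auto
  then have sym: "Gi $ i $ k = Gi $ k $ i" for i k
    using arg_cong[OF ginv_sym[OF c(1)], of "cmap c x" "\<lambda>G. G $ k $ i"] by (simp add: Gi_def transpose_def)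
  have "bilinear_normsq A g T x = (\<Sum>i\<in>UNIV. \<Sum>j\<in>UNIV. \<Sum>k\<in>UNIV. \<Sum>l\<in>UNIV. Gi $ i $ k * Gi $ j $ l * M $ i $ j * M $ k $ l)"
    by (simp add: bilinear_normsq_def Let_def c_def Gi_def M_def coord_matrix_def)
  also have "\<dots> = (\<Sum>k\<in>UNIV. \<Sum>i\<in>UNIV. \<Sum>j\<in>UNIV. \<Sum>l\<in>UNIV. Gi $ k $ i * M $ i $ j * Gi $ j $ l * M $ k $ l)"
  proof -
    have "(\<Sum>i\<in>UNIV. \<Sum>j\<in>UNIV. \<Sum>k\<in>UNIV. \<Sum>l\<in>UNIV. Gi $ i $ k * Gi $ j $ l * M $ i $ j * M $ k $ l)
      = (\<Sum>i\<in>UNIV. \<Sum>k\<in>UNIV. \<Sum>j\<in>UNIV. \<Sum>l\<in>UNIV. Gi $ i $ k * Gi $ j $ l * M $ i $ j * M $ k $ l)"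
      by (rule sum.cong[OF refl], rule sum.swap)
    also have "\<dots> = (\<Sum>k\<in>UNIV. \<Sum>i\<in>UNIV. \<Sum>j\<in>UNIV. \<Sum>l\<in>UNIV. Gi $ i $ k * Gi $ j $ l * M $ i $ j * M $ k $ l)"
      by (rule sum.swap)
    moreover have "Gi $ i $ k * Gi $ j $ l * M $ i $ j * M $ k $ l = Gi $ k $ i * M $ i $ j * Gi $ j $ l * M $ k $ l" for i j k l
      by (subst sym[of i k]) (simp only: mult_ac)
    ultimately show ?thesis by (simp only:)
  qed
  also have "\<dots> = (\<Sum>k\<in>UNIV. \<Sum>l\<in>UNIV. (\<Sum>j\<in>UNIV. (\<Sum>i\<in>UNIV. Gi $ k $ i * M $ i $ j) * Gi $ j $ l) * M $ k $ l)"
  proof (rule sum.cong[OF refl])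
    fix k
    have "(\<Sum>i\<in>UNIV. \<Sum>j\<in>UNIV. \<Sum>l\<in>UNIV. Gi $ k $ i * M $ i $ j * Gi $ j $ l * M $ k $ l)
       = (\<Sum>i\<in>UNIV. \<Sum>l\<in>UNIV. \<Sum>j\<in>UNIV. Gi $ k $ i * M $ i $ j * Gi $ j $ l * M $ k $ l)"
      by (rule sum.cong[OF refl], rule sum.swap)
    also have "\<dots> = (\<Sum>l\<in>UNIV. \<Sum>i\<in>UNIV. \<Sum>j\<in>UNIV. Gi $ k $ i * M $ i $ j * Gi $ j $ l * M $ k $ l)" by (rule sum.swap)
    also have "\<dots> = (\<Sum>l\<in>UNIV. \<Sum>j\<in>UNIV. \<Sum>i\<in>UNIV. Gi $ k $ i * M $ i $ j * Gi $ j $ l * M $ k $ l)"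
      by (rule sum.cong[OF refl], rule sum.swap)
    finally show "(\<Sum>i\<in>UNIV. \<Sum>j\<in>UNIV. \<Sum>l\<in>UNIV. Gi $ k $ i * M $ i $ j * Gi $ j $ l * M $ k $ l)
       = (\<Sum>l\<in>UNIV. (\<Sum>j\<in>UNIV. (\<Sum>i\<in>UNIV. Gi $ k $ i * M $ i $ j) * Gi $ j $ l) * M $ k $ l)"
      by (simp add: sum_distrib_right)
  qed
  also have "\<dots> = trace (Gi ** M ** Gi ** transpose M)"
    by (simp add: trace_def matrix_matrix_mult_def transpose_def)
  finally show ?thesis by (simp add: Let_def c_def Gi_def M_def)
qed

lemma bilinear_trace_trace:
  "bilinear_trace A g T x = (let c = chart_at A x in trace (ginv A g c (cmap c x) ** coord_matrix c T x))"
proof -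
  define c where "c = chart_at A x"
  define Gi where "Gi = ginv A g c (cmap c x)"
  have c: "c \<in> A" "x \<in> cdom c" using chart_at by (auto simp: c_def)
  have "cmap c x \<in> cimg c" using c by auto
  then have sym: "Gi $ i $ k = Gi $ k $ i" for i k
    using arg_cong[OF ginv_sym[OF c(1)], of "cmap c x" "\<lambda>G. G $ k $ i"] by (simp add: Gi_def transpose_def)
  have "bilinear_trace A g T x = (\<Sum>i\<in>UNIV. \<Sum>j\<in>UNIV. Gi $ i $ j * coord_matrix c T x $ i $ j)"
    by (simp add: bilinear_trace_def Let_def c_def Gi_def coord_matrix_def)
  also have "\<dots> = (\<Sum>j\<in>UNIV. \<Sum>i\<in>UNIV. Gi $ i $ j * coord_matrix c T x $ i $ j)" by (rule sum.swap)
  also have "\<dots> = (\<Sum>j\<in>UNIV. \<Sum>i\<in>UNIV. Gi $ j $ i * coord_matrix c T x $ i $ j)"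
    by (rule sum.cong[OF refl], rule sum.cong[OF refl], subst sym, rule refl)
  finally show ?thesis by (simp add: Let_def c_def Gi_def trace_def matrix_matrix_mult_def)
qed

lemma bilinear_normsq_chart:
  assumes c: "c \<in> A" "x \<in> cdom c" and bil: "bilinear (\<lambda>u v. T x (chart_vec A c x u) (chart_vec A c x v))"
  shows "bilinear_normsq A g T x = trace (ginv A g c (cmap c x) ** coord_matrix c T x ** ginv A g c (cmap c x) ** transpose (coord_matrix c T x))"
proof -
  let ?c = "chart_at A x"
  note c0 = chart_at[of x]
  let ?j = "trans_deriv ?c c (cmap ?c x)" let ?k = "trans_deriv c ?c (cmap c x)"
  note lj = trans_deriv_linear[OF c0(1) c(1) c0(2) c(2)] and lk = trans_deriv_linear[OF c(1) c0(1) c(2) c0(2)]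
  have y: "cmap c x \<in> cimg c" "cmap ?c x \<in> cimg ?c" using c c0 by auto
  have "?j \<circ> ?k = id" using trans_deriv_inverse[OF c(1) c0(1) c(2) c0(2)] by (simp add: fun_eq_iff)
  then have JK: "matrix ?j ** matrix ?k = mat 1"
    using matrix_compose[OF lk lj] by (simp add: matrix_id_mat_1)
  have M: "coord_matrix ?c T x = transpose (matrix ?j) ** coord_matrix c T x ** matrix ?j"
    using bilinear_pullback_matrix[OF bil] by (simp add: coord_matrix_def chart_vec_change[OF c0(1) c(1) c0(2) c(2)])
  have G: "gmat A g ?c (cmap ?c x) = transpose (matrix ?j) ** gmat A g c (cmap c x) ** matrix ?j"
    using bilinear_pullback_matrix[OF metric_coordD(1)[OF c(1) y(1)]]
    by (simp add: gmat_def metric_coord_change[OF c0(1) c(1) c0(2) c(2)])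
  show ?thesis
    unfolding bilinear_normsq_trace Let_def M ginv_def[of A g ?c] G trace_congruence(1)[OF JK ginv_mult(2)[OF c(1) y(1)]]
    by (rule trace_congruence(2)[OF JK ginv_mult(2)[OF c(1) y(1)]])
qed

end

section \<open>The second fundamental form in coordinates and the lower bound for the
  potential\<close>

context hypersurface
begin

definition normal_coord :: "('a, 'n) chart \<Rightarrow> ('b, 'm) chart \<Rightarrow> real^'m \<Rightarrow> real^'n"
  where "normal_coord c b y = vec_comp c (\<nu> (cinv b y))"

definition cov_normal_coord :: "('a, 'n) chart \<Rightarrow> ('b, 'm) chart \<Rightarrow> real^'m \<Rightarrow> real^'m \<Rightarrow> real^'n"
  where "cov_normal_coord c b y u = frechet_derivative (normal_coord c b) (at y) u + amb.Gam c (emb c b y) (demb c b y u) (normal_coord c b y)"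

definition II_loc :: "('a, 'n) chart \<Rightarrow> ('b, 'm) chart \<Rightarrow> real^'m \<Rightarrow> real^'m \<Rightarrow> real^'m \<Rightarrow> real"
  where "II_loc c b y u v = metric_coord A g c (emb c b y) (cov_normal_coord c b y u) (demb c b y v)"

lemma smooth_normal_coord: "c \<in> A \<Longrightarrow> b \<in> B \<Longrightarrow> smooth_on (normal_coord c b) (overlap c b)"
  using smooth_normal[of c b] by (simp add: normal_coord_def[abs_def])

lemma cov_deriv_chart:
  assumes b: "b \<in> B" "x \<in> cdom b"
  defines "c \<equiv> chart_at A (\<iota> x)"
  shows "cov_deriv_along A g \<iota> \<nu> x (chart_vec B b x u) = chart_vec A c (\<iota> x) (cov_normal_coord c b (cmap b x) u)"
proof -
  have c: "c \<in> A" "\<iota> x \<in> cdom c" using amb.chart_at by (auto simp: c_def)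
  have y: "cmap b x \<in> overlap c b" using b c by (auto simp: overlap_def)
  have e: "emb c b (cmap b x) = cmap c (\<iota> x)" "normal_coord c b (cmap b x) = vec_comp c (\<nu> x)"
    using sub.chartD(6)[OF b] by (simp_all add: emb_def normal_coord_def)
  have 1: "chart_vec B b x u (\<lambda>x'. vec_comp c (\<nu> x') $ k) = frechet_derivative (normal_coord c b) (at (cmap b x)) u $ k" for k
  proof -
    have "smooth_near B x (\<lambda>x'. vec_comp c (\<nu> x') $ k)"
      unfolding smooth_near_def using open_vimage_cdom[OF c(1)] c(2) sub.smooth_fun_vec_nth[OF open_vimage_cdom[OF c(1)] hypersurfaceD(7)[OF c(1)]]
      by blast
    moreover have "((\<lambda>y. normal_coord c b y $ k) has_derivative (\<lambda>u. frechet_derivative (normal_coord c b) (at (cmap b x)) u $ k)) (at (cmap b x))"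
      by (rule bounded_linear.has_derivative[OF bounded_linear_vec_nth smooth_on_has_derivative[OF smooth_normal_coord[OF c(1) b(1)] y]])
    ultimately show ?thesis
      by (simp add: sub.chart_vec_apply comp_def normal_coord_def frechet_derivative_eqI)
  qed
  have 2: "vec_comp c (differential A \<iota> x (chart_vec B b x u)) = demb c b (cmap b x) u"
    using differential_chart_vec[OF c b] amb.vec_comp_chart_vec[OF c] by simp
  show ?thesis
    unfolding cov_deriv_along_def Let_def c_def[symmetric] 1 2 cov_normal_coord_def amb.Gam_def e
    by (rule arg_cong[where f="chart_vec A c (\<iota> x)"]) (simp add: vec_eq_iff)
qed

lemma second_ff_chart_at:
  assumes b: "b \<in> B" "x \<in> cdom b"
  shows "second_ff A g \<iota> \<nu> x (chart_vec B b x u) (chart_vec B b x v) = II_loc (chart_at A (\<iota> x)) b (cmap b x) u v"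
proof -
  let ?c = "chart_at A (\<iota> x)"
  have c: "?c \<in> A" "\<iota> x \<in> cdom ?c" by (rule amb.chart_at)+
  have "emb ?c b (cmap b x) = cmap ?c (\<iota> x)" using sub.chartD(6)[OF b] by (simp add: emb_def)
  then show ?thesis
    unfolding second_ff_def cov_deriv_chart[OF b] differential_chart_vec[OF c b] amb.metric_chart_vec[OF c]
    by (simp add: II_loc_def)
qed

text \<open>The normal field transforms by the Jacobian of the ambient transition map, and
  differentiating that Jacobian along the hypersurface gives a \<open>T2\<close> term.
  \<open>Gam_trans\<close> contains the same term, so the covariant derivative transforms as a
  vector.\<close>

lemma II_loc_trans:
  assumes c: "c \<in> A" "c' \<in> A" and b: "b \<in> B" and y: "y \<in> overlap c b" "y \<in> overlap c' b"
  shows "II_loc c b y u v = II_loc c' b y u v"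
proof -
  let ?O = "overlap c b \<inter> overlap c' b"
  have o: "open ?O" by (intro open_Int open_overlap c b)
  have yO: "y \<in> ?O" using y by simp
  have ed: "emb c b z \<in> amb.chart_overlap c c'" "amb.trans c c' (emb c b z) = emb c' b z" if "z \<in> ?O" for z
    using overlapD[OF b] that amb.chartD(6)[OF c(1)] by (auto simp: amb.chart_overlap_def emb_def amb.trans_def)
  have Nu': "normal_coord c' b z = amb.J c c' (emb c b z) (normal_coord c b z)" if "z \<in> ?O" for z
    using amb.vec_comp_change[OF hypersurfaceD(5) c, of "cinv b z"] overlapD(2)[OF b, of z] that
    by (simp add: normal_coord_def emb_def amb.trans_def)
  note dE = smooth_on_has_derivative[OF smooth_emb[OF c(1) b] y(1)] and dN = smooth_on_has_derivative[OF smooth_normal_coord[OF c(1) b] y(1)]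
  note e = ed(1)[OF yO]
  have "((\<lambda>z. amb.trans c c' (emb c b z)) has_derivative (\<lambda>u. amb.J c c' (emb c b y) (demb c b y u))) (at y)"
    by (rule has_derivative_compose[OF dE amb.has_derivative_trans[OF c e]])
  then have "(emb c' b has_derivative (\<lambda>u. amb.J c c' (emb c b y) (demb c b y u))) (at y)"
    by (rule has_derivative_transform_within_open[OF _ o yO]) (rule ed(2))
  then have demb': "demb c' b y u = amb.J c c' (emb c b y) (demb c b y u)" for u
    by (simp add: frechet_derivative_eqI)
  have d: "((\<lambda>z. amb.J c c' (emb c b z) a) has_derivative (\<lambda>u. amb.T2 c c' (emb c b y) (demb c b y u) a)) (at y)" for a
    by (rule has_derivative_compose[OF dE smooth_on_has_derivative[OF amb.smooth_J[OF c] e]])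
  have "((\<lambda>z. amb.J c c' (emb c b z) (normal_coord c b z)) has_derivative
     (\<lambda>u. amb.T2 c c' (emb c b y) (demb c b y u) (normal_coord c b y) + amb.J c c' (emb c b y) (frechet_derivative (normal_coord c b) (at y) u))) (at y)"
    by (rule has_derivative_linear_family[OF o yO amb.linear_J[OF c ed(1)] d dN])
  then have "(normal_coord c' b has_derivative
     (\<lambda>u. amb.T2 c c' (emb c b y) (demb c b y u) (normal_coord c b y) + amb.J c c' (emb c b y) (frechet_derivative (normal_coord c b) (at y) u))) (at y)"
    by (rule has_derivative_transform_within_open[OF _ o yO]) (rule Nu'[symmetric])
  then have "cov_normal_coord c' b y u = amb.J c c' (emb c b y) (cov_normal_coord c b y u)"
    unfolding cov_normal_coord_def linear_add[OF amb.linear_J[OF c e]] amb.Gam_trans[OF c e]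
    by (simp add: frechet_derivative_eqI demb' Nu'[OF yO] ed(2)[OF yO])
  then show ?thesis
    unfolding II_loc_def amb.metric_coord_trans[OF c e] by (simp add: demb' ed(2)[OF yO])
qed

lemma second_ff_chart:
  assumes c: "c \<in> A" "\<iota> x \<in> cdom c" and b: "b \<in> B" "x \<in> cdom b"
  shows "second_ff A g \<iota> \<nu> x (chart_vec B b x u) (chart_vec B b x v) = II_loc c b (cmap b x) u v"
  unfolding second_ff_chart_at[OF b]
  by (rule II_loc_trans[OF amb.chart_at(1) c(1) b(1)]) (use c b amb.chart_at in \<open>auto simp: overlap_def\<close>)

lemma bilinear_II_loc:
  assumes c: "c \<in> A" and b: "b \<in> B" and y: "y \<in> overlap c b"
  shows "bilinear (II_loc c b y)"
proof -
  note bg = amb.metric_coordD(1)[OF c emb_cimg[OF b y]] and bG = amb.bilinear_Gam[of c "emb c b y"]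
  note lE = demb_linear[OF c b y] and lN = frechet_derivative_linear[OF smooth_on_differentiable[OF smooth_normal_coord[OF c b] y]]
  note ls = linear_add[OF lE] linear_scale[OF lE] linear_add[OF lN] linear_scale[OF lN]
    bilinear_ladd[OF bG] bilinear_lmul[OF bG] bilinear_ladd[OF bg] bilinear_radd[OF bg] bilinear_lmul[OF bg] bilinear_rmul[OF bg]
  show ?thesis
    unfolding bilinear_def II_loc_def cov_normal_coord_def by (auto intro!: linearI simp: ls algebra_simps)
qed

lemma continuous_II_loc:
  assumes c: "c \<in> A" and b: "b \<in> B"
  shows "continuous_on (overlap c b) (\<lambda>y. II_loc c b y u v)"
proof -
  note E = smooth_on_continuous[OF smooth_emb[OF c b]] and dE = smooth_on_continuous[OF smooth_on_frechet[OF smooth_emb[OF c b]]]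
  note N = smooth_on_continuous[OF smooth_normal_coord[OF c b]] and dN = smooth_on_continuous[OF smooth_on_frechet[OF smooth_normal_coord[OF c b]]]
  have im: "emb c b ` overlap c b \<subseteq> cimg c" using emb_cimg[OF b] by blast
  have ch: "continuous_on (overlap c b) (\<lambda>y. christoffel A g c k i j (emb c b y))" for k i j
    by (rule continuous_on_compose2[OF smooth_on_continuous[OF amb.smooth_christoffel[OF c]] E im])
  have "continuous_on (overlap c b) (\<lambda>y. cov_normal_coord c b y u)"
    unfolding cov_normal_coord_def amb.Gam_def by (intro continuous_intros ch dE dN N)
  then show ?thesis
    unfolding II_loc_def by (intro amb.continuous_metric_coord[OF c E im] dE)
qed

definition stability_potential :: "('a \<Rightarrow> real) \<Rightarrow> 'b \<Rightarrow> real"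
  where "stability_potential f x = Ric_inf A g f (\<iota> x) (\<nu> x) (\<nu> x) + bilinear_normsq B h (second_ff A g \<iota> \<nu>) x"

text \<open>Near \<open>x\<close> one pair of charts is fixed, and chart independence turns the
  potential into an explicit continuous expression \<open>q\<close> in the coordinates.\<close>

lemma continuous_stability_potential:
  assumes f: "smooth_fun A UNIV f"
  shows "continuous_on UNIV (stability_potential f)"
proof (rule continuous_at_imp_continuous_on, rule ballI)
  fix x
  define c where "c = chart_at A (\<iota> x)"
  define b where "b = chart_at B x"
  have c: "c \<in> A" "\<iota> x \<in> cdom c" using amb.chart_at by (auto simp: c_def)
  have b: "b \<in> B" "x \<in> cdom b" using sub.chart_at by (auto simp: b_def)
  let ?W = "\<iota> -` cdom c \<inter> cdom b"
  have W: "open ?W" using open_vimage_cdom[OF c(1)] sub.chartD(1)[OF b(1)] by auto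
  let ?O = "overlap c b"
  have im: "emb c b ` ?O \<subseteq> cimg c" using emb_cimg[OF b(1)] by blast
  note E = smooth_on_continuous[OF smooth_emb[OF c(1) b(1)]] and N = smooth_on_continuous[OF smooth_normal_coord[OF c(1) b(1)]]
  define M where "M y = (\<chi> i j. II_loc c b y (axis i 1) (axis j 1))" for y
  define q where "q y = amb.Ric_loc c (emb c b y) (normal_coord c b y) (normal_coord c b y) + amb.Hess_loc f c (emb c b y) (normal_coord c b y) (normal_coord c b y)
     + (\<Sum>i\<in>UNIV. \<Sum>j\<in>UNIV. (\<Sum>k\<in>UNIV. (\<Sum>l\<in>UNIV. ginv B h b y $ i $ l * M y $ l $ k) * ginv B h b y $ k $ j) * M y $ i $ j)" for y
  have Mc: "continuous_on ?O (\<lambda>y. M y $ i $ j)" for i j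
    unfolding M_def using continuous_II_loc[OF c(1) b(1)] by simp
  have Gc: "continuous_on ?O (\<lambda>y. ginv B h b y $ i $ j)" for i j
    by (rule continuous_on_subset[OF smooth_on_continuous[OF sub.smooth_ginv[OF b(1)]] overlap_subset])
  have q: "continuous_on ?O q"
    unfolding q_def by (intro Mc Gc continuous_intros amb.continuous_Ric_loc[OF c(1) E im N N] amb.continuous_Hess_loc[OF f c(1) E im N N])
  have "continuous_on ?W (\<lambda>z. q (cmap b z))"
    by (rule continuous_on_compose2[OF q continuous_on_subset[OF sub.chartD(3)[OF b(1)]]]) (auto simp: overlap_def)
  then have "continuous_on ?W (stability_potential f)"
  proof (rule continuous_on_eq)
    fix z assume z: "z \<in> ?W"
    then have zb: "z \<in> cdom b" and zc: "\<iota> z \<in> cdom c" by auto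
    have y: "cmap b z \<in> ?O" using z by (auto simp: overlap_def)
    have e: "emb c b (cmap b z) = cmap c (\<iota> z)" "normal_coord c b (cmap b z) = vec_comp c (\<nu> z)"
      using sub.chartD(6)[OF b(1) zb] by (simp_all add: emb_def normal_coord_def)
    note ff = second_ff_chart[OF c(1) zc b(1) zb]
    have T: "sub.coord_matrix b (second_ff A g \<iota> \<nu>) z = M (cmap b z)"
      by (simp add: sub.coord_matrix_def M_def ff)
    have "bilinear_normsq B h (second_ff A g \<iota> \<nu>) z = trace (ginv B h b (cmap b z) ** M (cmap b z) ** ginv B h b (cmap b z) ** transpose (M (cmap b z)))"
      unfolding T[symmetric] by (rule sub.bilinear_normsq_chart[OF b(1) zb]) (use bilinear_II_loc[OF c(1) b(1) y] in \<open>simp add: ff\<close>)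
    then show "q (cmap b z) = stability_potential f z"
      unfolding stability_potential_def q_def Ric_inf_def e amb.ricci_chart[OF c(1) zc hypersurfaceD(5) hypersurfaceD(5)] amb.hessian_chart[OF f c(1) zc hypersurfaceD(5) hypersurfaceD(5)]
      by (simp add: trace_def matrix_matrix_mult_def transpose_def)
  qed
  then show "isCont (stability_potential f) x" using W c b by (simp add: continuous_on_eq_continuous_at)
qed

lemma stability_potential_ge:
  assumes f: "smooth_fun A UNIV f" and min: "f_minimal A g f B \<iota> \<nu>"
    and Ric: "\<And>p X. X \<in> tangent_space A p \<Longrightarrow> Ric_1 A g f p X X \<ge> K * g p X X"
  shows "stability_potential f x \<ge> K"
proof -
  let ?b = "chart_at B x" let ?y = "cmap ?b x" let ?T = "second_ff A g \<iota> \<nu>"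
  note b = sub.chart_at[of x]
  have y: "?y \<in> cimg ?b" using b by auto
  define G where "G = gmat B h ?b ?y"
  define Gi where "Gi = ginv B h ?b ?y"
  define M where "M = sub.coord_matrix ?b ?T x"
  have "(trace (Gi ** M))\<^sup>2 \<le> real CARD('m) * trace (Gi ** M ** Gi ** transpose M)"
  proof (rule trace_sq_le_normsq)
    show "transpose G = G" unfolding G_def by (rule sub.gmat_sym[OF b(1) y])
    show "u \<bullet> (G *v u) > 0" if "u \<noteq> 0" for u
      unfolding G_def sub.metric_coord_matrix[OF b(1) y, symmetric] by (rule sub.metric_coordD(3)[OF b(1) y that])
    show "Gi ** G = mat 1" unfolding G_def Gi_def by (rule sub.ginv_mult[OF b(1) y])
  qed
  moreover have "trace (Gi ** M) = mean_curvature A g B \<iota> \<nu> x"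
    unfolding mean_curvature_def sub.bilinear_trace_trace by (simp add: Let_def Gi_def M_def)
  moreover have "mean_curvature A g B \<iota> \<nu> x = \<nu> x f"
    using min amb.grad_inner[OF f hypersurfaceD(5)] unfolding f_minimal_def by simp
  moreover have "trace (Gi ** M ** Gi ** transpose M) = bilinear_normsq B h ?T x"
    unfolding sub.bilinear_normsq_trace by (simp add: Let_def Gi_def M_def)
  ultimately have "(\<nu> x f)\<^sup>2 / real CARD('m) \<le> bilinear_normsq B h ?T x"
    by (simp add: divide_le_eq mult.commute)
  moreover have "K \<le> Ric_1 A g f (\<iota> x) (\<nu> x) (\<nu> x)" using Ric[OF hypersurfaceD(5), of x] hypersurfaceD(6) by simp
  \<comment> \<open>The hypersurface has dimension \<open>n - 1\<close>, so the constant of the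
    trace inequality is exactly the denominator in \<open>Ric_1\<close>.\<close>
  moreover have "Ric_1 A g f (\<iota> x) (\<nu> x) (\<nu> x) = Ric_inf A g f (\<iota> x) (\<nu> x) (\<nu> x) + (\<nu> x f)\<^sup>2 / real CARD('m)"
    using hypersurfaceD(1) by (simp add: Ric_1_def Ric_inf_def power2_eq_square)
  ultimately show ?thesis by (simp add: stability_potential_def)
qed

end

subsection \<open>The spectral bound from volume growth\<close>

text \<open>The slope of \<open>exp (- b * s)\<close> decreases in absolute value, so between two
  points it is bounded by the slope at the left one. Which of \<open>s\<close> and \<open>t\<close>
  that is remains open, hence a hypothesis at both.\<close>

lemma exp_neg_lipschitz:
  fixes b s t :: real
  assumes b: "0 \<le> b" and M: "b * exp (- b * s) \<le> M" "b * exp (- b * t) \<le> M"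
  shows "\<bar>exp (- b * s) - exp (- b * t)\<bar> \<le> M * \<bar>s - t\<bar>"
proof -
  have le: "\<bar>exp (- b * s) - exp (- b * t)\<bar> \<le> M * \<bar>s - t\<bar>"
    if "b * exp (- b * s) \<le> M" "s \<le> t" for s t
  proof -
    have "- b * t \<le> - b * s" using that b by (simp add: mult_left_mono)
    then have "\<bar>exp (- b * s) - exp (- b * t)\<bar> = exp (- b * s) - exp (- b * t)" by simp
    also have "\<dots> = exp (- b * s) * (1 - exp (- b * (t - s)))"
      by (simp add: right_diff_distrib flip: exp_add)
    also have "\<dots> \<le> exp (- b * s) * (b * (t - s))"
      using exp_ge_add_one_self[of "- b * (t - s)"] by (intro mult_left_mono) auto
    also have "\<dots> = (b * exp (- b * s)) * (t - s)" by simp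
    also have "\<dots> \<le> M * (t - s)" using that by (intro mult_right_mono) auto
    finally show ?thesis using that by simp
  qed
  show ?thesis using le[of s t] le[of t s] M by (cases "s \<le> t") (auto simp: abs_minus_commute)
qed

context riemannian_manifold
begin

lemma dist_component_iff: "riem_dist A g p q < top \<Longrightarrow> p \<in> dist_component x0 \<longleftrightarrow> q \<in> dist_component x0"
  using riem_dist_triangle[of x0 q p] riem_dist_triangle[of x0 p q] riem_dist_commute[of p q]
  by (auto simp: dist_component_def intro: le_less_trans)

text \<open>A small neighbourhood consists of points at finite distance from its centre, hence lies
  on one side. Openness of the complement is what makes the extension of the weight by 0
  continuous.\<close>

lemma open_Compl_dist_component: "open (- dist_component x0)"
proof (subst open_subopen, rule ballI)
  fix x assume x: "x \<in> - dist_component x0"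
  obtain U where U: "open U" "x \<in> U" "\<And>z. z \<in> U \<Longrightarrow> riem_dist A g x z < ennreal 1"
    using riem_dist_nhd[OF zero_less_one, of x] by blast
  have "z \<notin> dist_component x0" if z: "z \<in> U" for z
  proof -
    have "riem_dist A g x z < top" using U(3)[OF z] less_trans by fastforce
    then show ?thesis using dist_component_iff x by blast
  qed
  then show "\<exists>T. open T \<and> x \<in> T \<and> T \<subseteq> - dist_component x0" using U by blast
qed

lemma real_dist_diff_le:
  assumes "p \<in> dist_component x0" "riem_dist A g p q \<le> ennreal r" "0 \<le> r"
  shows "\<bar>real_dist x0 p - real_dist x0 q\<bar> \<le> r"
proof -
  interpret M: Metric_space "dist_component x0" real_dist by (rule Metric_space_dist_component)
  have "riem_dist A g p q < top" using assms(2) le_less_trans[OF _ ennreal_less_top] by blast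
  then have q: "q \<in> dist_component x0" using dist_component_iff assms(1) by blast
  have "ennreal (real_dist p q) \<le> ennreal r" using ennreal_real_dist[OF assms(1) q] assms(2) by simp
  then have "real_dist p q \<le> r" using assms(3) by simp
  moreover have "real_dist x0 q \<le> real_dist x0 p + real_dist p q" "real_dist x0 p \<le> real_dist x0 q + real_dist p q"
    using M.triangle[OF center_in_dist_component assms(1) q] M.triangle[OF center_in_dist_component q assms(1)] M.commute[of p q] by auto
  ultimately show ?thesis by linarith
qed

lemma continuous_real_dist: "continuous_on (dist_component x0) (real_dist x0)"
proof (rule continuous_at_imp_continuous_on, rule ballI)
  fix p assume p: "p \<in> dist_component x0"
  show "isCont (real_dist x0) p"
    unfolding isCont_def
  proof (rule tendstoI)
    fix e :: real assume e: "e > 0"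
    then have "e / 2 > 0" by simp
    then obtain U where U: "open U" "p \<in> U" "\<And>z. z \<in> U \<Longrightarrow> riem_dist A g p z < ennreal (e / 2)"
      using riem_dist_nhd[of "e / 2" p] by blast
    have "dist (real_dist x0 z) (real_dist x0 p) < e" if "z \<in> U" for z
    proof -
      have "\<bar>real_dist x0 p - real_dist x0 z\<bar> \<le> e / 2" using U(3)[OF that] e by (intro real_dist_diff_le[OF p]) simp_all
      then show ?thesis using e by (simp add: dist_real_def abs_minus_commute)
    qed
    then show "\<forall>\<^sub>F z in at p. dist (real_dist x0 z) (real_dist x0 p) < e"
      using U unfolding eventually_at_topological by blast
  qed
qed

text \<open>Off the component the distance is infinite, and for positive \<open>b\<close> the value
  0 is the limit of the exponential.\<close>

definition dist_exp :: "'a \<Rightarrow> real \<Rightarrow> 'a \<Rightarrow> real"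
  where "dist_exp x0 b x = (if x \<in> dist_component x0 then exp (- b * real_dist x0 x) else 0)"

lemma dist_exp_nonneg: "0 \<le> dist_exp x0 b x"
  by (simp add: dist_exp_def)

lemma dist_exp_le_1: "0 \<le> b \<Longrightarrow> dist_exp x0 b x \<le> 1"
  by (simp add: dist_exp_def real_dist_def)

lemma dist_exp_le:
  assumes "\<not> riem_dist A g x0 x < ennreal R" "0 \<le> b"
  shows "dist_exp x0 b x \<le> exp (- b * R)"
proof (cases "x \<in> dist_component x0")
  case True
  then have "ennreal R \<le> ennreal (real_dist x0 x)" using assms(1) ennreal_real_dist[OF center_in_dist_component True] by simp
  then have "R \<le> real_dist x0 x" by (simp add: real_dist_def ennreal_le_iff)
  then show ?thesis using True assms(2) by (simp add: dist_exp_def mult_left_mono)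
qed (simp add: dist_exp_def)

lemma continuous_dist_exp: "continuous_on UNIV (dist_exp x0 b)"
proof -
  have "continuous_on (dist_component x0) (dist_exp x0 b)"
    by (subst continuous_on_cong[OF refl, of _ _ "\<lambda>x. exp (- b * real_dist x0 x)"])
      (auto simp: dist_exp_def intro!: continuous_intros continuous_real_dist)
  moreover have "continuous_on (- dist_component x0) (dist_exp x0 b)"
    by (subst continuous_on_cong[OF refl, of _ _ "\<lambda>x. 0"]) (auto simp: dist_exp_def)
  ultimately have "continuous_on (dist_component x0 \<union> - dist_component x0) (dist_exp x0 b)"
    by (intro continuous_on_open_Un open_dist_component open_Compl_dist_component)
  then show ?thesis by simp
qed

text \<open>On the open set where \<open>b * dist_exp\<close> stays below the target bound,
  \<open>exp_neg_lipschitz\<close> applies to any two points of the component, and off the component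
  nothing varies. Subtracting a constant and truncating at 0 do not increase differences.\<close>

lemma lipschitz_dist_exp:
  assumes b: "0 \<le> b"
  shows "lipschitz_at (\<lambda>x. max (dist_exp x0 b x - c) 0) (\<lambda>x. b * dist_exp x0 b x)"
  unfolding lipschitz_at_def
proof (intro allI impI)
  fix p0 and \<delta> :: real assume \<delta>: "\<delta> > 0"
  let ?M = "b * dist_exp x0 b p0 + \<delta>"
  let ?U = "{x. b * dist_exp x0 b x < ?M}"
  have "open ?U" by (intro open_Collect_less continuous_intros continuous_dist_exp)
  moreover have "p0 \<in> ?U" using \<delta> by simp
  moreover have "\<bar>max (dist_exp x0 b p - c) 0 - max (dist_exp x0 b q - c) 0\<bar> \<le> ?M * r"
    if pq: "p \<in> ?U" "q \<in> ?U" and r: "r \<ge> 0" "riem_dist A g p q \<le> ennreal r" for p q r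
  proof -
    have "riem_dist A g p q < top" using r(2) le_less_trans[OF _ ennreal_less_top] by blast
    then have iff: "p \<in> dist_component x0 \<longleftrightarrow> q \<in> dist_component x0" by (rule dist_component_iff)
    have M: "?M \<ge> 0" using b \<delta> dist_exp_nonneg[of x0 b p0] by simp
    have "\<bar>dist_exp x0 b p - dist_exp x0 b q\<bar> \<le> ?M * r"
    proof (cases "p \<in> dist_component x0")
      case True
      then have "\<bar>dist_exp x0 b p - dist_exp x0 b q\<bar> \<le> ?M * \<bar>real_dist x0 p - real_dist x0 q\<bar>"
        using exp_neg_lipschitz[OF b, of "real_dist x0 p" ?M "real_dist x0 q"] pq iff by (simp add: dist_exp_def)
      also have "\<dots> \<le> ?M * r" by (rule mult_left_mono[OF real_dist_diff_le[OF True r(2,1)] M])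
      finally show ?thesis .
    qed (use iff M r in \<open>simp add: dist_exp_def\<close>)
    then show ?thesis by linarith
  qed
  ultimately show "\<exists>U. open U \<and> p0 \<in> U \<and> (\<forall>p\<in>U. \<forall>q\<in>U. \<forall>r\<ge>0. riem_dist A g p q \<le> ennreal r \<longrightarrow>
      \<bar>max (dist_exp x0 b p - c) 0 - max (dist_exp x0 b q - c) 0\<bar> \<le> ?M * r)" by blast
qed

lemma grad_vanishes:
  assumes \<phi>: "smooth_fun A UNIV \<phi>" and U: "open U" "p \<in> U" "\<And>q. q \<in> U \<Longrightarrow> \<phi> q = 0"
  shows "g p (grad A g \<phi> p) (grad A g \<phi> p) \<le> 0"
proof -
  have "X \<phi> = 0" if X: "X \<in> tangent_space A p" for X
    using tangent_cong[OF X smooth_near_fun[OF \<phi>] smooth_near_fun[OF smooth_fun_const] U(1,2), of 0] U(3) tangent_const[OF X]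
    by simp
  then show ?thesis using grad_bound[OF \<phi>, of 0 p] by simp
qed

lemma smooth_fun_continuous: "smooth_fun A UNIV \<phi> \<Longrightarrow> continuous_on UNIV \<phi>"
proof (rule continuous_at_imp_continuous_on, rule ballI)
  fix p assume \<phi>: "smooth_fun A UNIV \<phi>"
  note c = chart_at[of p]
  have "continuous_on (cimg (chart_at A p)) (\<phi> \<circ> cinv (chart_at A p))"
    using \<phi> c(1) by (intro smooth_on_continuous) (simp add: smooth_fun_def)
  then have "continuous_on (cdom (chart_at A p)) ((\<phi> \<circ> cinv (chart_at A p)) \<circ> cmap (chart_at A p))"
    by (rule continuous_on_compose[OF chartD(3)[OF c(1)]])
  then have "continuous_on (cdom (chart_at A p)) \<phi>"
    by (rule continuous_on_eq) (simp add: chartD[OF c(1)])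
  then show "isCont \<phi> p" using continuous_on_eq_continuous_at[OF chartD(1)[OF c(1)]] c(2) by blast
qed

text \<open>The hypothesis is only eventual. Enlarging every radius by a fixed \<open>r1\<close>
  brings it into the range where the bound is known, at the price of the factor
  \<open>exp (\<alpha> * r1)\<close>; the absolute value of \<open>C\<close> secures a nonnegative
  constant.\<close>

lemma exponential_growth_all_radii:
  fixes \<mu> :: "'a measure"
  assumes sets: "sets \<mu> = sets borel" and \<alpha>: "0 < \<alpha>"
    and growth: "\<forall>\<^sub>F r in at_top. emeasure \<mu> (geodesic_ball A g x0 r) \<le> ennreal (C * exp (\<alpha> * r))"
  obtains M where "0 \<le> M" "\<And>r. 0 \<le> r \<Longrightarrow> emeasure \<mu> (geodesic_ball A g x0 r) \<le> ennreal (M * exp (\<alpha> * r))"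
proof -
  obtain r0 where r0: "\<And>r. r \<ge> r0 \<Longrightarrow> emeasure \<mu> (geodesic_ball A g x0 r) \<le> ennreal (C * exp (\<alpha> * r))"
    using growth unfolding eventually_at_top_linorder by blast
  define r1 where "r1 = max r0 0"
  show thesis
  proof (rule that[of "\<bar>C\<bar> * exp (\<alpha> * r1)"])
    fix r :: real assume r: "0 \<le> r"
    have "emeasure \<mu> (geodesic_ball A g x0 r) \<le> emeasure \<mu> (geodesic_ball A g x0 (r + r1))"
    proof (rule emeasure_mono)
      show "geodesic_ball A g x0 r \<subseteq> geodesic_ball A g x0 (r + r1)"
        unfolding geodesic_ball_def using ennreal_leI[of r "r + r1"] by (auto simp: r1_def intro: less_le_trans)
      show "geodesic_ball A g x0 (r + r1) \<in> sets \<mu>" unfolding sets by (rule borel_open[OF open_riem_ball])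
    qed
    also have "\<dots> \<le> ennreal (C * exp (\<alpha> * (r + r1)))" using r by (intro r0) (simp add: r1_def)
    also have "\<dots> \<le> ennreal (\<bar>C\<bar> * exp (\<alpha> * r1) * exp (\<alpha> * r))"
      by (intro ennreal_leI) (simp add: distrib_left exp_add mult_ac mult_left_mono)
    finally show "emeasure \<mu> (geodesic_ball A g x0 r) \<le> ennreal (\<bar>C\<bar> * exp (\<alpha> * r1) * exp (\<alpha> * r))" .
  qed simp
qed

text \<open>With \<open>n\<close> the integer part of the distance, a single term of the series
  already dominates: \<open>x\<close> lies in the ball of radius \<open>n + 1\<close>, and the
  exponential is at most its value at distance \<open>n\<close>. Balls instead of shells overcount,
  but they fit the growth assumption directly.\<close>

lemma dist_exp_shells:
  assumes b: "0 \<le> b"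
  shows "ennreal ((dist_exp x0 b x)\<^sup>2) \<le> (\<Sum>n. ennreal (exp (- 2 * b * real n)) * indicator (geodesic_ball A g x0 (real n + 1)) x)"
proof (cases "x \<in> dist_component x0")
  case True
  let ?F = "\<lambda>n. ennreal (exp (- 2 * b * real n)) * indicator (geodesic_ball A g x0 (real n + 1)) x"
  define n where "n = nat \<lfloor>real_dist x0 x\<rfloor>"
  have "0 \<le> real_dist x0 x" by (simp add: real_dist_def)
  then have n: "real n \<le> real_dist x0 x" "real_dist x0 x < real n + 1" by (simp_all add: n_def)
  have "riem_dist A g x0 x < ennreal (real n + 1)"
    using ennreal_real_dist[OF center_in_dist_component True] n(2) \<open>0 \<le> real_dist x0 x\<close> by (metis ennreal_lessI le_less_trans)
  then have mem: "x \<in> geodesic_ball A g x0 (real n + 1)" by (simp add: geodesic_ball_def)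
  have "(dist_exp x0 b x)\<^sup>2 = exp (- 2 * b * real_dist x0 x)" using True by (simp add: dist_exp_def flip: exp_double)
  also have "\<dots> \<le> exp (- 2 * b * real n)" using n(1) b by (simp add: mult_left_mono)
  finally have "ennreal ((dist_exp x0 b x)\<^sup>2) \<le> ?F n" using mem by (simp add: ennreal_leI)
  also have "?F n = sum ?F {n}" by (simp only: sum.insert sum.empty finite.emptyI empty_iff not_False_eq_True add_0_right)
  also have "\<dots> \<le> (\<Sum>n. ?F n)" by (rule sum_le_suminf) auto
  finally show ?thesis .
qed (simp add: dist_exp_def)

lemma integrable_dist_exp:
  fixes \<mu> :: "'a measure"
  assumes sets: "sets \<mu> = sets borel" and b: "0 < \<alpha>" "\<alpha> < 2 * b"
    and M: "0 \<le> M" "\<And>r. 0 \<le> r \<Longrightarrow> emeasure \<mu> (geodesic_ball A g x0 r) \<le> ennreal (M * exp (\<alpha> * r))"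
  shows "integrable \<mu> (\<lambda>x. (dist_exp x0 b x)\<^sup>2)"
proof (rule integrableI_nonneg)
  have [measurable_cong]: "sets \<mu> = sets borel" by (rule sets)
  have [measurable]: "dist_exp x0 b \<in> borel_measurable borel"
    by (rule borel_measurable_continuous_onI[OF continuous_dist_exp])
  show "(\<lambda>x. (dist_exp x0 b x)\<^sup>2) \<in> borel_measurable \<mu>" by measurable
  have [measurable]: "geodesic_ball A g x0 r \<in> sets borel" for r by (rule borel_open[OF open_riem_ball])
  have "0 \<le> b" using b by simp
  \<comment> \<open>The sum over balls is dominated by a geometric series of this ratio. It is below
    1 by \<open>\<alpha> < 2 * b\<close>, the place where the growth of the measure meets the decay
    of the weight.\<close>
  let ?q = "exp (\<alpha> - 2 * b)"
  have q: "norm ?q < 1" using b by simp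
  have "(\<integral>\<^sup>+ x. ennreal ((dist_exp x0 b x)\<^sup>2) \<partial>\<mu>)
      \<le> (\<integral>\<^sup>+ x. (\<Sum>n. ennreal (exp (- 2 * b * real n)) * indicator (geodesic_ball A g x0 (real n + 1)) x) \<partial>\<mu>)"
    by (intro nn_integral_mono dist_exp_shells \<open>0 \<le> b\<close>)
  also have "\<dots> = (\<Sum>n. \<integral>\<^sup>+ x. ennreal (exp (- 2 * b * real n)) * indicator (geodesic_ball A g x0 (real n + 1)) x \<partial>\<mu>)"
    by (rule nn_integral_suminf) measurable
  also have "\<dots> = (\<Sum>n. ennreal (exp (- 2 * b * real n)) * emeasure \<mu> (geodesic_ball A g x0 (real n + 1)))"
    by (intro suminf_cong nn_integral_cmult_indicator) measurable
  also have "\<dots> \<le> (\<Sum>n. ennreal (M * exp \<alpha> * ?q ^ n))"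
  proof (intro suminf_le summableI)
    fix n
    have "ennreal (exp (- 2 * b * real n)) * emeasure \<mu> (geodesic_ball A g x0 (real n + 1))
        \<le> ennreal (exp (- 2 * b * real n)) * ennreal (M * exp (\<alpha> * (real n + 1)))"
      by (intro mult_left_mono M(2)) auto
    also have "\<dots> = ennreal (exp (- 2 * b * real n) * (M * exp (\<alpha> * (real n + 1))))"
      using M(1) by (simp add: ennreal_mult)
    also have "exp (- 2 * b * real n) * (M * exp (\<alpha> * (real n + 1))) = M * exp \<alpha> * ?q ^ n"
      by (simp add: algebra_simps flip: exp_add exp_of_nat_mult)
    finally show "ennreal (exp (- 2 * b * real n)) * emeasure \<mu> (geodesic_ball A g x0 (real n + 1)) \<le> ennreal (M * exp \<alpha> * ?q ^ n)" .
  qed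
  also have "\<dots> = ennreal (\<Sum>n. M * exp \<alpha> * ?q ^ n)"
    by (rule suminf_ennreal2) (use M(1) q in \<open>auto intro!: summable_mult summable_geometric\<close>)
  also have "\<dots> < \<infinity>" by simp
  finally show "(\<integral>\<^sup>+ x. ennreal ((dist_exp x0 b x)\<^sup>2) \<partial>\<mu>) < \<infinity>" .
qed auto

text \<open>The hypersurface matters only through a continuous potential bounded below, a Borel
  measure positive on open sets, and the stability inequality, so the argument is carried out on an
  abstract complete manifold.\<close>

theorem exponential_growth_ge:
  fixes \<mu> :: "'a measure" and Q :: "'a \<Rightarrow> real"
  assumes complete: "riem_complete A g" and sets: "sets \<mu> = sets borel"
    and pos: "\<And>U. open U \<Longrightarrow> U \<noteq> {} \<Longrightarrow> emeasure \<mu> U > 0"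
    and Q: "continuous_on UNIV Q" "\<And>x. K \<le> Q x" and K: "0 \<le> K"
    and stable: "\<And>\<phi>. smooth_fun A UNIV \<phi> \<Longrightarrow> compact (closure {x. \<phi> x \<noteq> 0}) \<Longrightarrow>
      (\<integral>x. Q x * (\<phi> x)\<^sup>2 \<partial>\<mu>) \<le> (\<integral>x. g x (grad A g \<phi> x) (grad A g \<phi> x) \<partial>\<mu>)"
    and \<alpha>: "0 < \<alpha>"
    and growth: "\<forall>\<^sub>F r in at_top. emeasure \<mu> (geodesic_ball A g x0 r) \<le> ennreal (C * exp (\<alpha> * r))"
    and b: "\<alpha> < 2 * b"
  shows "K \<le> b\<^sup>2"
proof -
  have [measurable_cong]: "sets \<mu> = sets borel" by (rule sets)
  have sp: "space \<mu> = UNIV" using sets_eq_imp_space_eq[OF sets] by simp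
  have meas_cont: "F \<in> borel_measurable \<mu>" if "continuous_on UNIV F" for F :: "'a \<Rightarrow> real"
    using borel_measurable_continuous_onI[OF that] by measurable
  have ball: "geodesic_ball A g x0 r \<in> sets \<mu>" for r unfolding sets by (rule borel_open[OF open_riem_ball])
  obtain M where M: "0 \<le> M" "\<And>r. 0 \<le> r \<Longrightarrow> emeasure \<mu> (geodesic_ball A g x0 r) \<le> ennreal (M * exp (\<alpha> * r))"
    using exponential_growth_all_radii[OF sets \<alpha> growth] by blast
  have fin: "emeasure \<mu> (geodesic_ball A g x0 r) < \<infinity>" if "0 \<le> r" for r
    using M(2)[OF that] by (simp add: le_less_trans[OF _ ennreal_less_top])
  define E where "E = dist_exp x0 b"
  have b0: "0 < b" using \<alpha> b by simp
  have E: "0 \<le> E x" "E x \<le> 1" "continuous_on UNIV E" for x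
    using b0 by (simp_all add: E_def dist_exp_nonneg dist_exp_le_1 continuous_dist_exp)
  have intE: "integrable \<mu> (\<lambda>x. (E x)\<^sup>2)" unfolding E_def by (rule integrable_dist_exp[OF sets \<alpha> b M])
  define I where "I = (\<integral>x. (E x)\<^sup>2 \<partial>\<mu>)"
  have I: "I > 0"
  proof -
    have x0: "x0 \<in> geodesic_ball A g x0 1" by (simp add: geodesic_ball_def riem_dist_self)
    \<comment> \<open>On the unit ball about \<open>x0\<close> the weight is positive, and the ball,
      being open and nonempty, has positive measure.\<close>
    have "I \<noteq> 0"
    proof
      assume "I = 0"
      then have "AE x in \<mu>. (E x)\<^sup>2 = 0" using integral_nonneg_eq_0_iff_AE[OF intE] by (simp add: I_def)
      then have "AE x in \<mu>. x \<notin> geodesic_ball A g x0 1"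
      proof (rule AE_mp, intro AE_I2 impI)
        fix x assume E0: "(E x)\<^sup>2 = 0"
        show "x \<notin> geodesic_ball A g x0 1"
        proof
          assume "x \<in> geodesic_ball A g x0 1"
          then have "x \<in> dist_component x0"
            using less_trans[OF _ ennreal_less_top, of _ 1] by (simp add: geodesic_ball_def dist_component_def)
          then show False using E0 by (simp add: E_def dist_exp_def)
        qed
      qed
      then have "emeasure \<mu> (geodesic_ball A g x0 1) = 0" using AE_iff_measurable[OF ball, of "\<lambda>x. x \<notin> geodesic_ball A g x0 1" 1] by (simp add: sp)
      then show False using pos[OF open_riem_ball, of x0 1] x0 by auto
    qed
    moreover have "I \<ge> 0" unfolding I_def by (rule integral_nonneg_AE) simp
    ultimately show ?thesis by simp
  qed
  define u where "u R x = max (E x - exp (- b * R)) 0" for R x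
  have u: "continuous_on UNIV (u R)" "0 \<le> u R x" "u R x \<le> E x" for R x
    unfolding u_def[abs_def] using E(1)[of x] by (auto intro!: continuous_intros E(3))
  have u0: "u R x = 0" if "\<not> riem_dist A g x0 x < ennreal R" for R x
    using dist_exp_le[OF that, of b] b0 by (simp add: u_def E_def)
  have intu: "integrable \<mu> (\<lambda>x. (u R x)\<^sup>2)" for R
    by (rule Bochner_Integration.integrable_bound[OF intE meas_cont])
      (use u in \<open>auto intro!: continuous_intros power_mono\<close>)
  have main: "K * (\<integral>x. (u R x)\<^sup>2 \<partial>\<mu>) \<le> b\<^sup>2 * I" if R: "R \<ge> 0" for R
  proof -
    \<comment> \<open>Test functions are supported in the closed ball of radius
      \<open>R + 1\<close>. The larger ball \<open>W\<close> contains it and has finite measure, so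
      all errors of size \<open>\<delta>\<close> are integrated over \<open>W\<close> only.\<close>
    define W where "W = geodesic_ball A g x0 (R + 2)"
    have W: "W \<in> sets \<mu>" "emeasure \<mu> W < \<infinity>" unfolding W_def using ball fin R by auto
    then have intW: "integrable \<mu> (indicator W :: 'a \<Rightarrow> real)" by (simp add: integrable_indicator_iff)
    have sub: "geodesic_ball A g x0 (R + 1) \<subseteq> W" "{x. riem_dist A g x0 x \<le> ennreal R} \<subseteq> geodesic_ball A g x0 (R + 1)"
      "{x. riem_dist A g x0 x \<le> ennreal (R + 1)} \<subseteq> W"
      unfolding W_def geodesic_ball_def using R
      by (auto intro: less_trans le_less_trans simp: ennreal_less_iff)
    have ineq: "K * (\<integral>x. (u R x)\<^sup>2 \<partial>\<mu>) \<le> b\<^sup>2 * I + \<delta> * ((2 * K + 2 * b + 1) * measure \<mu> W)"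
      if \<delta>: "0 < \<delta>" "\<delta> \<le> 1" for \<delta>
    proof -
      have Lc: "continuous_on UNIV (\<lambda>x. b * E x)" by (intro continuous_intros E)
      have lip: "lipschitz_at (u R) (\<lambda>x. b * E x)"
        unfolding u_def[abs_def] E_def using lipschitz_dist_exp[of b] b0 by simp
      obtain \<phi> where \<phi>: "smooth_fun A UNIV \<phi>" "{p. \<phi> p \<noteq> 0} \<subseteq> geodesic_ball A g x0 (R + 1)" "\<And>p. \<bar>\<phi> p - u R p\<bar> \<le> \<delta>"
        "\<And>p. g p (grad A g \<phi> p) (grad A g \<phi> p) \<le> (b * E p + \<delta>)\<^sup>2"
        by (rule smooth_approximation[OF u(1) lip Lc _ hopf_rinow[OF complete, of x0 R] _ open_riem_ball sub(2) \<delta>(1)])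
          (use E b0 in \<open>auto intro: u0 order.strict_implies_order\<close>)
      let ?Z = "{x. riem_dist A g x0 x \<le> ennreal (R + 1)}"
      have supp: "{x. \<phi> x \<noteq> 0} \<subseteq> ?Z" using \<phi>(2) by (auto simp: geodesic_ball_def)
      have cl: "compact (closure {x. \<phi> x \<noteq> 0})"
      proof -
        have "closure {x. \<phi> x \<noteq> 0} \<subseteq> ?Z" by (rule closure_minimal[OF supp closed_riem_cball])
        then have "closure {x. \<phi> x \<noteq> 0} = ?Z \<inter> closure {x. \<phi> x \<noteq> 0}" by blast
        then show ?thesis using compact_Int_closed[OF hopf_rinow[OF complete, of x0 "R + 1"] closed_closure] by metis
      qed
      have \<phi>c: "continuous_on UNIV \<phi>" by (rule smooth_fun_continuous[OF \<phi>(1)])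
      \<comment> \<open>A non-integrable function has Bochner integral 0, which would destroy the
        lower bound for the left side of the stability inequality. Continuity of \<open>Q\<close>
        bounds it on the compact ball.\<close>
      have Q\<phi>: "integrable \<mu> (\<lambda>x. Q x * (\<phi> x)\<^sup>2)"
      proof -
        have cont: "continuous_on UNIV (\<lambda>x. Q x * (\<phi> x)\<^sup>2)" by (intro continuous_intros Q(1) \<phi>c)
        have "bounded ((\<lambda>x. Q x * (\<phi> x)\<^sup>2) ` ?Z)"
          by (intro compact_imp_bounded compact_continuous_image continuous_on_subset[OF cont] hopf_rinow[OF complete]) auto
        then obtain D where D: "\<And>x. x \<in> ?Z \<Longrightarrow> norm (Q x * (\<phi> x)\<^sup>2) \<le> D" unfolding bounded_iff by blast
        have D': "norm (Q x * (\<phi> x)\<^sup>2) \<le> max D 0" for x using D[of x] supp by (cases "\<phi> x = 0") auto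
        show ?thesis
        proof (rule integrableI_bounded_set[OF W(1) meas_cont[OF cont] W(2), of "max D 0"])
          show "AE x in \<mu>. x \<in> W \<longrightarrow> norm (Q x * (\<phi> x)\<^sup>2) \<le> max D 0" using D' by blast
          show "AE x in \<mu>. x \<notin> W \<longrightarrow> Q x * (\<phi> x)\<^sup>2 = 0" using supp sub(3) by (intro AE_I2) auto
        qed
      qed
      have "K * (\<integral>x. (u R x)\<^sup>2 \<partial>\<mu>) - 2 * \<delta> * K * measure \<mu> W = (\<integral>x. K * (u R x)\<^sup>2 - 2 * \<delta> * K * indicator W x \<partial>\<mu>)"
        using intu intW by (simp add: sp)
      also have "\<dots> \<le> (\<integral>x. Q x * (\<phi> x)\<^sup>2 \<partial>\<mu>)"
      proof (rule integral_mono[OF _ Q\<phi>])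
        show "integrable \<mu> (\<lambda>x. K * (u R x)\<^sup>2 - 2 * \<delta> * K * indicator W x)"
          using intu intW by auto
        fix x
        \<comment> \<open>If \<open>u \<le> \<delta>\<close> then
          \<open>u^2 - 2 * \<delta> * u\<close> is not positive; otherwise
          \<open>\<phi> \<ge> u - \<delta> > 0\<close> may be squared. The bound
          \<open>u \<le> 1\<close> then replaces \<open>2 * \<delta> * u\<close> by
          \<open>2 * \<delta>\<close>.\<close>
        have "(u R x)\<^sup>2 - 2 * \<delta> * indicator W x \<le> (\<phi> x)\<^sup>2"
        proof (cases "x \<in> W")
          case True
          have "(u R x)\<^sup>2 - 2 * \<delta> * u R x \<le> (\<phi> x)\<^sup>2"
          proof (cases "u R x \<le> \<delta>")
            case True
            then have "u R x * u R x \<le> \<delta> * u R x" using u(2)[of R x] by (intro mult_right_mono) auto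
            moreover have "0 \<le> \<delta> * u R x" using u(2)[of R x] \<delta> by simp
            ultimately have "(u R x)\<^sup>2 - 2 * \<delta> * u R x \<le> 0" by (simp add: power2_eq_square)
            then show ?thesis using zero_le_power2[of "\<phi> x"] by linarith
          next
            case False
            then have "(u R x - \<delta>)\<^sup>2 \<le> (\<phi> x)\<^sup>2" using \<phi>(3)[of x] by (intro power_mono) (auto simp: abs_le_iff)
            moreover have "(u R x - \<delta>)\<^sup>2 = (u R x)\<^sup>2 - 2 * \<delta> * u R x + \<delta>\<^sup>2" by (simp add: power2_diff)
            ultimately show ?thesis using zero_le_power2[of \<delta>] by linarith
          qed
          moreover have "\<delta> * u R x \<le> \<delta> * 1" using u(3)[of R x] E(2)[of x] \<delta> by (intro mult_left_mono) auto
          ultimately show ?thesis using True by simp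
        next
          case False
          then have "\<not> riem_dist A g x0 x < ennreal R" using sub by (auto simp: subset_iff)
          then show ?thesis using u0 False by simp
        qed
        then have "K * ((u R x)\<^sup>2 - 2 * \<delta> * indicator W x) \<le> K * (\<phi> x)\<^sup>2" using K by (rule mult_left_mono)
        also have "\<dots> \<le> Q x * (\<phi> x)\<^sup>2" by (intro mult_right_mono Q(2)) simp
        finally show "K * (u R x)\<^sup>2 - 2 * \<delta> * K * indicator W x \<le> Q x * (\<phi> x)\<^sup>2" by (simp add: algebra_simps)
      qed
      also have "\<dots> \<le> (\<integral>x. g x (grad A g \<phi> x) (grad A g \<phi> x) \<partial>\<mu>)" by (rule stable[OF \<phi>(1) cl])
      \<comment> \<open>Only the majorant has to be integrable: it is nonnegative, so the comparison
        also covers a left integral that is 0 by convention.\<close>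
      also have "\<dots> \<le> (\<integral>x. b\<^sup>2 * (E x)\<^sup>2 + (2 * b + 1) * \<delta> * indicator W x \<partial>\<mu>)"
      proof (rule integral_mono')
        show "integrable \<mu> (\<lambda>x. b\<^sup>2 * (E x)\<^sup>2 + (2 * b + 1) * \<delta> * indicator W x)" using intE intW by auto
        fix x
        show nn: "0 \<le> b\<^sup>2 * (E x)\<^sup>2 + (2 * b + 1) * \<delta> * indicator W x" using b0 \<delta> by simp
        show "g x (grad A g \<phi> x) (grad A g \<phi> x) \<le> b\<^sup>2 * (E x)\<^sup>2 + (2 * b + 1) * \<delta> * indicator W x"
        proof (cases "x \<in> W")
          case True
          have "(b * E x + \<delta>)\<^sup>2 = b\<^sup>2 * (E x)\<^sup>2 + (2 * b * E x + \<delta>) * \<delta>" by (simp add: power2_eq_square algebra_simps)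
          also have "\<dots> \<le> b\<^sup>2 * (E x)\<^sup>2 + (2 * b + 1) * \<delta>"
            using \<delta> E(2)[of x] b0 by (intro add_left_mono mult_right_mono add_mono) auto
          finally show ?thesis using \<phi>(4)[of x] True by simp
        next
          case False
          \<comment> \<open>The general gradient bound leaves \<open>\<delta>^2\<close> even far
            away, which need not be integrable; outside the support ball the gradient vanishes
            because \<open>\<phi>\<close> is 0 on an open set.\<close>
          then have "g x (grad A g \<phi> x) (grad A g \<phi> x) \<le> 0"
            using supp sub(3) by (intro grad_vanishes[OF \<phi>(1), of "- ?Z"]) (auto simp: closed_riem_cball open_Compl)
          then show ?thesis using nn by linarith
        qed
      qed
      also have "\<dots> = b\<^sup>2 * I + (2 * b + 1) * \<delta> * measure \<mu> W" using intE intW by (simp add: sp I_def)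
      finally show ?thesis by (simp add: algebra_simps)
    qed
    show ?thesis
    proof (rule field_le_epsilon)
      fix e :: real assume e: "0 < e"
      \<comment> \<open>For fixed \<open>R\<close> the measure of \<open>W\<close> is a constant, so
        a small \<open>\<delta>\<close> brings the total error below any \<open>e\<close>.\<close>
      define D where "D = (2 * K + 2 * b + 1) * measure \<mu> W"
      have D: "0 \<le> D" using K b0 by (simp add: D_def)
      define \<delta> where "\<delta> = min 1 (e / (D + 1))"
      have "0 < \<delta>" "\<delta> \<le> 1" using e D by (simp_all add: \<delta>_def)
      moreover have "\<delta> * D \<le> e"
      proof -
        have "\<delta> * D \<le> e / (D + 1) * (D + 1)" using D e by (intro mult_mono) (auto simp: \<delta>_def)
        then show ?thesis using D by simp
      qed
      ultimately show "K * (\<integral>x. (u R x)\<^sup>2 \<partial>\<mu>) \<le> b\<^sup>2 * I + e" using ineq[of \<delta>] by (simp add: D_def)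
    qed
  qed
  \<comment> \<open>The truncations converge pointwise to the weight and are dominated by it, and
    the square of the weight is integrable.\<close>
  have "(\<lambda>n. \<integral>x. (u (real n) x)\<^sup>2 \<partial>\<mu>) \<longlonglongrightarrow> (\<integral>x. (E x)\<^sup>2 \<partial>\<mu>)"
  proof (rule integral_dominated_convergence[where w = "\<lambda>x. (E x)\<^sup>2"])
    show "(\<lambda>x. (E x)\<^sup>2) \<in> borel_measurable \<mu>" "(\<lambda>x. (u (real n) x)\<^sup>2) \<in> borel_measurable \<mu>" for n
      by (auto intro!: meas_cont continuous_intros E u)
    show "integrable \<mu> (\<lambda>x. (E x)\<^sup>2)" by (rule intE)
    show "AE x in \<mu>. norm ((u (real n) x)\<^sup>2) \<le> (E x)\<^sup>2" for n
      using u by (intro AE_I2) (auto intro!: power_mono)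
    have lim: "(\<lambda>n. exp (- b * real n)) \<longlonglongrightarrow> 0" 
      using LIMSEQ_power_zero[of "exp (- b)"] b0 by (simp add: mult.commute flip: exp_of_nat_mult)
    have "(\<lambda>n. (u (real n) x)\<^sup>2) \<longlonglongrightarrow> (max (E x - 0) 0)\<^sup>2" for x
      unfolding u_def by (intro tendsto_intros lim)
    then show "AE x in \<mu>. (\<lambda>n. (u (real n) x)\<^sup>2) \<longlonglongrightarrow> (E x)\<^sup>2" using E(1) by simp
  qed
  then have "(\<lambda>n. K * (\<integral>x. (u (real n) x)\<^sup>2 \<partial>\<mu>)) \<longlonglongrightarrow> K * I" unfolding I_def by (rule tendsto_mult_left)
  then have "K * I \<le> b\<^sup>2 * I" by (rule LIMSEQ_le_const2) (use main in auto)
  then show ?thesis using I by simp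
qed

end

context riemannian_manifold
begin

lemma emeasure_density_pos:
  assumes F: "continuous_on UNIV F" "\<And>x. 0 < F x" and U: "open U" "U \<noteq> {}"
  shows "emeasure (density (riem_volume A g) (\<lambda>x. ennreal (F x))) U > 0"
proof -
  let ?v = "riem_volume A g"
  have [measurable]: "U \<in> sets ?v" using U by simp
  have [measurable]: "(\<lambda>x. ennreal (F x)) \<in> borel_measurable ?v"
    using borel_measurable_continuous_onI[OF F(1)] by (simp add: measurable_cong_sets[OF sets_riem_volume refl])
  have "emeasure (density ?v (\<lambda>x. ennreal (F x))) U \<noteq> 0"
  proof
    assume "emeasure (density ?v (\<lambda>x. ennreal (F x))) U = 0"
    then have "(\<integral>\<^sup>+ x. ennreal (F x) * indicator U x \<partial>?v) = 0" by (subst (asm) emeasure_density) (auto simp: U)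
    then have "AE x in ?v. ennreal (F x) * indicator U x = 0" by (subst (asm) nn_integral_0_iff_AE) auto
    then have "AE x in ?v. x \<notin> U"
    proof (rule AE_mp, intro AE_I2 impI)
      fix x assume "ennreal (F x) * indicator U x = 0"
      then show "x \<notin> U" using F(2)[of x] by (auto simp: indicator_def split: if_splits)
    qed
    then have "emeasure ?v U = 0"
      using AE_iff_measurable[of U ?v "\<lambda>x. x \<notin> U"] sets_eq_imp_space_eq[OF sets_riem_volume] by (simp add: U)
    then show False using emeasure_riem_volume_pos[OF U] by simp
  qed
  then show ?thesis by (simp add: zero_less_iff_neq_zero)
qed

end

context hypersurface
begin

lemma stable_growth_ge:
  assumes f: "smooth_fun A UNIV f" and Ric: "\<And>p X. X \<in> tangent_space A p \<Longrightarrow> Ric_1 A g f p X X \<ge> K * g p X X"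
    and K: "0 \<le> K" and complete: "riem_complete B h" and minimal: "f_minimal A g f B \<iota> \<nu>"
    and stable: "f_stable A g f B \<iota> \<nu>" and \<alpha>: "0 < \<alpha>" "\<alpha> < 2 * b"
    and growth: "\<forall>\<^sub>F r in at_top. emeasure (weighted_measure A g f B \<iota>) (geodesic_ball B h x0 r)
      \<le> ennreal (C * exp (\<alpha> * r))"
  shows "K \<le> b\<^sup>2"
proof (rule sub.exponential_growth_ge[OF complete _ _ continuous_stability_potential[OF f] stability_potential_ge[OF f minimal Ric] K _ \<alpha>(1) growth \<alpha>(2)])
  show "sets (weighted_measure A g f B \<iota>) = sets borel"
    by (simp add: weighted_measure_def)
  have "continuous_on UNIV (\<lambda>x. exp (- f (\<iota> x)))"
    by (intro continuous_intros continuous_on_compose2[OF amb.smooth_fun_continuous[OF f] hypersurfaceD(2)]) simp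
  then show "emeasure (weighted_measure A g f B \<iota>) U > 0" if "open U" "U \<noteq> {}" for U
    unfolding weighted_measure_def using that by (intro sub.emeasure_density_pos) auto
  show "(\<integral>x. stability_potential f x * (\<phi> x)\<^sup>2 \<partial>weighted_measure A g f B \<iota>)
      \<le> (\<integral>x. h x (grad B h \<phi> x) (grad B h \<phi> x) \<partial>weighted_measure A g f B \<iota>)"
    if "smooth_fun B UNIV \<phi>" "compact (closure {x. \<phi> x \<noteq> 0})" for \<phi>
    using stable that unfolding f_stable_def Let_def stability_potential_def by blast
qed

end

theorem proposition4p2:
  fixes A :: "('a::{t2_space, second_countable_topology}, 'n::finite) chart set"
    and g :: "'a metric" and f :: "'a \<Rightarrow> real" and K :: real
  assumes "CARD('n) \<ge> 2"
    and "weighted_manifold A g f"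
    and "riem_complete A g"
    and "K > 0"
    and "\<forall>p. \<forall>X\<in>tangent_space A p. Ric_1 A g f p X X \<ge> K * g p X X"
  shows "\<not> (\<exists>(B :: ('b::{t2_space, second_countable_topology}, 'm::finite) chart set) \<iota> \<nu>.
    two_sided_hypersurface A g B \<iota> \<nu> \<and>
    riem_complete B (induced_metric A g \<iota>) \<and>
    f_minimal A g f B \<iota> \<nu> \<and>
    f_stable A g f B \<iota> \<nu> \<and>
    (\<exists>x\<^sub>0 \<alpha>. 0 < \<alpha> \<and> \<alpha> < 2 * sqrt K \<and>
      (\<exists>C. \<forall>\<^sub>F r in at_top.
        emeasure (weighted_measure A g f B \<iota>)
            (geodesic_ball B (induced_metric A g \<iota>) x\<^sub>0 r)
          \<le> ennreal (C * exp (\<alpha> * r)))))"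
proof
  assume "\<exists>(B :: ('b, 'm) chart set) \<iota> \<nu>.
    two_sided_hypersurface A g B \<iota> \<nu> \<and>
    riem_complete B (induced_metric A g \<iota>) \<and>
    f_minimal A g f B \<iota> \<nu> \<and>
    f_stable A g f B \<iota> \<nu> \<and>
    (\<exists>x\<^sub>0 \<alpha>. 0 < \<alpha> \<and> \<alpha> < 2 * sqrt K \<and>
      (\<exists>C. \<forall>\<^sub>F r in at_top.
        emeasure (weighted_measure A g f B \<iota>)
            (geodesic_ball B (induced_metric A g \<iota>) x\<^sub>0 r)
          \<le> ennreal (C * exp (\<alpha> * r))))"
  then obtain B :: "('b, 'm) chart set" and \<iota> \<nu> x0 \<alpha> C where
    B: "two_sided_hypersurface A g B \<iota> \<nu>" "riem_complete B (induced_metric A g \<iota>)"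
      "f_minimal A g f B \<iota> \<nu>" "f_stable A g f B \<iota> \<nu>"
    and \<alpha>: "0 < \<alpha>" "\<alpha> < 2 * sqrt K"
    and growth: "\<forall>\<^sub>F r in at_top. emeasure (weighted_measure A g f B \<iota>)
      (geodesic_ball B (induced_metric A g \<iota>) x0 r) \<le> ennreal (C * exp (\<alpha> * r))"
    by blast
  interpret hypersurface A g B \<iota> \<nu>
    using assms(2) B(1) by unfold_locales (auto simp: weighted_manifold_def)
  \<comment> \<open>The midpoint between \<open>\<alpha> / 2\<close> and \<open>sqrt K\<close>:
    large enough for the weight to be square integrable and small enough to contradict
    \<open>K \<le> b^2\<close>.\<close>
  define b where "b = (\<alpha> / 2 + sqrt K) / 2"
  have b: "\<alpha> < 2 * b" "0 \<le> b" "b < sqrt K" using \<alpha> by (auto simp: b_def)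
  have "K \<le> b\<^sup>2"
    using stable_growth_ge[OF _ _ _ B(2-4) \<alpha>(1) b(1) growth] assms(2,4,5) by (simp add: weighted_manifold_def)
  moreover have "b\<^sup>2 < (sqrt K)\<^sup>2" using b by (intro power_strict_mono) auto
  ultimately show False using assms(4) by simp
qed

end
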